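(* Let $(M,\nabla)$ be a smooth manifold with torsion-free connection, $\mathcal{U} \subseteq TM$ an open neighbourhood of the zero section and $\mathcal{V}\subseteq M\times M$ an open neighbourhood of the diagonal such that $\mathcal{U}\ni v_p\mapsto(\exp_p(-v_p),\exp_p(v_p))\in\mathcal{V}$ is a well-defined diffeomorphism. Let $\theta$ be a $\mathcal{U}$-admissible vertical Poisson structure on $TM$ with vertical action of $\mathbb{R}^d$, fundamental vector fields $X_1,\ldots,X_d$ and skew-symmetric matrix $\Theta$. Let $p\in M$, $\mathcal{U}_p=\mathcal{U}\cap T_pM$ and $\mathcal{V}_p=\exp_p(\mathcal{U}_p)$, where $\exp_p:\mathcal{U}_p\to\mathcal{V}_p$ is a diffeomorphism onto an open subset of $M$. Let $\star_p$ be the deformed product for functions on $T_pM$ defined by $\Theta$ and the action with fundamental vector fields $X_i^p=X_i|_{T_pM}$, and let $\tilde{\star}_p$ be the deformed product for functions on $M$ defined by $\Theta$ and the action with fundamental vector fields $\tilde{X}_i^p$ equal to $(\exp_p)_*X_i^p$ on $\mathcal{V}_p$ and to $0$ elsewhere. (1) $\star_p$ restricts from $T_pM$ to $\mathcal{U}_p$ and $\tilde{\star}_p$ restricts from $M$ to $\mathcal{V}_p$. That is, the restriction map induces a $^*$-homomorphism $(C^0(T_pM)^\infty,\star_p)\to(C^0(\mathcal{U}_p)^\infty,\star_p)$ continuous with respect to the deformed pro-$C^*$-topologies, and likewise for $C^0_b$ with respect to the deformed $C^*$-topologies; the inclusion $(C^0_\infty(\mathcal{U}_p)^\infty,\star_p)\to(C^0_\infty(T_pM)^\infty,\star_p)$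 is a $^*$-homomorphism continuous with respect to the deformed $C^*$-topologies; and the same statements hold with $(M,\mathcal{V}_p,\tilde{\star}_p)$ in place of $(T_pM,\mathcal{U}_p,\star_p)$. (2) The pull-back $\exp_p^*:C^0(\mathcal{V}_p)\to C^0(\mathcal{U}_p)$ induces a $^*$-isomorphism $$\exp_p^*:(C^0(\mathcal{V}_p)^\infty,\tilde{\star}_p)\longrightarrow(C^0(\mathcal{U}_p)^\infty,\star_p),$$ continuous with respect to the deformed pro-$C^*$-topologies. (3) The analogous statements hold for the $C^*$-algebraic cases: $\exp_p^*$ induces $^*$-isomorphisms $(C^0_b(\mathcal{V}_p)^\infty,\tilde{\star}_p)\to(C^0_b(\mathcal{U}_p)^\infty,\star_p)$ and $(C^0_\infty(\mathcal{V}_p)^\infty,\tilde{\star}_p)\to(C^0_\infty(\mathcal{U}_p)^\infty,\star_p)$, continuous with respect to the deformed $C^*$-topologies.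
   Context: Admissibility: a vertical Poisson structure $\theta$ on $TM$ is $\mathcal{U}$-admissible if there are a smooth action of $\mathbb{R}^d$ on $TM$ by vertical diffeomorphisms (mapping each $T_pM$ to itself), with (vertical) fundamental vector fields $X_1,\ldots,X_d$, and constants $\Theta^{ij} = -\Theta^{ji} \in \mathbb{R}$ with $\theta = \frac12\sum_{i,j}\Theta^{ij} X_i \wedge X_j$, $\operatorname{supp} X_i \subseteq \mathcal{U}$, and $\operatorname{supp} X_i \cap T_pM$ compact for all $p \in M$. $\Theta$ also denotes the skew-symmetric operator on $\mathbb{R}^d$ with matrix $(\Theta^{ij})$. Commuting complete vector fields $Z_1,\ldots,Z_d$ with flows $\phi^{Z_i}$ induce the action $\alpha_v(f) = f\circ\phi^{Z_1}_{v_1}\circ\cdots\circ\phi^{Z_d}_{v_d}$ on functions; on an open subset containing the supports of the $Z_i$ (which is invariant) one uses the restricted action, and the deformed product there is denoted by the same symbol. Function algebras: for a manifold $N$, $C^0(N)$ denotes all continuous complex functions (a pro-$C^*$-algebra with the seminorms $\|f\|_L=\sup_L|f|$, $L$ compact), $C^0_b(N)$ the bounded ones and $C^0_\infty(N)$ those vanishing at infinity ($C^*$-algebras with the sup-norm). The involution is complex conjugation. Inclusions of function spaces on open subsets are extension by $0$. Deformed product: let $\mathcal{A}$ be one of these algebras, with an action $\alpha$ of $\mathbb{R}^d$. $\mathcal{A}^\infty$ is the set of smooth vectors ($v\mapsto\alpha_v(a)$ is smooth into $\mathcal{A}$), and $a \star b = \iint \alpha_{\Theta u}(a)\,\alpha_v(b)\,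 e^{2\pi i u\cdot v}\,du\,dv$ for $a,b\in\mathcal{A}^\infty$. Here the oscillatory integral of a function $F$ on $\mathbb{R}^d\times\mathbb{R}^d$ that is bounded with all derivatives is $\sum_w\iint F\varphi_w e^{2\pi i u\cdot v}\,du\,dv$, with $\{\varphi_w\}$ a smooth partition of unity consisting of lattice translates of one compactly supported smooth function. Deformed topology: $C^0_u(\mathbb{R}^d,\mathcal{A})^\infty$ denotes the smooth vectors for translation in the bounded uniformly continuous functions $\mathbb{R}^d\to\mathcal{A}$, with product $(F\star G)(x)=\iint F(x+\Theta u)G(x+v)e^{2\pi i u\cdot v}\,du\,dv$. $\mathcal{S}^{\mathcal{A}}(\mathbb{R}^d)$ is the subspace of those $f$ all of whose derivatives multiplied by any polynomial are bounded, with $\langle f,g\rangle=\int f(v)^*g(v)\,dv$ and $\|f\|_q=q(\langle f,f\rangle)^{1/2}$ for each continuous $C^*$-seminorm $q$ on $\mathcal{A}$. For $a\in\mathcal{A}^\infty$ put $\phi(a)(v)=\alpha_v(a)$ and $\mathsf{L}_{\phi(a)}g=\phi(a)\star g$ on $\mathcal{S}^{\mathcal{A}}(\mathbb{R}^d)$, and $\|a\|_{\Theta,q}=\sup\{\|\mathsf{L}_{\phi(a)}g\|_q:\|g\|_q\le1\}$. The deformed pro-$C^*$-topology on $\mathcal{A}^\infty$ is defined by all seminorms $\|\cdot\|_{\Theta,q}$; if $\mathcal{A}$ is a $C^*$-algebra, the deformed $C^*$-topology is given by $\|\cdot\|_\Theta$, where $q$ is the $C^*$-norm. *)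

theory Defs
  imports "HOL-Analysis.Analysis" "HOL-Library.Function_Algebras"
begin

section \<open>Smooth maps into locally convex spaces\<close>

instantiation "fun" :: (type, real_vector) real_vector
begin

definition scaleR_fun_def: "c *\<^sub>R f = (\<lambda>x. c *\<^sub>R f x)"

instance
  by standard (simp_all add: scaleR_fun_def fun_eq_iff scaleR_add_right scaleR_add_left)

end

lemma scaleR_fun_apply [simp]: "(c *\<^sub>R f) x = c *\<^sub>R f x"
  by (simp add: scaleR_fun_def)

text \<open>
  The topology on a set \<open>A\<close> of vectors given by a family \<open>P\<close> of seminorms. The seminorms are
  extended-real valued because deformed norms are defined as suprema.
\<close>

definition seminorm_top :: "'b::real_vector set \<Rightarrow> ('b \<Rightarrow> ereal) set \<Rightarrow> 'b topology" where
  "seminorm_top A P = topology (\<lambda>U. U \<subseteq> A \<and>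
     (\<forall>f\<in>U. \<exists>F \<epsilon>. finite F \<and> F \<subseteq> P \<and> 0 < (\<epsilon>::real) \<and> {g\<in>A. \<forall>p\<in>F. p (g - f) < ereal \<epsilon>} \<subseteq> U))"

lemma openin_seminorm_top:
  "openin (seminorm_top A P) U \<longleftrightarrow> U \<subseteq> A \<and>
     (\<forall>f\<in>U. \<exists>F \<epsilon>. finite F \<and> F \<subseteq> P \<and> 0 < (\<epsilon>::real) \<and> {g\<in>A. \<forall>p\<in>F. p (g - f) < ereal \<epsilon>} \<subseteq> U)"
proof -
  let ?Q = "\<lambda>U. U \<subseteq> A \<and>
     (\<forall>f\<in>U. \<exists>F \<epsilon>. finite F \<and> F \<subseteq> P \<and> 0 < (\<epsilon>::real) \<and> {g\<in>A. \<forall>p\<in>F. p (g - f) < ereal \<epsilon>} \<subseteq> U)"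
  have "istopology ?Q"
    unfolding istopology_def
  proof (intro conjI allI impI)
    fix S T assume S: "?Q S" and T: "?Q T"
    show "S \<inter> T \<subseteq> A" using S by blast
    show "\<forall>f\<in>S \<inter> T. \<exists>F \<epsilon>. finite F \<and> F \<subseteq> P \<and> 0 < (\<epsilon>::real) \<and>
            {g\<in>A. \<forall>p\<in>F. p (g - f) < ereal \<epsilon>} \<subseteq> S \<inter> T"
    proof
      fix f assume f: "f \<in> S \<inter> T"
      obtain F e where 1: "finite F" "F \<subseteq> P" "0 < (e::real)" "{g\<in>A. \<forall>p\<in>F. p (g - f) < ereal e} \<subseteq> S"
        using S f by blast
      obtain G d where 2: "finite G" "G \<subseteq> P" "0 < (d::real)" "{g\<in>A. \<forall>p\<in>G. p (g - f) < ereal d} \<subseteq> T"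
        using T f by blast
      have "{g\<in>A. \<forall>p\<in>F \<union> G. p (g - f) < ereal (min e d)} \<subseteq> S \<inter> T"
      proof
        fix g assume g: "g \<in> {g\<in>A. \<forall>p\<in>F \<union> G. p (g - f) < ereal (min e d)}"
        have "ereal (min e d) \<le> ereal e" "ereal (min e d) \<le> ereal d" by auto
        with g have "g \<in> {g\<in>A. \<forall>p\<in>F. p (g - f) < ereal e}" "g \<in> {g\<in>A. \<forall>p\<in>G. p (g - f) < ereal d}"
          by (auto dest: less_le_trans)
        with 1(4) 2(4) show "g \<in> S \<inter> T" by blast
      qed
      moreover have "finite (F \<union> G)" "F \<union> G \<subseteq> P" "0 < min e d" using 1 2 by auto
      ultimately show "\<exists>F \<epsilon>. finite F \<and> F \<subseteq> P \<and> 0 < (\<epsilon>::real) \<and>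
            {g\<in>A. \<forall>p\<in>F. p (g - f) < ereal \<epsilon>} \<subseteq> S \<inter> T"
        by meson
    qed
  next
    fix K assume K: "\<forall>S\<in>K. ?Q S"
    show "\<Union>K \<subseteq> A" using K by blast
    show "\<forall>f\<in>\<Union>K. \<exists>F \<epsilon>. finite F \<and> F \<subseteq> P \<and> 0 < (\<epsilon>::real) \<and>
            {g\<in>A. \<forall>p\<in>F. p (g - f) < ereal \<epsilon>} \<subseteq> \<Union>K"
    proof
      fix f assume "f \<in> \<Union>K"
      then obtain S where S: "S \<in> K" "f \<in> S" by blast
      have "?Q S" using K S(1) by (rule bspec)
      then have "\<exists>F \<epsilon>. finite F \<and> F \<subseteq> P \<and> 0 < (\<epsilon>::real) \<and> {g\<in>A. \<forall>p\<in>F. p (g - f) < ereal \<epsilon>} \<subseteq> S"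
        using S(2) by blast
      then obtain F e where "finite F" "F \<subseteq> P" "0 < (e::real)" "{g\<in>A. \<forall>p\<in>F. p (g - f) < ereal e} \<subseteq> S"
        by blast
      moreover have "S \<subseteq> \<Union>K" using S by blast
      ultimately show "\<exists>F \<epsilon>. finite F \<and> F \<subseteq> P \<and> 0 < (\<epsilon>::real) \<and>
            {g\<in>A. \<forall>p\<in>F. p (g - f) < ereal \<epsilon>} \<subseteq> \<Union>K"
        by (meson subset_trans)
    qed
  qed
  then show ?thesis unfolding seminorm_top_def by (simp add: topology_inverse')
qed

text \<open>
  \<open>D [v\<^sub>k, \<dots>, v\<^sub>1]\<close> is the iterated directional derivative \<open>\<partial>\<^bsub>v\<^sub>k\<^esub> \<dots> \<partial>\<^bsub>v\<^sub>1\<^esub> F\<close>. On an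
  open subset of a finite-dimensional space, existence and continuity of all of them is smoothness.
\<close>

definition is_derivs ::
  "'b::real_vector topology \<Rightarrow> 'e::real_normed_vector set \<Rightarrow> ('e \<Rightarrow> 'b) \<Rightarrow> ('e list \<Rightarrow> 'e \<Rightarrow> 'b) \<Rightarrow> bool" where
  "is_derivs X S F D \<longleftrightarrow> D [] = F \<and>
     (\<forall>vs. continuous_map (top_of_set S) X (D vs)) \<and>
     (\<forall>vs v. \<forall>x\<in>S. limitin X (\<lambda>t. (D vs (x + t *\<^sub>R v) - D vs x) /\<^sub>R t) (D (v # vs) x) (at 0))"

definition smooth_into ::
  "'b::real_vector topology \<Rightarrow> 'e::real_normed_vector set \<Rightarrow> ('e \<Rightarrow> 'b) \<Rightarrow> bool" where
  "smooth_into X S F \<longleftrightarrow> (\<exists>D. is_derivs X S F D)"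

definition smooth_on :: "'e::euclidean_space set \<Rightarrow> ('e \<Rightarrow> 'f::real_normed_vector) \<Rightarrow> bool" where
  "smooth_on S F \<longleftrightarrow> smooth_into euclidean S F"

definition smooth_vectors ::
  "'b::real_vector topology \<Rightarrow> ('v::euclidean_space \<Rightarrow> 'b \<Rightarrow> 'b) \<Rightarrow> 'b set" where
  "smooth_vectors X \<alpha> = {a \<in> topspace X. smooth_into X UNIV (\<lambda>v. \<alpha> v a)}"


section \<open>Smooth manifolds\<close>

text \<open>A manifold is given by an atlas on a subset of a type; the subset is the union of the
  chart domains.\<close>

type_synonym ('a, 'e) chart = "'a set \<times> ('a \<Rightarrow> 'e)"

definition chart_inv :: "('a, 'e) chart \<Rightarrow> 'e \<Rightarrow> 'a" where
  "chart_inv c = inv_into (fst c) (snd c)"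

definition atlas_space :: "('a, 'e) chart set \<Rightarrow> 'a set" where
  "atlas_space A = \<Union> (fst ` A)"

definition smooth_atlas :: "('a, 'e::euclidean_space) chart set \<Rightarrow> bool" where
  "smooth_atlas A \<longleftrightarrow>
     (\<forall>c\<in>A. inj_on (snd c) (fst c)) \<and>
     (\<forall>c\<in>A. \<forall>d\<in>A. open (snd c ` (fst c \<inter> fst d)) \<and>
        smooth_on (snd c ` (fst c \<inter> fst d)) (snd d \<circ> chart_inv c))"

definition atlas_top :: "('a, 'e::euclidean_space) chart set \<Rightarrow> 'a topology" where
  "atlas_top A = topology (\<lambda>W. W \<subseteq> atlas_space A \<and> (\<forall>c\<in>A. open (snd c ` (W \<inter> fst c))))"

lemma openin_atlas_top:
  assumes "\<forall>c\<in>A. inj_on (snd c) (fst c)"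
  shows "openin (atlas_top A) W \<longleftrightarrow> W \<subseteq> atlas_space A \<and> (\<forall>c\<in>A. open (snd c ` (W \<inter> fst c)))"
proof -
  let ?Q = "\<lambda>W. W \<subseteq> atlas_space A \<and> (\<forall>c\<in>A. open (snd c ` (W \<inter> fst c)))"
  have "istopology ?Q"
    unfolding istopology_def
  proof (intro conjI allI impI)
    fix S T assume S: "?Q S" and T: "?Q T"
    show "S \<inter> T \<subseteq> atlas_space A" using S by blast
    show "\<forall>c\<in>A. open (snd c ` (S \<inter> T \<inter> fst c))"
    proof
      fix c assume c: "c \<in> A"
      have "snd c ` (S \<inter> T \<inter> fst c) = snd c ` (S \<inter> fst c) \<inter> snd c ` (T \<inter> fst c)"
        using assms c by (auto simp: inj_on_def)
      then show "open (snd c ` (S \<inter> T \<inter> fst c))" using S T c by auto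
    qed
  next
    fix K assume K: "\<forall>S\<in>K. ?Q S"
    show "\<Union>K \<subseteq> atlas_space A" using K by blast
    show "\<forall>c\<in>A. open (snd c ` (\<Union>K \<inter> fst c))"
    proof
      fix c assume c: "c \<in> A"
      have "snd c ` (\<Union>K \<inter> fst c) = (\<Union>S\<in>K. snd c ` (S \<inter> fst c))" by blast
      then show "open (snd c ` (\<Union>K \<inter> fst c))" using K c by auto
    qed
  qed
  then show ?thesis unfolding atlas_top_def by (simp add: topology_inverse')
qed

definition smooth_manifold :: "('a, 'e::euclidean_space) chart set \<Rightarrow> bool" where
  "smooth_manifold A \<longleftrightarrow>
     smooth_atlas A \<and> Hausdorff_space (atlas_top A) \<and> second_countable (atlas_top A)"

definition euclid_atlas :: "('e, 'e) chart set" where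
  "euclid_atlas = {(UNIV, \<lambda>x. x)}"

definition product_atlas ::
  "('a, 'e) chart set \<Rightarrow> ('b, 'f) chart set \<Rightarrow> ('a \<times> 'b, 'e \<times> 'f) chart set" where
  "product_atlas A B =
     (\<lambda>(c, d). (fst c \<times> fst d, \<lambda>(x, y). (snd c x, snd d y))) ` (A \<times> B)"

definition manifold_smooth ::
  "('a, 'e::euclidean_space) chart set \<Rightarrow> ('b, 'f::euclidean_space) chart set \<Rightarrow> 'a set \<Rightarrow> ('a \<Rightarrow> 'b) \<Rightarrow> bool" where
  "manifold_smooth A B S f \<longleftrightarrow> S \<subseteq> atlas_space A \<and> f ` S \<subseteq> atlas_space B \<and>
     continuous_map (subtopology (atlas_top A) S) (atlas_top B) f \<and>
     (\<forall>c\<in>A. \<forall>d\<in>B. smooth_on (snd c ` (S \<inter> fst c \<inter> f -` fst d)) (snd d \<circ> f \<circ> chart_inv c))"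

definition diffeo ::
  "('a, 'e::euclidean_space) chart set \<Rightarrow> 'a set \<Rightarrow> ('b, 'f::euclidean_space) chart set \<Rightarrow> 'b set \<Rightarrow> ('a \<Rightarrow> 'b) \<Rightarrow> bool" where
  "diffeo A S B T f \<longleftrightarrow> openin (atlas_top A) S \<and> openin (atlas_top B) T \<and> bij_betw f S T \<and>
     manifold_smooth A B S f \<and> manifold_smooth B A T (inv_into S f)"

definition chart_at :: "('a, 'e) chart set \<Rightarrow> 'a \<Rightarrow> ('a, 'e) chart" where
  "chart_at A x = (SOME c. c \<in> A \<and> x \<in> fst c)"

definition smooth_funs :: "('a, 'e::euclidean_space) chart set \<Rightarrow> ('a \<Rightarrow> real) set" where
  "smooth_funs A = {f. (\<forall>c\<in>A. smooth_on (snd c ` fst c) (f \<circ> chart_inv c)) \<and>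
     (\<forall>x. x \<notin> atlas_space A \<longrightarrow> f x = 0)}"

text \<open>
  A tangent vector at \<open>x\<close> is the family of its coordinate vectors in all charts around \<open>x\<close>,
  compatible with the chart changes (and \<open>0\<close> at the other charts).
\<close>

type_synonym ('a, 'e) tvec = "('a, 'e) chart \<Rightarrow> 'e"
type_synonym ('a, 'e) tpoint = "'a \<times> ('a, 'e) tvec"

definition tspace :: "('a, 'e::euclidean_space) chart set \<Rightarrow> 'a \<Rightarrow> ('a, 'e) tvec set" where
  "tspace A x = {v. (\<forall>c. c \<notin> A \<or> x \<notin> fst c \<longrightarrow> v c = 0) \<and>
     (\<forall>c\<in>A. \<forall>d\<in>A. x \<in> fst c \<and> x \<in> fst d \<longrightarrow>
        v d = frechet_derivative (snd d \<circ> chart_inv c) (at (snd c x)) (v c))}"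

definition tbundle :: "('a, 'e::euclidean_space) chart set \<Rightarrow> ('a, 'e) tpoint set" where
  "tbundle A = Sigma (atlas_space A) (tspace A)"

definition tangent_atlas ::
  "('a, 'e::euclidean_space) chart set \<Rightarrow> (('a, 'e) tpoint, 'e \<times> 'e) chart set" where
  "tangent_atlas A =
     (\<lambda>c. ({w \<in> tbundle A. fst w \<in> fst c}, \<lambda>w. (snd c (fst w), snd w c))) ` A"

text \<open>The tangent space at \<open>p\<close> as a manifold, with its linear charts.\<close>

definition fibre_atlas ::
  "('a, 'e::euclidean_space) chart set \<Rightarrow> 'a \<Rightarrow> (('a, 'e) chart \<Rightarrow> 'e, 'e) chart set" where
  "fibre_atlas A p = (\<lambda>c. (tspace A p, \<lambda>v. v c)) ` {c\<in>A. p \<in> fst c}"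

definition differential ::
  "('a, 'e::euclidean_space) chart set \<Rightarrow> ('b, 'f::euclidean_space) chart set \<Rightarrow> ('a \<Rightarrow> 'b) \<Rightarrow> 'a \<Rightarrow>
   ('a, 'e) tvec \<Rightarrow> ('b, 'f) chart \<Rightarrow> 'f" where
  "differential A B f x v = (\<lambda>d. if d \<in> B \<and> f x \<in> fst d
     then frechet_derivative (snd d \<circ> f \<circ> chart_inv (chart_at A x))
            (at (snd (chart_at A x) x)) (v (chart_at A x))
     else 0)"

definition velocity :: "('a, 'e::euclidean_space) chart set \<Rightarrow> (real \<Rightarrow> 'a) \<Rightarrow> real \<Rightarrow> ('a, 'e) chart \<Rightarrow> 'e" where
  "velocity A \<gamma> t = (\<lambda>c. if c \<in> A \<and> \<gamma> t \<in> fst c then vector_derivative (snd c \<circ> \<gamma>) (at t) else 0)"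

text \<open>Vector fields are extended by \<open>0\<close> outside the manifold, so that they form a vector space
  under the pointwise operations.\<close>

definition vector_fields ::
  "('a, 'e::euclidean_space) chart set \<Rightarrow> ('a \<Rightarrow> ('a, 'e) chart \<Rightarrow> 'e) set" where
  "vector_fields A = {X. (\<forall>x\<in>atlas_space A. X x \<in> tspace A x) \<and>
     (\<forall>x. x \<notin> atlas_space A \<longrightarrow> X x = 0) \<and>
     manifold_smooth A (tangent_atlas A) (atlas_space A) (\<lambda>x. (x, X x))}"

text \<open>The covector \<open>d\<^sub>x f\<close>, extended by \<open>0\<close> outside the tangent space.\<close>

definition dfun ::
  "('a, 'e::euclidean_space) chart set \<Rightarrow> ('a \<Rightarrow> real) \<Rightarrow> 'a \<Rightarrow> ('a, 'e) tvec \<Rightarrow> real" where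
  "dfun A f x v = (if v \<in> tspace A x
     then frechet_derivative (f \<circ> chart_inv (chart_at A x)) (at (snd (chart_at A x) x)) (v (chart_at A x))
     else 0)"

definition field_deriv ::
  "('a, 'e::euclidean_space) chart set \<Rightarrow> ('a \<Rightarrow> ('a, 'e) chart \<Rightarrow> 'e) \<Rightarrow> ('a \<Rightarrow> real) \<Rightarrow> 'a \<Rightarrow> real" where
  "field_deriv A X f = (\<lambda>x. if x \<in> atlas_space A then dfun A f x (X x) else 0)"


section \<open>Connections and the exponential map\<close>

type_synonym ('a, 'e) field_op =
  "('a \<Rightarrow> ('a, 'e) tvec) \<Rightarrow> ('a \<Rightarrow> ('a, 'e) tvec) \<Rightarrow> 'a \<Rightarrow> ('a, 'e) tvec"

definition connection ::
  "('a, 'e::euclidean_space) chart set \<Rightarrow> ('a, 'e) field_op \<Rightarrow> bool" where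
  "connection A nabla \<longleftrightarrow>
     (\<forall>X\<in>vector_fields A. \<forall>Y\<in>vector_fields A. nabla X Y \<in> vector_fields A) \<and>
     (\<forall>X\<in>vector_fields A. \<forall>X'\<in>vector_fields A. \<forall>Y\<in>vector_fields A. nabla (X + X') Y = nabla X Y + nabla X' Y) \<and>
     (\<forall>f\<in>smooth_funs A. \<forall>X\<in>vector_fields A. \<forall>Y\<in>vector_fields A.
        nabla (\<lambda>x. f x *\<^sub>R X x) Y = (\<lambda>x. f x *\<^sub>R nabla X Y x)) \<and>
     (\<forall>X\<in>vector_fields A. \<forall>Y\<in>vector_fields A. \<forall>Y'\<in>vector_fields A. nabla X (Y + Y') = nabla X Y + nabla X Y') \<and>
     (\<forall>f\<in>smooth_funs A. \<forall>X\<in>vector_fields A. \<forall>Y\<in>vector_fields A.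
        nabla X (\<lambda>x. f x *\<^sub>R Y x) = (\<lambda>x. field_deriv A X f x *\<^sub>R Y x + f x *\<^sub>R nabla X Y x))"

text \<open>\<open>\<nabla>\<^sub>X Y - \<nabla>\<^sub>Y X = [X, Y]\<close>, the Lie bracket being the commutator of derivations.\<close>

definition torsion_free ::
  "('a, 'e::euclidean_space) chart set \<Rightarrow> ('a, 'e) field_op \<Rightarrow> bool" where
  "torsion_free A nabla \<longleftrightarrow> (\<forall>X\<in>vector_fields A. \<forall>Y\<in>vector_fields A. \<forall>f\<in>smooth_funs A.
     field_deriv A (nabla X Y - nabla Y X) f =
     field_deriv A X (field_deriv A Y f) - field_deriv A Y (field_deriv A X f))"

text \<open>
  \<open>\<Gamma>(u, w) = \<Gamma>\<^sub>i\<^sub>j u\<^sup>i w\<^sup>j\<close> in the chart \<open>c\<close> at \<open>x\<close>: the coordinate vector of \<open>\<nabla>\<^sub>X Y\<close> at \<open>x\<close> for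
  global fields with \<open>X(x) = u\<close> and \<open>Y = w\<close> constant in the chart near \<open>x\<close>.
\<close>

definition christoffel ::
  "('a, 'e::euclidean_space) chart set \<Rightarrow> ('a, 'e) field_op \<Rightarrow>
   ('a, 'e) chart \<Rightarrow> 'a \<Rightarrow> 'e \<Rightarrow> 'e \<Rightarrow> 'e" where
  "christoffel A nabla c x u w = (THE z. \<forall>X\<in>vector_fields A. \<forall>Y\<in>vector_fields A.
     X x c = u \<and> (\<exists>W. openin (atlas_top A) W \<and> x \<in> W \<and> W \<subseteq> fst c \<and> (\<forall>y\<in>W. Y y c = w)) \<longrightarrow>
     nabla X Y x c = z)"

definition geodesic_on ::
  "('a, 'e::euclidean_space) chart set \<Rightarrow> ('a, 'e) field_op \<Rightarrow>
   real set \<Rightarrow> (real \<Rightarrow> 'a) \<Rightarrow> bool" where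
  "geodesic_on A nabla I \<gamma> \<longleftrightarrow> manifold_smooth euclid_atlas A I \<gamma> \<and>
     (\<forall>t\<in>I. \<forall>c\<in>A. \<gamma> t \<in> fst c \<longrightarrow>
        vector_derivative (\<lambda>s. vector_derivative (snd c \<circ> \<gamma>) (at s)) (at t)
        + christoffel A nabla c (\<gamma> t) (velocity A \<gamma> t c) (velocity A \<gamma> t c) = 0)"

definition exp_rel ::
  "('a, 'e::euclidean_space) chart set \<Rightarrow> ('a, 'e) field_op \<Rightarrow>
   'a \<Rightarrow> ('a, 'e) tvec \<Rightarrow> 'a \<Rightarrow> bool" where
  "exp_rel A nabla p v q \<longleftrightarrow> (\<exists>a b \<gamma>. a < 0 \<and> 1 < b \<and> geodesic_on A nabla {a<..<b} \<gamma> \<and>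
     \<gamma> 0 = p \<and> velocity A \<gamma> 0 = v \<and> \<gamma> 1 = q)"

definition exp_defined ::
  "('a, 'e::euclidean_space) chart set \<Rightarrow> ('a, 'e) field_op \<Rightarrow>
   'a \<Rightarrow> ('a, 'e) tvec \<Rightarrow> bool" where
  "exp_defined A nabla p v \<longleftrightarrow> (\<exists>q. exp_rel A nabla p v q)"

definition exp_map ::
  "('a, 'e::euclidean_space) chart set \<Rightarrow> ('a, 'e) field_op \<Rightarrow>
   'a \<Rightarrow> ('a, 'e) tvec \<Rightarrow> 'a" where
  "exp_map A nabla p v = (THE q. exp_rel A nabla p v q)"


section \<open>Vertical Poisson structures\<close>

type_synonym ('a, 'e) bivector_field =
  "'a \<Rightarrow> (('a, 'e) tvec \<Rightarrow> real) \<Rightarrow> (('a, 'e) tvec \<Rightarrow> real) \<Rightarrow> real"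

definition covectors ::
  "('a, 'e::euclidean_space) chart set \<Rightarrow> 'a \<Rightarrow> (('a, 'e) tvec \<Rightarrow> real) set" where
  "covectors A x = {\<alpha>. (\<forall>u\<in>tspace A x. \<forall>v\<in>tspace A x. \<alpha> (u + v) = \<alpha> u + \<alpha> v) \<and>
     (\<forall>r. \<forall>v\<in>tspace A x. \<alpha> (r *\<^sub>R v) = r * \<alpha> v) \<and> (\<forall>v. v \<notin> tspace A x \<longrightarrow> \<alpha> v = 0)}"

text \<open>Bivectors are alternating bilinear forms on covectors; a bivector field is smooth if all the
  brackets \<open>{f, g} = \<theta>(df, dg)\<close> are.\<close>

definition bracket ::
  "('a, 'e::euclidean_space) chart set \<Rightarrow> ('a, 'e) bivector_field \<Rightarrow>
   ('a \<Rightarrow> real) \<Rightarrow> ('a \<Rightarrow> real) \<Rightarrow> 'a \<Rightarrow> real" where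
  "bracket A \<theta> f g = (\<lambda>x. if x \<in> atlas_space A then \<theta> x (dfun A f x) (dfun A g x) else 0)"

definition poisson_structure ::
  "('a, 'e::euclidean_space) chart set \<Rightarrow> ('a, 'e) bivector_field \<Rightarrow> bool" where
  "poisson_structure A \<theta> \<longleftrightarrow>
     (\<forall>x\<in>atlas_space A. \<forall>\<alpha>\<in>covectors A x. \<forall>\<beta>\<in>covectors A x. \<theta> x \<alpha> \<beta> = - \<theta> x \<beta> \<alpha> \<and>
        (\<forall>\<alpha>'\<in>covectors A x. \<theta> x (\<alpha> + \<alpha>') \<beta> = \<theta> x \<alpha> \<beta> + \<theta> x \<alpha>' \<beta>) \<and>
        (\<forall>r. \<theta> x (r *\<^sub>R \<alpha>) \<beta> = r * \<theta> x \<alpha> \<beta>)) \<and>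
     (\<forall>f\<in>smooth_funs A. \<forall>g\<in>smooth_funs A. bracket A \<theta> f g \<in> smooth_funs A) \<and>
     (\<forall>f\<in>smooth_funs A. \<forall>g\<in>smooth_funs A. \<forall>h\<in>smooth_funs A.
        bracket A \<theta> f (bracket A \<theta> g h) + bracket A \<theta> g (bracket A \<theta> h f)
        + bracket A \<theta> h (bracket A \<theta> f g) = 0)"

definition wedge :: "'v \<Rightarrow> 'v \<Rightarrow> ('v \<Rightarrow> real) \<Rightarrow> ('v \<Rightarrow> real) \<Rightarrow> real" where
  "wedge u v \<alpha> \<beta> = \<alpha> u * \<beta> v - \<alpha> v * \<beta> u"

text \<open>A bivector lies in the second exterior power of a subspace iff its contraction with every
  annihilator of the subspace vanishes; here the subspace is the kernel of the differential of the
  bundle projection.\<close>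

definition vertical_bivector ::
  "('a, 'e::euclidean_space) chart set \<Rightarrow>
   (('a, 'e) tpoint, 'e \<times> 'e) bivector_field \<Rightarrow> bool" where
  "vertical_bivector A \<theta> \<longleftrightarrow> (\<forall>w\<in>tbundle A.
     \<forall>\<alpha>\<in>covectors (tangent_atlas A) w. \<forall>\<beta>\<in>covectors (tangent_atlas A) w.
       (\<forall>\<xi>\<in>tspace (tangent_atlas A) w. differential (tangent_atlas A) A fst w \<xi> = 0 \<longrightarrow> \<alpha> \<xi> = 0) \<longrightarrow>
       \<theta> w \<alpha> \<beta> = 0)"

definition smooth_action ::
  "('a, 'e::euclidean_space) chart set \<Rightarrow> (real^'d \<Rightarrow> 'a \<Rightarrow> 'a) \<Rightarrow> bool" where
  "smooth_action A \<sigma> \<longleftrightarrow>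
     (\<forall>x\<in>atlas_space A. \<sigma> 0 x = x \<and> (\<forall>u v. \<sigma> (u + v) x = \<sigma> u (\<sigma> v x))) \<and>
     manifold_smooth (product_atlas euclid_atlas A) A (UNIV \<times> atlas_space A) (\<lambda>(v, x). \<sigma> v x)"

definition fund_field ::
  "('a, 'e::euclidean_space) chart set \<Rightarrow> (real^'d \<Rightarrow> 'a \<Rightarrow> 'a) \<Rightarrow> 'd \<Rightarrow> 'a \<Rightarrow> ('a, 'e) chart \<Rightarrow> 'e" where
  "fund_field A \<sigma> i x = velocity A (\<lambda>t. \<sigma> (t *\<^sub>R axis i 1) x) 0"

definition field_support ::
  "('a, 'e::euclidean_space) chart set \<Rightarrow> ('a \<Rightarrow> ('a, 'e) chart \<Rightarrow> 'e) \<Rightarrow> 'a set" where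
  "field_support A X = (atlas_top A) closure_of {x \<in> atlas_space A. X x \<noteq> 0}"

definition admissible ::
  "('a, 'e::euclidean_space) chart set \<Rightarrow> ('a, 'e) tpoint set \<Rightarrow>
   (('a, 'e) tpoint, 'e \<times> 'e) bivector_field \<Rightarrow>
   (real^'d \<Rightarrow> ('a, 'e) tpoint \<Rightarrow> ('a, 'e) tpoint) \<Rightarrow> real^'d^'d \<Rightarrow> bool" where
  "admissible A U \<theta> \<sigma> \<Theta> \<longleftrightarrow>
     smooth_action (tangent_atlas A) \<sigma> \<and>
     (\<forall>v. \<forall>w\<in>tbundle A. fst (\<sigma> v w) = fst w) \<and>
     (\<forall>i j. \<Theta> $ i $ j = - (\<Theta> $ j $ i)) \<and>
     (\<forall>w\<in>tbundle A. \<forall>\<alpha>\<in>covectors (tangent_atlas A) w. \<forall>\<beta>\<in>covectors (tangent_atlas A) w.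
        \<theta> w \<alpha> \<beta> = 1/2 * (\<Sum>i\<in>UNIV. \<Sum>j\<in>UNIV. \<Theta> $ i $ j *
          wedge (fund_field (tangent_atlas A) \<sigma> i w) (fund_field (tangent_atlas A) \<sigma> j w) \<alpha> \<beta>)) \<and>
     (\<forall>i. field_support (tangent_atlas A) (fund_field (tangent_atlas A) \<sigma> i) \<subseteq> U) \<and>
     (\<forall>i. \<forall>p\<in>atlas_space A. compactin (atlas_top (tangent_atlas A))
        (field_support (tangent_atlas A) (fund_field (tangent_atlas A) \<sigma> i) \<inter> {p} \<times> tspace A p))"

text \<open>The restriction \<open>X|\<^bsub>T\<^sub>pM\<^esub>\<close>: the field on the submanifold \<open>T\<^sub>pM\<close> which the inclusion
  \<open>v \<mapsto> (p, v)\<close> relates to \<open>X\<close>.\<close>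

definition fibre_field ::
  "('a, 'e::euclidean_space) chart set \<Rightarrow> 'a \<Rightarrow>
   (('a, 'e) tpoint \<Rightarrow> (('a, 'e) tpoint, 'e \<times> 'e) chart \<Rightarrow> 'e \<times> 'e) \<Rightarrow>
   ('a, 'e) tvec \<Rightarrow> (('a, 'e) chart \<Rightarrow> 'e, 'e) chart \<Rightarrow> 'e" where
  "fibre_field A p X v = (THE \<zeta>. \<zeta> \<in> tspace (fibre_atlas A p) v \<and>
     differential (fibre_atlas A p) (tangent_atlas A) (Pair p) v \<zeta> = X (p, v))"

definition pushforward_field ::
  "('a, 'e::euclidean_space) chart set \<Rightarrow> 'a set \<Rightarrow> ('b, 'f::euclidean_space) chart set \<Rightarrow> ('a \<Rightarrow> 'b) \<Rightarrow>
   ('a \<Rightarrow> ('a, 'e) chart \<Rightarrow> 'e) \<Rightarrow> 'b \<Rightarrow> ('b, 'f) chart \<Rightarrow> 'f" where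
  "pushforward_field A S B f X y = (if y \<in> f ` S
     then differential A B f (inv_into S f y) (X (inv_into S f y)) else 0)"

definition integral_curve ::
  "('a, 'e::euclidean_space) chart set \<Rightarrow> ('a \<Rightarrow> ('a, 'e) chart \<Rightarrow> 'e) \<Rightarrow> 'a \<Rightarrow> (real \<Rightarrow> 'a) \<Rightarrow> bool" where
  "integral_curve A Z x \<gamma> \<longleftrightarrow> \<gamma> 0 = x \<and> continuous_map euclideanreal (atlas_top A) \<gamma> \<and>
     (\<forall>t. \<forall>c\<in>A. \<gamma> t \<in> fst c \<longrightarrow> ((snd c \<circ> \<gamma>) has_vector_derivative Z (\<gamma> t) c) (at t))"

definition field_flow ::
  "('a, 'e::euclidean_space) chart set \<Rightarrow> ('a \<Rightarrow> ('a, 'e) chart \<Rightarrow> 'e) \<Rightarrow> real \<Rightarrow> 'a \<Rightarrow> 'a" where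
  "field_flow A Z t x = (THE \<gamma>. integral_curve A Z x \<gamma>) t"

text \<open>\<open>\<phi>\<^bsub>v\<^sub>1\<^esub> \<circ> \<dots> \<circ> \<phi>\<^bsub>v\<^sub>d\<^esub>\<close> for the flows of \<open>Z\<^sub>1, \<dots>, Z\<^sub>d\<close>; the order on the index type
  only serves to write down the composition.\<close>

definition joint_flow ::
  "('a, 'e::euclidean_space) chart set \<Rightarrow> (('d::{finite,linorder}) \<Rightarrow> 'a \<Rightarrow> ('a, 'e) chart \<Rightarrow> 'e) \<Rightarrow>
   real^('d::{finite,linorder}) \<Rightarrow> 'a \<Rightarrow> 'a" where
  "joint_flow A Z v =
     foldr (\<lambda>i h. field_flow A (Z i) (v $ i) \<circ> h) (sorted_list_of_set UNIV) id"


section \<open>Function algebras\<close>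

text \<open>
  Functions on a space \<open>N\<close> are represented by functions on the whole type vanishing outside \<open>N\<close>.
  Thus \<open>cut N\<close> is the restriction of functions to \<open>N\<close>, and the inclusion of functions on \<open>N\<close> into
  functions on a larger space, extension by \<open>0\<close>, is \<open>id\<close>.
\<close>

definition cut :: "'n set \<Rightarrow> ('n \<Rightarrow> complex) \<Rightarrow> 'n \<Rightarrow> complex" where
  "cut N f = (\<lambda>x. if x \<in> N then f x else 0)"

definition C0_carrier :: "'n topology \<Rightarrow> ('n \<Rightarrow> complex) set" where
  "C0_carrier X = {f. continuous_map X euclidean f \<and> (\<forall>x. x \<notin> topspace X \<longrightarrow> f x = 0)}"

definition sup_seminorm :: "'n set \<Rightarrow> ('n \<Rightarrow> complex) \<Rightarrow> real" where
  "sup_seminorm L f = (if L = {} then 0 else SUP x\<in>L. cmod (f x))"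

definition cstar_seminorm :: "('n \<Rightarrow> complex) set \<Rightarrow> (('n \<Rightarrow> complex) \<Rightarrow> real) \<Rightarrow> bool" where
  "cstar_seminorm A q \<longleftrightarrow>
     (\<forall>f\<in>A. 0 \<le> q f \<and> (\<forall>c. q (\<lambda>x. c * f x) = cmod c * q f) \<and> q (\<lambda>x. cnj (f x) * f x) = (q f)\<^sup>2) \<and>
     (\<forall>f\<in>A. \<forall>g\<in>A. q (f + g) \<le> q f + q g \<and> q (f * g) \<le> q f * q g)"

text \<open>A function algebra with defining seminorms \<open>snorms\<close> and an action of \<open>\<real>\<^sup>d\<close>; \<open>qnorms\<close> are
  the \<open>C\<^sup>*\<close>-seminorms \<open>q\<close> entering the definition of the deformed topology.\<close>

record ('n, 'd) fun_system =
  carr :: "('n \<Rightarrow> complex) set"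
  snorms :: "(('n \<Rightarrow> complex) \<Rightarrow> real) set"
  qnorms :: "(('n \<Rightarrow> complex) \<Rightarrow> real) set"
  act :: "real^'d \<Rightarrow> ('n \<Rightarrow> complex) \<Rightarrow> 'n \<Rightarrow> complex"

definition real_seminorm_top :: "('n \<Rightarrow> complex) set \<Rightarrow> (('n \<Rightarrow> complex) \<Rightarrow> real) set \<Rightarrow> ('n \<Rightarrow> complex) topology" where
  "real_seminorm_top A P = seminorm_top A ((\<lambda>p f. ereal (p f)) ` P)"

definition alg_top :: "('n, 'd::finite) fun_system \<Rightarrow> ('n \<Rightarrow> complex) topology" where
  "alg_top S = real_seminorm_top (carr S) (snorms S)"

definition compact_seminorms :: "'n topology \<Rightarrow> (('n \<Rightarrow> complex) \<Rightarrow> real) set" where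
  "compact_seminorms X = sup_seminorm ` {L. compactin X L}"

text \<open>\<open>C\<^sup>0\<close>, \<open>C\<^sup>0\<^sub>b\<close> and \<open>C\<^sup>0\<^sub>\<infinity>\<close> of the space \<open>X\<close>, with \<open>\<real>\<^sup>d\<close> acting by
  \<open>\<alpha>\<^sub>v f = f \<circ> \<Phi>\<^sub>v\<close>. Here \<open>X\<close> may be an invariant subspace of the space on which \<open>\<Phi>\<close> acts.\<close>

definition C0 :: "'n topology \<Rightarrow> (real^'d \<Rightarrow> 'n \<Rightarrow> 'n) \<Rightarrow> ('n, 'd::finite) fun_system" where
  "C0 X \<Phi> = \<lparr> carr = C0_carrier X, snorms = compact_seminorms X,
     qnorms = {q. cstar_seminorm (C0_carrier X) q \<and>
       continuous_map (real_seminorm_top (C0_carrier X) (compact_seminorms X)) euclideanreal q},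
     act = (\<lambda>v f. cut (topspace X) (f \<circ> \<Phi> v)) \<rparr>"

definition C0b :: "'n topology \<Rightarrow> (real^'d \<Rightarrow> 'n \<Rightarrow> 'n) \<Rightarrow> ('n, 'd::finite) fun_system" where
  "C0b X \<Phi> = \<lparr> carr = {f \<in> C0_carrier X. bounded (range f)},
     snorms = {sup_seminorm (topspace X)}, qnorms = {sup_seminorm (topspace X)},
     act = (\<lambda>v f. cut (topspace X) (f \<circ> \<Phi> v)) \<rparr>"

definition C0inf :: "'n topology \<Rightarrow> (real^'d \<Rightarrow> 'n \<Rightarrow> 'n) \<Rightarrow> ('n, 'd::finite) fun_system" where
  "C0inf X \<Phi> = \<lparr> carr = {f \<in> C0_carrier X. \<forall>\<epsilon>>0. \<exists>K. compactin X K \<and> (\<forall>x\<in>topspace X - K. cmod (f x) < \<epsilon>)},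
     snorms = {sup_seminorm (topspace X)}, qnorms = {sup_seminorm (topspace X)},
     act = (\<lambda>v f. cut (topspace X) (f \<circ> \<Phi> v)) \<rparr>"

definition smooth_part :: "('n, 'd::finite) fun_system \<Rightarrow> ('n \<Rightarrow> complex) set" where
  "smooth_part S = smooth_vectors (alg_top S) (act S)"


section \<open>Deformation\<close>

definition lattice_set :: "'v::euclidean_space set \<Rightarrow> bool" where
  "lattice_set \<Lambda> \<longleftrightarrow> (\<exists>B. independent B \<and> span B = UNIV \<and>
     \<Lambda> = range (\<lambda>n :: 'v \<Rightarrow> int. \<Sum>b\<in>B. of_int (n b) *\<^sub>R b))"

text \<open>The translates \<open>\<phi>(\<cdot> - w)\<close>, \<open>w \<in> \<Lambda>\<close>, form a smooth partition of unity.\<close>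

definition lattice_partition :: "'v::euclidean_space set \<Rightarrow> ('v \<Rightarrow> real) \<Rightarrow> bool" where
  "lattice_partition \<Lambda> \<phi> \<longleftrightarrow> lattice_set \<Lambda> \<and> smooth_on UNIV \<phi> \<and> (\<forall>z. 0 \<le> \<phi> z) \<and>
     compact (closure {z. \<phi> z \<noteq> 0}) \<and> (\<forall>z. ((\<lambda>w. \<phi> (z - w)) has_sum 1) \<Lambda>)"

text \<open>
  The oscillatory integral of a function with values in a function algebra. Evaluation at a point is
  linear and continuous on each of the algebras, so integrals and series are computed pointwise.
\<close>

definition osc_integral ::
  "((real^'d) \<times> (real^'d)) set \<Rightarrow> ((real^'d) \<times> (real^'d) \<Rightarrow> real) \<Rightarrow>
   ((real^'d) \<times> (real^'d) \<Rightarrow> 'n \<Rightarrow> complex) \<Rightarrow> 'n \<Rightarrow> complex" where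
  "osc_integral \<Lambda> \<phi> F = (\<lambda>x. \<Sum>\<^sub>\<infinity>w\<in>\<Lambda>.
     (LINT z|lborel. F z x * of_real (\<phi> (z - w)) * exp (2 * of_real pi * \<i> * of_real (fst z \<bullet> snd z))))"

definition star ::
  "((real^'d) \<times> (real^'d)) set \<Rightarrow> ((real^'d) \<times> (real^'d) \<Rightarrow> real) \<Rightarrow> real^'d^'d \<Rightarrow> ('n, 'd::finite) fun_system \<Rightarrow>
   ('n \<Rightarrow> complex) \<Rightarrow> ('n \<Rightarrow> complex) \<Rightarrow> 'n \<Rightarrow> complex" where
  "star \<Lambda> \<phi> \<Theta> S a b = osc_integral \<Lambda> \<phi> (\<lambda>(u, v). act S (\<Theta> *v u) a * act S v b)"

definition Cu :: "('n, 'd::finite) fun_system \<Rightarrow> (real^'d \<Rightarrow> 'n \<Rightarrow> complex) set" where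
  "Cu S = {F. range F \<subseteq> carr S \<and> (\<forall>p\<in>snorms S. bounded (range (\<lambda>v. p (F v))) \<and>
     (\<forall>\<epsilon>>0. \<exists>\<delta>>0. \<forall>v w. dist v w < \<delta> \<longrightarrow> p (F v - F w) < \<epsilon>))}"

definition Cu_top :: "('n, 'd::finite) fun_system \<Rightarrow> (real^'d \<Rightarrow> 'n \<Rightarrow> complex) topology" where
  "Cu_top S = seminorm_top (Cu S) ((\<lambda>p F. ereal (SUP v. p (F v))) ` snorms S)"

definition Cu_star ::
  "((real^'d) \<times> (real^'d)) set \<Rightarrow> ((real^'d) \<times> (real^'d) \<Rightarrow> real) \<Rightarrow> real^'d^'d \<Rightarrow>
   (real^'d \<Rightarrow> 'n \<Rightarrow> complex) \<Rightarrow> (real^'d \<Rightarrow> 'n \<Rightarrow> complex) \<Rightarrow> real^'d \<Rightarrow> 'n \<Rightarrow> complex" where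
  "Cu_star \<Lambda> \<phi> \<Theta> F G = (\<lambda>x. osc_integral \<Lambda> \<phi> (\<lambda>(u, v). F (x + \<Theta> *v u) * G (x + v)))"

definition schwartz :: "('n, 'd::finite) fun_system \<Rightarrow> (real^'d \<Rightarrow> 'n \<Rightarrow> complex) set" where
  "schwartz S = {f \<in> smooth_vectors (Cu_top S) (\<lambda>v F x. F (x + v)).
     \<exists>D. is_derivs (alg_top S) UNIV f D \<and>
       (\<forall>vs P. real_polynomial_function P \<longrightarrow>
          (\<forall>p\<in>snorms S. bounded (range (\<lambda>v. p (P v *\<^sub>R D vs v)))))}"

definition module_inner ::
  "(real^'d \<Rightarrow> 'n \<Rightarrow> complex) \<Rightarrow> (real^'d \<Rightarrow> 'n \<Rightarrow> complex) \<Rightarrow> 'n \<Rightarrow> complex" where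
  "module_inner f g = (\<lambda>x. LINT v|lborel. cnj (f v x) * g v x)"

definition module_norm ::
  "(('n \<Rightarrow> complex) \<Rightarrow> real) \<Rightarrow> (real^'d \<Rightarrow> 'n \<Rightarrow> complex) \<Rightarrow> real" where
  "module_norm q f = sqrt (q (module_inner f f))"

definition deformed_norm ::
  "((real^'d) \<times> (real^'d)) set \<Rightarrow> ((real^'d) \<times> (real^'d) \<Rightarrow> real) \<Rightarrow> real^'d^'d \<Rightarrow> ('n, 'd::finite) fun_system \<Rightarrow>
   (('n \<Rightarrow> complex) \<Rightarrow> real) \<Rightarrow> ('n \<Rightarrow> complex) \<Rightarrow> ereal" where
  "deformed_norm \<Lambda> \<phi> \<Theta> S q a =
     (SUP g \<in> {g \<in> schwartz S. module_norm q g \<le> 1}.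
        ereal (module_norm q (Cu_star \<Lambda> \<phi> \<Theta> (\<lambda>v. act S v a) g)))"

definition deformed_top ::
  "((real^'d) \<times> (real^'d)) set \<Rightarrow> ((real^'d) \<times> (real^'d) \<Rightarrow> real) \<Rightarrow> real^'d^'d \<Rightarrow> ('n, 'd::finite) fun_system \<Rightarrow>
   ('n \<Rightarrow> complex) topology" where
  "deformed_top \<Lambda> \<phi> \<Theta> S = seminorm_top (smooth_part S) (deformed_norm \<Lambda> \<phi> \<Theta> S ` qnorms S)"

text \<open>\<open>T\<close> induces a \<open>*\<close>-homomorphism \<open>(S\<^sup>\<infinity>, \<star>) \<rightarrow> (S'\<^sup>\<infinity>, \<star>)\<close>.\<close>

definition star_hom ::
  "((real^'d) \<times> (real^'d)) set \<Rightarrow> ((real^'d) \<times> (real^'d) \<Rightarrow> real) \<Rightarrow> real^'d^'d \<Rightarrow>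
   ('m, 'd::finite) fun_system \<Rightarrow> ('n, 'd::finite) fun_system \<Rightarrow> (('m \<Rightarrow> complex) \<Rightarrow> 'n \<Rightarrow> complex) \<Rightarrow> bool" where
  "star_hom \<Lambda> \<phi> \<Theta> S S' T \<longleftrightarrow> T ` smooth_part S \<subseteq> smooth_part S' \<and>
     (\<forall>a\<in>smooth_part S. \<forall>b\<in>smooth_part S. T (a + b) = T a + T b \<and>
        T (star \<Lambda> \<phi> \<Theta> S a b) = star \<Lambda> \<phi> \<Theta> S' (T a) (T b)) \<and>
     (\<forall>a\<in>smooth_part S. (\<forall>c. T (\<lambda>x. c * a x) = (\<lambda>x. c * T a x)) \<and>
        T (\<lambda>x. cnj (a x)) = (\<lambda>x. cnj (T a x)))"

definition continuous_star_hom ::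
  "((real^'d) \<times> (real^'d)) set \<Rightarrow> ((real^'d) \<times> (real^'d) \<Rightarrow> real) \<Rightarrow> real^'d^'d \<Rightarrow>
   ('m, 'd::finite) fun_system \<Rightarrow> ('n, 'd::finite) fun_system \<Rightarrow> (('m \<Rightarrow> complex) \<Rightarrow> 'n \<Rightarrow> complex) \<Rightarrow> bool" where
  "continuous_star_hom \<Lambda> \<phi> \<Theta> S S' T \<longleftrightarrow> star_hom \<Lambda> \<phi> \<Theta> S S' T \<and>
     continuous_map (deformed_top \<Lambda> \<phi> \<Theta> S) (deformed_top \<Lambda> \<phi> \<Theta> S') T"

definition continuous_star_iso ::
  "((real^'d) \<times> (real^'d)) set \<Rightarrow> ((real^'d) \<times> (real^'d) \<Rightarrow> real) \<Rightarrow> real^'d^'d \<Rightarrow>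
   ('m, 'd::finite) fun_system \<Rightarrow> ('n, 'd::finite) fun_system \<Rightarrow> (('m \<Rightarrow> complex) \<Rightarrow> 'n \<Rightarrow> complex) \<Rightarrow> bool" where
  "continuous_star_iso \<Lambda> \<phi> \<Theta> S S' T \<longleftrightarrow> continuous_star_hom \<Lambda> \<phi> \<Theta> S S' T \<and>
     bij_betw T (smooth_part S) (smooth_part S')"

text \<open>The deformed product for the action \<open>\<Phi>\<close> on the space \<open>X\<close> restricts to the invariant open
  subset \<open>N\<close>.\<close>

definition star_restricts ::
  "((real^'d) \<times> (real^'d)) set \<Rightarrow> ((real^'d) \<times> (real^'d) \<Rightarrow> real) \<Rightarrow> real^'d^'d \<Rightarrow>
   'n topology \<Rightarrow> (real^'d \<Rightarrow> 'n \<Rightarrow> 'n) \<Rightarrow> 'n set \<Rightarrow> bool" where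
  "star_restricts \<Lambda> \<phi> \<Theta> X \<Phi> N \<longleftrightarrow>
     continuous_star_hom \<Lambda> \<phi> \<Theta> (C0 X \<Phi>) (C0 (subtopology X N) \<Phi>) (cut N) \<and>
     continuous_star_hom \<Lambda> \<phi> \<Theta> (C0b X \<Phi>) (C0b (subtopology X N) \<Phi>) (cut N) \<and>
     continuous_star_hom \<Lambda> \<phi> \<Theta> (C0inf (subtopology X N) \<Phi>) (C0inf X \<Phi>) id"

definition pullback :: "'m set \<Rightarrow> ('m \<Rightarrow> 'n) \<Rightarrow> ('n \<Rightarrow> complex) \<Rightarrow> 'm \<Rightarrow> complex" where
  "pullback N f h = cut N (h \<circ> f)"

end

theory Submission
  imports Defs "HOL-Probability.Sinc_Integral"
begin

text \<open>
  The product \<open>a \<star> b\<close> and all the norms that define the deformed topologies are computed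
  point by point on the space: the value at \<open>n\<close> is an oscillatory integral of
  \<open>(u, v) \<mapsto> a (\<Phi>\<^bsub>\<Theta>u\<^esub> n) b (\<Phi>\<^bsub>v\<^esub> n)\<close> and only sees the orbit of \<open>n\<close>.
  Therefore every map of the form \<open>f \<mapsto> \<eta> (f \<circ> \<kappa>)\<close>, with \<open>\<eta>\<close> an invariant function with
  values \<open>0\<close> and \<open>1\<close> and \<open>\<kappa>\<close> equivariant, is compatible with the products. Restriction to an
  invariant open set, extension by \<open>0\<close> and pull-back along an equivariant homeomorphism are such
  maps. The substance of the theorem is the continuity of these maps, and the equivariance of the
  exponential map.

  Continuity. The norm \<open>\<parallel>a\<parallel>\<^sub>\<Theta>\<close> is a supremum over Schwartz functions \<open>g\<close>, so a bound of a norm on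
  \<open>N\<close> by a norm on \<open>X\<close> requires to turn a Schwartz function on \<open>N\<close> into one on \<open>X\<close>.
  This is done by multiplication with a cut-off function \<open>\<eta>\<close> with compact support in \<open>N\<close>.
  The function \<open>\<eta>\<close> need not be invariant: in \<open>\<phi>(a) \<star> g\<close> the flow moves the argument of \<open>a\<close> only,
  so \<open>\<phi>(a) \<star> (\<eta> g) = \<eta> (\<phi>(a) \<star> g)\<close>. For \<open>C\<^sup>0\<close> a continuous \<open>C\<^sup>*\<close>-seminorm only depends
  on the values on some compact set (\<open>continuous_cstar_seminorm_compact_support\<close>), and \<open>\<eta>\<close>
  is chosen to be \<open>1\<close> there. For the sup-norms it suffices to have \<open>\<eta> = 1\<close> at one point at a
  time (\<open>supnorm_domination\<close>). The topologies are made from the norms of differences, hence such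
  bounds give continuity.

  Analysis. These arguments need that \<open>\<phi>(a) \<star> g\<close> has finite module norm and depends
  continuously on the point. Both follow from one estimate of oscillatory integrals
  (\<open>osc_estimate\<close>): integration by parts with \<open>1 + \<partial>\<^sub>b\<close>, twice for each coordinate, gains an
  integrable factor, uniformly in parameters, whence the sum over the lattice of cells converges
  absolutely and \<open>\<phi>(a) \<star> g\<close> decays (\<open>twisted_estimates\<close>).

  Geometry. The flow of a field is defined by its integral curves; if \<open>\<psi>\<close> is a one-parameter group
  that is known to generate the field, these are unique because
  \<open>t \<mapsto> \<psi>\<^bsub>-t\<^esub> (\<gamma> t)\<close> has derivative \<open>0\<close> for every integral curve \<open>\<gamma>\<close>.
  So the flow on \<open>T\<^sub>pM\<close> is the given action, and the flow on \<open>M\<close> is its conjugate by \<open>exp\<^sub>p\<close>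
  on \<open>V\<^sub>p\<close> and the identity elsewhere. The latter uses that the supports meet \<open>T\<^sub>pM\<close> in a compact
  subset \<open>K\<close> of \<open>U\<^sub>p\<close>: its image is closed in the Hausdorff space \<open>M\<close>, hence near a point
  outside \<open>V\<^sub>p\<close> the field vanishes. In particular \<open>exp\<^sub>p\<close> is equivariant.
\<close>

section \<open>Weights and symbol classes\<close>

text \<open>A product over the coordinates, so that it splits on \<open>\<real>\<^sup>d \<times> \<real>\<^sup>d\<close> and its integrability reduces to dimension one.\<close>

definition decay :: "'e::euclidean_space \<Rightarrow> real" where
  "decay v = (\<Prod>b\<in>Basis. inverse (1 + (v \<bullet> b)\<^sup>2))"

lemma decay_pos: "0 < decay v"
  unfolding decay_def by (intro prod_pos) (auto simp: add_pos_nonneg)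

lemma decay_nonneg [simp]: "0 \<le> decay v"
  using decay_pos[of v] by linarith

lemma decay_le_1: "decay v \<le> 1"
  unfolding decay_def by (intro prod_le_1) (auto simp: add_nonneg_pos inverse_le_1_iff)

lemma continuous_on_decay [continuous_intros]:
  "continuous_on S f \<Longrightarrow> continuous_on S (\<lambda>x. decay (f x))"
  unfolding decay_def
  by (intro continuous_intros) (auto simp: add_nonneg_eq_0_iff)

lemma borel_measurable_decay [measurable]: "decay \<in> borel_measurable borel"
  by (intro borel_measurable_continuous_onI continuous_intros)

lemma integrable_inverse_1_plus_square_lborel: "integrable lborel (\<lambda>x::real. inverse (1 + x\<^sup>2))"
  using integrable_inverse_1_plus_square by (simp add: set_integrable_def)

lemma integrable_decay: "integrable lborel (decay :: 'e::euclidean_space \<Rightarrow> real)"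
proof (rule integrableI_bounded)
  have "(\<integral>\<^sup>+ x. ennreal (norm (decay (x::'e))) \<partial>lborel) =
      (\<integral>\<^sup>+ x. (\<Prod>b\<in>Basis. ennreal (inverse (1 + ((x::'e) \<bullet> b)\<^sup>2))) \<partial>lborel)"
    by (intro nn_integral_cong) (simp add: decay_def prod_ennreal prod_nonneg)
  also have "\<dots> = (\<Prod>b\<in>(Basis::'e set). (\<integral>\<^sup>+ x. ennreal (inverse (1 + (x::real)\<^sup>2)) \<partial>lborel))"
    by (rule nn_integral_lborel_prod[where f = "\<lambda>(b::'e) x. ennreal (inverse (1 + x\<^sup>2))"]) auto
  also have "\<dots> < \<infinity>"
  proof -
    have "(\<integral>\<^sup>+ x. ennreal (inverse (1 + (x::real)\<^sup>2)) \<partial>lborel) =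
        ennreal (LINT x|lborel. inverse (1 + (x::real)\<^sup>2))"
      by (intro nn_integral_eq_integral integrable_inverse_1_plus_square_lborel) auto
    then show ?thesis by (simp add: ennreal_power)
  qed
  finally show "(\<integral>\<^sup>+ x. ennreal (norm (decay (x::'e))) \<partial>lborel) < \<infinity>" .
qed simp

lemma decay_mult_decay_le:
  fixes x v :: "'e::euclidean_space"
  shows "decay (x + v) * decay v \<le> 2 ^ DIM('e) * decay x"
proof -
  have *: "inverse (1 + (a + c)\<^sup>2) * inverse (1 + c\<^sup>2) \<le> 2 * inverse (1 + a\<^sup>2)" for a c :: real
  proof -
    have "1 + a\<^sup>2 \<le> 2 * ((1 + (a + c)\<^sup>2) * (1 + c\<^sup>2))"
    proof -
      have "0 \<le> (a + 2 * c)\<^sup>2 + 2 * ((a + c) * c)\<^sup>2" by simp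
      then show ?thesis by (simp add: power2_eq_square algebra_simps)
    qed
    moreover have "0 < 1 + a\<^sup>2" "0 < (1 + (a + c)\<^sup>2) * (1 + c\<^sup>2)"
      by (auto intro!: mult_pos_pos add_pos_nonneg)
    ultimately show ?thesis
      by (simp add: field_simps flip: inverse_mult_distrib)
  qed
  have "decay (x + v) * decay v = (\<Prod>b\<in>Basis. inverse (1 + ((x \<bullet> b) + (v \<bullet> b))\<^sup>2) * inverse (1 + (v \<bullet> b)\<^sup>2))"
    by (simp add: decay_def prod.distrib inner_add_left)
  also have "\<dots> \<le> (\<Prod>b\<in>Basis. 2 * inverse (1 + (x \<bullet> b)\<^sup>2))"
    by (intro prod_mono conjI * mult_nonneg_nonneg) auto
  also have "\<dots> = 2 ^ DIM('e) * decay x"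
    by (simp add: decay_def prod.distrib)
  finally show ?thesis .
qed

lemma prod_Basis_prod:
  fixes f :: "'a::euclidean_space \<times> 'b::euclidean_space \<Rightarrow> real"
  shows "prod f Basis = (\<Prod>b\<in>Basis. f (b, 0)) * (\<Prod>b\<in>Basis. f (0, b))"
proof -
  have inj: "inj_on (\<lambda>u. (u::'a, 0::'b)) Basis" "inj_on (\<lambda>u. (0::'a, u::'b)) Basis"
    by (auto simp: inj_on_def)
  show ?thesis
    unfolding Basis_prod_def
    by (subst prod.union_disjoint) (auto simp: Basis_prod_def prod.reindex inj nonzero_Basis)
qed

lemma decay_Pair: "decay (u, v) = decay u * decay v"
  unfolding decay_def by (simp add: prod_Basis_prod)

definition osc_kernel :: "'v::euclidean_space \<times> 'v \<Rightarrow> complex" where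
  "osc_kernel z = exp (2 * of_real pi * \<i> * of_real (fst z \<bullet> snd z))"

text \<open>Since \<open>\<partial>\<^sub>b osc_kernel z = 2\<pi>i (z \<bullet> swap b) osc_kernel z\<close>, this is the inverse of the factor by which \<open>1 + \<partial>\<^sub>b\<close> multiplies \<open>osc_kernel\<close>.\<close>

definition resol :: "'v::euclidean_space \<times> 'v \<Rightarrow> 'v \<times> 'v \<Rightarrow> complex" where
  "resol b z = inverse (1 + 2 * of_real pi * \<i> * of_real (z \<bullet> prod.swap b))"

lemma inner_swap: "fst z \<bullet> snd b + fst b \<bullet> snd z = z \<bullet> prod.swap b"
  for z b :: "'v::euclidean_space \<times> 'v"
  by (cases z; cases b) (simp add: inner_commute)

lemma resol_denom_nonzero: "1 + 2 * of_real pi * \<i> * of_real y \<noteq> 0"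
proof
  assume "1 + 2 * of_real pi * \<i> * of_real y = 0"
  then have "Re (1 + 2 * of_real pi * \<i> * of_real y) = 0" by simp
  then show False by simp
qed

lemma cmod_resol_sq: "(cmod (resol b z))\<^sup>2 \<le> inverse (1 + (z \<bullet> prod.swap b)\<^sup>2)"
proof -
  let ?y = "z \<bullet> prod.swap b"
  have "(cmod (resol b z))\<^sup>2 = inverse ((cmod (1 + 2 * of_real pi * \<i> * of_real ?y))\<^sup>2)"
    by (simp add: resol_def norm_inverse power_inverse)
  also have "(cmod (1 + 2 * of_real pi * \<i> * of_real ?y))\<^sup>2 = 1 + (2 * pi * ?y)\<^sup>2"
    by (simp add: cmod_power2)
  also have "inverse (1 + (2 * pi * ?y)\<^sup>2) \<le> inverse (1 + ?y\<^sup>2)"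
  proof -
    have "1 \<le> (2 * pi)\<^sup>2" using pi_ge_two by (intro one_le_power) auto
    then have "?y\<^sup>2 \<le> (2 * pi)\<^sup>2 * ?y\<^sup>2" by (simp add: mult_le_cancel_right1)
    then show ?thesis
      by (intro le_imp_inverse_le) (auto simp: power_mult_distrib intro: add_pos_nonneg)
  qed
  finally show ?thesis .
qed

lemma cmod_resol_le_1: "cmod (resol b z) \<le> 1"
proof -
  have "(cmod (resol b z))\<^sup>2 \<le> 1"
    using cmod_resol_sq[of b z] by (rule order_trans) (simp add: inverse_le_1_iff)
  then show ?thesis by (simp add: abs_square_le_1)
qed

lemma swap_image_Basis: "prod.swap ` (Basis :: ('v::euclidean_space \<times> 'v) set) = Basis"
  by (auto simp: Basis_prod_def image_Un image_image)

lemma prod_cmod_resol_le_decay: "(\<Prod>b\<in>Basis. (cmod (resol b z))\<^sup>2) \<le> decay z"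
proof -
  have "(\<Prod>b\<in>Basis. (cmod (resol b z))\<^sup>2) \<le> (\<Prod>b\<in>Basis. inverse (1 + (z \<bullet> prod.swap b)\<^sup>2))"
    by (intro prod_mono conjI cmod_resol_sq) auto
  also have "\<dots> = (\<Prod>b\<in>prod.swap ` Basis. inverse (1 + (z \<bullet> b)\<^sup>2))"
    by (subst prod.reindex) auto
  also have "\<dots> = decay z" by (simp only: swap_image_Basis decay_def)
  finally show ?thesis .
qed

lemma continuous_on_osc_kernel [continuous_intros]: "continuous_on S osc_kernel"
  unfolding osc_kernel_def by (intro continuous_intros)

lemma cmod_osc_kernel [simp]: "cmod (osc_kernel z) = 1"
  by (simp add: osc_kernel_def)

lemma continuous_on_resol: "continuous_on S (resol b)"
  unfolding resol_def by (intro continuous_intros) (auto simp: resol_denom_nonzero)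

text \<open>Bounds are uniform in the index \<open>i\<close>; it will range over the points of the space, the cells of the partition and the variable \<open>x\<close> of \<open>\<phi>(a) \<star> g\<close>.\<close>

definition dominated :: "'i set \<Rightarrow> ('i \<Rightarrow> 'e::euclidean_space \<Rightarrow> real) \<Rightarrow> ('i \<Rightarrow> 'e \<Rightarrow> complex) \<Rightarrow> bool" where
  "dominated I W H \<longleftrightarrow> (\<exists>C\<ge>0. \<forall>i\<in>I. continuous_on UNIV (H i) \<and> (\<forall>z. cmod (H i z) \<le> C * W i z))"

definition dir_deriv :: "'i set \<Rightarrow> 'e::euclidean_space \<Rightarrow> ('i \<Rightarrow> 'e \<Rightarrow> complex) \<Rightarrow> ('i \<Rightarrow> 'e \<Rightarrow> complex) \<Rightarrow> bool" where
  "dir_deriv I b H H' \<longleftrightarrow> (\<forall>i\<in>I. \<forall>z. ((\<lambda>t. H i (z + t *\<^sub>R b)) has_vector_derivative H' i z) (at 0))"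

text \<open>Functions whose derivatives up to order \<open>k\<close> are bounded by the same weight: the class is stable under products, with the product of the weights.\<close>

primrec symb :: "nat \<Rightarrow> 'i set \<Rightarrow> ('i \<Rightarrow> 'e::euclidean_space \<Rightarrow> real) \<Rightarrow> ('i \<Rightarrow> 'e \<Rightarrow> complex) \<Rightarrow> bool" where
  "symb 0 I W H \<longleftrightarrow> dominated I W H"
| "symb (Suc k) I W H \<longleftrightarrow> dominated I W H \<and> (\<forall>b\<in>Basis. \<exists>H'. dir_deriv I b H H' \<and> symb k I W H')"

lemma symb_dominated: "symb k I W H \<Longrightarrow> dominated I W H"
  by (cases k) auto

lemma dominatedI:
  assumes "\<And>i. i \<in> I \<Longrightarrow> continuous_on UNIV (H i)" "\<And>i z. i \<in> I \<Longrightarrow> cmod (H i z) \<le> C * W i z"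
    "\<And>i z. i \<in> I \<Longrightarrow> 0 \<le> W i z"
  shows "dominated I W H"
  unfolding dominated_def
proof (intro exI[of _ "max C 0"] conjI ballI allI)
  fix i z assume "i \<in> I"
  then have "C * W i z \<le> max C 0 * W i z" by (intro mult_right_mono assms) auto
  with assms(2)[OF \<open>i \<in> I\<close>, of z] show "cmod (H i z) \<le> max C 0 * W i z" by linarith
qed (use assms in auto)

lemma symb_SucD:
  "symb (Suc k) I W H \<Longrightarrow> b \<in> Basis \<Longrightarrow> \<exists>H'. dir_deriv I b H H' \<and> symb k I W H'"
  by simp

lemma symb_SucI:
  "dominated I W H \<Longrightarrow> (\<And>b. b \<in> Basis \<Longrightarrow> \<exists>H'. dir_deriv I b H H' \<and> symb k I W H') \<Longrightarrow> symb (Suc k) I W H"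
  by simp

declare symb.simps(2) [simp del]

lemma symb_Suc_imp: "symb (Suc k) I W H \<Longrightarrow> symb k I W H"
proof (induction k arbitrary: H)
  case (Suc k)
  show ?case
  proof (rule symb_SucI)
    fix b :: 'b assume "b \<in> Basis"
    from symb_SucD[OF Suc.prems this] obtain H' where "dir_deriv I b H H'" "symb (Suc k) I W H'"
      by auto
    then show "\<exists>H'. dir_deriv I b H H' \<and> symb k I W H'" using Suc.IH[of H'] by (intro exI[of _ H'] conjI)
  qed (use Suc.prems symb_dominated in metis)
qed (simp add: symb_dominated)

lemma symb_mono_weight:
  assumes "symb k I W H" "\<And>i z. i \<in> I \<Longrightarrow> W i z \<le> W' i z"
  shows "symb k I W' H"
proof -
  have dom: "dominated I W' H" if "dominated I W H" for H
  proof -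
    obtain C where "C \<ge> 0" and C: "\<And>i. i \<in> I \<Longrightarrow> continuous_on UNIV (H i)"
      "\<And>i z. i \<in> I \<Longrightarrow> cmod (H i z) \<le> C * W i z"
      using \<open>dominated I W H\<close> by (auto simp: dominated_def)
    have "cmod (H i z) \<le> C * W' i z" if "i \<in> I" for i z
      using C(2)[OF that, of z] mult_left_mono[OF assms(2)[OF that, of z] \<open>C \<ge> 0\<close>] by linarith
    with C \<open>C \<ge> 0\<close> show ?thesis by (auto simp: dominated_def)
  qed
  from assms(1) show ?thesis
  proof (induction k arbitrary: H)
    case (Suc k)
    show ?case
    proof (rule symb_SucI)
      fix b :: 'b assume "b \<in> Basis"
      from symb_SucD[OF Suc.prems this] obtain H' where "dir_deriv I b H H'" "symb k I W H'"
        by auto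
      then show "\<exists>H'. dir_deriv I b H H' \<and> symb k I W' H'" using Suc.IH[of H'] by (intro exI[of _ H'] conjI)
    qed (use Suc.prems symb_dominated dom in metis)
  qed (simp add: dom)
qed

lemma dominated_mult:
  assumes "dominated I W H" "dominated I V G"
  shows "dominated I (\<lambda>i z. W i z * V i z) (\<lambda>i z. H i z * G i z)"
proof -
  obtain C where C: "C \<ge> 0" "\<And>i. i \<in> I \<Longrightarrow> continuous_on UNIV (H i)"
      "\<And>i z. i \<in> I \<Longrightarrow> cmod (H i z) \<le> C * W i z"
    using assms(1) by (auto simp: dominated_def)
  obtain D where D: "D \<ge> 0" "\<And>i. i \<in> I \<Longrightarrow> continuous_on UNIV (G i)"
      "\<And>i z. i \<in> I \<Longrightarrow> cmod (G i z) \<le> D * V i z"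
    using assms(2) by (auto simp: dominated_def)
  show ?thesis
    unfolding dominated_def
  proof (intro exI[of _ "C * D"] conjI ballI allI)
    fix i z assume i: "i \<in> I"
    have "cmod (H i z) * cmod (G i z) \<le> (C * W i z) * (D * V i z)"
      by (rule mult_mono[OF C(3)[OF i] D(3)[OF i]])
         (use order_trans[OF norm_ge_zero C(3)[OF i]] in auto)
    then show "cmod (H i z * G i z) \<le> C * D * (W i z * V i z)"
      by (simp add: norm_mult mult_ac)
  qed (use C D in \<open>auto intro!: continuous_intros\<close>)
qed

lemma dominated_add:
  assumes "dominated I W H" "dominated I W G"
  shows "dominated I W (\<lambda>i z. H i z + G i z)"
proof -
  obtain C where C: "C \<ge> 0" "\<And>i. i \<in> I \<Longrightarrow> continuous_on UNIV (H i)"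
      "\<And>i z. i \<in> I \<Longrightarrow> cmod (H i z) \<le> C * W i z"
    using assms(1) by (auto simp: dominated_def)
  obtain D where D: "D \<ge> 0" "\<And>i. i \<in> I \<Longrightarrow> continuous_on UNIV (G i)"
      "\<And>i z. i \<in> I \<Longrightarrow> cmod (G i z) \<le> D * W i z"
    using assms(2) by (auto simp: dominated_def)
  show ?thesis
    unfolding dominated_def
  proof (intro exI[of _ "C + D"] conjI ballI allI)
    fix i z assume i: "i \<in> I"
    show "cmod (H i z + G i z) \<le> (C + D) * W i z"
      using norm_triangle_ineq[of "H i z" "G i z"] C(3)[OF i, of z] D(3)[OF i, of z]
      by (simp add: distrib_right)
  qed (use C D in \<open>auto intro!: continuous_intros\<close>)
qed

lemma dir_deriv_add:
  "dir_deriv I b H H' \<Longrightarrow> dir_deriv I b G G' \<Longrightarrow> dir_deriv I b (\<lambda>i z. H i z + G i z) (\<lambda>i z. H' i z + G' i z)"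
  unfolding dir_deriv_def by (auto intro!: derivative_eq_intros)

lemma dir_deriv_mult:
  assumes "dir_deriv I b H H'" "dir_deriv I b G G'"
  shows "dir_deriv I b (\<lambda>i z. H i z * G i z) (\<lambda>i z. H i z * G' i z + H' i z * G i z)"
  unfolding dir_deriv_def
proof (intro ballI allI)
  fix i z assume "i \<in> I"
  then have "((\<lambda>t. H i (z + t *\<^sub>R b)) has_vector_derivative H' i z) (at 0)"
    "((\<lambda>t. G i (z + t *\<^sub>R b)) has_vector_derivative G' i z) (at 0)"
    using assms by (auto simp: dir_deriv_def)
  from has_vector_derivative_mult[OF this]
  show "((\<lambda>t. H i (z + t *\<^sub>R b) * G i (z + t *\<^sub>R b)) has_vector_derivative H i z * G' i z + H' i z * G i z) (at 0)"
    by simp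
qed

lemma symb_add:
  "symb k I W H \<Longrightarrow> symb k I W G \<Longrightarrow> symb k I W (\<lambda>i z. H i z + G i z)"
proof (induction k arbitrary: H G)
  case (Suc k)
  have "\<exists>K. dir_deriv I b (\<lambda>i z. H i z + G i z) K \<and> symb k I W K" if b: "b \<in> Basis" for b
  proof -
    obtain H' G' where "dir_deriv I b H H'" "symb k I W H'" "dir_deriv I b G G'" "symb k I W G'"
      using symb_SucD[OF Suc.prems(1) b] symb_SucD[OF Suc.prems(2) b] by auto
    then have "dir_deriv I b (\<lambda>i z. H i z + G i z) (\<lambda>i z. H' i z + G' i z)"
      "symb k I W (\<lambda>i z. H' i z + G' i z)"
      using Suc.IH by (auto intro: dir_deriv_add)
    then show ?thesis by (intro exI conjI)
  qed
  then show ?case using symb_dominated[OF Suc.prems(1)] symb_dominated[OF Suc.prems(2)]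
    by (intro symb_SucI dominated_add)
qed (simp add: dominated_add)

lemma symb_mult:
  "symb k I W H \<Longrightarrow> symb k I V G \<Longrightarrow> symb k I (\<lambda>i z. W i z * V i z) (\<lambda>i z. H i z * G i z)"
proof (induction k arbitrary: H G)
  case (Suc k)
  have "\<exists>K. dir_deriv I b (\<lambda>i z. H i z * G i z) K \<and> symb k I (\<lambda>i z. W i z * V i z) K" if b: "b \<in> Basis" for b
  proof -
    obtain H' G' where "dir_deriv I b H H'" "symb k I W H'" "dir_deriv I b G G'" "symb k I V G'"
      using symb_SucD[OF Suc.prems(1) b] symb_SucD[OF Suc.prems(2) b] by auto
    moreover have "symb k I W H" "symb k I V G" using Suc.prems symb_Suc_imp by blast+
    ultimately have "dir_deriv I b (\<lambda>i z. H i z * G i z) (\<lambda>i z. H i z * G' i z + H' i z * G i z)"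
      "symb k I (\<lambda>i z. W i z * V i z) (\<lambda>i z. H i z * G' i z + H' i z * G i z)"
      using Suc.IH by (auto intro: dir_deriv_mult symb_add)
    then show ?thesis by (intro exI conjI)
  qed
  then show ?case using symb_dominated[OF Suc.prems(1)] symb_dominated[OF Suc.prems(2)]
    by (intro symb_SucI dominated_mult)
qed (simp add: dominated_mult)

lemma symb_const: "symb k I (\<lambda>i (z::'e::euclidean_space). 1) (\<lambda>i z. c)"
proof -
  have dom: "dominated I (\<lambda>i (z::'e). 1) (\<lambda>i z. c)" for c by (rule dominatedI[where C = "cmod c"]) auto
  have der: "dir_deriv I b (\<lambda>i z. c) (\<lambda>i z. 0)" for b :: 'e and c by (auto simp: dir_deriv_def)
  show ?thesis
  proof (induction k arbitrary: c)
    case (Suc k)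
    have "\<exists>H'. dir_deriv I b (\<lambda>i z. c) H' \<and> symb k I (\<lambda>i z. 1) H'" for b :: 'e
      using Suc[of 0] der[of b c] by (intro exI[of _ "\<lambda>i z. 0"] conjI)
    then show ?case by (intro symb_SucI dom)
  qed (simp add: dom)
qed

lemma symb_cmult: "symb k I W H \<Longrightarrow> symb k I W (\<lambda>i z. c * H i z)"
  using symb_mult[OF symb_const[of k I c], of W H] by simp

text \<open>A derivative of \<open>resol b\<close> is a bounded multiple of its square, and \<open>resol b\<close> is bounded by \<open>1\<close>.\<close>

lemma symb_resol: "symb k I (\<lambda>i z. cmod (resol b z)) (\<lambda>i. resol b)"
proof (induction k)
  case 0
  show ?case by (auto intro!: dominatedI[where C = 1] continuous_on_resol)
next
  case (Suc k)
  have "\<exists>K. dir_deriv I b' (\<lambda>i. resol b) K \<and> symb k I (\<lambda>i z. cmod (resol b z)) K" for b'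
  proof (intro exI conjI)
    let ?c = "- (2 * of_real pi * \<i> * of_real (b' \<bullet> prod.swap b))"
    show "dir_deriv I b' (\<lambda>i. resol b) (\<lambda>i z. ?c * (resol b z * resol b z))"
      unfolding dir_deriv_def
    proof (intro ballI allI)
      fix z
      have "((\<lambda>t. inverse (1 + 2 * of_real pi * \<i> * of_real (z \<bullet> prod.swap b + t * (b' \<bullet> prod.swap b))))
        has_vector_derivative ?c * (resol b z * resol b z)) (at (0::real))"
        unfolding resol_def has_vector_derivative_def
        by ((rule derivative_eq_intros refl | simp add: resol_denom_nonzero scaleR_conv_of_real)+,
            simp add: fun_eq_iff mult_ac)
      then show "((\<lambda>t. resol b (z + t *\<^sub>R b')) has_vector_derivative ?c * (resol b z * resol b z)) (at 0)"
        by (simp add: resol_def inner_add_left)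
    qed
    have "symb k I (\<lambda>i z. cmod (resol b z) * cmod (resol b z)) (\<lambda>i z. resol b z * resol b z)"
      by (rule symb_mult[OF Suc Suc])
    then have "symb k I (\<lambda>i z. cmod (resol b z)) (\<lambda>i z. resol b z * resol b z)"
      by (rule symb_mono_weight) (simp add: mult_left_le_one_le cmod_resol_le_1)
    then show "symb k I (\<lambda>i z. cmod (resol b z)) (\<lambda>i z. ?c * (resol b z * resol b z))"
      by (rule symb_cmult)
  qed
  moreover have "dominated I (\<lambda>i z. cmod (resol b z)) (\<lambda>i. resol b)"
    by (auto intro!: dominatedI[where C = 1] continuous_on_resol)
  ultimately show ?case by (intro symb_SucI)
qed

section \<open>Oscillatory integration by parts\<close>

lemma has_vector_derivative_iff_quotient:
  fixes F :: "'a::real_normed_vector \<Rightarrow> 'b::real_normed_vector"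
  shows "((\<lambda>t. F (x + t *\<^sub>R v)) has_vector_derivative D) (at 0) \<longleftrightarrow>
    ((\<lambda>t. (F (x + t *\<^sub>R v) - F x) /\<^sub>R t) \<longlongrightarrow> D) (at 0)"
proof -
  have eq: "norm (F (x + t *\<^sub>R v) - F x - t *\<^sub>R D) / norm t = norm ((F (x + t *\<^sub>R v) - F x) /\<^sub>R t - D)"
    if "t \<noteq> 0" for t
  proof -
    have "(F (x + t *\<^sub>R v) - F x) /\<^sub>R t - D = (F (x + t *\<^sub>R v) - F x - t *\<^sub>R D) /\<^sub>R t"
      using that by (simp add: scaleR_diff_right)
    then show ?thesis by (simp add: divide_inverse mult.commute)
  qed
  have "((\<lambda>t. F (x + t *\<^sub>R v)) has_vector_derivative D) (at 0) \<longleftrightarrow>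
      ((\<lambda>t. norm (F (x + t *\<^sub>R v) - F x - t *\<^sub>R D) / norm t) \<longlongrightarrow> 0) (at 0)"
    unfolding has_vector_derivative_def has_derivative_at by (simp add: bounded_linear_scaleR_left)
  also have "\<dots> \<longleftrightarrow> ((\<lambda>t. norm ((F (x + t *\<^sub>R v) - F x) /\<^sub>R t - D)) \<longlongrightarrow> 0) (at 0)"
    by (rule tendsto_cong) (use eq in \<open>simp add: eventually_at_filter\<close>)
  also have "\<dots> \<longleftrightarrow> ((\<lambda>t. (F (x + t *\<^sub>R v) - F x) /\<^sub>R t) \<longlongrightarrow> D) (at 0)"
    by (simp add: tendsto_norm_zero_iff LIM_zero_iff)
  finally show ?thesis .
qed

lemma has_vector_derivative_imp_eq_0:
  fixes f :: "real \<Rightarrow> 'a::real_normed_vector"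
  assumes "(f has_vector_derivative D) (at x)" "eventually (\<lambda>t. f t = 0) (nhds x)"
  shows "D = 0"
proof -
  obtain d where d: "d > 0" "\<And>t. dist t x < d \<Longrightarrow> f t = 0"
    using assms(2) by (auto simp: eventually_nhds_metric)
  have "((\<lambda>t. 0) has_vector_derivative D) (at x)"
    by (rule has_vector_derivative_transform_within[OF assms(1) d(1)]) (use d(2) in auto)
  moreover have "((\<lambda>t. 0::'a) has_vector_derivative 0) (at x)" by simp
  ultimately show ?thesis by (rule vector_derivative_unique_at)
qed

lemma integrable_continuous_bounded_support:
  fixes G :: "'e::euclidean_space \<Rightarrow> 'b::{banach,second_countable_topology}"
  assumes "continuous_on UNIV G" "\<And>z. norm z > R \<Longrightarrow> G z = 0"
  shows "integrable lborel G"
proof -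
  have "integrable lborel (\<lambda>x. indicator (cball 0 R) x *\<^sub>R G x)"
    by (intro borel_integrable_compact continuous_on_subset[OF assms(1)]) auto
  moreover have "(\<lambda>x. indicator (cball 0 R) x *\<^sub>R G x) = G"
    using assms(2) by (auto simp: fun_eq_iff indicator_def)
  ultimately show ?thesis by simp
qed

lemma lborel_integral_translate:
  fixes G :: "'e::euclidean_space \<Rightarrow> 'b::{banach,second_countable_topology}"
  assumes "G \<in> borel_measurable borel"
  shows "(LINT z|lborel. G (c + z)) = (LINT z|lborel. G z)"
proof -
  have "(LINT z|lborel. G z) = (LINT z|distr lborel borel ((+) c). G z)"
    by (simp add: lborel_distr_plus)
  also have "\<dots> = (LINT z|lborel. G (c + z))"
    using assms by (subst integral_distr) auto
  finally show ?thesis ..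
qed

lemma lborel_integrable_translate:
  fixes G :: "'e::euclidean_space \<Rightarrow> 'b::{banach,second_countable_topology}"
  assumes "integrable lborel G"
  shows "integrable lborel (\<lambda>z. G (c + z))"
proof -
  have "integrable (distr lborel borel ((+) c)) G" using assms by (simp add: lborel_distr_plus)
  then show ?thesis by (subst (asm) integrable_distr_eq) (use assms in auto)
qed

text \<open>The integral of \<open>G (z + t b)\<close> does not depend on \<open>t\<close> by translation invariance, and can be differentiated under the integral sign as the support is bounded.\<close>

lemma integral_directional_derivative_eq_0:
  fixes G :: "'e::euclidean_space \<Rightarrow> complex"
  assumes der: "\<And>z. ((\<lambda>t. G (z + t *\<^sub>R b)) has_vector_derivative G' z) (at 0)"
    and contG: "continuous_on UNIV G" and contG': "continuous_on UNIV G'"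
    and supp: "\<And>z. norm z > R \<Longrightarrow> G z = 0"
  shows "(LINT z|lborel. G' z) = 0"
proof -
  have G'0: "G' z = 0" if "norm z > R" for z
  proof (rule has_vector_derivative_imp_eq_0[OF der])
    have "((\<lambda>t. norm (z + t *\<^sub>R b)) \<longlongrightarrow> norm (z + 0 *\<^sub>R b)) (nhds (0::real))"
      by (intro tendsto_intros) (simp add: filterlim_ident)
    then have "eventually (\<lambda>t. norm (z + t *\<^sub>R b) > R) (nhds 0)"
      using that by (intro order_tendstoD) auto
    then show "eventually (\<lambda>t. G (z + t *\<^sub>R b) = 0) (nhds 0)"
      by (rule eventually_mono) (rule supp)
  qed
  have "bounded (G' ` cball 0 R)"
    by (intro compact_imp_bounded compact_continuous_image continuous_on_subset[OF contG']) auto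
  then obtain B where B: "\<And>z. norm z \<le> R \<Longrightarrow> cmod (G' z) \<le> B"
    unfolding bounded_iff by (metis imageI mem_cball_0)
  define C where "C = max B 0"
  have C: "cmod (G' z) \<le> C" for z
    using B[of z] G'0[of z] by (cases "norm z \<le> R") (auto simp: C_def)
  have der': "((\<lambda>t. G (z + t *\<^sub>R b)) has_vector_derivative G' (z + t *\<^sub>R b)) (at t)" for z t
  proof -
    have "((\<lambda>s. G ((z + t *\<^sub>R b) + s *\<^sub>R b)) has_vector_derivative G' (z + t *\<^sub>R b)) (at (t - t))"
      using der[of "z + t *\<^sub>R b"] by simp
    moreover have "((\<lambda>s. s - t) has_vector_derivative 1) (at t)"
      by (auto intro!: derivative_eq_intros)
    ultimately have "((\<lambda>s. G ((z + t *\<^sub>R b) + s *\<^sub>R b)) \<circ> (\<lambda>s. s - t) has_vector_derivative 1 *\<^sub>R G' (z + t *\<^sub>R b)) (at t)"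
      using vector_diff_chain_at by blast
    then show ?thesis by (simp add: o_def algebra_simps)
  qed
  have bound: "cmod (G (z + s *\<^sub>R b) - G z) \<le> C * s" if "s > 0" for z s
  proof -
    have "norm (G (z + s *\<^sub>R b) - G (z + 0 *\<^sub>R b)) \<le> C * norm (s - 0)"
    proof (rule differentiable_bound[of "{0..s}" "\<lambda>t. G (z + t *\<^sub>R b)" "\<lambda>t h. h *\<^sub>R G' (z + t *\<^sub>R b)"])
      show "((\<lambda>t. G (z + t *\<^sub>R b)) has_derivative (\<lambda>h. h *\<^sub>R G' (z + x *\<^sub>R b))) (at x within {0..s})" for x
        using der'[of z x] by (auto simp: has_vector_derivative_def intro: has_derivative_at_withinI)
      show "onorm (\<lambda>h. h *\<^sub>R G' (z + x *\<^sub>R b)) \<le> C" for x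
        using C[of "z + x *\<^sub>R b"] by (intro onorm_le) (simp, metis mult.commute mult_left_mono abs_ge_zero)
    qed (use that in auto)
    then show ?thesis using that by simp
  qed
  define s :: "nat \<Rightarrow> real" where "s n = inverse (Suc n)" for n
  have s: "0 < s n" "s n \<le> 1" for n by (auto simp: s_def inverse_le_1_iff)
  have s0: "filterlim s (at 0) sequentially"
    unfolding filterlim_at using LIMSEQ_inverse_real_of_nat by (auto simp: s_def[abs_def])
  define q where "q n z = (G (z + s n *\<^sub>R b) - G z) /\<^sub>R s n" for n z
  have intG: "integrable lborel G" by (rule integrable_continuous_bounded_support[OF contG supp])
  then have [measurable]: "G \<in> borel_measurable borel" by (auto simp: integrable_iff_bounded)
  have "(\<lambda>n. LINT z|lborel. q n z) \<longlonglongrightarrow> (LINT z|lborel. G' z)"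
  proof (rule integral_dominated_convergence[where w = "\<lambda>z. C * indicator (cball 0 (\<bar>R\<bar> + norm b)) z"])
    show "G' \<in> borel_measurable lborel" using borel_measurable_continuous_onI[OF contG'] by simp
    show "q n \<in> borel_measurable lborel" for n unfolding q_def by measurable
    show "integrable lborel (\<lambda>z. C * indicator (cball 0 (\<bar>R\<bar> + norm b)) z)"
      by (intro integrable_mult_right integrable_real_indicator) (simp_all add: emeasure_bounded_finite[OF bounded_cball, unfolded infinity_ennreal_def])
    show "AE z in lborel. (\<lambda>n. q n z) \<longlonglongrightarrow> G' z"
    proof (rule AE_I2)
      fix z
      have "((\<lambda>t. (G (z + t *\<^sub>R b) - G z) /\<^sub>R t) \<longlongrightarrow> G' z) (at 0)"
        using der[of z] by (simp add: has_vector_derivative_iff_quotient)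
      then show "(\<lambda>n. q n z) \<longlonglongrightarrow> G' z"
        unfolding q_def using s0 by (rule filterlim_compose)
    qed
    show "AE z in lborel. norm (q n z) \<le> C * indicator (cball 0 (\<bar>R\<bar> + norm b)) z" for n
    proof (rule AE_I2)
      fix z
      show "norm (q n z) \<le> C * indicator (cball 0 (\<bar>R\<bar> + norm b)) z"
      proof (cases "norm z \<le> \<bar>R\<bar> + norm b")
        case True
        have "norm (q n z) = cmod (G (z + s n *\<^sub>R b) - G z) / s n"
          using s[of n] by (simp add: q_def norm_inverse divide_inverse mult.commute)
        also have "\<dots> \<le> C" using bound[OF s(1), of z n] s[of n] by (simp add: divide_le_eq)
        finally show ?thesis using True by simp
      next
        case False
        have "norm z - norm (s n *\<^sub>R b) \<le> norm (z + s n *\<^sub>R b)"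
          using norm_triangle_ineq2[of z "- (s n *\<^sub>R b)"] by simp
        moreover have "norm (s n *\<^sub>R b) \<le> norm b" using s[of n] by (simp add: mult_left_le_one_le)
        ultimately have "R < norm (z + s n *\<^sub>R b)" using False by linarith
        moreover have "R < norm z" using False by (smt (verit) norm_ge_zero)
        moreover have "0 \<le> C" by (simp add: C_def)
        ultimately show ?thesis using supp by (simp add: q_def)
      qed
    qed
  qed
  moreover have "(LINT z|lborel. q n z) = 0" for n
  proof -
    have "integrable lborel (\<lambda>z. G (z + s n *\<^sub>R b))"
      using lborel_integrable_translate[OF intG, of "s n *\<^sub>R b"] by (simp add: add.commute)
    moreover have "(LINT z|lborel. G (z + s n *\<^sub>R b)) = (LINT z|lborel. G z)"
      using lborel_integral_translate[of G "s n *\<^sub>R b"] by (simp add: add.commute)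
    ultimately show ?thesis unfolding q_def using intG by (simp add: Bochner_Integration.integral_diff)
  qed
  ultimately show ?thesis by (simp add: LIMSEQ_const_iff)
qed

lemma osc_kernel_derivative:
  assumes "b \<in> Basis"
  shows "((\<lambda>t. osc_kernel (z + t *\<^sub>R b)) has_vector_derivative
     osc_kernel z * (2 * of_real pi * \<i> * of_real (z \<bullet> prod.swap b))) (at 0)"
proof -
  have 0: "fst b \<bullet> snd b = 0" using assms by (auto simp: Basis_prod_def)
  have "osc_kernel (z + t *\<^sub>R b) = osc_kernel z * exp (of_real t * (2 * of_real pi * \<i> * of_real (z \<bullet> prod.swap b)))" for t
    unfolding osc_kernel_def inner_swap[symmetric]
    by (simp add: inner_add_left inner_add_right 0 inner_commute algebra_simps flip: exp_add)
  moreover have "((\<lambda>t. osc_kernel z * exp (of_real t * (2 * of_real pi * \<i> * of_real (z \<bullet> prod.swap b))))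
     has_vector_derivative osc_kernel z * (2 * of_real pi * \<i> * of_real (z \<bullet> prod.swap b))) (at (0::real))"
  proof (rule has_vector_derivative_real_field)
    let ?c = "2 * of_real pi * \<i> * of_real (z \<bullet> prod.swap b) :: complex"
    have "((\<lambda>w. osc_kernel z * exp (w * ?c)) has_field_derivative osc_kernel z * (exp (0 * ?c) * ?c)) (at 0)"
      by (auto intro!: derivative_eq_intros simp del: mult_zero_left)
    then show "((\<lambda>w. osc_kernel z * exp (w * ?c)) has_field_derivative osc_kernel z * ?c) (at (of_real 0))"
      by simp
  qed
  ultimately show ?thesis by simp
qed

lemma inner_swap_Basis: "b \<in> Basis \<Longrightarrow> b \<bullet> prod.swap b = 0" for b :: "'v::euclidean_space \<times> 'v"
  by (auto simp: Basis_prod_def)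

text \<open>As \<open>b \<bullet> swap b = 0\<close>, the factor \<open>resol b\<close> is constant in the direction \<open>b\<close>; hence \<open>osc_kernel = (1 + \<partial>\<^sub>b) (resol b osc_kernel)\<close>, and moving \<open>\<partial>\<^sub>b\<close> to \<open>H\<close> replaces \<open>H\<close> by \<open>resol b (H - \<partial>\<^sub>b H)\<close>.\<close>

lemma oscillatory_integration_by_parts:
  fixes b :: "'v::euclidean_space \<times> 'v"
  assumes sy: "symb (Suc k) I W H" and b: "b \<in> Basis"
    and supp: "\<And>i. i \<in> I \<Longrightarrow> \<exists>R. \<forall>z. norm z > R \<longrightarrow> W i z = 0"
  shows "\<exists>H1. symb k I (\<lambda>i z. W i z * cmod (resol b z)) H1 \<and>
     (\<forall>i\<in>I. (LINT z|lborel. H i z * osc_kernel z) = (LINT z|lborel. H1 i z * osc_kernel z))"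
proof -
  obtain H' where H': "dir_deriv I b H H'" "symb k I W H'"
    using symb_SucD[OF sy b] by auto
  define H1 where "H1 i z = (H i z + (-1) * H' i z) * resol b z" for i z
  have "symb k I (\<lambda>i z. W i z * cmod (resol b z)) H1"
    unfolding H1_def by (intro symb_mult symb_add symb_cmult symb_resol symb_Suc_imp[OF sy] H')
  moreover have "(LINT z|lborel. H i z * osc_kernel z) = (LINT z|lborel. H1 i z * osc_kernel z)" if i: "i \<in> I" for i
  proof -
    obtain R where R: "\<And>z. norm z > R \<Longrightarrow> W i z = 0" using supp[OF i] by blast
    have dom: "continuous_on UNIV (G i) \<and> (\<forall>z. norm z > R \<longrightarrow> G i z = 0)" if G: "dominated I W G" for G
    proof -
      obtain C where "\<And>z. cmod (G i z) \<le> C * W i z" "continuous_on UNIV (G i)"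
        using G i unfolding dominated_def by blast
      then show ?thesis using R by (metis mult_zero_right norm_le_zero_iff)
    qed
    have cont: "continuous_on UNIV (H i)" "continuous_on UNIV (H' i)" "\<And>z. norm z > R \<Longrightarrow> H i z = 0"
       "\<And>z. norm z > R \<Longrightarrow> H' i z = 0"
      using dom[OF symb_dominated[OF sy]] dom[OF symb_dominated[OF H'(2)]] by blast+
    let ?G = "\<lambda>z. H i z * resol b z * osc_kernel z"
    let ?\<kappa> = "\<lambda>z. 2 * of_real pi * \<i> * of_real (z \<bullet> prod.swap b)"
    let ?G' = "\<lambda>z. (H' i z + H i z * ?\<kappa> z) * (resol b z * osc_kernel z)"
    have "((\<lambda>t. ?G (z + t *\<^sub>R b)) has_vector_derivative ?G' z) (at 0)" for z
    proof -
      have *: "resol b (z + t *\<^sub>R b) = resol b z" for t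
        using inner_swap_Basis[OF b] by (simp add: resol_def inner_add_left)
      have "((\<lambda>t. H i (z + t *\<^sub>R b)) has_vector_derivative H' i z) (at 0)"
        using H'(1) i unfolding dir_deriv_def by blast
      from has_vector_derivative_mult[OF has_vector_derivative_mult_left[OF this, of "resol b z"] osc_kernel_derivative[OF b, of z]]
      show ?thesis by (simp add: * algebra_simps)
    qed
    then have 0: "(LINT z|lborel. ?G' z) = 0"
      by (rule integral_directional_derivative_eq_0[where R = R])
         (use cont in \<open>auto intro!: continuous_intros continuous_on_resol\<close>)
    have eq: "H i z * osc_kernel z = H1 i z * osc_kernel z + ?G' z" for z
    proof -
      have "resol b z * (1 + ?\<kappa> z) = 1"
        unfolding resol_def by (rule left_inverse) (rule resol_denom_nonzero)
      then have "H i z * osc_kernel z = H i z * (resol b z * (1 + ?\<kappa> z)) * osc_kernel z" by simp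
      also have "\<dots> = H1 i z * osc_kernel z + ?G' z" by (simp add: H1_def algebra_simps)
      finally show ?thesis .
    qed
    have "integrable lborel (\<lambda>z. H1 i z * osc_kernel z)" "integrable lborel ?G'"
      by (rule integrable_continuous_bounded_support[where R = R];
          use cont in \<open>auto simp: H1_def intro!: continuous_intros continuous_on_resol\<close>)+
    then show ?thesis unfolding eq by (simp add: 0)
  qed
  ultimately show ?thesis by blast
qed

lemma oscillatory_integration_by_parts_list:
  fixes W :: "'i \<Rightarrow> 'v::euclidean_space \<times> 'v \<Rightarrow> real"
  assumes "symb (length bs + k) I W H" "set bs \<subseteq> Basis"
    and "\<And>i. i \<in> I \<Longrightarrow> \<exists>R. \<forall>z. norm z > R \<longrightarrow> W i z = 0"
  shows "\<exists>H1. symb k I (\<lambda>i z. W i z * (\<Prod>b\<leftarrow>bs. cmod (resol b z))) H1 \<and>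
     (\<forall>i\<in>I. (LINT z|lborel. H i z * osc_kernel z) = (LINT z|lborel. H1 i z * osc_kernel z))"
  using assms
proof (induction bs arbitrary: W H)
  case (Cons b bs)
  have 1: "symb (Suc (length bs + k)) I W H" "b \<in> Basis" using Cons.prems by auto
  from oscillatory_integration_by_parts[OF this Cons.prems(3)]
  obtain H1 where H1: "symb (length bs + k) I (\<lambda>i z. W i z * cmod (resol b z)) H1"
    "\<forall>i\<in>I. (LINT z|lborel. H i z * osc_kernel z) = (LINT z|lborel. H1 i z * osc_kernel z)" by auto
  have "\<exists>H2. symb k I (\<lambda>i z. W i z * cmod (resol b z) * (\<Prod>b\<leftarrow>bs. cmod (resol b z))) H2 \<and>
     (\<forall>i\<in>I. (LINT z|lborel. H1 i z * osc_kernel z) = (LINT z|lborel. H2 i z * osc_kernel z))"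
    using Cons.prems(2,3) by (intro Cons.IH[OF H1(1)]) fastforce+
  then obtain H2 where H2: "symb k I (\<lambda>i z. W i z * cmod (resol b z) * (\<Prod>b\<leftarrow>bs. cmod (resol b z))) H2"
     "\<forall>i\<in>I. (LINT z|lborel. H1 i z * osc_kernel z) = (LINT z|lborel. H2 i z * osc_kernel z)" by auto
  then show ?case using H1(2) by (intro exI[of _ H2]) (simp add: mult_ac)
qed auto

text \<open>Integration by parts twice in every coordinate direction collects the factor \<open>(\<Prod>b\<in>Basis. (cmod (resol b z))\<^sup>2)\<close>, which is at most \<open>decay z\<close>.\<close>

lemma oscillatory_integral_decay:
  fixes W :: "'i \<Rightarrow> 'v::euclidean_space \<times> 'v \<Rightarrow> real"
  assumes sy: "symb (2 * DIM('v \<times> 'v)) I W H"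
    and supp: "\<And>i. i \<in> I \<Longrightarrow> \<exists>R. \<forall>z. norm z > R \<longrightarrow> W i z = 0"
    and W: "\<And>i z. i \<in> I \<Longrightarrow> 0 \<le> W i z"
    and int: "\<And>i. i \<in> I \<Longrightarrow> integrable lborel (\<lambda>z. W i z * decay z)"
  shows "\<exists>C\<ge>0. \<forall>i\<in>I. cmod (LINT z|lborel. H i z * osc_kernel z) \<le> C * (LINT z|lborel. W i z * decay z)"
proof -
  obtain bs where bs: "set bs = (Basis :: ('v \<times> 'v) set)" "distinct bs"
    using finite_distinct_list[OF finite_Basis] by blast
  have len: "length (bs @ bs) + 0 = 2 * DIM('v \<times> 'v)"
    using distinct_card[OF bs(2)] bs(1) by (simp add: mult_2)
  from oscillatory_integration_by_parts_list[of "bs @ bs" 0 I W H] sy supp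
  obtain H1 where H1: "symb 0 I (\<lambda>i z. W i z * (\<Prod>b\<leftarrow>bs @ bs. cmod (resol b z))) H1"
     "\<forall>i\<in>I. (LINT z|lborel. H i z * osc_kernel z) = (LINT z|lborel. H1 i z * osc_kernel z)"
    unfolding len using bs(1) by (auto simp del: symb.simps)
  have "(\<Prod>b\<leftarrow>bs @ bs. cmod (resol b z)) \<le> decay z" for z
  proof -
    have "(\<Prod>b\<leftarrow>bs @ bs. cmod (resol b z)) = (\<Prod>b\<in>Basis. (cmod (resol b z))\<^sup>2)"
      using bs by (simp add: prod.distinct_set_conv_list[symmetric] power2_eq_square prod.distrib)
    then show ?thesis using prod_cmod_resol_le_decay[of z] by simp
  qed
  then have "symb 0 I (\<lambda>i z. W i z * decay z) H1"
    by (intro symb_mono_weight[OF H1(1)] mult_left_mono W)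
  then obtain C where C: "C \<ge> 0" "\<And>i. i \<in> I \<Longrightarrow> continuous_on UNIV (H1 i)"
     "\<And>i z. i \<in> I \<Longrightarrow> cmod (H1 i z) \<le> C * (W i z * decay z)"
    by (auto simp: dominated_def)
  have "cmod (LINT z|lborel. H i z * osc_kernel z) \<le> C * (LINT z|lborel. W i z * decay z)" if i: "i \<in> I" for i
  proof -
    have "cmod (LINT z|lborel. H1 i z * osc_kernel z) \<le> (LINT z|lborel. C * (W i z * decay z))"
    proof (rule Bochner_Integration.integral_norm_bound_integral)
      show *: "integrable lborel (\<lambda>z. C * (W i z * decay z))" using int[OF i] by simp
      have "(\<lambda>z. H1 i z * osc_kernel z) \<in> borel_measurable borel"
        using C(2)[OF i] by (intro borel_measurable_continuous_onI continuous_intros)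
      then show "integrable lborel (\<lambda>z. H1 i z * osc_kernel z)"
        using C(3)[OF i] by (intro Bochner_Integration.integrable_bound[OF *] AE_I2)
          (auto simp: norm_mult intro: order_trans[OF _ abs_ge_self])
    qed (use C(3)[OF i] in \<open>simp add: norm_mult\<close>)
    then show ?thesis using H1(2) i by simp
  qed
  with C(1) show ?thesis by blast
qed

section \<open>Oscillatory integrals over a lattice of cells\<close>

lemma lattice_bounded_count:
  fixes \<Lambda> :: "'v::euclidean_space set"
  assumes "lattice_set \<Lambda>"
  shows "finite {w\<in>\<Lambda>. norm w \<le> R}"
proof -
  obtain B where B: "independent B" "span B = UNIV"
    and \<Lambda>: "\<Lambda> = range (\<lambda>n :: 'v \<Rightarrow> int. \<Sum>b\<in>B. of_int (n b) *\<^sub>R b)"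
    using assms by (auto simp: lattice_set_def)
  have fin: "finite B" using B(1) by (rule independent_imp_finite)
  have "\<exists>K>0. \<forall>w. \<bar>representation B w b\<bar> \<le> K * norm w" for b
  proof -
    have "linear (\<lambda>w. representation B w b)"
      using B by (intro linearI) (auto simp: representation_add representation_scale)
    from linear_bounded_pos[OF this] show ?thesis by auto
  qed
  then obtain K where K: "\<And>b. 0 < K b" "\<And>b w. \<bar>representation B w b\<bar> \<le> K b * norm w" by metis
  define f where "f n = (\<Sum>b\<in>B. of_int (n b) *\<^sub>R b)" for n :: "'v \<Rightarrow> int"
  have rep: "representation B (f n) b = of_int (n b)" if "b \<in> B" for n b
  proof -
    have "representation B (f n) b = (\<Sum>b'\<in>B. of_int (n b') * representation B b' b)"
      unfolding f_def using B by (subst representation_sum) (auto simp: representation_scale)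
    also have "\<dots> = (\<Sum>b'\<in>B. if b' = b then of_int (n b) else 0)"
      using B(1) by (intro sum.cong refl) (auto simp: representation_basis)
    also have "\<dots> = of_int (n b)" using fin that by simp
    finally show ?thesis .
  qed
  define T where "T = (\<Pi>\<^sub>E b\<in>B. {- \<lceil>K b * \<bar>R\<bar>\<rceil> .. \<lceil>K b * \<bar>R\<bar>\<rceil>})"
  have "finite T" unfolding T_def using fin by (intro finite_PiE) auto
  moreover have "{w\<in>\<Lambda>. norm w \<le> R} \<subseteq> f ` T"
  proof
    fix w assume w: "w \<in> {w\<in>\<Lambda>. norm w \<le> R}"
    then obtain n where n: "w = f n" using \<Lambda> by (auto simp: f_def)
    have "\<bar>n b\<bar> \<le> \<lceil>K b * \<bar>R\<bar>\<rceil>" if "b \<in> B" for b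
    proof -
      have "\<bar>real_of_int (n b)\<bar> \<le> K b * norm w"
        using K(2)[of w b] unfolding n rep[OF that] .
      also have "\<dots> \<le> K b * \<bar>R\<bar>" using w K(1)[of b] by (intro mult_left_mono) auto
      finally show ?thesis by linarith
    qed
    then have "restrict n B \<in> T" by (auto simp: T_def abs_le_iff minus_le_iff)
    moreover have "w = f (restrict n B)" unfolding n f_def by (rule sum.cong) auto
    ultimately show "w \<in> f ` T" by blast
  qed
  ultimately show ?thesis using finite_subset by blast
qed

lemma lattice_set_diff:
  assumes "lattice_set \<Lambda>" "w \<in> \<Lambda>" "w' \<in> \<Lambda>"
  shows "w - w' \<in> \<Lambda>"
proof -
  obtain B where \<Lambda>: "\<Lambda> = range (\<lambda>n :: 'a \<Rightarrow> int. \<Sum>b\<in>B. of_int (n b) *\<^sub>R b)"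
    using assms by (auto simp: lattice_set_def)
  obtain n m where "w = (\<Sum>b\<in>B. of_int (n b) *\<^sub>R b)" "w' = (\<Sum>b\<in>B. of_int (m b) *\<^sub>R b)"
    using assms \<Lambda> by auto
  then have "w - w' = (\<Sum>b\<in>B. of_int (n b - m b) *\<^sub>R b)"
    by (simp add: sum_subtractf scaleR_diff_left)
  then show ?thesis unfolding \<Lambda> by (intro range_eqI[where x = "\<lambda>b. n b - m b"]) simp
qed

text \<open>Two lattice points counted for the same \<open>z\<close> differ by a lattice point of bounded norm, and there are finitely many of these.\<close>

lemma lattice_translates_locally_finite:
  fixes \<Lambda> :: "'v::euclidean_space set"
  assumes "lattice_set \<Lambda>" "bounded Q"
  shows "\<exists>M::nat. \<forall>z F. finite F \<longrightarrow> F \<subseteq> \<Lambda> \<longrightarrow> card {w\<in>F. z - w \<in> Q} \<le> M"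
proof -
  obtain r where r: "\<And>x. x \<in> Q \<Longrightarrow> norm x \<le> r" using assms(2) by (auto simp: bounded_iff)
  let ?D = "{w\<in>\<Lambda>. norm w \<le> 2 * r}"
  have "card {w\<in>F. z - w \<in> Q} \<le> card ?D" if F: "finite F" "F \<subseteq> \<Lambda>" for z F
  proof (cases "{w\<in>F. z - w \<in> Q} = {}")
    case False
    then obtain w0 where w0: "w0 \<in> F" "z - w0 \<in> Q" by blast
    show ?thesis
    proof (rule card_inj_on_le[of "\<lambda>w. w - w0"])
      show "(\<lambda>w. w - w0) ` {w \<in> F. z - w \<in> Q} \<subseteq> ?D"
      proof clarsimp
        fix w assume w: "w \<in> F" "z - w \<in> Q"
        have "norm (w - w0) \<le> norm (z - w0) + norm (z - w)"
          using norm_triangle_ineq4[of "z - w0" "z - w"] by simp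
        also have "\<dots> \<le> 2 * r" using r[OF w(2)] r[OF w0(2)] by linarith
        finally show "w - w0 \<in> \<Lambda> \<and> norm (w - w0) \<le> 2 * r"
          using lattice_set_diff[OF assms(1)] F w w0 by blast
      qed
      show "finite ?D" by (rule lattice_bounded_count[OF assms(1)])
    qed (auto simp: inj_on_def)
  next
    case True
    show ?thesis unfolding True by simp
  qed
  then show ?thesis by blast
qed

definition osc :: "('v::euclidean_space \<times> 'v) set \<Rightarrow> ('v \<times> 'v \<Rightarrow> real) \<Rightarrow> ('v \<times> 'v \<Rightarrow> complex) \<Rightarrow> complex" where
  "osc \<Lambda> \<phi> H = (\<Sum>\<^sub>\<infinity>w\<in>\<Lambda>. (LINT z|lborel. H z * of_real (\<phi> (z - w)) * osc_kernel z))"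

lemma osc_integral_eq_osc: "osc_integral \<Lambda> \<phi> F x = osc \<Lambda> \<phi> (\<lambda>z. F z x)"
  unfolding osc_integral_def osc_def osc_kernel_def by (rule refl)

lemma osc_cmult: "osc \<Lambda> \<phi> (\<lambda>z. c * H z) = c * osc \<Lambda> \<phi> H"
proof -
  have "(LINT z|lborel. c * H z * of_real (\<phi> (z - w)) * osc_kernel z) =
      c * (LINT z|lborel. H z * of_real (\<phi> (z - w)) * osc_kernel z)" for w
    by (simp only: mult.assoc integral_mult_right_zero)
  then show ?thesis unfolding osc_def by (simp only: infsum_cmult_right')
qed

definition smooth_derivs :: "('e::real_normed_vector \<Rightarrow> 'b::real_normed_vector) \<Rightarrow> ('e list \<Rightarrow> 'e \<Rightarrow> 'b) \<Rightarrow> bool" where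
  "smooth_derivs F D \<longleftrightarrow> D [] = F \<and> (\<forall>vs. continuous_on UNIV (D vs)) \<and>
     (\<forall>vs v x. ((\<lambda>t. D vs (x + t *\<^sub>R v)) has_vector_derivative D (v # vs) x) (at 0))"

lemma smooth_on_UNIV_iff: "smooth_on UNIV F \<longleftrightarrow> (\<exists>D. smooth_derivs F D)"
proof -
  have *: "limitin euclidean (\<lambda>t. (E (x + t *\<^sub>R v) - E x) /\<^sub>R t) L (at 0) \<longleftrightarrow>
      ((\<lambda>t. E (x + t *\<^sub>R v)) has_vector_derivative L) (at 0)" for E :: "'a \<Rightarrow> 'b" and x v L
    unfolding has_vector_derivative_iff_quotient[of E] limitin_canonical_iff ..
  show ?thesis
    unfolding smooth_on_def smooth_into_def is_derivs_def smooth_derivs_def * by simp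
qed

lemma smooth_derivs_eq_0_outside:
  assumes "smooth_derivs F D" "z \<notin> closure {z. F z \<noteq> 0}"
  shows "D vs z = 0"
proof -
  have op: "open (- closure {z. F z \<noteq> 0})" by auto
  show ?thesis
    using assms(2)
  proof (induction vs arbitrary: z)
    case Nil
    have "F z = 0" using Nil closure_subset[of "{z. F z \<noteq> 0}"] by blast
    then show ?case using assms(1) by (simp add: smooth_derivs_def)
  next
    case (Cons v vs)
    have "((\<lambda>t. z + t *\<^sub>R v) \<longlongrightarrow> z + 0 *\<^sub>R v) (nhds 0)"
      by (intro tendsto_intros) (simp add: filterlim_ident)
    then have "((\<lambda>t. z + t *\<^sub>R v) \<longlongrightarrow> z) (nhds 0)" by simp
    then have "eventually (\<lambda>t. z + t *\<^sub>R v \<in> - closure {z. F z \<noteq> 0}) (nhds 0)"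
      using topological_tendstoD[OF _ op] Cons.prems by (metis ComplI)
    then have "eventually (\<lambda>t. D vs (z + t *\<^sub>R v) = 0) (nhds 0)"
      by (rule eventually_mono) (rule Cons.IH, simp)
    moreover have "((\<lambda>t. D vs (z + t *\<^sub>R v)) has_vector_derivative D (v # vs) z) (at 0)"
      using assms(1) by (simp add: smooth_derivs_def)
    ultimately show ?case by (rule has_vector_derivative_imp_eq_0[rotated])
  qed
qed

lemma symb_smooth_derivs:
  assumes lin: "linear A"
    and sm: "\<And>n. n \<in> L \<Longrightarrow> smooth_derivs (F n) (D n)"
    and W: "\<And>v. 0 \<le> W v"
    and bd: "\<And>vs. \<exists>C. \<forall>n\<in>L. \<forall>v. cmod (D n vs v) \<le> C * W v"
    and I: "\<And>i. i \<in> I \<Longrightarrow> nn i \<in> L"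
  shows "symb k I (\<lambda>i z. W (x i + A z)) (\<lambda>i z. D (nn i) vs (x i + A z))"
proof -
  have bl: "bounded_linear A" using lin linear_conv_bounded_linear by auto
  have dom: "dominated I (\<lambda>i z. W (x i + A z)) (\<lambda>i z. D (nn i) vs (x i + A z))" for vs
  proof -
    obtain C where C: "\<And>n v. n \<in> L \<Longrightarrow> cmod (D n vs v) \<le> C * W v" using bd by blast
    show ?thesis
    proof (rule dominatedI[where C = C])
      fix i assume i: "i \<in> I"
      have "continuous_on UNIV (D (nn i) vs)" using sm[OF I[OF i]] by (simp add: smooth_derivs_def)
      then show "continuous_on UNIV (\<lambda>z. D (nn i) vs (x i + A z))"
        by (rule continuous_on_compose2) (auto intro!: continuous_intros bounded_linear.continuous_on[OF bl])
    qed (use C I W in auto)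
  qed
  show ?thesis
  proof (induction k arbitrary: vs)
    case (Suc k)
    show ?case
    proof (rule symb_SucI[OF dom])
      fix b :: 'a
      have "dir_deriv I b (\<lambda>i z. D (nn i) vs (x i + A z)) (\<lambda>i z. D (nn i) (A b # vs) (x i + A z))"
        unfolding dir_deriv_def
      proof (intro ballI allI)
        fix i z assume "i \<in> I"
        then have "((\<lambda>t. D (nn i) vs ((x i + A z) + t *\<^sub>R A b)) has_vector_derivative D (nn i) (A b # vs) (x i + A z)) (at 0)"
          using sm[OF I] by (simp add: smooth_derivs_def)
        then show "((\<lambda>t. D (nn i) vs (x i + A (z + t *\<^sub>R b))) has_vector_derivative D (nn i) (A b # vs) (x i + A z)) (at 0)"
          using lin by (simp add: linear_add linear_scale add.assoc)
      qed
      then show "\<exists>H'. dir_deriv I b (\<lambda>i z. D (nn i) vs (x i + A z)) H' \<and> symb k I (\<lambda>i z. W (x i + A z)) H'"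
        using Suc by blast
    qed
  qed (simp add: dom)
qed

text \<open>All derivatives of a translate of \<open>\<phi>\<close> are supported in the same cell; the indicator function of the cell is the weight.\<close>

lemma symb_partition:
  assumes "lattice_partition \<Lambda> \<phi>"
  shows "symb k (I \<times> \<Lambda>) (\<lambda>(i, w) z. indicator (closure {z. \<phi> z \<noteq> 0}) (z - w)) (\<lambda>(i, w) z. complex_of_real (\<phi> (z - w)))"
proof -
  let ?Q = "closure {z. \<phi> z \<noteq> 0}"
  obtain D where D: "smooth_derivs \<phi> D"
    using assms by (auto simp: lattice_partition_def smooth_on_UNIV_iff)
  have Q: "compact ?Q" using assms by (simp add: lattice_partition_def)
  have D': "smooth_derivs (\<lambda>z. complex_of_real (\<phi> z)) (\<lambda>vs z. complex_of_real (D vs z))"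
    using D unfolding smooth_derivs_def
    by (auto intro!: continuous_intros has_vector_derivative_of_real simp: has_real_derivative_iff_has_vector_derivative)
  have bd: "\<exists>C. \<forall>n\<in>{()}. \<forall>v. cmod (complex_of_real (D vs v)) \<le> C * indicator ?Q v" for vs
  proof -
    have "bounded (D vs ` ?Q)"
      using D Q by (intro compact_imp_bounded compact_continuous_image)
        (auto simp: smooth_derivs_def intro: continuous_on_subset)
    then obtain C where C: "\<And>v. v \<in> ?Q \<Longrightarrow> \<bar>D vs v\<bar> \<le> C" unfolding bounded_iff by auto
    show ?thesis
      using C smooth_derivs_eq_0_outside[OF D] by (intro exI[of _ C]) (auto simp: indicator_def)
  qed
  have "symb k (I \<times> \<Lambda>) (\<lambda>i z. indicator ?Q (- snd i + id z)) (\<lambda>i z. complex_of_real (D [] (- snd i + id z)))"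
    by (rule symb_smooth_derivs[where L = "{()}" and nn = "\<lambda>i. ()" and D = "\<lambda>_ vs z. complex_of_real (D vs z)"
        and F = "\<lambda>_ z. complex_of_real (\<phi> z)"])
       (use D' bd in \<open>auto intro: linear_ident\<close>)
  moreover have "D [] = \<phi>" using D by (simp add: smooth_derivs_def)
  ultimately show ?thesis by (simp add: case_prod_unfold)
qed

lemma integrable_cell:
  fixes f :: "'v::euclidean_space \<Rightarrow> real"
  assumes "closed Q" "integrable lborel f"
  shows "integrable lborel (\<lambda>z. indicator Q (z - w) * f z)"
proof -
  have [measurable]: "Q \<in> sets borel" using assms(1) by simp
  have [measurable]: "f \<in> borel_measurable borel" using assms(2) by auto
  have "(\<lambda>z. indicator Q (z - w) :: real) \<in> borel_measurable borel" by measurable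
  then show ?thesis
    by (intro Bochner_Integration.integrable_bound[OF assms(2)] AE_I2) (auto simp: indicator_def)
qed

text \<open>A point lies in at most \<open>M\<close> cells, so the cells together give at most \<open>M\<close> times the total mass.\<close>

lemma sum_cells_le:
  fixes f :: "'v::euclidean_space \<Rightarrow> real"
  assumes M: "\<And>z F. finite F \<Longrightarrow> F \<subseteq> \<Lambda> \<Longrightarrow> card {w\<in>F. z - w \<in> Q} \<le> M"
    and Q: "closed Q" and f: "integrable lborel f" "\<And>z. 0 \<le> f z" and F: "finite F" "F \<subseteq> \<Lambda>"
  shows "(\<Sum>w\<in>F. LINT z|lborel. indicator Q (z - w) * f z) \<le> M * (LINT z|lborel. f z)"
proof -
  note int = integrable_cell[OF Q f(1)]
  have "(\<Sum>w\<in>F. LINT z|lborel. indicator Q (z - w) * f z) = (LINT z|lborel. (\<Sum>w\<in>F. indicator Q (z - w) * f z))"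
    by (rule Bochner_Integration.integral_sum[symmetric]) (rule int)
  also have "\<dots> \<le> (LINT z|lborel. real M * f z)"
  proof (rule integral_mono)
    fix z
    have "(\<Sum>w\<in>F. indicator Q (z - w)) = real (card {w\<in>F. z - w \<in> Q})"
      using F(1) by (simp add: indicator_def sum.If_cases Int_def)
    also have "\<dots> \<le> real M" using M[OF F] by simp
    finally show "(\<Sum>w\<in>F. indicator Q (z - w) * f z) \<le> real M * f z"
      using f(2) by (simp add: mult_right_mono flip: sum_distrib_right)
  qed (use int f in auto)
  finally show "(\<Sum>w\<in>F. LINT z|lborel. indicator Q (z - w) * f z) \<le> M * (LINT z|lborel. f z)" by simp
qed

text \<open>The cell \<open>w\<close> contributes at most a constant times the mass that \<open>W decay\<close> has in it. Bounding
  \<open>W\<close> by \<open>1\<close> gives a majorant of the series that does not depend on the parameter; keeping \<open>W\<close>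
  shows that decay of the integrand in parameters is inherited by the oscillatory integral.\<close>

lemma osc_estimate:
  fixes W :: "'i \<Rightarrow> 'v::euclidean_space \<times> 'v \<Rightarrow> real"
  assumes part: "lattice_partition \<Lambda> \<phi>"
    and sy: "symb (2 * DIM('v \<times> 'v)) I W H"
    and W: "\<And>i z. i \<in> I \<Longrightarrow> 0 \<le> W i z" "\<And>i z. i \<in> I \<Longrightarrow> W i z \<le> 1"
    and Wc: "\<And>i. i \<in> I \<Longrightarrow> continuous_on UNIV (W i)"
  shows "\<exists>B. B summable_on \<Lambda> \<and> (\<forall>i\<in>I. \<forall>w\<in>\<Lambda>. cmod (LINT z|lborel. H i z * of_real (\<phi> (z - w)) * osc_kernel z) \<le> B w)"
    and "\<exists>C\<ge>0. \<forall>i\<in>I. cmod (osc \<Lambda> \<phi> (H i)) \<le> C * (LINT z|lborel. W i z * decay z)"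
proof -
  let ?Q = "closure {z. \<phi> z \<noteq> 0}"
  have Q: "bounded ?Q" "closed ?Q" using part by (auto simp: lattice_partition_def compact_imp_bounded)
  obtain M where M: "\<And>z F. finite F \<Longrightarrow> F \<subseteq> \<Lambda> \<Longrightarrow> card {w\<in>F. z - w \<in> ?Q} \<le> M"
    using lattice_translates_locally_finite[OF _ Q(1)] part unfolding lattice_partition_def by blast
  have intW: "integrable lborel (\<lambda>z. W i z * decay z)" if "i \<in> I" for i
  proof (rule Bochner_Integration.integrable_bound[OF integrable_decay])
    show "(\<lambda>z. W i z * decay z) \<in> borel_measurable lborel"
      using Wc[OF that] by (auto intro!: borel_measurable_continuous_onI continuous_intros)
    show "AE z in lborel. norm (W i z * decay z) \<le> norm (decay z)"
      using W[OF that] by (intro AE_I2) (simp add: abs_mult mult_left_le_one_le)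
  qed
  let ?W = "\<lambda>(i, w) z. W i z * indicator ?Q (z - w)"
  let ?H = "\<lambda>(i, w) z. H i z * complex_of_real (\<phi> (z - w))"
  have sy': "symb (2 * DIM('v \<times> 'v)) (I \<times> \<Lambda>) ?W ?H"
  proof -
    have re: "symb k (I \<times> \<Lambda>) (\<lambda>iw. W (fst iw)) (\<lambda>iw. H (fst iw))" if "symb k I W H" for k H
      using that
    proof (induction k arbitrary: H)
      case 0
      then show ?case by (fastforce simp: dominated_def)
    next
      case (Suc k)
      show ?case
      proof (rule symb_SucI)
        show "dominated (I \<times> \<Lambda>) (\<lambda>iw. W (fst iw)) (\<lambda>iw. H (fst iw))"
          using symb_dominated[OF Suc.prems] unfolding dominated_def by (metis mem_Times_iff)
        fix b :: "'v \<times> 'v" assume "b \<in> Basis"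
        from symb_SucD[OF Suc.prems this] obtain H' where H': "dir_deriv I b H H'" "symb k I W H'" by auto
        have "dir_deriv (I \<times> \<Lambda>) b (\<lambda>iw. H (fst iw)) (\<lambda>iw. H' (fst iw))"
          using H'(1) unfolding dir_deriv_def by auto
        with Suc.IH[OF H'(2)]
        show "\<exists>H'. dir_deriv (I \<times> \<Lambda>) b (\<lambda>iw. H (fst iw)) H' \<and> symb k (I \<times> \<Lambda>) (\<lambda>iw. W (fst iw)) H'" by blast
      qed
    qed
    show ?thesis
      using symb_mult[OF re[OF sy] symb_partition[OF part]] by (simp add: case_prod_unfold)
  qed
  have intW': "integrable lborel (\<lambda>z. W i z * indicator ?Q (z - w) * decay z)" if "i \<in> I" for i w
    using integrable_cell[OF Q(2) intW[OF that], of w] by (simp add: mult_ac)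
  have "\<exists>C\<ge>0. \<forall>j\<in>I \<times> \<Lambda>. cmod (LINT z|lborel. ?H j z * osc_kernel z) \<le> C * (LINT z|lborel. ?W j z * decay z)"
  proof (rule oscillatory_integral_decay[OF sy'])
    fix j assume "j \<in> I \<times> \<Lambda>"
    then obtain i w where j: "j = (i, w)" "i \<in> I" by auto
    obtain r where r: "\<And>x. x \<in> ?Q \<Longrightarrow> norm x \<le> r" using Q(1) by (auto simp: bounded_iff)
    have "z - w \<notin> ?Q" if "norm z > r + norm w" for z
      using that norm_triangle_ineq2[of z w] r[of "z - w"] by fastforce
    then show "\<exists>R. \<forall>z. norm z > R \<longrightarrow> ?W j z = 0"
      unfolding j by (intro exI[of _ "r + norm w"]) auto
    show "integrable lborel (\<lambda>z. ?W j z * decay z)" using intW'[OF j(2), of w] by (simp add: j)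
    show "0 \<le> ?W j z" for z using W(1)[OF j(2)] by (simp add: j)
  qed
  then obtain C where C: "C \<ge> 0" "\<And>i w. i \<in> I \<Longrightarrow> w \<in> \<Lambda> \<Longrightarrow>
      cmod (LINT z|lborel. H i z * of_real (\<phi> (z - w)) * osc_kernel z) \<le> C * (LINT z|lborel. W i z * indicator ?Q (z - w) * decay z)"
    by fastforce
  define B where "B w = C * (LINT z|lborel. indicator ?Q (z - w) * decay z)" for w
  have int1: "integrable lborel (\<lambda>z. indicator ?Q (z - w) * decay z)" for w :: "'v \<times> 'v"
    by (rule integrable_cell[OF Q(2) integrable_decay])
  have "cmod (LINT z|lborel. H i z * of_real (\<phi> (z - w)) * osc_kernel z) \<le> B w" if "i \<in> I" "w \<in> \<Lambda>" for i w
  proof -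
    have "(LINT z|lborel. W i z * indicator ?Q (z - w) * decay z) \<le> (LINT z|lborel. indicator ?Q (z - w) * decay z)"
      using W[OF that(1)] by (intro integral_mono intW' int1 that) (simp add: mult_left_le_one_le mult.assoc)
    then have "C * (LINT z|lborel. W i z * indicator ?Q (z - w) * decay z) \<le> B w"
      unfolding B_def using C(1) by (rule mult_left_mono)
    then show ?thesis using C(2)[OF that] by linarith
  qed
  moreover have "B summable_on \<Lambda>"
  proof (rule nonneg_bdd_above_summable_on)
    show "0 \<le> B w" for w
      unfolding B_def using C(1) by (intro mult_nonneg_nonneg integral_nonneg_AE AE_I2) auto
    show "bdd_above (sum B ` {F. F \<subseteq> \<Lambda> \<and> finite F})"
    proof (rule bdd_aboveI2)
      fix F assume F: "F \<in> {F. F \<subseteq> \<Lambda> \<and> finite F}"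
      have "sum B F = C * (\<Sum>w\<in>F. LINT z|lborel. indicator ?Q (z - w) * decay z)"
        unfolding B_def by (simp add: sum_distrib_left)
      also have "\<dots> \<le> C * (M * (LINT z|lborel. decay (z :: 'v \<times> 'v)))"
        using F C(1) by (intro mult_left_mono sum_cells_le[OF M Q(2) integrable_decay]) auto
      finally show "sum B F \<le> C * (M * (LINT z|lborel. decay (z :: 'v \<times> 'v)))" .
    qed
  qed
  ultimately show ex: "\<exists>B. B summable_on \<Lambda> \<and> (\<forall>i\<in>I. \<forall>w\<in>\<Lambda>. cmod (LINT z|lborel. H i z * of_real (\<phi> (z - w)) * osc_kernel z) \<le> B w)"
    by blast
  have "cmod (osc \<Lambda> \<phi> (H i)) \<le> C * M * (LINT z|lborel. W i z * decay z)" if i: "i \<in> I" for i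
  proof -
    let ?t = "\<lambda>w. LINT z|lborel. H i z * of_real (\<phi> (z - w)) * osc_kernel z"
    obtain B where B: "B summable_on \<Lambda>" "\<And>w. w \<in> \<Lambda> \<Longrightarrow> cmod (?t w) \<le> B w" using ex i by blast
    have abs: "(\<lambda>w. norm (?t w)) summable_on \<Lambda>"
      using B by (intro Infinite_Sum.abs_summable_on_comparison_test'[of B]) auto
    have "cmod (osc \<Lambda> \<phi> (H i)) \<le> (\<Sum>\<^sub>\<infinity>w\<in>\<Lambda>. cmod (?t w))"
      unfolding osc_def by (rule norm_infsum_bound[OF abs])
    also have "\<dots> \<le> C * M * (LINT z|lborel. W i z * decay z)"
    proof (rule infsum_le_finite_sums[OF abs])
      fix F assume F: "finite F" "F \<subseteq> \<Lambda>"
      have "(\<Sum>w\<in>F. cmod (?t w)) \<le> (\<Sum>w\<in>F. C * (LINT z|lborel. indicator ?Q (z - w) * (W i z * decay z)))"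
        using C(2)[OF i] F(2) by (intro sum_mono) (auto simp: mult_ac)
      also have "\<dots> = C * (\<Sum>w\<in>F. (LINT z|lborel. indicator ?Q (z - w) * (W i z * decay z)))"
        by (simp add: sum_distrib_left)
      also have "\<dots> \<le> C * (M * (LINT z|lborel. W i z * decay z))"
        using C(1) W[OF i] F by (intro mult_left_mono sum_cells_le[OF M Q(2) intW[OF i]]) auto
      finally show "(\<Sum>w\<in>F. cmod (?t w)) \<le> C * M * (LINT z|lborel. W i z * decay z)" by (simp add: mult_ac)
    qed
    finally show ?thesis .
  qed
  then show "\<exists>C\<ge>0. \<forall>i\<in>I. cmod (osc \<Lambda> \<phi> (H i)) \<le> C * (LINT z|lborel. W i z * decay z)"
    using C(1) by (intro exI[of _ "C * M"]) auto
qed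

text \<open>Dominated convergence in every cell, and again for the sum over the cells.\<close>

lemma osc_tendsto:
  assumes part: "lattice_partition \<Lambda> \<phi>"
    and B: "B summable_on \<Lambda>" "\<And>k w. w \<in> \<Lambda> \<Longrightarrow> cmod (LINT z|lborel. H k z * of_real (\<phi> (z - w)) * osc_kernel z) \<le> B w"
    and bd: "\<And>k z. cmod (H k z) \<le> C" and cont: "\<And>k. continuous_on UNIV (H k)"
    and lim: "\<And>z. (\<lambda>k. H k z) \<longlonglongrightarrow> G z" and contG: "continuous_on UNIV G"
  shows "(\<lambda>k. osc \<Lambda> \<phi> (H k)) \<longlonglongrightarrow> osc \<Lambda> \<phi> G"
proof -
  let ?Q = "closure {z. \<phi> z \<noteq> 0}"
  let ?t = "\<lambda>H w. LINT z|lborel. H z * complex_of_real (\<phi> (z - w)) * osc_kernel z"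
  have c\<phi>: "continuous_on UNIV \<phi>"
    using part by (auto simp: lattice_partition_def smooth_on_UNIV_iff smooth_derivs_def)
  have m: "(\<lambda>z. H z * complex_of_real (\<phi> (z - w)) * osc_kernel z) \<in> borel_measurable borel"
    if "continuous_on UNIV H" for H w
    by (intro borel_measurable_continuous_onI continuous_intros that continuous_on_compose2[OF c\<phi>]) auto
  have t: "(\<lambda>k. ?t (H k) w) \<longlonglongrightarrow> ?t G w" for w
  proof (rule integral_dominated_convergence[where w = "\<lambda>z. C * \<bar>\<phi> (z - w)\<bar>"])
    have "bounded ?Q" using part by (auto simp: lattice_partition_def compact_imp_bounded)
    then obtain r where r: "\<And>x. x \<in> ?Q \<Longrightarrow> norm x \<le> r" by (auto simp: bounded_iff)
    have "\<phi> x = 0" if "norm x > r" for x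
    proof (rule ccontr)
      assume "\<phi> x \<noteq> 0"
      then have "x \<in> ?Q" using closure_subset[of "{z. \<phi> z \<noteq> 0}"] by blast
      with r that show False by fastforce
    qed
    then have *: "\<phi> (z - w) = 0" if "norm z > r + norm w" for z
      using that norm_triangle_ineq2[of z w] by (metis add.commute diff_le_eq le_less_trans not_le)
    show "integrable lborel (\<lambda>z. C * \<bar>\<phi> (z - w)\<bar>)"
      by (rule integrable_continuous_bounded_support[where R = "r + norm w"])
         (auto simp: * intro!: continuous_intros continuous_on_compose2[OF c\<phi>])
    show "AE z in lborel. norm (H k z * complex_of_real (\<phi> (z - w)) * osc_kernel z) \<le> C * \<bar>\<phi> (z - w)\<bar>" for k
      using bd[of k] by (intro AE_I2) (simp add: norm_mult mult_right_mono)
    show "AE z in lborel. (\<lambda>k. H k z * complex_of_real (\<phi> (z - w)) * osc_kernel z) \<longlonglongrightarrow> G z * complex_of_real (\<phi> (z - w)) * osc_kernel z"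
      by (intro AE_I2 tendsto_intros lim)
  qed (use m cont contG in auto)
  have "((\<lambda>k. \<Sum>\<^sub>\<infinity>w\<in>\<Lambda>. ?t (H k) w) \<longlongrightarrow> (\<Sum>\<^sub>\<infinity>w\<in>\<Lambda>. ?t G w)) sequentially"
  proof -

    have Bi: "integrable (count_space \<Lambda>) B"
      using iffD1[OF summable_on_iff_abs_summable_on_real B(1)]
      unfolding abs_summable_equivalent Infinite_Set_Sum.abs_summable_on_def .
    have sum: "(\<Sum>\<^sub>\<infinity>w\<in>\<Lambda>. f w) = (LINT w|count_space \<Lambda>. f w)" if "\<And>w. w \<in> \<Lambda> \<Longrightarrow> cmod (f w) \<le> B w" for f
    proof -
      have "(\<lambda>w. norm (f w)) summable_on \<Lambda>" using B(1) that by (intro Infinite_Sum.abs_summable_on_comparison_test'[of B]) auto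
      then show ?thesis
        unfolding abs_summable_equivalent by (simp add: infsetsum_infsum[symmetric] infsetsum_def)
    qed
    have Gb: "cmod (?t G w) \<le> B w" if "w \<in> \<Lambda>" for w
      by (rule Lim_bounded[OF tendsto_norm[OF t]]) (use B(2)[OF that] in blast)
    have "(\<lambda>k. LINT w|count_space \<Lambda>. ?t (H k) w) \<longlonglongrightarrow> (LINT w|count_space \<Lambda>. ?t G w)"
      by (rule integral_dominated_convergence[where w = B]) (use Bi t B(2) in \<open>auto simp: AE_count_space\<close>)
    then show ?thesis using sum[OF B(2)] sum[OF Gb] by simp
  qed
  then show ?thesis by (simp add: osc_def)
qed

section \<open>Function systems and weighted composition\<close>

lemma topspace_seminorm_top [simp]: "topspace (seminorm_top A P) = A"
proof -
  have "openin (seminorm_top A P) A"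
    unfolding openin_seminorm_top by (auto intro!: exI[of _ "{}"] exI[of _ "1::real"])
  moreover have "topspace (seminorm_top A P) \<subseteq> A"
    using openin_topspace[of "seminorm_top A P"] unfolding openin_seminorm_top by (rule conjunct1)
  ultimately show ?thesis
    using openin_subset[of "seminorm_top A P" A] by (intro subset_antisym)
qed

lemma continuous_map_seminorm_top:
  assumes T: "\<And>f. f \<in> A \<Longrightarrow> T f \<in> A'"
    and le: "\<And>p'. p' \<in> P' \<Longrightarrow> \<exists>p\<in>P. \<forall>f\<in>A. \<forall>g\<in>A. p' (T g - T f) \<le> p (g - f)"
  shows "continuous_map (seminorm_top A P) (seminorm_top A' P') T"
  unfolding continuous_map_def topspace_seminorm_top
proof (intro conjI allI impI)
  show "T \<in> A \<rightarrow> A'" using T by auto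
  fix U assume U: "openin (seminorm_top A' P') U"
  obtain r where r: "\<And>p'. p' \<in> P' \<Longrightarrow> r p' \<in> P"
    "\<And>p' f g. p' \<in> P' \<Longrightarrow> f \<in> A \<Longrightarrow> g \<in> A \<Longrightarrow> p' (T g - T f) \<le> r p' (g - f)"
    using le by metis
  show "openin (seminorm_top A P) {x \<in> A. T x \<in> U}"
    unfolding openin_seminorm_top
  proof (intro conjI ballI)
    fix f assume f: "f \<in> {x \<in> A. T x \<in> U}"
    then obtain F and e :: real where F: "finite F" "F \<subseteq> P'" "0 < e" "{g \<in> A'. \<forall>p\<in>F. p (g - T f) < ereal e} \<subseteq> U"
      using U unfolding openin_seminorm_top by blast
    have "{g \<in> A. \<forall>p\<in>r ` F. p (g - f) < ereal e} \<subseteq> {x \<in> A. T x \<in> U}"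
    proof (rule subsetI)
      fix g assume "g \<in> {g \<in> A. \<forall>p\<in>r ` F. p (g - f) < ereal e}"
      then have g: "g \<in> A" "\<forall>p\<in>r ` F. p (g - f) < ereal e" by auto
      have "p (T g - T f) < ereal e" if "p \<in> F" for p
      proof -
        have "p (T g - T f) \<le> r p (g - f)" using r(2)[of p f g] that F(2) f g by auto
        also have "\<dots> < ereal e" using g that by auto
        finally show ?thesis .
      qed
      with F(4) T[OF g(1)] g(1) show "g \<in> {x \<in> A. T x \<in> U}" by blast
    qed
    moreover have "r ` F \<subseteq> P" using r(1) F(2) by auto
    ultimately show "\<exists>F \<epsilon>. finite F \<and> F \<subseteq> P \<and> 0 < (\<epsilon>::real) \<and> {g \<in> A. \<forall>p\<in>F. p (g - f) < ereal \<epsilon>} \<subseteq> {x \<in> A. T x \<in> U}"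
      using F(1,3) by (intro exI[of _ "r ` F"] exI[of _ e]) auto
  qed auto
qed

lemma continuous_map_seminorm_top_dist:
  fixes T :: "'b::real_vector \<Rightarrow> 'c::metric_space"
  assumes "p \<in> P" "\<And>f g. f \<in> A \<Longrightarrow> g \<in> A \<Longrightarrow> ereal (dist (T g) (T f)) \<le> p (g - f)"
  shows "continuous_map (seminorm_top A P) euclidean T"
  unfolding continuous_map_def topspace_seminorm_top
proof (intro conjI allI impI)
  fix U :: "'c set" assume "openin euclidean U"
  then have U: "open U" by simp
  show "openin (seminorm_top A P) {x \<in> A. T x \<in> U}"
    unfolding openin_seminorm_top
  proof (intro conjI ballI)
    fix f assume f: "f \<in> {x \<in> A. T x \<in> U}"
    then obtain e where e: "e > 0" "ball (T f) e \<subseteq> U" using U open_contains_ball by blast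
    have "{g \<in> A. \<forall>p\<in>{p}. p (g - f) < ereal e} \<subseteq> {x \<in> A. T x \<in> U}"
    proof (rule subsetI)
      fix g assume "g \<in> {g \<in> A. \<forall>p\<in>{p}. p (g - f) < ereal e}"
      then have g: "g \<in> A" "\<forall>p\<in>{p}. p (g - f) < ereal e" by auto
      have "ereal (dist (T g) (T f)) \<le> p (g - f)" using assms(2)[of f g] g f by auto
      also have "\<dots> < ereal e" using g by auto
      finally have "ereal (dist (T g) (T f)) < ereal e" .
      with e(2) g(1) show "g \<in> {x \<in> A. T x \<in> U}" by (auto simp: dist_commute)
    qed
    then show "\<exists>F \<epsilon>. finite F \<and> F \<subseteq> P \<and> 0 < (\<epsilon>::real) \<and> {g \<in> A. \<forall>p\<in>F. p (g - f) < ereal \<epsilon>} \<subseteq> {x \<in> A. T x \<in> U}"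
      using assms(1) e(1) by (intro exI[of _ "{p}"] exI[of _ e]) auto
  qed auto
qed auto

lemma is_derivs_linear_image:
  assumes "is_derivs X S F D" "continuous_map X Y T" "linear T"
  shows "is_derivs Y S (\<lambda>x. T (F x)) (\<lambda>vs x. T (D vs x))"
  unfolding is_derivs_def
proof (intro conjI allI ballI)
  show "(\<lambda>x. T (D [] x)) = (\<lambda>x. T (F x))" using assms(1) by (simp add: is_derivs_def)
  show "continuous_map (top_of_set S) Y (\<lambda>x. T (D vs x))" for vs
  proof -
    have "continuous_map (top_of_set S) X (D vs)" using assms(1) by (simp add: is_derivs_def)
    from continuous_map_compose[OF this assms(2)] show ?thesis by (simp add: o_def)
  qed
  fix vs v x assume x: "x \<in> S"
  have "limitin X (\<lambda>t. (D vs (x + t *\<^sub>R v) - D vs x) /\<^sub>R t) (D (v # vs) x) (at 0)"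
    using assms(1) x by (simp add: is_derivs_def)
  from continuous_map_limit[OF assms(2) this]
  show "limitin Y (\<lambda>t. (T (D vs (x + t *\<^sub>R v)) - T (D vs x)) /\<^sub>R t) (T (D (v # vs) x)) (at 0)"
    by (simp add: o_def linear_diff[OF assms(3)] linear_scale[OF assms(3)])
qed

lemma sup_seminorm_upper: "bounded (f ` L) \<Longrightarrow> y \<in> L \<Longrightarrow> cmod (f y) \<le> sup_seminorm L f"
proof -
  assume b: "bounded (f ` L)" and y: "y \<in> L"
  obtain B where "\<And>x. x \<in> L \<Longrightarrow> cmod (f x) \<le> B" using b by (auto simp: bounded_iff)
  then have "bdd_above ((\<lambda>x. cmod (f x)) ` L)" by (rule bdd_aboveI2)
  then show ?thesis using y by (auto simp: sup_seminorm_def intro: cSUP_upper)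
qed

lemma sup_seminorm_least: "(\<And>y. y \<in> L \<Longrightarrow> cmod (f y) \<le> C) \<Longrightarrow> 0 \<le> C \<Longrightarrow> sup_seminorm L f \<le> C"
  by (auto simp: sup_seminorm_def intro: cSUP_least)

lemma sup_seminorm_nonneg: "bounded (f ` L) \<Longrightarrow> 0 \<le> sup_seminorm L f"
proof (cases "L = {}")
  case False
  assume b: "bounded (f ` L)"
  obtain y where "y \<in> L" using False by auto
  with sup_seminorm_upper[OF b this] show ?thesis by (meson norm_ge_zero order_trans)
qed (simp add: sup_seminorm_def)

lemma scaleR_complex_fun: "c *\<^sub>R f = (\<lambda>x. complex_of_real c * f x)" for f :: "'n \<Rightarrow> complex"
  by (simp add: fun_eq_iff scaleR_conv_of_real)

text \<open>The common properties of \<open>C\<^sup>0\<close>, \<open>C\<^sup>0\<^sub>b\<close> and \<open>C\<^sup>0\<^sub>\<infinity>\<close>: the seminorms are suprema over a family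
  \<open>\<L>\<close> of subsets, namely the compact ones or just the whole space.\<close>

locale sup_system =
  fixes S :: "('n, 'd::finite) fun_system" and X :: "'n topology"
    and \<Phi> :: "real^'d \<Rightarrow> 'n \<Rightarrow> 'n" and \<L> :: "'n set set"
  assumes carr_C0: "carr S \<subseteq> C0_carrier X"
    and carr_add: "\<And>f g. f \<in> carr S \<Longrightarrow> g \<in> carr S \<Longrightarrow> f + g \<in> carr S"
    and carr_cmult: "\<And>f c. f \<in> carr S \<Longrightarrow> (\<lambda>x. c * f x) \<in> carr S"
    and snorms_eq: "snorms S = sup_seminorm ` \<L>"
    and act_eq: "act S = (\<lambda>v f. cut (topspace X) (f \<circ> \<Phi> v))"
    and family_bounded: "\<And>L f. L \<in> \<L> \<Longrightarrow> f \<in> carr S \<Longrightarrow> bounded (f ` L)"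
    and family_cover: "\<Union>\<L> = topspace X"
begin

lemma carr_outside: "f \<in> carr S \<Longrightarrow> n \<notin> topspace X \<Longrightarrow> f n = 0"
  using carr_C0 by (auto simp: C0_carrier_def)

lemma carr_continuous: "f \<in> carr S \<Longrightarrow> continuous_map X euclidean f"
  using carr_C0 by (auto simp: C0_carrier_def)

lemma carr_diff: "f \<in> carr S \<Longrightarrow> g \<in> carr S \<Longrightarrow> f - g \<in> carr S"
  using carr_add[of f "\<lambda>x. (-1) * g x"] carr_cmult[of g "-1"] by (simp add: fun_diff_def plus_fun_def)

lemma carr_scaleR: "f \<in> carr S \<Longrightarrow> c *\<^sub>R f \<in> carr S"
  by (simp add: scaleR_complex_fun carr_cmult)

lemma family_sub: "L \<in> \<L> \<Longrightarrow> L \<subseteq> topspace X"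
  using family_cover by blast

lemma act_apply: "act S v f n = (if n \<in> topspace X then f (\<Phi> v n) else 0)"
  by (simp add: act_eq cut_def)

lemma alg_top_eq: "alg_top S = seminorm_top (carr S) ((\<lambda>L f. ereal (sup_seminorm L f)) ` \<L>)"
  by (simp add: alg_top_def real_seminorm_top_def snorms_eq image_image)

lemma topspace_alg_top [simp]: "topspace (alg_top S) = carr S"
  by (simp add: alg_top_eq)

lemma continuous_evaluation:
  assumes "n \<in> topspace X"
  shows "continuous_map (alg_top S) euclidean (\<lambda>f. f n)"
proof -
  obtain L where L: "L \<in> \<L>" "n \<in> L" using assms family_cover by blast
  show ?thesis
    unfolding alg_top_eq
  proof (rule continuous_map_seminorm_top_dist)
    show "(\<lambda>f. ereal (sup_seminorm L f)) \<in> (\<lambda>L f. ereal (sup_seminorm L f)) ` \<L>" using L(1) by blast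
    fix f g assume fg: "f \<in> carr S" "g \<in> carr S"
    have "bounded ((g - f) ` L)" by (rule family_bounded[OF L(1) carr_diff[OF fg(2,1)]])
    from sup_seminorm_upper[OF this L(2)]
    show "ereal (dist (g n) (f n)) \<le> ereal (sup_seminorm L (g - f))" by (simp add: dist_norm)
  qed
qed

lemma is_derivs_carr: "is_derivs (alg_top S) UNIV F D \<Longrightarrow> D vs v \<in> carr S"
  unfolding is_derivs_def by (auto simp: continuous_map_def)

text \<open>Point evaluations are linear and continuous, so they commute with the derivatives.\<close>

lemma is_derivs_pointwise:
  assumes "is_derivs (alg_top S) UNIV F D" "n \<in> topspace X"
  shows "smooth_derivs (\<lambda>v. F v n) (\<lambda>vs v. D vs v n)"
proof -
  have "linear (\<lambda>f::'n \<Rightarrow> complex. f n)" by (intro linearI) auto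
  from is_derivs_linear_image[OF assms(1) continuous_evaluation[OF assms(2)] this]
  have d: "is_derivs euclidean UNIV (\<lambda>v. F v n) (\<lambda>vs v. D vs v n)" .
  have *: "limitin euclidean (\<lambda>t. (E (x + t *\<^sub>R v) - E x) /\<^sub>R t) L (at 0) \<longleftrightarrow>
      ((\<lambda>t. E (x + t *\<^sub>R v)) has_vector_derivative L) (at 0)" for E :: "'a::real_normed_vector \<Rightarrow> complex" and x v L
    unfolding has_vector_derivative_iff_quotient[of E] limitin_canonical_iff by (rule refl)
  show ?thesis
    using d unfolding is_derivs_def smooth_derivs_def
    unfolding *[of "\<lambda>v. D vs v n" for vs] by simp
qed

end

text \<open>Restriction, extension by \<open>0\<close>, pull-back and multiplication with a cut-off function are all of
  this form.\<close>

definition wco :: "('m \<Rightarrow> complex) \<Rightarrow> ('m \<Rightarrow> 'n) \<Rightarrow> ('n \<Rightarrow> complex) \<Rightarrow> 'm \<Rightarrow> complex" where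
  "wco \<eta> \<kappa> f = (\<lambda>y. \<eta> y * f (\<kappa> y))"

lemma linear_wco: "linear (wco \<eta> \<kappa>)"
  by (intro linearI) (auto simp: wco_def fun_eq_iff distrib_left)

lemma linear_wco_pointwise: "linear (\<lambda>F v. wco \<eta> \<kappa> (F v))"
  by (intro linearI) (auto simp: wco_def fun_eq_iff distrib_left)

locale wco_morphism = dom: sup_system S X \<Phi> \<L> + cod: sup_system S' X' \<Phi>' \<L>'
  for S :: "('n, 'd::finite) fun_system" and X \<Phi> \<L>
  and S' :: "('m, 'd) fun_system" and X' \<Phi>' \<L>' +
  fixes \<eta> :: "'m \<Rightarrow> complex" and \<kappa> :: "'m \<Rightarrow> 'n"
  assumes wco_carr: "\<And>f. f \<in> carr S \<Longrightarrow> wco \<eta> \<kappa> f \<in> carr S'"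
    and wco_family: "\<And>L'. L' \<in> \<L>' \<Longrightarrow> \<exists>L\<in>\<L>. \<forall>y\<in>L'. \<eta> y \<noteq> 0 \<longrightarrow> \<kappa> y \<in> L"
    and weight_le_1: "\<And>y. cmod (\<eta> y) \<le> 1"
begin

lemma seminorm_le:
  assumes "L' \<in> \<L>'"
  shows "\<exists>L\<in>\<L>. \<forall>f\<in>carr S. sup_seminorm L' (wco \<eta> \<kappa> f) \<le> sup_seminorm L f"
proof -
  obtain L where L: "L \<in> \<L>" "\<And>y. y \<in> L' \<Longrightarrow> \<eta> y \<noteq> 0 \<Longrightarrow> \<kappa> y \<in> L" using wco_family[OF assms] by blast
  have "sup_seminorm L' (wco \<eta> \<kappa> f) \<le> sup_seminorm L f" if f: "f \<in> carr S" for f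
  proof (rule sup_seminorm_least)
    have b: "bounded (f ` L)" by (rule dom.family_bounded[OF L(1) f])
    then show nn: "0 \<le> sup_seminorm L f" by (rule sup_seminorm_nonneg)
    fix y assume y: "y \<in> L'"
    show "cmod (wco \<eta> \<kappa> f y) \<le> sup_seminorm L f"
    proof (cases "\<eta> y = 0")
      case False
      have "cmod (wco \<eta> \<kappa> f y) \<le> 1 * cmod (f (\<kappa> y))"
        unfolding wco_def norm_mult by (intro mult_right_mono weight_le_1) auto
      also have "\<dots> \<le> sup_seminorm L f" using sup_seminorm_upper[OF b L(2)[OF y False]] by simp
      finally show ?thesis .
    qed (use nn in \<open>simp add: wco_def\<close>)
  qed
  with L(1) show ?thesis by blast
qed

lemma wco_diff: "wco \<eta> \<kappa> g - wco \<eta> \<kappa> f = wco \<eta> \<kappa> (g - f)"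
  using linear_diff[OF linear_wco] by metis

lemma continuous_wco: "continuous_map (alg_top S) (alg_top S') (wco \<eta> \<kappa>)"
  unfolding dom.alg_top_eq cod.alg_top_eq
proof (rule continuous_map_seminorm_top)
  fix p' assume "p' \<in> (\<lambda>L f. ereal (sup_seminorm L f)) ` \<L>'"
  then obtain L' where L': "L' \<in> \<L>'" "p' = (\<lambda>f. ereal (sup_seminorm L' f))" by blast
  obtain L where L: "L \<in> \<L>" "\<And>f. f \<in> carr S \<Longrightarrow> sup_seminorm L' (wco \<eta> \<kappa> f) \<le> sup_seminorm L f"
    using seminorm_le[OF L'(1)] by blast
  show "\<exists>p\<in>(\<lambda>L f. ereal (sup_seminorm L f)) ` \<L>. \<forall>f\<in>carr S. \<forall>g\<in>carr S. p' (wco \<eta> \<kappa> g - wco \<eta> \<kappa> f) \<le> p (g - f)"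
    using L by (intro bexI[of _ "\<lambda>f. ereal (sup_seminorm L f)"]) (auto simp: L'(2) wco_diff dom.carr_diff)
qed (rule wco_carr)

lemma wco_smooth_part:
  assumes "\<And>v f. f \<in> carr S \<Longrightarrow> act S' v (wco \<eta> \<kappa> f) = wco \<eta> \<kappa> (act S v f)" "a \<in> smooth_part S"
  shows "wco \<eta> \<kappa> a \<in> smooth_part S'"
proof -
  obtain D where a: "a \<in> carr S" and D: "is_derivs (alg_top S) UNIV (\<lambda>v. act S v a) D"
    using assms(2) by (auto simp: smooth_part_def smooth_vectors_def smooth_into_def)
  from is_derivs_linear_image[OF D continuous_wco linear_wco]
  show ?thesis
    using a by (auto simp: smooth_part_def smooth_vectors_def smooth_into_def assms(1) wco_carr)
qed

lemma wco_Cu: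
  assumes "F \<in> Cu S"
  shows "(\<lambda>v. wco \<eta> \<kappa> (F v)) \<in> Cu S'"
  unfolding Cu_def
proof (intro CollectI conjI ballI allI impI)
  have F: "F v \<in> carr S" for v using assms by (auto simp: Cu_def)
  then show "range (\<lambda>v. wco \<eta> \<kappa> (F v)) \<subseteq> carr S'" using wco_carr by auto
  fix p' assume "p' \<in> snorms S'"
  then obtain L' where L': "L' \<in> \<L>'" "p' = sup_seminorm L'" by (auto simp: cod.snorms_eq)
  obtain L where L: "L \<in> \<L>" "\<And>f. f \<in> carr S \<Longrightarrow> sup_seminorm L' (wco \<eta> \<kappa> f) \<le> sup_seminorm L f"
    using seminorm_le[OF L'(1)] by blast
  have p: "sup_seminorm L \<in> snorms S" using L(1) by (simp add: dom.snorms_eq)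
  have "bounded (range (\<lambda>v. sup_seminorm L (F v)))" using assms p by (auto simp: Cu_def)
  then obtain B where B: "\<And>v. \<bar>sup_seminorm L (F v)\<bar> \<le> B" by (auto simp: bounded_iff)
  have "\<bar>p' (wco \<eta> \<kappa> (F v))\<bar> \<le> B" for v
  proof -
    have "0 \<le> p' (wco \<eta> \<kappa> (F v))"
      unfolding L'(2) by (intro sup_seminorm_nonneg cod.family_bounded[OF L'(1)] wco_carr F)
    moreover have "p' (wco \<eta> \<kappa> (F v)) \<le> sup_seminorm L (F v)" using L(2)[OF F, of v] L'(2) by simp
      ultimately show ?thesis using B[of v] by linarith
  qed
  then show "bounded (range (\<lambda>v. p' (wco \<eta> \<kappa> (F v))))" by (auto simp: bounded_iff)
  fix e :: real assume "e > 0"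
  then obtain d where d: "d > 0" "\<And>v w. dist v w < d \<Longrightarrow> sup_seminorm L (F v - F w) < e"
    using assms p unfolding Cu_def by blast
  have "p' (wco \<eta> \<kappa> (F v) - wco \<eta> \<kappa> (F w)) < e" if "dist v w < d" for v w
    unfolding wco_diff L'(2) by (rule le_less_trans[OF L(2)[OF dom.carr_diff[OF F F]] d(2)[OF that]])
  with d(1) show "\<exists>d>0. \<forall>v w. dist v w < d \<longrightarrow> p' (wco \<eta> \<kappa> (F v) - wco \<eta> \<kappa> (F w)) < e" by blast
qed

lemma Cu_diff:
  assumes "F \<in> Cu S" "G \<in> Cu S" "p \<in> snorms S"
  shows "bdd_above (range (\<lambda>v. p ((F - G) v)))"
proof -
  obtain L where L: "L \<in> \<L>" "p = sup_seminorm L" using assms(3) by (auto simp: dom.snorms_eq)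
  have F: "F v \<in> carr S" "G v \<in> carr S" for v using assms by (auto simp: Cu_def)
  have "\<exists>B. \<forall>v. p (F v) \<le> B" if "F \<in> Cu S" for F
  proof -
    have "bounded (range (\<lambda>v. p (F v)))" using that assms(3) by (simp add: Cu_def)
    then show ?thesis unfolding bounded_iff by (auto simp: abs_le_iff)
  qed
  from this[OF assms(1)] this[OF assms(2)]
  obtain B C where B: "\<forall>v. p (F v) \<le> B" "\<forall>v. p (G v) \<le> C"
    by (elim exE)
  have "p ((F - G) v) \<le> B + C" for v
  proof -
    have b: "bounded (F v ` L)" "bounded (G v ` L)" using dom.family_bounded[OF L(1)] F by auto
    have "sup_seminorm L (F v - G v) \<le> sup_seminorm L (F v) + sup_seminorm L (G v)"
    proof (rule sup_seminorm_least)
      fix y assume "y \<in> L"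
      from sup_seminorm_upper[OF b(1) this] sup_seminorm_upper[OF b(2) this] norm_triangle_ineq4[of "F v y" "G v y"]
      show "cmod ((F v - G v) y) \<le> sup_seminorm L (F v) + sup_seminorm L (G v)" by simp
    qed (intro add_nonneg_nonneg sup_seminorm_nonneg b)
    moreover have "sup_seminorm L (F v) \<le> B" "sup_seminorm L (G v) \<le> C" using B L(2) by auto
    ultimately show ?thesis using L(2) by (simp add: fun_diff_def)
  qed
  then show ?thesis by (rule bdd_aboveI2)
qed

lemma continuous_wco_Cu: "continuous_map (Cu_top S) (Cu_top S') (\<lambda>F v. wco \<eta> \<kappa> (F v))"
  unfolding Cu_top_def
proof (rule continuous_map_seminorm_top)
  fix q' :: "(real^'d \<Rightarrow> 'm \<Rightarrow> complex) \<Rightarrow> ereal" assume "q' \<in> (\<lambda>p F. ereal (SUP v. p (F v))) ` snorms S'"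
  then obtain L' where L': "L' \<in> \<L>'" "q' = (\<lambda>F. ereal (SUP v. sup_seminorm L' (F v)))" by (auto simp: cod.snorms_eq)
  obtain L where L: "L \<in> \<L>" "\<And>f. f \<in> carr S \<Longrightarrow> sup_seminorm L' (wco \<eta> \<kappa> f) \<le> sup_seminorm L f"
    using seminorm_le[OF L'(1)] by blast
  have p: "sup_seminorm L \<in> snorms S" using L(1) by (simp add: dom.snorms_eq)
  have "q' ((\<lambda>v. wco \<eta> \<kappa> (G v)) - (\<lambda>v. wco \<eta> \<kappa> (F v))) \<le> ereal (SUP v. sup_seminorm L ((G - F) v))"
    if FG: "F \<in> Cu S" "G \<in> Cu S" for F G
  proof -
    have c: "G v - F v \<in> carr S" for v using FG by (auto simp: Cu_def intro!: dom.carr_diff)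
    have "(SUP v. sup_seminorm L' (wco \<eta> \<kappa> (G v - F v))) \<le> (SUP v. sup_seminorm L ((G - F) v))"
      by (rule cSUP_mono) (use Cu_diff[OF FG(2,1) p] L(2)[OF c] in \<open>auto simp: fun_diff_def\<close>)
    then show ?thesis unfolding L'(2) by (simp add: wco_diff)
  qed
  then show "\<exists>p\<in>(\<lambda>p F. ereal (SUP v. p (F v))) ` snorms S. \<forall>F\<in>Cu S. \<forall>G\<in>Cu S.
      q' ((\<lambda>v. wco \<eta> \<kappa> (G v)) - (\<lambda>v. wco \<eta> \<kappa> (F v))) \<le> p (G - F)"
    using p by (intro bexI[of _ "\<lambda>F. ereal (SUP v. sup_seminorm L (F v))"]) auto
qed (rule wco_Cu)

text \<open>A continuous linear map commutes with derivatives and translations, and the bound on the weight preserves the Schwartz bounds.\<close>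

lemma wco_schwartz:
  assumes "g \<in> schwartz S"
  shows "(\<lambda>v. wco \<eta> \<kappa> (g v)) \<in> schwartz S'"
proof -
  have s1: "g \<in> smooth_vectors (Cu_top S) (\<lambda>v F x. F (x + v))"
    and s2: "\<exists>D. is_derivs (alg_top S) UNIV g D \<and>
       (\<forall>vs P. real_polynomial_function P \<longrightarrow> (\<forall>p\<in>snorms S. bounded (range (\<lambda>v. p (P v *\<^sub>R D vs v)))))"
    using assms unfolding schwartz_def by (simp_all only: mem_Collect_eq)
  have g: "g \<in> Cu S" using s1 by (simp add: smooth_vectors_def Cu_top_def)
  from s1 have "\<exists>E. is_derivs (Cu_top S) UNIV (\<lambda>v x. g (x + v)) E"
    by (simp add: smooth_vectors_def smooth_into_def)
  then obtain E where E: "is_derivs (Cu_top S) UNIV (\<lambda>v x. g (x + v)) E" by (elim exE)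
  from s2 obtain D where D: "is_derivs (alg_top S) UNIV g D"
    and bd': "\<forall>vs P. real_polynomial_function P \<longrightarrow> (\<forall>p\<in>snorms S. bounded (range (\<lambda>v. p (P v *\<^sub>R D vs v))))"
    by (elim exE conjE)
  note bd = bd'[rule_format]
  from is_derivs_linear_image[OF E continuous_wco_Cu linear_wco_pointwise]
  have "smooth_into (Cu_top S') UNIV (\<lambda>v x. wco \<eta> \<kappa> (g (x + v)))"
    unfolding smooth_into_def by (rule exI[where x = "\<lambda>vs x v. wco \<eta> \<kappa> (E vs x v)"])
  then have 1: "(\<lambda>v. wco \<eta> \<kappa> (g v)) \<in> smooth_vectors (Cu_top S') (\<lambda>v F x. F (x + v))"
    using wco_Cu[OF g] by (simp add: smooth_vectors_def Cu_top_def)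
  have 2: "bounded (range (\<lambda>v. p' (P v *\<^sub>R wco \<eta> \<kappa> (D vs v))))"
    if P: "real_polynomial_function P" and p': "p' \<in> snorms S'" for P p' vs
  proof -
    obtain L' where L': "L' \<in> \<L>'" "p' = sup_seminorm L'" using p' by (auto simp: cod.snorms_eq)
    obtain L where L: "L \<in> \<L>" "\<And>f. f \<in> carr S \<Longrightarrow> sup_seminorm L' (wco \<eta> \<kappa> f) \<le> sup_seminorm L f"
      using seminorm_le[OF L'(1)] by blast
    have p: "sup_seminorm L \<in> snorms S" using L(1) by (simp add: dom.snorms_eq)
    obtain B where B: "\<And>v. \<bar>sup_seminorm L (P v *\<^sub>R D vs v)\<bar> \<le> B"
      using bd[OF P p, of vs] by (auto simp: bounded_iff)
    have c: "P v *\<^sub>R D vs v \<in> carr S" for v by (intro dom.carr_scaleR dom.is_derivs_carr[OF D])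
    have "\<bar>p' (P v *\<^sub>R wco \<eta> \<kappa> (D vs v))\<bar> \<le> B" for v
    proof -
      have eq: "P v *\<^sub>R wco \<eta> \<kappa> (D vs v) = wco \<eta> \<kappa> (P v *\<^sub>R D vs v)"
        using linear_scale[OF linear_wco] by metis
      have "0 \<le> p' (P v *\<^sub>R wco \<eta> \<kappa> (D vs v))"
        unfolding L'(2) eq by (intro sup_seminorm_nonneg cod.family_bounded[OF L'(1)] wco_carr c)
      moreover have "p' (P v *\<^sub>R wco \<eta> \<kappa> (D vs v)) \<le> sup_seminorm L (P v *\<^sub>R D vs v)"
        unfolding eq L'(2) by (rule L(2)[OF c])
      ultimately show ?thesis using B[of v] by linarith
    qed
    then show ?thesis by (auto simp: bounded_iff)
  qed
  show ?thesis
    unfolding schwartz_def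
    by (intro CollectI conjI exI[of _ "\<lambda>vs v. wco \<eta> \<kappa> (D vs v)"] allI impI ballI 1 2
        is_derivs_linear_image[OF D continuous_wco linear_wco])
qed

end

lemma C0_carrier_add: "f \<in> C0_carrier X \<Longrightarrow> g \<in> C0_carrier X \<Longrightarrow> f + g \<in> C0_carrier X"
  by (auto simp: C0_carrier_def plus_fun_def intro!: continuous_map_add)

lemma continuous_map_complex_mult:
  fixes f g :: "'n \<Rightarrow> complex"
  assumes "continuous_map X euclidean f" "continuous_map X euclidean g"
  shows "continuous_map X euclidean (\<lambda>x. f x * g x)"
  using assms by (simp add: continuous_map_atin tendsto_mult)

lemma C0_carrier_mult: "f \<in> C0_carrier X \<Longrightarrow> continuous_map X euclidean g \<Longrightarrow> (\<lambda>x. g x * f x) \<in> C0_carrier X"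
  by (auto simp: C0_carrier_def intro!: continuous_map_complex_mult)

lemma C0_carrier_cmult: "f \<in> C0_carrier X \<Longrightarrow> (\<lambda>x. c * f x) \<in> C0_carrier X"
  using C0_carrier_mult[of f X "\<lambda>_. c"] by simp

lemma sup_system_C0: "sup_system (C0 X \<Phi>) X \<Phi> {L. compactin X L}"
proof
  fix L f assume "L \<in> {L. compactin X L}" "f \<in> carr (C0 X \<Phi>)"
  then have "compactin euclidean (f ` L)"
    by (intro image_compactin) (auto simp: C0_def C0_carrier_def)
  then show "bounded (f ` L)" by (simp add: compact_imp_bounded)
next
  show "\<Union> {L. compactin X L} = topspace X"
  proof
    show "topspace X \<subseteq> \<Union> {L. compactin X L}"
    proof
      fix x assume "x \<in> topspace X"
      then have "compactin X {x}" by simp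
      then show "x \<in> \<Union> {L. compactin X L}" by blast
    qed
  qed (auto dest: compactin_subset_topspace)
qed (auto simp: C0_def compact_seminorms_def C0_carrier_add C0_carrier_cmult)

lemma bounded_range_iff: "bounded (range f) \<longleftrightarrow> (\<exists>B. \<forall>x. cmod (f x) \<le> B)"
  by (auto simp: bounded_iff)

lemma sup_system_C0b: "sup_system (C0b X \<Phi>) X \<Phi> {topspace X}"
proof
  fix f g assume fg: "f \<in> carr (C0b X \<Phi>)" "g \<in> carr (C0b X \<Phi>)"
  then obtain B C where "\<And>x. cmod (f x) \<le> B" "\<And>x. cmod (g x) \<le> C"
    by (auto simp: C0b_def bounded_range_iff)
  then have "\<And>x. cmod (f x + g x) \<le> B + C" by (meson add_mono norm_triangle_le)
  then show "f + g \<in> carr (C0b X \<Phi>)"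
    using fg by (auto simp: C0b_def bounded_range_iff C0_carrier_add)
next
  fix f c assume f: "f \<in> carr (C0b X \<Phi>)"
  then obtain B where "\<And>x. cmod (f x) \<le> B" by (auto simp: C0b_def bounded_range_iff)
  then have "\<And>x. cmod (c * f x) \<le> cmod c * B" by (simp add: norm_mult mult_left_mono)
  then show "(\<lambda>x. c * f x) \<in> carr (C0b X \<Phi>)"
    using f by (auto simp: C0b_def bounded_range_iff C0_carrier_cmult)
qed (auto simp: C0b_def intro: bounded_subset)

lemma C0inf_vanishing:
  "f \<in> carr (C0inf X \<Phi>) \<Longrightarrow> 0 < e \<Longrightarrow> \<exists>K. compactin X K \<and> (\<forall>x\<in>topspace X - K. cmod (f x) < e)"
  by (simp add: C0inf_def)

lemma C0inf_bounded:
  assumes "f \<in> carr (C0inf X \<Phi>)"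
  shows "bounded (range f)"
proof -
  obtain K where K: "compactin X K" "\<And>x. x \<in> topspace X - K \<Longrightarrow> cmod (f x) < 1"
    using C0inf_vanishing[OF assms, of 1] by auto
  have "compactin euclidean (f ` K)"
    using assms K by (intro image_compactin) (auto simp: C0inf_def C0_carrier_def)
  then have "bounded (f ` K)" by (simp add: compact_imp_bounded)
  then obtain B where B: "\<And>x. x \<in> K \<Longrightarrow> cmod (f x) \<le> B" by (auto simp: bounded_iff)
  have "cmod (f x) \<le> max B 1" for x
  proof -
    consider "x \<in> K" | "x \<in> topspace X - K" | "x \<notin> topspace X" by blast
    then show ?thesis
    proof cases
      case 1 then show ?thesis using B[of x] by simp
    next
      case 2 then show ?thesis using K(2)[of x] by simp
    next
      case 3 then show ?thesis using assms by (simp add: C0inf_def C0_carrier_def)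
    qed
  qed
  then show ?thesis by (auto simp: bounded_range_iff)
qed

lemma sup_system_C0inf: "sup_system (C0inf X \<Phi>) X \<Phi> {topspace X}"
proof
  fix f g assume fg: "f \<in> carr (C0inf X \<Phi>)" "g \<in> carr (C0inf X \<Phi>)"
  have "\<exists>K. compactin X K \<and> (\<forall>x\<in>topspace X - K. cmod (f x + g x) < e)" if "e > 0" for e
  proof -
    have "e / 2 > 0" using that by simp
    from C0inf_vanishing[OF fg(1) this] C0inf_vanishing[OF fg(2) this]
    obtain K K' where K: "compactin X K" "\<forall>x\<in>topspace X - K. cmod (f x) < e / 2"
      "compactin X K'" "\<forall>x\<in>topspace X - K'. cmod (g x) < e / 2"
      by (elim exE conjE)
    have "cmod (f x + g x) < e" if "x \<in> topspace X - (K \<union> K')" for x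
    proof -
      have "cmod (f x) < e / 2" "cmod (g x) < e / 2" using K(2,4) that by blast+
      then show ?thesis using norm_triangle_ineq[of "f x" "g x"] by linarith
    qed
    then show ?thesis using compactin_Un[OF K(1,3)] by blast
  qed
  then show "f + g \<in> carr (C0inf X \<Phi>)" using fg by (auto simp: C0inf_def C0_carrier_add)
next
  fix f c assume f: "f \<in> carr (C0inf X \<Phi>)"
  have "\<exists>K. compactin X K \<and> (\<forall>x\<in>topspace X - K. cmod (c * f x) < e)" if "e > 0" for e
  proof -
    have "e / (cmod c + 1) > 0" using that by (simp add: add_nonneg_pos)
    then obtain K where K: "compactin X K" "\<And>x. x \<in> topspace X - K \<Longrightarrow> cmod (f x) < e / (cmod c + 1)"
      using C0inf_vanishing[OF f, of "e / (cmod c + 1)"] by auto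
    have "cmod (c * f x) < e" if "x \<in> topspace X - K" for x
    proof -
      have "cmod (c * f x) \<le> (cmod c + 1) * cmod (f x)" by (simp add: norm_mult mult_right_mono)
      also have "\<dots> < e"
      proof -
        have "0 < cmod c + 1" by (rule add_nonneg_pos) auto
        from iffD1[OF pos_less_divide_eq[OF this] K(2)[OF that]] show ?thesis by (simp add: mult.commute)
      qed
      finally show ?thesis .
    qed
    with K(1) show ?thesis by blast
  qed
  then show "(\<lambda>x. c * f x) \<in> carr (C0inf X \<Phi>)" using f by (auto simp: C0inf_def C0_carrier_cmult)
next
  fix L f assume "L \<in> {topspace X}" "f \<in> carr (C0inf X \<Phi>)"
  then show "bounded (f ` L)" using C0inf_bounded[of f X \<Phi>] by (auto intro: bounded_subset)
qed (auto simp: C0inf_def)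

section \<open>Twisted products with Schwartz functions\<close>

lemma inverse_decay: "inverse (decay v) = (\<Prod>b\<in>Basis. 1 + (v \<bullet> b)\<^sup>2)"
  by (simp add: decay_def prod_inversef[symmetric])

lemma real_polynomial_function_prod:
  assumes "finite I" "\<And>i. i \<in> I \<Longrightarrow> real_polynomial_function (f i)"
  shows "real_polynomial_function (\<lambda>x. \<Prod>i\<in>I. f i x)"
  using assms by (induction I rule: finite_induct) (auto intro: real_polynomial_function.intros)

lemma real_polynomial_function_inverse_decay: "real_polynomial_function (\<lambda>v. (inverse (decay v))\<^sup>2)"
  unfolding inverse_decay
proof (intro real_polynomial_function_power real_polynomial_function_prod finite_Basis)
  fix b :: 'a
  have "real_polynomial_function (\<lambda>v. v \<bullet> b)"
    by (intro real_polynomial_function.intros(1) bounded_linear_inner_left)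
  then show "real_polynomial_function (\<lambda>v. 1 + (v \<bullet> b)\<^sup>2)"
    by (intro real_polynomial_function.intros(2,3) real_polynomial_function_power)
qed

lemma symb_cong:
  assumes "symb k I W H" and eq: "\<And>i z. i \<in> I \<Longrightarrow> H i z = H' i z"
  shows "symb k I W H'"
proof -
  have eq': "H i = H' i" if "i \<in> I" for i using eq[OF that] by (simp add: fun_eq_iff)
  have dom: "dominated I W H'"
    using symb_dominated[OF assms(1)] eq' unfolding dominated_def by metis
  show ?thesis
  proof (cases k)
    case (Suc j)
    show ?thesis
      unfolding Suc
    proof (rule symb_SucI[OF dom])
      fix b :: 'b assume "b \<in> Basis"
      from symb_SucD[OF assms(1)[unfolded Suc] this] obtain K where K: "dir_deriv I b H K" "symb j I W K" by auto
      have "dir_deriv I b H' K" using K(1) eq' unfolding dir_deriv_def by metis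
      with K(2) show "\<exists>K. dir_deriv I b H' K \<and> symb j I W K" by blast
    qed
  qed (simp add: dom)
qed

text \<open>The family \<open>\<L>\<close> is invariant up to enlargement. For compact sets this holds because the flow is the
  identity outside a compact set; it makes all orbits of smooth vectors bounded.\<close>

locale flow_system = sup_system S X \<Phi> \<L> for S :: "('n, 'd::finite) fun_system" and X \<Phi> \<L> +
  assumes flow_closed: "\<And>n v. n \<in> topspace X \<Longrightarrow> \<Phi> v n \<in> topspace X"
    and flow_0: "\<And>n. n \<in> topspace X \<Longrightarrow> \<Phi> 0 n = n"
    and flow_add: "\<And>n v w. n \<in> topspace X \<Longrightarrow> \<Phi> (v + w) n = \<Phi> v (\<Phi> w n)"
    and flow_family: "\<And>L. L \<in> \<L> \<Longrightarrow> \<exists>L'\<in>\<L>. \<forall>v. \<Phi> v ` L \<subseteq> L'"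
begin

text \<open>A pointwise form of smoothness, sufficient for all estimates. It does not refer to
  the topology of the function algebra, and it is stable under subtraction.\<close>

definition wsmooth :: "('n \<Rightarrow> complex) \<Rightarrow> bool" where
  "wsmooth a \<longleftrightarrow> (\<exists>D. D [] = (\<lambda>v. act S v a) \<and> (\<forall>vs v. D vs v \<in> carr S) \<and>
     (\<forall>n\<in>topspace X. smooth_derivs (\<lambda>v. act S v a n) (\<lambda>vs v. D vs v n)))"

lemma smooth_part_wsmooth:
  assumes "a \<in> smooth_part S"
  shows "wsmooth a"
proof -
  obtain D where D: "is_derivs (alg_top S) UNIV (\<lambda>v. act S v a) D"
    using assms by (auto simp: smooth_part_def smooth_vectors_def smooth_into_def)
  then have "D [] = (\<lambda>v. act S v a)" by (simp add: is_derivs_def)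
  then show ?thesis
    unfolding wsmooth_def using is_derivs_pointwise[OF D] is_derivs_carr[OF D] by blast
qed

lemma act_diff: "act S v (a - b) = act S v a - act S v b"
  by (simp add: fun_eq_iff act_apply)

lemma wsmooth_diff:
  assumes "wsmooth a" "wsmooth b"
  shows "wsmooth (a - b)"
proof -
  obtain D where D: "D [] = (\<lambda>v. act S v a)" "\<And>vs v. D vs v \<in> carr S"
     "\<And>n. n \<in> topspace X \<Longrightarrow> smooth_derivs (\<lambda>v. act S v a n) (\<lambda>vs v. D vs v n)"
    using assms(1) unfolding wsmooth_def by metis
  obtain E where E: "E [] = (\<lambda>v. act S v b)" "\<And>vs v. E vs v \<in> carr S"
     "\<And>n. n \<in> topspace X \<Longrightarrow> smooth_derivs (\<lambda>v. act S v b n) (\<lambda>vs v. E vs v n)"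
    using assms(2) unfolding wsmooth_def by metis
  have "smooth_derivs (\<lambda>v. act S v (a - b) n) (\<lambda>vs v. (D vs v - E vs v) n)" if "n \<in> topspace X" for n
    using D(3)[OF that] E(3)[OF that] unfolding smooth_derivs_def
    by (auto simp: act_diff D(1) E(1) intro!: continuous_intros has_vector_derivative_diff)
  then show ?thesis
    unfolding wsmooth_def using D E
    by (intro exI[of _ "\<lambda>vs v. D vs v - E vs v"]) (simp add: act_diff fun_eq_iff carr_diff)
qed

text \<open>The function \<open>v \<mapsto> act S v a n\<close> at \<open>v + w\<close> is the one of the point \<open>\<Phi> w n\<close> at \<open>v\<close>. So
  derivatives at every \<open>v\<close> are derivatives at \<open>0\<close> for another point, and bounds over a set of
  points give bounds uniform in \<open>v\<close>.\<close>

lemma derivs_along_orbit: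
  assumes D: "\<And>n. n \<in> topspace X \<Longrightarrow> smooth_derivs (\<lambda>v. act S v a n) (\<lambda>vs v. D vs v n)"
    and n: "n \<in> topspace X"
  shows "D vs v n = D vs 0 (\<Phi> v n)"
  using n
proof (induction vs arbitrary: v n)
  case Nil
  have "D [] v n = act S v a n" if "n \<in> topspace X" for v n
    using D[OF that] by (simp add: smooth_derivs_def fun_eq_iff)
  then show ?case using Nil flow_0 flow_closed by (simp add: act_apply)
next
  case (Cons u vs)
  have der: "((\<lambda>t. D vs (x + t *\<^sub>R u) m) has_vector_derivative D (u # vs) x m) (at 0)" if "m \<in> topspace X" for x m
    using D[OF that] by (simp add: smooth_derivs_def)
  have "D vs (v + t *\<^sub>R u) n = D vs (0 + t *\<^sub>R u) (\<Phi> v n)" for t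
  proof -
    have "D vs (v + t *\<^sub>R u) n = D vs 0 (\<Phi> (t *\<^sub>R u + v) n)" using Cons by (simp add: add.commute)
    also have "\<dots> = D vs 0 (\<Phi> (t *\<^sub>R u) (\<Phi> v n))" using Cons.prems by (simp add: flow_add)
    also have "\<dots> = D vs (t *\<^sub>R u) (\<Phi> v n)" using Cons flow_closed by metis
    finally show ?thesis by simp
  qed
  then have "((\<lambda>t. D vs (v + t *\<^sub>R u) n) has_vector_derivative D (u # vs) 0 (\<Phi> v n)) (at 0)"
    using der[OF flow_closed[OF Cons.prems, of v], of 0] by simp
  with der[OF Cons.prems, of v] show ?case by (rule vector_derivative_unique_at)
qed

lemma wsmooth_bounds:
  assumes "wsmooth a"
  shows "\<exists>D. (\<forall>n\<in>topspace X. smooth_derivs (\<lambda>v. act S v a n) (\<lambda>vs v. D vs v n)) \<and>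
    (\<forall>L\<in>\<L>. \<forall>vs. \<exists>C. \<forall>n\<in>L. \<forall>v. cmod (D vs v n) \<le> C * 1)"
proof -
  obtain D where D: "\<And>vs v. D vs v \<in> carr S"
     "\<And>n. n \<in> topspace X \<Longrightarrow> smooth_derivs (\<lambda>v. act S v a n) (\<lambda>vs v. D vs v n)"
    using assms(1) unfolding wsmooth_def by metis
  have "\<exists>C. \<forall>n\<in>L. \<forall>v. cmod (D vs v n) \<le> C * 1" if L: "L \<in> \<L>" for L vs
  proof -
    obtain L' where L': "L' \<in> \<L>" "\<And>v. \<Phi> v ` L \<subseteq> L'" using flow_family[OF L] by blast
    have b: "bounded (D vs 0 ` L')" by (rule family_bounded[OF L'(1) D(1)])
    have "cmod (D vs v n) \<le> sup_seminorm L' (D vs 0)" if "n \<in> L" for n v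
    proof -
      have "D vs v n = D vs 0 (\<Phi> v n)" by (rule derivs_along_orbit[OF D(2)]) (use family_sub[OF L] that in auto)
      moreover have "\<Phi> v n \<in> L'" using L'(2)[of v] that by blast
      ultimately show ?thesis using sup_seminorm_upper[OF b] by simp
    qed
    then show ?thesis by (intro exI[of _ "sup_seminorm L' (D vs 0)"]) simp
  qed
  with D(2) show ?thesis by (intro exI[of _ D]) blast
qed

lemma schwartz_bounds:
  assumes "g \<in> schwartz S"
  shows "\<exists>D. (\<forall>n\<in>topspace X. smooth_derivs (\<lambda>v. g v n) (\<lambda>vs v. D vs v n)) \<and>
    (\<forall>L\<in>\<L>. \<forall>vs. \<exists>C. \<forall>n\<in>L. \<forall>v. cmod (D vs v n) \<le> C * (decay v)\<^sup>2)"
proof -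
  have "\<exists>D. is_derivs (alg_top S) UNIV g D \<and>
       (\<forall>vs P. real_polynomial_function P \<longrightarrow> (\<forall>p\<in>snorms S. bounded (range (\<lambda>v. p (P v *\<^sub>R D vs v)))))"
    using assms unfolding schwartz_def by (simp_all only: mem_Collect_eq)
  then obtain D where D: "is_derivs (alg_top S) UNIV g D"
    and bd: "\<forall>vs P. real_polynomial_function P \<longrightarrow> (\<forall>p\<in>snorms S. bounded (range (\<lambda>v. p (P v *\<^sub>R D vs v))))"
    by (elim exE conjE)
  have "\<exists>C. \<forall>n\<in>L. \<forall>v. cmod (D vs v n) \<le> C * (decay v)\<^sup>2" if L: "L \<in> \<L>" for L vs
  proof -
    let ?P = "\<lambda>v::real^'d. (inverse (decay v))\<^sup>2"
    have "bounded (range (\<lambda>v. sup_seminorm L (?P v *\<^sub>R D vs v)))"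
      by (rule bd[rule_format, OF real_polynomial_function_inverse_decay]) (use L in \<open>simp add: snorms_eq\<close>)
    then obtain C where C: "\<And>v. \<bar>sup_seminorm L (?P v *\<^sub>R D vs v)\<bar> \<le> C" by (auto simp: bounded_iff)
    have "cmod (D vs v n) \<le> C * (decay v)\<^sup>2" if n: "n \<in> L" for n v
    proof -
      have "bounded ((?P v *\<^sub>R D vs v) ` L)"
        by (intro family_bounded[OF L] carr_scaleR is_derivs_carr[OF D])
      from sup_seminorm_upper[OF this n]
      have "?P v * cmod (D vs v n) \<le> C" using C[of v] by simp
      then have "(decay v)\<^sup>2 * (?P v * cmod (D vs v n)) \<le> (decay v)\<^sup>2 * C" by (rule mult_left_mono) simp
      moreover have "(decay v)\<^sup>2 * (?P v * cmod (D vs v n)) = cmod (D vs v n)"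
        using decay_pos[of v] by (simp add: power_inverse)
      ultimately show ?thesis by (simp only: mult.commute[of C])
    qed
    then show ?thesis by blast
  qed
  with is_derivs_pointwise[OF D] show ?thesis by (intro exI[of _ D]) blast
qed

lemma Cu_star_eq_osc:
  "Cu_star \<Lambda> \<phi> \<Theta> F g x n = osc \<Lambda> \<phi> (\<lambda>z. F (x + \<Theta> *v fst z) n * g (x + snd z) n)" for F g :: "real^'d \<Rightarrow> 'n \<Rightarrow> complex"
  by (simp add: Cu_star_def osc_integral_eq_osc case_prod_unfold)

text \<open>The function \<open>g\<close> is bounded by \<open>(decay (x + v))\<^sup>2\<close>, and integration against \<open>decay (u, v)\<close>
  leaves \<open>decay x\<close>, because \<open>decay (x + v) decay v\<close> is at most a constant times \<open>decay x\<close>; the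
  second factor \<open>decay (x + v)\<close> keeps the integral finite. The continuity
  statements are instances of \<open>osc_tendsto\<close>.\<close>

lemma twisted_estimates:
  assumes part: "lattice_partition \<Lambda> \<phi>" and a: "wsmooth a" and g: "g \<in> schwartz S" and L: "L \<in> \<L>"
  shows "\<exists>C\<ge>0. \<forall>n\<in>L. \<forall>x. cmod (Cu_star \<Lambda> \<phi> \<Theta> (\<lambda>v. act S v a) g x n) \<le> C * decay x"
    and "(\<And>k::nat. nn k \<in> L) \<Longrightarrow> m \<in> L \<Longrightarrow> (\<And>v. (\<lambda>k. act S v a (nn k)) \<longlonglongrightarrow> act S v a m) \<Longrightarrow>
       (\<And>v. (\<lambda>k. g v (nn k)) \<longlonglongrightarrow> g v m) \<Longrightarrow>
       (\<lambda>k. Cu_star \<Lambda> \<phi> \<Theta> (\<lambda>v. act S v a) g x (nn k)) \<longlonglongrightarrow> Cu_star \<Lambda> \<phi> \<Theta> (\<lambda>v. act S v a) g x m"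
    and "n \<in> L \<Longrightarrow> continuous_on UNIV (\<lambda>x. Cu_star \<Lambda> \<phi> \<Theta> (\<lambda>v. act S v a) g x n)"
proof -
  obtain D where D: "\<And>n. n \<in> topspace X \<Longrightarrow> smooth_derivs (\<lambda>v. act S v a n) (\<lambda>vs v. D vs v n)"
    "\<forall>L\<in>\<L>. \<forall>vs. \<exists>C. \<forall>n\<in>L. \<forall>v. cmod (D vs v n) \<le> C * 1"
    using wsmooth_bounds[OF a] by blast
  obtain E where E: "\<And>n. n \<in> topspace X \<Longrightarrow> smooth_derivs (\<lambda>v. g v n) (\<lambda>vs v. E vs v n)"
    "\<forall>L\<in>\<L>. \<forall>vs. \<exists>C. \<forall>n\<in>L. \<forall>v. cmod (E vs v n) \<le> C * (decay v)\<^sup>2"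
    using schwartz_bounds[OF g] by blast
  have top: "n \<in> topspace X" if "n \<in> L" for n using family_sub[OF L] that by blast
  have D0: "D [] v n = act S v a n" and E0: "E [] v n = g v n" if "n \<in> L" for v n
    using D(1)[OF top[OF that]] E(1)[OF top[OF that]] by (auto simp: smooth_derivs_def fun_eq_iff)
  let ?I = "(UNIV :: (real^'d) set) \<times> L"
  let ?H = "\<lambda>i z. act S (fst i + \<Theta> *v fst z) a (snd i) * g (fst i + snd z) (snd i)"
  let ?W = "\<lambda>i (z :: (real^'d) \<times> (real^'d)). (decay (fst i + snd z))\<^sup>2"
  have lin: "linear (\<lambda>z :: (real^'d) \<times> (real^'d). \<Theta> *v fst z)" "linear (\<lambda>z :: (real^'d) \<times> (real^'d). snd z)"
    by (auto intro!: linearI simp: matrix_vector_right_distrib matrix_vector_mult_scaleR)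
  have s1: "symb k ?I (\<lambda>i z. 1) (\<lambda>i (z :: (real^'d) \<times> (real^'d)). D [] (fst i + \<Theta> *v fst z) (snd i))" for k
    by (rule symb_smooth_derivs[OF lin(1), where L = L and x = fst and nn = snd and W = "\<lambda>_. 1" and D = "\<lambda>n vs v. D vs v n"
          and F = "\<lambda>n v. act S v a n"])
       (use D(1) D(2) L top in auto)
  have s2: "symb k ?I ?W (\<lambda>i z. E [] (fst i + snd z) (snd i))" for k
    by (rule symb_smooth_derivs[OF lin(2), where L = L and x = fst and nn = snd and W = "\<lambda>v. (decay v)\<^sup>2" and D = "\<lambda>n vs v. E vs v n"
          and F = "\<lambda>n v. g v n"])
       (use E(1) E(2) L top in auto)
  have sy: "symb k ?I ?W ?H" for k
  proof (rule symb_cong)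
    show "symb k ?I ?W (\<lambda>i z. D [] (fst i + \<Theta> *v fst z) (snd i) * E [] (fst i + snd z) (snd i))"
      using symb_mult[OF s1[of k] s2[of k]] by simp
  qed (use D0 E0 in auto)
  have W: "0 \<le> ?W i z" "?W i z \<le> 1" for i z by (simp_all add: power_le_one decay_le_1)
  have Wc: "continuous_on UNIV (?W i)" for i by (intro continuous_intros)
  obtain B where B: "B summable_on \<Lambda>"
    "\<And>i w. i \<in> ?I \<Longrightarrow> w \<in> \<Lambda> \<Longrightarrow> cmod (LINT z|lborel. ?H i z * of_real (\<phi> (z - w)) * osc_kernel z) \<le> B w"
    using osc_estimate(1)[OF part sy W Wc] by blast
  obtain C where C: "C \<ge> 0" "\<And>i. i \<in> ?I \<Longrightarrow> cmod (osc \<Lambda> \<phi> (?H i)) \<le> C * (LINT z|lborel. ?W i z * decay z)"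
    using osc_estimate(2)[OF part sy W Wc] by blast
  obtain K where K: "K \<ge> 0" "\<And>i. i \<in> ?I \<Longrightarrow> continuous_on UNIV (?H i)" "\<And>i z. i \<in> ?I \<Longrightarrow> cmod (?H i z) \<le> K * ?W i z"
    using symb_dominated[OF sy] unfolding dominated_def by blast
  have Kb: "cmod (?H i z) \<le> K" if "i \<in> ?I" for i z
    using K(3)[OF that, of z] mult_left_mono[OF W(2) K(1), of i z] by linarith
  let ?J = "LINT z|lborel. decay (z :: (real^'d) \<times> (real^'d))"
  have int: "(LINT z|lborel. (decay (x + snd z))\<^sup>2 * decay (z :: (real^'d) \<times> (real^'d))) \<le> 2 ^ CARD('d) * decay x * ?J" for x :: "real^'d"
  proof -
    have i1: "integrable lborel (\<lambda>z :: (real^'d) \<times> (real^'d). decay ((0, x) + z))"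
      by (rule lborel_integrable_translate[OF integrable_decay])
    have le: "(decay (x + snd z))\<^sup>2 * decay z \<le> 2 ^ CARD('d) * decay x * decay ((0, x) + z)" for z :: "(real^'d) \<times> (real^'d)"
    proof -
      obtain u v where z: "z = (u, v)" by (cases z)
      have "decay (x + v) * decay v * (decay (x + v) * decay u) \<le> 2 ^ CARD('d) * decay x * (decay (x + v) * decay u)"
        using decay_mult_decay_le[of x v] by (intro mult_right_mono) auto
      then show ?thesis by (simp add: z decay_Pair power2_eq_square mult_ac)
    qed
    have "(LINT z|lborel. (decay (x + snd z))\<^sup>2 * decay (z :: (real^'d) \<times> (real^'d))) \<le> (LINT z|lborel. 2 ^ CARD('d) * decay x * decay ((0, x) + (z :: (real^'d) \<times> (real^'d))))"
    proof (rule integral_mono)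
      show i2: "integrable lborel (\<lambda>z :: (real^'d) \<times> (real^'d). 2 ^ CARD('d) * decay x * decay ((0, x) + z))" using i1 by simp
      show "integrable lborel (\<lambda>z. (decay (x + snd z))\<^sup>2 * decay (z :: (real^'d) \<times> (real^'d)))"
        by (rule Bochner_Integration.integrable_bound[OF i2])
           (use le in \<open>auto intro!: borel_measurable_continuous_onI continuous_intros\<close>)
    qed (rule le)
    also have "\<dots> = 2 ^ CARD('d) * decay x * ?J"
      by (simp add: lborel_integral_translate)
    finally show ?thesis .
  qed
  have eq: "Cu_star \<Lambda> \<phi> \<Theta> (\<lambda>v. act S v a) g x n = osc \<Lambda> \<phi> (?H (x, n))" for x n
    by (simp add: Cu_star_eq_osc)
  have "cmod (Cu_star \<Lambda> \<phi> \<Theta> (\<lambda>v. act S v a) g x n) \<le> C * 2 ^ CARD('d) * ?J * decay x" if "n \<in> L" for n x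
  proof -
    have "cmod (osc \<Lambda> \<phi> (?H (x, n))) \<le> C * (LINT z|lborel. ?W (x, n) z * decay z)" by (rule C(2)) (use that in auto)
    also have "\<dots> \<le> C * (2 ^ CARD('d) * decay x * ?J)" using int[of x] C(1) by (intro mult_left_mono) auto
    finally show ?thesis unfolding eq by (simp add: mult_ac)
  qed
  moreover have "0 \<le> C * 2 ^ CARD('d) * ?J"
    using C(1) by (intro mult_nonneg_nonneg integral_nonneg_AE AE_I2) auto
  ultimately show "\<exists>C\<ge>0. \<forall>n\<in>L. \<forall>x. cmod (Cu_star \<Lambda> \<phi> \<Theta> (\<lambda>v. act S v a) g x n) \<le> C * decay x" by blast
  show "(\<lambda>k. Cu_star \<Lambda> \<phi> \<Theta> (\<lambda>v. act S v a) g x (nn k)) \<longlonglongrightarrow> Cu_star \<Lambda> \<phi> \<Theta> (\<lambda>v. act S v a) g x m"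
    if nn: "\<And>k::nat. nn k \<in> L" "m \<in> L" "\<And>v. (\<lambda>k. act S v a (nn k)) \<longlonglongrightarrow> act S v a m"
       "\<And>v. (\<lambda>k. g v (nn k)) \<longlonglongrightarrow> g v m"
    unfolding eq
  proof (rule osc_tendsto[OF part B(1), where C = K])
    show "(\<lambda>k. ?H (x, nn k) z) \<longlonglongrightarrow> ?H (x, m) z" for z
      unfolding fst_conv snd_conv by (intro tendsto_mult nn)
  qed (use nn B(2) K(2) Kb in auto)
  show "continuous_on UNIV (\<lambda>x. Cu_star \<Lambda> \<phi> \<Theta> (\<lambda>v. act S v a) g x n)" if n: "n \<in> L"
  proof (rule continuous_at_imp_continuous_on, rule ballI, rule continuous_at_sequentiallyI)
    fix x :: "real^'d" and u assume u: "u \<longlonglongrightarrow> x"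
    have ca: "continuous_on UNIV (\<lambda>v. act S v a n)" "continuous_on UNIV (\<lambda>v. g v n)"
    proof -
      have "continuous_on UNIV (\<lambda>v. D [] v n)" "continuous_on UNIV (\<lambda>v. E [] v n)"
        using D(1)[OF top[OF n]] E(1)[OF top[OF n]] unfolding smooth_derivs_def by blast+
      then show "continuous_on UNIV (\<lambda>v. act S v a n)" "continuous_on UNIV (\<lambda>v. g v n)"
        unfolding D0[OF n] E0[OF n] .
    qed
    show "(\<lambda>k. Cu_star \<Lambda> \<phi> \<Theta> (\<lambda>v. act S v a) g (u k) n) \<longlonglongrightarrow> Cu_star \<Lambda> \<phi> \<Theta> (\<lambda>v. act S v a) g x n"
      unfolding eq
    proof (rule osc_tendsto[OF part B(1), where C = K])
      show "(\<lambda>k. ?H (u k, n) z) \<longlonglongrightarrow> ?H (x, n) z" for z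
        unfolding fst_conv snd_conv
        by (intro tendsto_mult continuous_on_tendsto_compose[OF ca(1)] continuous_on_tendsto_compose[OF ca(2)]
            tendsto_add u tendsto_const) auto
    qed (use n B(2) K(2) Kb in auto)
  qed
qed

end

lemma module_inner_bound:
  fixes G :: "real^'d \<Rightarrow> 'n \<Rightarrow> complex"
  assumes "C \<ge> 0" "\<And>n x. n \<in> L \<Longrightarrow> cmod (G x n) \<le> C * decay x"
    and "\<And>n. n \<in> L \<Longrightarrow> continuous_on UNIV (\<lambda>x. G x n)"
  shows "\<exists>B. \<forall>n\<in>L. cmod (module_inner G G n) \<le> B"
    and "(\<And>k::nat. nn k \<in> L) \<Longrightarrow> m \<in> L \<Longrightarrow> (\<And>x. (\<lambda>k. G x (nn k)) \<longlonglongrightarrow> G x m) \<Longrightarrow>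
      (\<lambda>k. module_inner G G (nn k)) \<longlonglongrightarrow> module_inner G G m"
proof -
  have int: "integrable lborel (\<lambda>x :: real^'d. C\<^sup>2 * decay x)" by (simp add: integrable_decay)
  have le: "cmod (cnj (G x n) * G x n) \<le> C\<^sup>2 * decay x" if "n \<in> L" for n x
  proof -
    have "cmod (cnj (G x n) * G x n) \<le> (C * decay x) * (C * decay x)"
      unfolding norm_mult complex_mod_cnj using assms(1) assms(2)[OF that, of x] by (intro mult_mono) auto
    also have "\<dots> \<le> C\<^sup>2 * decay x"
      using mult_left_mono[OF decay_le_1, of "C * C * decay x" x] assms(1) by (simp add: power2_eq_square mult_ac)
    finally show ?thesis .
  qed
  have m: "(\<lambda>x. cnj (G x n) * G x n) \<in> borel_measurable borel" if "n \<in> L" for n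
    using assms(3)[OF that] by (intro borel_measurable_continuous_onI continuous_intros)
  have "cmod (module_inner G G n) \<le> (LINT x|lborel. C\<^sup>2 * decay (x :: real^'d))" if "n \<in> L" for n
    unfolding module_inner_def
  proof (rule Bochner_Integration.integral_norm_bound_integral[OF _ int])
    show "integrable lborel (\<lambda>x. cnj (G x n) * G x n)"
      using le[OF that] m[OF that] order_trans[OF _ abs_ge_self]
      by (intro Bochner_Integration.integrable_bound[OF int] AE_I2) (auto simp: abs_mult)
  qed (rule le[OF that])
  then show "\<exists>B. \<forall>n\<in>L. cmod (module_inner G G n) \<le> B" by blast
  show "(\<lambda>k. module_inner G G (nn k)) \<longlonglongrightarrow> module_inner G G m"
    if "\<And>k::nat. nn k \<in> L" "m \<in> L" "\<And>x. (\<lambda>k. G x (nn k)) \<longlonglongrightarrow> G x m"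
    unfolding module_inner_def
    by (rule integral_dominated_convergence[OF _ _ int])
       (use that le m in \<open>auto intro!: AE_I2 tendsto_intros\<close>)
qed

context flow_system
begin

lemma schwartz_decay:
  assumes "g \<in> schwartz S" "L \<in> \<L>"
  shows "\<exists>C\<ge>0. \<forall>n\<in>L. \<forall>x. cmod (g x n) \<le> C * decay x"
    and "n \<in> topspace X \<Longrightarrow> continuous_on UNIV (\<lambda>x. g x n)"
proof -
  obtain E where E: "\<And>n. n \<in> topspace X \<Longrightarrow> smooth_derivs (\<lambda>v. g v n) (\<lambda>vs v. E vs v n)"
    "\<forall>L\<in>\<L>. \<forall>vs. \<exists>C. \<forall>n\<in>L. \<forall>v. cmod (E vs v n) \<le> C * (decay v)\<^sup>2"
    using schwartz_bounds[OF assms(1)] by blast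
  have E0: "(\<lambda>v. E [] v n) = (\<lambda>v. g v n)" if "n \<in> topspace X" for n
    using E(1)[OF that] by (auto simp: smooth_derivs_def)
  show "continuous_on UNIV (\<lambda>x. g x n)" if "n \<in> topspace X" for n
    using E(1)[OF that] unfolding E0[OF that, symmetric] smooth_derivs_def by blast
  obtain C where C: "\<forall>n\<in>L. \<forall>v. cmod (E [] v n) \<le> C * (decay v)\<^sup>2"
    using spec[OF bspec[OF E(2) assms(2)], of "[]"] by (elim exE)
  have "cmod (g v n) \<le> \<bar>C\<bar> * decay v" if "n \<in> L" for n v
  proof -
    have "cmod (g v n) \<le> C * (decay v)\<^sup>2"
      using bspec[OF C that] fun_cong[OF E0[of n], of v] family_sub[OF assms(2)] that by (metis subsetD)
    also have "\<dots> \<le> \<bar>C\<bar> * decay v"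
      using decay_le_1[of v] by (intro mult_mono) (auto simp: power2_eq_square mult_left_le)
    finally show ?thesis .
  qed
  then show "\<exists>C\<ge>0. \<forall>n\<in>L. \<forall>x. cmod (g x n) \<le> C * decay x" by (intro exI[of _ "\<bar>C\<bar>"]) auto
qed

lemma module_inner_bounded:
  assumes "lattice_partition \<Lambda> \<phi>" "wsmooth a" "g \<in> schwartz S" "L \<in> \<L>"
  shows "\<exists>B. \<forall>n\<in>L. cmod (module_inner g g n) \<le> B"
    and "\<exists>B. \<forall>n\<in>L. cmod (module_inner (Cu_star \<Lambda> \<phi> \<Theta> (\<lambda>v. act S v a) g) (Cu_star \<Lambda> \<phi> \<Theta> (\<lambda>v. act S v a) g) n) \<le> B"
proof -
  obtain C where C: "C \<ge> 0" "\<And>n x. n \<in> L \<Longrightarrow> cmod (g x n) \<le> C * decay x" using schwartz_decay(1)[OF assms(3,4)] by blast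
  show "\<exists>B. \<forall>n\<in>L. cmod (module_inner g g n) \<le> B"
    by (rule module_inner_bound(1)[OF C]) (use schwartz_decay(2)[OF assms(3,4)] family_sub[OF assms(4)] in auto)
  obtain C where C: "C \<ge> 0" "\<And>n x. n \<in> L \<Longrightarrow> cmod (Cu_star \<Lambda> \<phi> \<Theta> (\<lambda>v. act S v a) g x n) \<le> C * decay x"
    using twisted_estimates(1)[OF assms] by blast
  show "\<exists>B. \<forall>n\<in>L. cmod (module_inner (Cu_star \<Lambda> \<phi> \<Theta> (\<lambda>v. act S v a) g) (Cu_star \<Lambda> \<phi> \<Theta> (\<lambda>v. act S v a) g) n) \<le> B"
    by (rule module_inner_bound(1)[OF C twisted_estimates(3)[OF assms]])
qed

lemma module_inner_tendsto:
  assumes "lattice_partition \<Lambda> \<phi>" "wsmooth a" "g \<in> schwartz S" "L \<in> \<L>"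
    and "\<And>k::nat. nn k \<in> L" "m \<in> L" and lim: "\<And>f. f \<in> carr S \<Longrightarrow> (\<lambda>k. f (nn k)) \<longlonglongrightarrow> f m"
  shows "(\<lambda>k. module_inner g g (nn k)) \<longlonglongrightarrow> module_inner g g m"
    and "(\<lambda>k. module_inner (Cu_star \<Lambda> \<phi> \<Theta> (\<lambda>v. act S v a) g) (Cu_star \<Lambda> \<phi> \<Theta> (\<lambda>v. act S v a) g) (nn k))
      \<longlonglongrightarrow> module_inner (Cu_star \<Lambda> \<phi> \<Theta> (\<lambda>v. act S v a) g) (Cu_star \<Lambda> \<phi> \<Theta> (\<lambda>v. act S v a) g) m"
proof -
  have g: "g v \<in> carr S" for v
    using assms(3) by (auto simp: schwartz_def smooth_vectors_def Cu_top_def Cu_def)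
  have a: "act S v a \<in> carr S" for v using assms(2) unfolding wsmooth_def by metis
  obtain C where C: "C \<ge> 0" "\<And>n x. n \<in> L \<Longrightarrow> cmod (g x n) \<le> C * decay x" using schwartz_decay(1)[OF assms(3,4)] by blast
  show "(\<lambda>k. module_inner g g (nn k)) \<longlonglongrightarrow> module_inner g g m"
    by (rule module_inner_bound(2)[OF C])
       (use schwartz_decay(2)[OF assms(3,4)] family_sub[OF assms(4)] assms(5,6) lim[OF g] in auto)
  obtain C where C: "C \<ge> 0" "\<And>n x. n \<in> L \<Longrightarrow> cmod (Cu_star \<Lambda> \<phi> \<Theta> (\<lambda>v. act S v a) g x n) \<le> C * decay x"
    using twisted_estimates(1)[OF assms(1-4)] by blast
  show "(\<lambda>k. module_inner (Cu_star \<Lambda> \<phi> \<Theta> (\<lambda>v. act S v a) g) (Cu_star \<Lambda> \<phi> \<Theta> (\<lambda>v. act S v a) g) (nn k))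
      \<longlonglongrightarrow> module_inner (Cu_star \<Lambda> \<phi> \<Theta> (\<lambda>v. act S v a) g) (Cu_star \<Lambda> \<phi> \<Theta> (\<lambda>v. act S v a) g) m"
    by (rule module_inner_bound(2)[OF C twisted_estimates(3)[OF assms(1-4)] assms(5,6)])
       (assumption | rule twisted_estimates(2)[OF assms(1-6) lim[OF a] lim[OF g]])+
qed

end

section \<open>Homomorphisms of deformed algebras\<close>

lemma Cu_star_osc:
  "Cu_star \<Lambda> \<phi> \<Theta> F g x n = osc \<Lambda> \<phi> (\<lambda>z. F (x + \<Theta> *v fst z) n * g (x + snd z) n)"
  by (simp add: Cu_star_def osc_integral_eq_osc case_prod_unfold)

lemma star_osc:
  "star \<Lambda> \<phi> \<Theta> S a b n = osc \<Lambda> \<phi> (\<lambda>z. act S (\<Theta> *v fst z) a n * act S (snd z) b n)"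
  by (simp add: star_def osc_integral_eq_osc case_prod_unfold)

lemma osc_zero [simp]: "osc \<Lambda> \<phi> (\<lambda>z. 0) = 0"
  by (simp add: osc_def)

text \<open>The point \<open>n\<close> is the same on both sides of the product, so a weight on \<open>g\<close> can be pulled out of the oscillatory integral.\<close>

lemma Cu_star_wco:
  fixes F' :: "real^'d \<Rightarrow> 'm \<Rightarrow> complex" and F :: "real^'d \<Rightarrow> 'n \<Rightarrow> complex"
  assumes "\<And>n v. \<eta> n \<noteq> 0 \<Longrightarrow> F' v n = F v (\<kappa> n)"
  shows "Cu_star \<Lambda> \<phi> \<Theta> F' (\<lambda>v. wco \<eta> \<kappa> (g v)) = (\<lambda>x. wco \<eta> \<kappa> (Cu_star \<Lambda> \<phi> \<Theta> F g x))"
proof (intro ext)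
  fix x n
  show "Cu_star \<Lambda> \<phi> \<Theta> F' (\<lambda>v. wco \<eta> \<kappa> (g v)) x n = wco \<eta> \<kappa> (Cu_star \<Lambda> \<phi> \<Theta> F g x) n"
  proof (cases "\<eta> n = 0")
    case True
    then show ?thesis by (simp add: Cu_star_osc wco_def)
  next
    case False
    have eq: "(\<lambda>z. F' (x + \<Theta> *v fst z) n * wco \<eta> \<kappa> (g (x + snd z)) n) =
        (\<lambda>z. \<eta> n * (F (x + \<Theta> *v fst z) (\<kappa> n) * g (x + snd z) (\<kappa> n)))"
      by (simp add: fun_eq_iff assms[OF False] wco_def)
    show ?thesis unfolding Cu_star_osc eq osc_cmult by (simp add: wco_def Cu_star_osc)
  qed
qed

lemma module_inner_wco:
  "module_inner (\<lambda>v. wco \<eta> \<kappa> (G v)) (\<lambda>v. wco \<eta> \<kappa> (G v)) = wco (\<lambda>n. cnj (\<eta> n) * \<eta> n) \<kappa> (module_inner G G)"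
proof
  fix n
  have eq: "(\<lambda>v. cnj (\<eta> n * G v (\<kappa> n)) * (\<eta> n * G v (\<kappa> n))) =
      (\<lambda>v. (cnj (\<eta> n) * \<eta> n) * (cnj (G v (\<kappa> n)) * G v (\<kappa> n)))"
    by (simp add: fun_eq_iff)
  show "module_inner (\<lambda>v. wco \<eta> \<kappa> (G v)) (\<lambda>v. wco \<eta> \<kappa> (G v)) n = wco (\<lambda>n. cnj (\<eta> n) * \<eta> n) \<kappa> (module_inner G G) n"
    unfolding module_inner_def wco_def eq by (simp only: integral_mult_right_zero)
qed

lemma deformed_norm_leI:
  assumes "\<And>g. g \<in> schwartz S' \<Longrightarrow> module_norm q' g \<le> 1 \<Longrightarrow>
     ereal (module_norm q' (Cu_star \<Lambda> \<phi> \<Theta> (\<lambda>v. act S' v a') g)) \<le> r"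
  shows "deformed_norm \<Lambda> \<phi> \<Theta> S' q' a' \<le> r"
  unfolding deformed_norm_def by (rule SUP_least) (use assms in blast)

lemma deformed_norm_upper:
  assumes "g \<in> schwartz S" "module_norm q g \<le> 1"
  shows "ereal (module_norm q (Cu_star \<Lambda> \<phi> \<Theta> (\<lambda>v. act S v a) g)) \<le> deformed_norm \<Lambda> \<phi> \<Theta> S q a"
  unfolding deformed_norm_def by (rule SUP_upper) (use assms in blast)

text \<open>A weight with \<open>\<eta>\<^sup>2 = \<eta>\<close> is multiplicative. The last hypothesis is the domination of
  each seminorm of the target by one of the source, on differences of smooth vectors.\<close>

lemma wco_continuous_star_hom:
  fixes S :: "('n, 'd::finite) fun_system" and S' :: "('m, 'd) fun_system"
  assumes mor: "wco_morphism S X \<Phi> \<L> S' X' \<Phi>' \<L>' \<eta> \<kappa>"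
    and idem: "\<And>y. \<eta> y = 0 \<or> \<eta> y = 1"
    and inter: "\<And>v f. f \<in> carr S \<Longrightarrow> act S' v (wco \<eta> \<kappa> f) = wco \<eta> \<kappa> (act S v f)"
    and dom: "\<And>q'. q' \<in> qnorms S' \<Longrightarrow> \<exists>q\<in>qnorms S. \<forall>f\<in>smooth_part S. \<forall>g\<in>smooth_part S.
      deformed_norm \<Lambda> \<phi> \<Theta> S' q' (wco \<eta> \<kappa> (g - f)) \<le> deformed_norm \<Lambda> \<phi> \<Theta> S q (g - f)"
  shows "continuous_star_hom \<Lambda> \<phi> \<Theta> S S' (wco \<eta> \<kappa>)"
proof -
  interpret wco_morphism S X \<Phi> \<L> S' X' \<Phi>' \<L>' \<eta> \<kappa> by (rule mor)
  have sm: "wco \<eta> \<kappa> a \<in> smooth_part S'" if "a \<in> smooth_part S" for a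
    by (rule wco_smooth_part[OF inter that])
  have carr: "a \<in> carr S" if "a \<in> smooth_part S" for a
    using that by (simp add: smooth_part_def smooth_vectors_def)
  have "wco \<eta> \<kappa> (star \<Lambda> \<phi> \<Theta> S a b) = star \<Lambda> \<phi> \<Theta> S' (wco \<eta> \<kappa> a) (wco \<eta> \<kappa> b)"
    if a: "a \<in> smooth_part S" and b: "b \<in> smooth_part S" for a b
  proof
    fix y
    have "star \<Lambda> \<phi> \<Theta> S' (wco \<eta> \<kappa> a) (wco \<eta> \<kappa> b) y =
        osc \<Lambda> \<phi> (\<lambda>z. \<eta> y * (act S (\<Theta> *v fst z) a (\<kappa> y) * act S (snd z) b (\<kappa> y)))"
      unfolding star_osc inter[OF carr[OF a]] inter[OF carr[OF b]]
      using idem[of y] by (auto simp: wco_def)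
    also have "\<dots> = wco \<eta> \<kappa> (star \<Lambda> \<phi> \<Theta> S a b) y"
      unfolding osc_cmult wco_def star_osc by (rule refl)
    finally show "wco \<eta> \<kappa> (star \<Lambda> \<phi> \<Theta> S a b) y = star \<Lambda> \<phi> \<Theta> S' (wco \<eta> \<kappa> a) (wco \<eta> \<kappa> b) y" ..
  qed
  moreover have "cnj (\<eta> y) = \<eta> y" for y using idem[of y] by auto
  ultimately have "star_hom \<Lambda> \<phi> \<Theta> S S' (wco \<eta> \<kappa>)"
    unfolding star_hom_def using sm by (auto simp: wco_def fun_eq_iff algebra_simps)
  moreover have "continuous_map (deformed_top \<Lambda> \<phi> \<Theta> S) (deformed_top \<Lambda> \<phi> \<Theta> S') (wco \<eta> \<kappa>)"
    unfolding deformed_top_def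
  proof (rule continuous_map_seminorm_top[OF sm])
    fix p' assume "p' \<in> deformed_norm \<Lambda> \<phi> \<Theta> S' ` qnorms S'"
    then obtain q' where q': "q' \<in> qnorms S'" "p' = deformed_norm \<Lambda> \<phi> \<Theta> S' q'" by blast
    from dom[OF q'(1)] obtain q where q: "q \<in> qnorms S" "\<forall>f\<in>smooth_part S. \<forall>g\<in>smooth_part S.
      deformed_norm \<Lambda> \<phi> \<Theta> S' q' (wco \<eta> \<kappa> (g - f)) \<le> deformed_norm \<Lambda> \<phi> \<Theta> S q (g - f)" by blast
    show "\<exists>p\<in>deformed_norm \<Lambda> \<phi> \<Theta> S ` qnorms S. \<forall>f\<in>smooth_part S. \<forall>g\<in>smooth_part S.
        p' (wco \<eta> \<kappa> g - wco \<eta> \<kappa> f) \<le> p (g - f)"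
      using q unfolding q'(2) wco_diff by (intro bexI[of _ "deformed_norm \<Lambda> \<phi> \<Theta> S q"]) auto
  qed
  ultimately show ?thesis by (simp add: continuous_star_hom_def)
qed

text \<open>Schwartz functions for \<open>S'\<close> are carried to Schwartz functions for \<open>S\<close> with the same module norms, also after multiplication by \<open>\<phi>(a)\<close>; so the supremum for \<open>S\<close> is over more values.\<close>

lemma deformed_norm_transport:
  fixes S :: "('n, 'd::finite) fun_system" and S' :: "('m, 'd) fun_system"
  assumes mor: "wco_morphism S' X' \<Phi>' \<L>' S X \<Phi> \<L> \<eta> \<kappa>"
    and idem: "\<And>y. \<eta> y = 0 \<or> \<eta> y = 1"
    and agree: "\<And>n v. \<eta> n \<noteq> 0 \<Longrightarrow> act S v a n = act S' v a' (\<kappa> n)"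
    and q: "\<And>h. (\<And>n. n \<notin> topspace X' \<Longrightarrow> h n = 0) \<Longrightarrow> q (wco \<eta> \<kappa> h) = q' h"
  shows "deformed_norm \<Lambda> \<phi> \<Theta> S' q' a' \<le> deformed_norm \<Lambda> \<phi> \<Theta> S q a"
proof (rule deformed_norm_leI)
  interpret wco_morphism S' X' \<Phi>' \<L>' S X \<Phi> \<L> \<eta> \<kappa> by (rule mor)
  fix g assume g: "g \<in> schwartz S'" "module_norm q' g \<le> 1"
  have gc: "g v \<in> carr S'" for v
    using g(1) by (auto simp: schwartz_def smooth_vectors_def Cu_top_def Cu_def)
  have \<eta>2: "(\<lambda>n. cnj (\<eta> n) * \<eta> n) = \<eta>"   proof
    show "cnj (\<eta> n) * \<eta> n = \<eta> n" for n using idem[of n] by auto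
  qed
  let ?g = "\<lambda>v. wco \<eta> \<kappa> (g v)"
  have n1: "module_norm q ?g = module_norm q' g"
    unfolding module_norm_def module_inner_wco \<eta>2
    by (subst q) (auto simp: module_inner_def dom.carr_outside[OF gc])
  have e: "Cu_star \<Lambda> \<phi> \<Theta> (\<lambda>v. act S v a) ?g = (\<lambda>x. wco \<eta> \<kappa> (Cu_star \<Lambda> \<phi> \<Theta> (\<lambda>v. act S' v a') g x))"
    by (rule Cu_star_wco) (rule agree)
  have "module_norm q (Cu_star \<Lambda> \<phi> \<Theta> (\<lambda>v. act S v a) ?g) = module_norm q' (Cu_star \<Lambda> \<phi> \<Theta> (\<lambda>v. act S' v a') g)"
    unfolding e module_norm_def module_inner_wco \<eta>2
    by (subst q) (auto simp: module_inner_def Cu_star_osc dom.carr_outside[OF gc])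
  with n1 show "ereal (module_norm q' (Cu_star \<Lambda> \<phi> \<Theta> (\<lambda>v. act S' v a') g)) \<le> deformed_norm \<Lambda> \<phi> \<Theta> S q a"
    using deformed_norm_upper[OF wco_schwartz[OF g(1)], of q \<Lambda> \<phi> \<Theta> a] g(2) by simp
qed

lemma cstar_seminorm_pullback:
  assumes mor: "wco_morphism (C0 X \<Phi>) X \<Phi> {L. compactin X L} (C0 X' \<Phi>') X' \<Phi>' {L. compactin X' L} \<eta> \<kappa>"
    and idem: "\<And>y. \<eta> y = 0 \<or> \<eta> y = 1" and q': "q' \<in> qnorms (C0 X' \<Phi>')"
  shows "(\<lambda>f. q' (wco \<eta> \<kappa> f)) \<in> qnorms (C0 X \<Phi>)"
proof -
  interpret wco_morphism "C0 X \<Phi>" X \<Phi> "{L. compactin X L}" "C0 X' \<Phi>'" X' \<Phi>' "{L. compactin X' L}" \<eta> \<kappa> by (rule mor)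
  have c: "carr (C0 X \<Phi>) = C0_carrier X" "carr (C0 X' \<Phi>') = C0_carrier X'" by (simp_all add: C0_def)
  have W: "wco \<eta> \<kappa> f \<in> C0_carrier X'" if "f \<in> C0_carrier X" for f using wco_carr that unfolding c by blast
  have q1: "cstar_seminorm (C0_carrier X') q'" and q2: "continuous_map (alg_top (C0 X' \<Phi>')) euclideanreal q'"
    using q' by (auto simp: C0_def alg_top_def)
  have w1: "wco \<eta> \<kappa> (\<lambda>x. c * f x) = (\<lambda>x. c * wco \<eta> \<kappa> f x)" for f c by (simp add: wco_def fun_eq_iff)
  have w2: "wco \<eta> \<kappa> (\<lambda>x. cnj (f x) * f x) = (\<lambda>x. cnj (wco \<eta> \<kappa> f x) * wco \<eta> \<kappa> f x)" for f
  proof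
    show "wco \<eta> \<kappa> (\<lambda>x. cnj (f x) * f x) y = cnj (wco \<eta> \<kappa> f y) * wco \<eta> \<kappa> f y" for y
      using idem[of y] by (auto simp: wco_def)
  qed
  have w3: "wco \<eta> \<kappa> (f + g) = wco \<eta> \<kappa> f + wco \<eta> \<kappa> g" for f g by (simp add: wco_def fun_eq_iff distrib_left)
  have w4: "wco \<eta> \<kappa> (f * g) = wco \<eta> \<kappa> f * wco \<eta> \<kappa> g" for f g
  proof
    show "wco \<eta> \<kappa> (f * g) y = (wco \<eta> \<kappa> f * wco \<eta> \<kappa> g) y" for y
      using idem[of y] by (auto simp: wco_def)
  qed
  have "cstar_seminorm (C0_carrier X) (\<lambda>f. q' (wco \<eta> \<kappa> f))"
    using q1 W unfolding cstar_seminorm_def w1 w2 w3 w4 by simp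
  moreover have "continuous_map (alg_top (C0 X \<Phi>)) euclideanreal (\<lambda>f. q' (wco \<eta> \<kappa> f))"
    using continuous_map_compose[OF continuous_wco q2] by (simp add: o_def)
  ultimately show ?thesis by (simp add: C0_def alg_top_def)
qed

lemma pullback_wco: "pullback N \<kappa> = wco (indicator N) \<kappa>"
  by (auto simp: pullback_def cut_def wco_def fun_eq_iff indicator_def)

lemma C0_carrier_pullback:
  assumes "continuous_map Y' Y \<kappa>" "f \<in> C0_carrier Y"
  shows "wco (indicator (topspace Y')) \<kappa> f \<in> C0_carrier Y'"
proof -
  have "continuous_map Y' euclidean (f \<circ> \<kappa>)"
    using assms by (intro continuous_map_compose[of _ Y]) (auto simp: C0_carrier_def)
  moreover have "wco (indicator (topspace Y')) \<kappa> f x = (f \<circ> \<kappa>) x" if "x \<in> topspace Y'" for x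
    using that by (simp add: wco_def)
  ultimately have "continuous_map Y' euclidean (wco (indicator (topspace Y')) \<kappa> f)"
    by (metis (mono_tags, lifting) continuous_map_eq)
  then show ?thesis by (auto simp: C0_carrier_def wco_def)
qed

lemma pullback_morphism:
  fixes Y :: "'n topology" and Y' :: "'m topology" and \<Phi> :: "real^'d::finite \<Rightarrow> 'n \<Rightarrow> 'n" and \<Phi>' :: "real^'d \<Rightarrow> 'm \<Rightarrow> 'm"
  assumes \<kappa>: "continuous_map Y' Y \<kappa>"
  shows "wco_morphism (C0 Y \<Phi>) Y \<Phi> {L. compactin Y L} (C0 Y' \<Phi>') Y' \<Phi>' {L. compactin Y' L} (indicator (topspace Y')) \<kappa>"
    and "wco_morphism (C0b Y \<Phi>) Y \<Phi> {topspace Y} (C0b Y' \<Phi>') Y' \<Phi>' {topspace Y'} (indicator (topspace Y')) \<kappa>"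
    and "(\<And>K. compactin Y K \<Longrightarrow> \<exists>K'. compactin Y' K' \<and> (\<forall>y\<in>topspace Y' - K'. \<kappa> y \<notin> K)) \<Longrightarrow>
      wco_morphism (C0inf Y \<Phi>) Y \<Phi> {topspace Y} (C0inf Y' \<Phi>') Y' \<Phi>' {topspace Y'} (indicator (topspace Y')) \<kappa>"
proof -
  have im: "\<kappa> y \<in> topspace Y" if "y \<in> topspace Y'" for y using \<kappa> that by (auto simp: continuous_map_def)
  show "wco_morphism (C0 Y \<Phi>) Y \<Phi> {L. compactin Y L} (C0 Y' \<Phi>') Y' \<Phi>' {L. compactin Y' L} (indicator (topspace Y')) \<kappa>"
  proof (intro wco_morphism.intro sup_system_C0 wco_morphism_axioms.intro)
    show "wco (indicator (topspace Y')) \<kappa> f \<in> carr (C0 Y' \<Phi>')" if "f \<in> carr (C0 Y \<Phi>)" for f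
      using that C0_carrier_pullback[OF \<kappa>] by (simp add: C0_def)
    show "\<exists>L\<in>{L. compactin Y L}. \<forall>y\<in>L'. indicator (topspace Y') y \<noteq> (0::complex) \<longrightarrow> \<kappa> y \<in> L"
      if "L' \<in> {L. compactin Y' L}" for L'
      using image_compactin[OF _ \<kappa>, of L'] that by (intro bexI[of _ "\<kappa> ` L'"]) auto
  qed (auto simp: indicator_def)
  show "wco_morphism (C0b Y \<Phi>) Y \<Phi> {topspace Y} (C0b Y' \<Phi>') Y' \<Phi>' {topspace Y'} (indicator (topspace Y')) \<kappa>"
  proof (intro wco_morphism.intro sup_system_C0b wco_morphism_axioms.intro)
    show "wco (indicator (topspace Y')) \<kappa> f \<in> carr (C0b Y' \<Phi>')" if f: "f \<in> carr (C0b Y \<Phi>)" for f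
    proof -
      obtain B where B: "\<And>x. cmod (f x) \<le> B" using f by (auto simp: C0b_def bounded_range_iff)
      have "cmod (wco (indicator (topspace Y')) \<kappa> f y) \<le> B" for y
        using B[of "\<kappa> y"] order_trans[OF norm_ge_zero B[of "\<kappa> y"]] by (simp add: wco_def indicator_def)
      then show ?thesis
        using f C0_carrier_pullback[OF \<kappa>] unfolding C0b_def bounded_range_iff by auto
    qed
  qed (use im in \<open>auto simp: indicator_def\<close>)
  show "wco_morphism (C0inf Y \<Phi>) Y \<Phi> {topspace Y} (C0inf Y' \<Phi>') Y' \<Phi>' {topspace Y'} (indicator (topspace Y')) \<kappa>"
    if proper: "\<And>K. compactin Y K \<Longrightarrow> \<exists>K'. compactin Y' K' \<and> (\<forall>y\<in>topspace Y' - K'. \<kappa> y \<notin> K)"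
  proof (intro wco_morphism.intro sup_system_C0inf wco_morphism_axioms.intro)
    show "wco (indicator (topspace Y')) \<kappa> f \<in> carr (C0inf Y' \<Phi>')" if f: "f \<in> carr (C0inf Y \<Phi>)" for f
    proof -
      have "\<exists>K. compactin Y' K \<and> (\<forall>y\<in>topspace Y' - K. cmod (wco (indicator (topspace Y')) \<kappa> f y) < e)" if e: "e > 0" for e
      proof -
        obtain K where K: "compactin Y K" "\<forall>x\<in>topspace Y - K. cmod (f x) < e"
          using C0inf_vanishing[OF f e] by blast
        obtain K' where K': "compactin Y' K'" "\<forall>y\<in>topspace Y' - K'. \<kappa> y \<notin> K" using proper[OF K(1)] by blast
        have "cmod (wco (indicator (topspace Y')) \<kappa> f y) < e" if "y \<in> topspace Y' - K'" for y
          using that K(2) K'(2) im[of y] by (auto simp: wco_def)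
        with K'(1) show ?thesis by blast
      qed
      then show ?thesis using f C0_carrier_pullback[OF \<kappa>, of f] by (simp add: C0inf_def)
    qed
  qed (use im in \<open>auto simp: indicator_def\<close>)
qed

lemma act_C0 [simp]:
  "act (C0 Y \<Phi>) v f n = (if n \<in> topspace Y then f (\<Phi> v n) else 0)"
  "act (C0b Y \<Phi>) v f n = (if n \<in> topspace Y then f (\<Phi> v n) else 0)"
  "act (C0inf Y \<Phi>) v f n = (if n \<in> topspace Y then f (\<Phi> v n) else 0)"
  by (simp_all add: C0_def C0b_def C0inf_def cut_def)

lemma continuous_star_isoI:
  assumes mor: "wco_morphism S X \<Phi> \<L> S' X' \<Phi>' \<L>' \<eta> \<kappa>" and mor': "wco_morphism S' X' \<Phi>' \<L>' S X \<Phi> \<L> \<eta>' \<kappa>'"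
    and inter: "\<And>v f. f \<in> carr S \<Longrightarrow> act S' v (wco \<eta> \<kappa> f) = wco \<eta> \<kappa> (act S v f)"
    and inter': "\<And>v f. f \<in> carr S' \<Longrightarrow> act S v (wco \<eta>' \<kappa>' f) = wco \<eta>' \<kappa>' (act S' v f)"
    and inv: "\<And>f. f \<in> carr S \<Longrightarrow> wco \<eta>' \<kappa>' (wco \<eta> \<kappa> f) = f"
    and inv': "\<And>f. f \<in> carr S' \<Longrightarrow> wco \<eta> \<kappa> (wco \<eta>' \<kappa>' f) = f"
    and hom: "continuous_star_hom \<Lambda> \<phi> \<Theta> S S' (wco \<eta> \<kappa>)"
  shows "continuous_star_iso \<Lambda> \<phi> \<Theta> S S' (wco \<eta> \<kappa>)"
proof -
  have c: "a \<in> carr S" if "a \<in> smooth_part S" for a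
    using that sup_system.topspace_alg_top wco_morphism.axioms(1)[OF mor] unfolding smooth_part_def smooth_vectors_def by fastforce
  have c': "a \<in> carr S'" if "a \<in> smooth_part S'" for a
    using that sup_system.topspace_alg_top wco_morphism.axioms(2)[OF mor] unfolding smooth_part_def smooth_vectors_def by fastforce
  have "bij_betw (wco \<eta> \<kappa>) (smooth_part S) (smooth_part S')"
    by (rule bij_betw_byWitness[where f' = "wco \<eta>' \<kappa>'"])
       (use inv[OF c] inv'[OF c'] wco_morphism.wco_smooth_part[OF mor inter] wco_morphism.wco_smooth_part[OF mor' inter'] in auto)
  with hom show ?thesis by (simp add: continuous_star_iso_def)
qed

text \<open>The transport of norms applies to the homeomorphism and to its inverse.\<close>

lemma pullback_star_iso:
  fixes Y :: "'n topology" and Y' :: "'m topology" and \<Phi> :: "real^'d::finite \<Rightarrow> 'n \<Rightarrow> 'n" and \<Phi>' :: "real^'d \<Rightarrow> 'm \<Rightarrow> 'm"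
  assumes \<kappa>: "continuous_map Y' Y \<kappa>" and \<kappa>': "continuous_map Y Y' \<kappa>'"
    and inv: "\<And>y. y \<in> topspace Y' \<Longrightarrow> \<kappa>' (\<kappa> y) = y" "\<And>x. x \<in> topspace Y \<Longrightarrow> \<kappa> (\<kappa>' x) = x"
    and inter: "\<And>v y. y \<in> topspace Y' \<Longrightarrow> \<kappa> (\<Phi>' v y) = \<Phi> v (\<kappa> y)"
    and closed: "\<And>v y. y \<in> topspace Y' \<Longrightarrow> \<Phi>' v y \<in> topspace Y'" "\<And>v x. x \<in> topspace Y \<Longrightarrow> \<Phi> v x \<in> topspace Y"
  shows "continuous_star_iso \<Lambda> \<phi> \<Theta> (C0 Y \<Phi>) (C0 Y' \<Phi>') (pullback (topspace Y') \<kappa>)"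
    "continuous_star_iso \<Lambda> \<phi> \<Theta> (C0b Y \<Phi>) (C0b Y' \<Phi>') (pullback (topspace Y') \<kappa>)"
    "continuous_star_iso \<Lambda> \<phi> \<Theta> (C0inf Y \<Phi>) (C0inf Y' \<Phi>') (pullback (topspace Y') \<kappa>)"
proof -
  let ?\<eta> = "indicator (topspace Y') :: 'm \<Rightarrow> complex" and ?\<eta>' = "indicator (topspace Y) :: 'n \<Rightarrow> complex"
  have im: "\<kappa> y \<in> topspace Y" if "y \<in> topspace Y'" for y using \<kappa> that by (auto simp: continuous_map_def)
  have im': "\<kappa>' y \<in> topspace Y'" if "y \<in> topspace Y" for y using \<kappa>' that by (auto simp: continuous_map_def)
  have inter': "\<kappa>' (\<Phi> v x) = \<Phi>' v (\<kappa>' x)" if x: "x \<in> topspace Y" for v x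
  proof -
    have "\<Phi> v x = \<kappa> (\<Phi>' v (\<kappa>' x))" using inter[OF im'[OF x], of v] inv(2)[OF x] by simp
    then show ?thesis using inv(1) closed(1) im'[OF x] by simp
  qed
  have idem: "?\<eta> y = 0 \<or> ?\<eta> y = 1" "?\<eta>' x = 0 \<or> ?\<eta>' x = 1" for x y by (auto simp: indicator_def)
  have proper: "\<exists>K'. compactin Y' K' \<and> (\<forall>y\<in>topspace Y' - K'. \<kappa> y \<notin> K)" if "compactin Y K" for K
    using image_compactin[OF that \<kappa>'] inv(1) by (intro exI[of _ "\<kappa>' ` K"]) (metis Diff_iff image_eqI)
  have proper': "\<exists>K'. compactin Y K' \<and> (\<forall>y\<in>topspace Y - K'. \<kappa>' y \<notin> K)" if "compactin Y' K" for K
    using image_compactin[OF that \<kappa>] inv(2) by (intro exI[of _ "\<kappa> ` K"]) (metis Diff_iff image_eqI)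
  have mor3: "wco_morphism (C0inf Y \<Phi>) Y \<Phi> {topspace Y} (C0inf Y' \<Phi>') Y' \<Phi>' {topspace Y'} ?\<eta> \<kappa>"
    by (rule pullback_morphism(3)[OF \<kappa>]) (rule proper)
  have mor3': "wco_morphism (C0inf Y' \<Phi>') Y' \<Phi>' {topspace Y'} (C0inf Y \<Phi>) Y \<Phi> {topspace Y} ?\<eta>' \<kappa>'"
    by (rule pullback_morphism(3)[OF \<kappa>']) (rule proper')
  note mor = pullback_morphism(1)[OF \<kappa>, of \<Phi> \<Phi>'] pullback_morphism(2)[OF \<kappa>, of \<Phi> \<Phi>'] mor3
  note mor' = pullback_morphism(1)[OF \<kappa>', of \<Phi>' \<Phi>] pullback_morphism(2)[OF \<kappa>', of \<Phi>' \<Phi>] mor3'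
  have TT: "wco ?\<eta>' \<kappa>' (wco ?\<eta> \<kappa> f) = f" if "\<And>n. n \<notin> topspace Y \<Longrightarrow> f n = 0" for f
    using that im' inv by (auto simp: wco_def fun_eq_iff indicator_def)
  have TT': "wco ?\<eta> \<kappa> (wco ?\<eta>' \<kappa>' f) = f" if "\<And>n. n \<notin> topspace Y' \<Longrightarrow> f n = 0" for f
    using that im inv by (auto simp: wco_def fun_eq_iff indicator_def)
  have out: "f n = 0" if "f \<in> carr (C0 Y \<Phi>) \<or> f \<in> carr (C0b Y \<Phi>) \<or> f \<in> carr (C0inf Y \<Phi>)" "n \<notin> topspace Y" for f n
    using that by (auto simp: C0_def C0b_def C0inf_def C0_carrier_def)
  have out': "f n = 0" if "f \<in> carr (C0 Y' \<Phi>') \<or> f \<in> carr (C0b Y' \<Phi>') \<or> f \<in> carr (C0inf Y' \<Phi>')" "n \<notin> topspace Y'" for f n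
    using that by (auto simp: C0_def C0b_def C0inf_def C0_carrier_def)
  have i: "act (C0 Y' \<Phi>') v (wco ?\<eta> \<kappa> f) = wco ?\<eta> \<kappa> (act (C0 Y \<Phi>) v f)"
    "act (C0b Y' \<Phi>') v (wco ?\<eta> \<kappa> f) = wco ?\<eta> \<kappa> (act (C0b Y \<Phi>) v f)"
    "act (C0inf Y' \<Phi>') v (wco ?\<eta> \<kappa> f) = wco ?\<eta> \<kappa> (act (C0inf Y \<Phi>) v f)" for v f
    using inter closed im by (auto simp: wco_def fun_eq_iff)
  have i': "act (C0 Y \<Phi>) v (wco ?\<eta>' \<kappa>' f) = wco ?\<eta>' \<kappa>' (act (C0 Y' \<Phi>') v f)"
    "act (C0b Y \<Phi>) v (wco ?\<eta>' \<kappa>' f) = wco ?\<eta>' \<kappa>' (act (C0b Y' \<Phi>') v f)"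
    "act (C0inf Y \<Phi>) v (wco ?\<eta>' \<kappa>' f) = wco ?\<eta>' \<kappa>' (act (C0inf Y' \<Phi>') v f)" for v f
    using inter' closed im' by (auto simp: wco_def fun_eq_iff)
  have agree: "?\<eta>' n \<noteq> 0 \<Longrightarrow> act (C0 Y \<Phi>) v a n = act (C0 Y' \<Phi>') v (wco ?\<eta> \<kappa> a) (\<kappa>' n)"
    "?\<eta>' n \<noteq> 0 \<Longrightarrow> act (C0b Y \<Phi>) v a n = act (C0b Y' \<Phi>') v (wco ?\<eta> \<kappa> a) (\<kappa>' n)"
    "?\<eta>' n \<noteq> 0 \<Longrightarrow> act (C0inf Y \<Phi>) v a n = act (C0inf Y' \<Phi>') v (wco ?\<eta> \<kappa> a) (\<kappa>' n)" for n v a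
    using im' inv inter closed by (auto simp: wco_def indicator_def split: if_splits)
  have sup: "sup_seminorm (topspace Y) (wco ?\<eta>' \<kappa>' h) = sup_seminorm (topspace Y') h" for h
  proof -
    have "\<kappa>' ` topspace Y = topspace Y'" using im im' inv by (auto simp: image_iff) metis
    then have "(\<lambda>x. cmod (h (\<kappa>' x))) ` topspace Y = (\<lambda>x. cmod (h x)) ` topspace Y'" by (metis image_image)
    moreover have "(\<lambda>x. cmod (wco ?\<eta>' \<kappa>' h x)) ` topspace Y = (\<lambda>x. cmod (h (\<kappa>' x))) ` topspace Y"
      by (intro image_cong) (auto simp: wco_def)
    moreover have "topspace Y = {} \<longleftrightarrow> topspace Y' = {}" using im im' by blast
    ultimately show ?thesis unfolding sup_seminorm_def by simp
  qed
  have "continuous_star_hom \<Lambda> \<phi> \<Theta> (C0 Y \<Phi>) (C0 Y' \<Phi>') (wco ?\<eta> \<kappa>)"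
  proof (rule wco_continuous_star_hom[OF mor(1) idem(1) i(1)])
    fix q' assume q': "q' \<in> qnorms (C0 Y' \<Phi>')"
    show "\<exists>q\<in>qnorms (C0 Y \<Phi>). \<forall>f\<in>smooth_part (C0 Y \<Phi>). \<forall>g\<in>smooth_part (C0 Y \<Phi>).
        deformed_norm \<Lambda> \<phi> \<Theta> (C0 Y' \<Phi>') q' (wco ?\<eta> \<kappa> (g - f)) \<le> deformed_norm \<Lambda> \<phi> \<Theta> (C0 Y \<Phi>) q (g - f)"
      by (intro bexI[OF _ cstar_seminorm_pullback[OF mor(1) idem(1) q']] ballI
          deformed_norm_transport[OF mor'(1) idem(2) agree(1)] arg_cong[where f = q'] TT')
  qed
  then show "continuous_star_iso \<Lambda> \<phi> \<Theta> (C0 Y \<Phi>) (C0 Y' \<Phi>') (pullback (topspace Y') \<kappa>)"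
    unfolding pullback_wco
    by (rule continuous_star_isoI[OF mor(1) mor'(1) i(1) i'(1), rotated 2]) (use TT TT' out out' in metis)+
  have "continuous_star_hom \<Lambda> \<phi> \<Theta> (C0b Y \<Phi>) (C0b Y' \<Phi>') (wco ?\<eta> \<kappa>)"
  proof (rule wco_continuous_star_hom[OF mor(2) idem(1) i(2)])
    fix q' assume "q' \<in> qnorms (C0b Y' \<Phi>')"
    then have q': "q' = sup_seminorm (topspace Y')" by (simp add: C0b_def)
    have m: "sup_seminorm (topspace Y) \<in> qnorms (C0b Y \<Phi>)" by (simp add: C0b_def)
    show "\<exists>q\<in>qnorms (C0b Y \<Phi>). \<forall>f\<in>smooth_part (C0b Y \<Phi>). \<forall>g\<in>smooth_part (C0b Y \<Phi>).
        deformed_norm \<Lambda> \<phi> \<Theta> (C0b Y' \<Phi>') q' (wco ?\<eta> \<kappa> (g - f)) \<le> deformed_norm \<Lambda> \<phi> \<Theta> (C0b Y \<Phi>) q (g - f)"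
      unfolding q' by (intro bexI[OF _ m] ballI deformed_norm_transport[OF mor'(2) idem(2) agree(2)] sup)
  qed
  then show "continuous_star_iso \<Lambda> \<phi> \<Theta> (C0b Y \<Phi>) (C0b Y' \<Phi>') (pullback (topspace Y') \<kappa>)"
    unfolding pullback_wco
    by (rule continuous_star_isoI[OF mor(2) mor'(2) i(2) i'(2), rotated 2]) (use TT TT' out out' in metis)+
  have "continuous_star_hom \<Lambda> \<phi> \<Theta> (C0inf Y \<Phi>) (C0inf Y' \<Phi>') (wco ?\<eta> \<kappa>)"
  proof (rule wco_continuous_star_hom[OF mor(3) idem(1) i(3)])
    fix q' assume "q' \<in> qnorms (C0inf Y' \<Phi>')"
    then have q': "q' = sup_seminorm (topspace Y')" by (simp add: C0inf_def)
    have m: "sup_seminorm (topspace Y) \<in> qnorms (C0inf Y \<Phi>)" by (simp add: C0inf_def)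
    show "\<exists>q\<in>qnorms (C0inf Y \<Phi>). \<forall>f\<in>smooth_part (C0inf Y \<Phi>). \<forall>g\<in>smooth_part (C0inf Y \<Phi>).
        deformed_norm \<Lambda> \<phi> \<Theta> (C0inf Y' \<Phi>') q' (wco ?\<eta> \<kappa> (g - f)) \<le> deformed_norm \<Lambda> \<phi> \<Theta> (C0inf Y \<Phi>) q (g - f)"
      unfolding q' by (intro bexI[OF _ m] ballI deformed_norm_transport[OF mor'(3) idem(2) agree(3)] sup)
  qed
  then show "continuous_star_iso \<Lambda> \<phi> \<Theta> (C0inf Y \<Phi>) (C0inf Y' \<Phi>') (pullback (topspace Y') \<kappa>)"
    unfolding pullback_wco
    by (rule continuous_star_isoI[OF mor(3) mor'(3) i(3) i'(3), rotated 2]) (use TT TT' out out' in metis)+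
qed

section \<open>Domination of deformed norms\<close>

text \<open>The sup-norm of \<open>\<langle>G, G\<rangle>\<close> for \<open>G = \<phi>(a') \<star> g\<close> is approached at single points \<open>n0\<close>. With a weight that is
  \<open>1\<close> at \<open>n0\<close>, the function \<open>\<eta> g\<close> has module norm at most \<open>1\<close>, and \<open>\<phi>(a) \<star> (\<eta> g) = \<eta> G\<close> has the
  same value as \<open>G\<close> at \<open>n0\<close>. Points with \<open>a' = 0\<close> on the orbit do not contribute.\<close>

lemma supnorm_domination:
  fixes S S' :: "('n, 'd::finite) fun_system"
  assumes flow: "flow_system S' Y' \<Phi>' {topspace Y'}" and part: "lattice_partition \<Lambda> \<phi>"
    and ws: "flow_system.wsmooth S' Y' a'"
    and ex: "\<exists>\<eta>. wco_morphism S' Y' \<Phi>' {topspace Y'} S Y \<Phi> {topspace Y} \<eta> id \<and>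
        (\<forall>n v. \<eta> n \<noteq> 0 \<longrightarrow> act S v a n = act S' v a' n)"
    and cut: "\<And>n0. n0 \<in> topspace Y' \<Longrightarrow> \<exists>v. act S' v a' n0 \<noteq> 0 \<Longrightarrow> n0 \<in> topspace Y \<and>
        (\<exists>\<eta>. wco_morphism S' Y' \<Phi>' {topspace Y'} S Y \<Phi> {topspace Y} \<eta> id \<and>
        (\<forall>n v. \<eta> n \<noteq> 0 \<longrightarrow> act S v a n = act S' v a' n) \<and> \<eta> n0 = 1)"
  shows "deformed_norm \<Lambda> \<phi> \<Theta> S' (sup_seminorm (topspace Y')) a' \<le> deformed_norm \<Lambda> \<phi> \<Theta> S (sup_seminorm (topspace Y)) a"
    (is "_ \<le> ?D")
proof (rule deformed_norm_leI)
  interpret flow_system S' Y' \<Phi>' "{topspace Y'}" by (rule flow)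
  fix g assume g: "g \<in> schwartz S'" "module_norm (sup_seminorm (topspace Y')) g \<le> 1"
  have gc: "g v \<in> carr S'" for v
    using g(1) by (auto simp: schwartz_def smooth_vectors_def Cu_top_def Cu_def)
  let ?G = "Cu_star \<Lambda> \<phi> \<Theta> (\<lambda>v. act S' v a') g"
  obtain B where B: "\<And>n. n \<in> topspace Y' \<Longrightarrow> cmod (module_inner g g n) \<le> B"
    using module_inner_bounded(1)[OF part ws g(1)] by blast
  have "\<exists>C. \<forall>n\<in>topspace Y'. cmod (module_inner ?G ?G n) \<le> C"
    by (rule module_inner_bounded(2)[OF part ws g(1)]) simp
  then obtain C where C: "\<And>n. n \<in> topspace Y' \<Longrightarrow> cmod (module_inner ?G ?G n) \<le> C" by metis
  have out: "module_inner g g n = 0" "module_inner ?G ?G n = 0" if "n \<notin> topspace Y'" for n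
    using carr_outside[OF gc that] by (simp_all add: module_inner_def Cu_star_osc)
  have bdg: "bounded (module_inner g g ` topspace Y')" using B by (auto simp: bounded_iff)
  let ?s = "sup_seminorm (topspace Y') (module_inner g g)"
  have s0: "0 \<le> ?s" by (rule sup_seminorm_nonneg[OF bdg])
  have s1: "?s \<le> 1" using g(2) s0 by (simp add: module_norm_def)
  have gn: "cmod (module_inner g g n) \<le> ?s" for n
    using sup_seminorm_upper[OF bdg, of n] out(1)[of n] s0 by (cases "n \<in> topspace Y'") auto
  have Gn: "cmod (module_inner ?G ?G n) \<le> max C 0" for n
    using C[of n] out(2)[of n] by (cases "n \<in> topspace Y'") auto
  have test: "0 \<le> ?D \<and> (\<forall>n0\<in>topspace Y. \<eta> n0 = 1 \<longrightarrow> ereal (sqrt (cmod (module_inner ?G ?G n0))) \<le> ?D)"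
    if mor: "wco_morphism S' Y' \<Phi>' {topspace Y'} S Y \<Phi> {topspace Y} \<eta> id"
      and agree: "\<And>n v. \<eta> n \<noteq> 0 \<Longrightarrow> act S v a n = act S' v a' n" for \<eta>
  proof -
    interpret m: wco_morphism S' Y' \<Phi>' "{topspace Y'}" S Y \<Phi> "{topspace Y}" \<eta> id by (rule mor)
    let ?g = "\<lambda>v. wco \<eta> id (g v)"
    have w1: "cmod (cnj (\<eta> n) * \<eta> n) \<le> 1" for n
      using m.weight_le_1[of n] by (simp add: norm_mult mult_le_one)
    have le: "cmod (wco (\<lambda>n. cnj (\<eta> n) * \<eta> n) id h n) \<le> cmod (h n)" for h n
      unfolding wco_def norm_mult[of "cnj (\<eta> n) * \<eta> n"] id_apply
      by (rule mult_left_le_one_le) (use w1 in auto)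
    have "sup_seminorm (topspace Y) (module_inner ?g ?g) \<le> ?s"
      unfolding module_inner_wco by (rule sup_seminorm_least) (use le gn s0 order_trans in blast)+
    then have n1: "module_norm (sup_seminorm (topspace Y)) ?g \<le> 1"
      unfolding module_norm_def using s1 by simp
    have e: "Cu_star \<Lambda> \<phi> \<Theta> (\<lambda>v. act S v a) ?g = (\<lambda>x. wco \<eta> id (?G x))"
      by (rule Cu_star_wco) (simp add: agree)
    let ?h = "wco (\<lambda>n. cnj (\<eta> n) * \<eta> n) id (module_inner ?G ?G)"
    have up: "ereal (sqrt (sup_seminorm (topspace Y) ?h)) \<le> ?D"
      using deformed_norm_upper[OF m.wco_schwartz[OF g(1)] n1, of \<Lambda> \<phi> \<Theta> a]
      unfolding e module_norm_def module_inner_wco .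
    have bd: "bounded (?h ` topspace Y)"
      unfolding bounded_iff using le[of "module_inner ?G ?G"] Gn order_trans by blast
    have "0 \<le> sqrt (sup_seminorm (topspace Y) ?h)" using sup_seminorm_nonneg[OF bd] by simp
    then have "0 \<le> ereal (sqrt (sup_seminorm (topspace Y) ?h))" by simp
    then have "0 \<le> ?D" using up by (rule order_trans)
    moreover have "ereal (sqrt (cmod (module_inner ?G ?G n0))) \<le> ?D" if "n0 \<in> topspace Y" "\<eta> n0 = 1" for n0
    proof -
      have "cmod (module_inner ?G ?G n0) \<le> sup_seminorm (topspace Y) ?h"
        using sup_seminorm_upper[OF bd that(1)] that(2) by (simp add: wco_def)
      then have "ereal (sqrt (cmod (module_inner ?G ?G n0))) \<le> ereal (sqrt (sup_seminorm (topspace Y) ?h))" by simp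
      then show ?thesis using up by (rule order_trans)
    qed
    ultimately show ?thesis by blast
  qed
  have D0: "0 \<le> ?D" using ex test by blast
  have Dn: "ereal (sqrt (cmod (module_inner ?G ?G n0))) \<le> ?D" if n0: "n0 \<in> topspace Y'" for n0
  proof (cases "\<exists>v. act S' v a' n0 \<noteq> 0")
    case True
    then show ?thesis using cut[OF n0 True] test by blast
  next
    case False
    then have "module_inner ?G ?G n0 = 0" by (simp add: module_inner_def Cu_star_osc)
    then show ?thesis using D0 by (simp add: zero_ereal_def)
  qed
  show "ereal (module_norm (sup_seminorm (topspace Y')) ?G) \<le> ?D"
  proof (cases ?D)
    case (real r)
    have r0: "0 \<le> r" using D0 real by simp
    have "sup_seminorm (topspace Y') (module_inner ?G ?G) \<le> r\<^sup>2"
    proof (rule sup_seminorm_least)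
      fix n0 assume "n0 \<in> topspace Y'"
      from Dn[OF this] have "sqrt (cmod (module_inner ?G ?G n0)) \<le> r" by (simp add: real)
      then show "cmod (module_inner ?G ?G n0) \<le> r\<^sup>2" by (rule sqrt_le_D)
    qed simp
    then have "sqrt (sup_seminorm (topspace Y') (module_inner ?G ?G)) \<le> sqrt (r\<^sup>2)" by (rule real_sqrt_le_mono)
    then show ?thesis using r0 by (simp add: real module_norm_def)
  qed (use D0 in auto)
qed

lemma first_countable_sequential_continuity:
  fixes h :: "'n \<Rightarrow> 'b::metric_space"
  assumes X: "first_countable X"
    and seq: "\<And>m nn. m \<in> topspace X \<Longrightarrow> (\<And>k::nat. nn k \<in> topspace X) \<Longrightarrow> limitin X nn m sequentially \<Longrightarrow> (\<lambda>k. h (nn k)) \<longlonglongrightarrow> h m"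
  shows "continuous_map X euclidean h"
proof (rule ccontr)
  assume "\<not> continuous_map X euclidean h"
  then obtain U where U: "open U" "\<not> openin X {x \<in> topspace X. h x \<in> U}"
    by (auto simp: continuous_map_def)
  then obtain m where m: "m \<in> topspace X" "h m \<in> U"
    and no: "\<And>T. openin X T \<Longrightarrow> m \<in> T \<Longrightarrow> \<not> T \<subseteq> {x \<in> topspace X. h x \<in> U}"
    using openin_subopen[of X "{x \<in> topspace X. h x \<in> U}"] by blast
  obtain \<B> where \<B>: "countable \<B>" "\<And>V. V \<in> \<B> \<Longrightarrow> openin X V"
    "\<And>W. openin X W \<Longrightarrow> m \<in> W \<Longrightarrow> \<exists>V\<in>\<B>. m \<in> V \<and> V \<subseteq> W"
    using X m(1) unfolding first_countable_def by meson
  define \<B>' where "\<B>' = {V \<in> \<B>. m \<in> V}"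
  have ne: "\<B>' \<noteq> {}" using \<B>(3)[OF openin_topspace m(1)] by (auto simp: \<B>'_def)
  have "countable \<B>'" using \<B>(1) by (simp add: \<B>'_def)
  then have "range (from_nat_into \<B>') = \<B>'" using ne by (intro range_from_nat_into)
  then obtain b :: "nat \<Rightarrow> 'n set" where b: "range b = \<B>'" by (rule that)
  define T where "T k = (\<Inter>i\<le>k. b i)" for k :: nat
  have bi: "openin X (b i)" "m \<in> b i" for i using b \<B>(2) by (auto simp: \<B>'_def)
  have T: "openin X (T k)" "m \<in> T k" for k
    unfolding T_def using bi by (auto intro!: openin_INT)
  have "\<exists>x. x \<in> T k \<and> x \<in> topspace X \<and> h x \<notin> U" for k
    using no[OF T] openin_subset[OF T(1)[of k]] by blast
  then obtain nn where nn: "\<And>k. nn k \<in> T k" "\<And>k. nn k \<in> topspace X" "\<And>k. h (nn k) \<notin> U" by metis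
  have "limitin X nn m sequentially"
    unfolding limitin_def
  proof (intro conjI allI impI)
    fix W assume "openin X W \<and> m \<in> W"
    then obtain V where V: "V \<in> \<B>" "m \<in> V" "V \<subseteq> W" using \<B>(3) by blast
    then obtain i where i: "b i = V" using b by (metis (mono_tags, lifting) \<B>'_def mem_Collect_eq rangeE)
    have "nn k \<in> W" if "i \<le> k" for k using nn(1)[of k] that V(3) i by (auto simp: T_def)
    then show "\<forall>\<^sub>F k in sequentially. nn k \<in> W" by (auto simp: eventually_sequentially)
  qed (rule m(1))
  from seq[OF m(1) nn(2) this] have "eventually (\<lambda>k. h (nn k) \<in> U) sequentially"
    using U(1) m(2) by (rule topological_tendstoD)
  with nn(3) show False by (auto simp: eventually_sequentially)
qed

text \<open>Continuity of the inner products on the space is what allows to evaluate a \<open>C\<^sup>*\<close>-seminorm on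
  them. It is checked along sequences, as it comes from the dominated convergence theorem; this is where
  first countability enters.\<close>

lemma module_inner_C0:
  assumes flow: "flow_system (C0 X \<Phi>) X \<Phi> {L. compactin X L}" and fc: "first_countable X"
    and part: "lattice_partition \<Lambda> \<phi>"
    and ws: "flow_system.wsmooth (C0 X \<Phi>) X a" and g: "g \<in> schwartz (C0 X \<Phi>)"
  shows "module_inner g g \<in> C0_carrier X"
    and "module_inner (Cu_star \<Lambda> \<phi> \<Theta> (\<lambda>v. act (C0 X \<Phi>) v a) g) (Cu_star \<Lambda> \<phi> \<Theta> (\<lambda>v. act (C0 X \<Phi>) v a) g) \<in> C0_carrier X"
proof -
  interpret flow_system "C0 X \<Phi>" X \<Phi> "{L. compactin X L}" by (rule flow)
  have gc: "g v \<in> carr (C0 X \<Phi>)" for v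
    using g by (auto simp: schwartz_def smooth_vectors_def Cu_top_def Cu_def)
  let ?G = "Cu_star \<Lambda> \<phi> \<Theta> (\<lambda>v. act (C0 X \<Phi>) v a) g"
  have out: "module_inner g g n = 0" "module_inner ?G ?G n = 0" if "n \<notin> topspace X" for n
    using carr_outside[OF gc that] by (simp_all add: module_inner_def Cu_star_osc)
  have lim: "(\<lambda>k. module_inner g g (nn k)) \<longlonglongrightarrow> module_inner g g m"
    "(\<lambda>k. module_inner ?G ?G (nn k)) \<longlonglongrightarrow> module_inner ?G ?G m"
    if nn: "\<And>k::nat. nn k \<in> topspace X" and l: "limitin X nn m sequentially" for nn m
  proof -
    have L: "insert m (range nn) \<in> {L. compactin X L}"
      using compactin_sequence_with_limit[OF l, of "range nn"] nn by auto
    have f: "(\<lambda>k. f (nn k)) \<longlonglongrightarrow> f m" if "f \<in> carr (C0 X \<Phi>)" for f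
      using continuous_map_limit[OF carr_continuous[OF that] l] by (simp add: o_def)
    show "(\<lambda>k. module_inner g g (nn k)) \<longlonglongrightarrow> module_inner g g m"
      by (rule module_inner_tendsto(1)[OF part ws g L]) (use f in auto)
    show "(\<lambda>k. module_inner ?G ?G (nn k)) \<longlonglongrightarrow> module_inner ?G ?G m"
      by (rule module_inner_tendsto(2)[OF part ws g L]) (use f in auto)
  qed
  show "module_inner g g \<in> C0_carrier X" "module_inner ?G ?G \<in> C0_carrier X"
    unfolding C0_carrier_def using out
    by (auto intro!: first_countable_sequential_continuity[OF fc] lim)
qed

text \<open>By continuity \<open>q < 1\<close> on a neighbourhood of \<open>0\<close> that is given by a compact set \<open>L\<close>. All multiples of
  a function vanishing on \<open>L\<close> lie in it, thus \<open>q\<close> is \<open>0\<close> on such functions.\<close>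

lemma continuous_cstar_seminorm_compact_support:
  assumes "q \<in> qnorms (C0 X \<Phi>)"
  shows "\<exists>L. compactin X L \<and> (\<forall>f\<in>C0_carrier X. \<forall>g\<in>C0_carrier X. (\<forall>y\<in>L. f y = g y) \<longrightarrow> q f = q g)"
proof -
  interpret sup_system "C0 X \<Phi>" X \<Phi> "{L. compactin X L}" by (rule sup_system_C0)
  have c: "carr (C0 X \<Phi>) = C0_carrier X" by (simp add: C0_def)
  have q1: "cstar_seminorm (C0_carrier X) q" and q2: "continuous_map (alg_top (C0 X \<Phi>)) euclideanreal q"
    using assms by (auto simp: C0_def alg_top_def)
  have nn: "0 \<le> q f" and sc: "q (\<lambda>x. c * f x) = cmod c * q f" if "f \<in> C0_carrier X" for f c
    using q1 that by (auto simp: cstar_seminorm_def)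
  have add: "q (f + g) \<le> q f + q g" if "f \<in> C0_carrier X" "g \<in> C0_carrier X" for f g
    using q1 that by (auto simp: cstar_seminorm_def)
  have z: "(\<lambda>_. 0) \<in> C0_carrier X" by (simp add: C0_carrier_def)
  have q0: "q (\<lambda>_. 0) = 0" using sc[OF z, of 0] by simp
  have "openin (alg_top (C0 X \<Phi>)) {f \<in> C0_carrier X. q f \<in> {..<1}}"
    using openin_continuous_map_preimage[OF q2, of "{..<1}"] unfolding topspace_alg_top c by simp
  moreover have "(\<lambda>_. 0) \<in> {f \<in> C0_carrier X. q f \<in> {..<1}}" using z q0 by simp
  ultimately obtain F and e :: real where F: "finite F" "F \<subseteq> (\<lambda>L f. ereal (sup_seminorm L f)) ` {L. compactin X L}" "0 < e"
    "{g \<in> C0_carrier X. \<forall>p\<in>F. p (g - (\<lambda>_. 0)) < ereal e} \<subseteq> {f \<in> C0_carrier X. q f \<in> {..<1}}"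
    unfolding alg_top_eq openin_seminorm_top c by blast
  obtain \<F> where \<F>: "\<F> \<subseteq> {L. compactin X L}" "finite \<F>" "F = (\<lambda>L f. ereal (sup_seminorm L f)) ` \<F>"
    using finite_subset_image[OF F(1,2)] by blast
  have L: "compactin X (\<Union>\<F>)" by (rule compactin_Union) (use \<F> in auto)
  have v: "q f = 0" if f: "f \<in> C0_carrier X" "\<And>y. y \<in> \<Union>\<F> \<Longrightarrow> f y = 0" for f
  proof (rule ccontr)
    assume "q f \<noteq> 0"
    with nn[OF f(1)] have pos: "0 < q f" by simp
    let ?f = "\<lambda>x. complex_of_real (1 / q f) * f x"
    have "?f \<in> C0_carrier X" by (rule C0_carrier_cmult[OF f(1)])
    moreover have "p (?f - (\<lambda>_. 0)) < ereal e" if pF: "p \<in> F" for p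
    proof -
      obtain K where K: "K \<in> \<F>" "p = (\<lambda>f. ereal (sup_seminorm K f))" using pF \<F>(3) by blast
      have "sup_seminorm K (?f - (\<lambda>_. 0)) \<le> 0"
        by (rule sup_seminorm_least) (use f(2) K(1) in auto)
      then have "sup_seminorm K (?f - (\<lambda>_. 0)) < e" using F(3) by linarith
      then show ?thesis unfolding K(2) by simp
    qed
    ultimately have "q ?f < 1" using F(4) by blast
    moreover have "q ?f = 1" unfolding sc[OF f(1)] using pos by (simp add: norm_divide)
    ultimately show False by simp
  qed
  have le: "q f \<le> q g" if fg: "f \<in> C0_carrier X" "g \<in> C0_carrier X" "\<forall>y\<in>\<Union>\<F>. f y = g y" for f g
  proof -
    have d: "f - g \<in> C0_carrier X" using carr_diff fg unfolding c by blast
    have "q ((f - g) + g) \<le> q (f - g) + q g" by (rule add[OF d fg(2)])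
    moreover have "q (f - g) = 0" by (rule v[OF d]) (use fg(3) in auto)
    ultimately show ?thesis by (simp add: fun_eq_iff)
  qed
  show ?thesis
    by (intro exI[of _ "\<Union>\<F>"] conjI L ballI impI order_antisym le) auto
qed

section \<open>Restriction to an invariant open set\<close>

text \<open>A flow that moves only points of a compact set \<open>K\<close>, with an open set \<open>N\<close> around it; then \<open>N\<close> is automatically invariant.\<close>

locale open_flow =
  fixes X :: "'n topology" and \<Phi> :: "real^'d::finite \<Rightarrow> 'n \<Rightarrow> 'n" and N K :: "'n set"
  assumes Hausdorff: "Hausdorff_space X" and locally_compact: "locally_compact_space X"
    and first_countable: "first_countable X"
    and N_open: "openin X N" and K_compact: "compactin X K" and K_subset: "K \<subseteq> N"
    and flow_closed: "\<And>n v. n \<in> topspace X \<Longrightarrow> \<Phi> v n \<in> topspace X"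
    and flow_0: "\<And>n. n \<in> topspace X \<Longrightarrow> \<Phi> 0 n = n"
    and flow_add: "\<And>n v w. n \<in> topspace X \<Longrightarrow> \<Phi> (v + w) n = \<Phi> v (\<Phi> w n)"
    and flow_fixed: "\<And>n v. n \<in> topspace X - K \<Longrightarrow> \<Phi> v n = n"
begin

lemma N_sub: "N \<subseteq> topspace X"
  using N_open by (rule openin_subset)

lemma topspace_N [simp]: "topspace (subtopology X N) = N"
  using N_sub by auto

lemma flow_K: "n \<in> K \<Longrightarrow> \<Phi> v n \<in> K"
proof (rule ccontr)
  assume n: "n \<in> K" and no: "\<Phi> v n \<notin> K"
  have nX: "n \<in> topspace X" using n K_subset N_sub by blast
  have "n = \<Phi> (- v) (\<Phi> v n)" using flow_add[OF nX, of "- v" v] flow_0[OF nX] by simp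
  also have "\<dots> = \<Phi> v n" by (rule flow_fixed) (use no flow_closed[OF nX] in blast)
  finally show False using n no by simp
qed

lemma flow_N: "n \<in> N \<Longrightarrow> \<Phi> v n \<in> N"
  using flow_K[of n v] flow_fixed[of n v] K_subset N_sub by (metis DiffI subsetD)

lemma flow_outside_N: "n \<in> topspace X \<Longrightarrow> n \<notin> N \<Longrightarrow> \<Phi> v n = n"
  using flow_fixed K_subset by blast

lemma flow_system_C0: "flow_system (C0 X \<Phi>) X \<Phi> {L. compactin X L}"
proof (intro flow_system.intro sup_system_C0 flow_system_axioms.intro)
  fix L assume L: "L \<in> {L. compactin X L}"
  have "\<Phi> v ` L \<subseteq> L \<union> K" for v
  proof
    fix y assume "y \<in> \<Phi> v ` L"
    then obtain n where n: "n \<in> L" "y = \<Phi> v n" by blast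
    moreover have "n \<in> topspace X" using n(1) L compactin_subset_topspace by blast
    ultimately show "y \<in> L \<union> K" using flow_K[of n v] flow_fixed[of n v] by (cases "n \<in> K") auto
  qed
  then show "\<exists>L'\<in>{L. compactin X L}. \<forall>v. \<Phi> v ` L \<subseteq> L'"
    using L K_compact by (intro bexI[of _ "L \<union> K"]) (auto intro: compactin_Un)
qed (use flow_closed flow_0 flow_add in auto)

lemma flow_system_C0b: "flow_system (C0b X \<Phi>) X \<Phi> {topspace X}"
  by (intro flow_system.intro sup_system_C0b flow_system_axioms.intro) (use flow_closed flow_0 flow_add in auto)

lemma flow_system_C0inf: "flow_system (C0inf X \<Phi>) X \<Phi> {topspace X}"
  by (intro flow_system.intro sup_system_C0inf flow_system_axioms.intro) (use flow_closed flow_0 flow_add in auto)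

lemma open_flow_N: "open_flow (subtopology X N) \<Phi> N K"
proof (intro open_flow.intro)
  show "Hausdorff_space (subtopology X N)" by (rule Hausdorff_space_subtopology[OF Hausdorff])
  show "locally_compact_space (subtopology X N)"
    using locally_compact_space_open_subset[OF _ locally_compact N_open] Hausdorff by blast
  show "first_countable (subtopology X N)" by (rule first_countable_subtopology[OF first_countable])
  show "openin (subtopology X N) N" using openin_open_subtopology[OF N_open] N_open by blast
  show "compactin (subtopology X N) K" using K_compact K_subset by (simp add: compactin_subtopology)
qed (use K_subset N_sub flow_N flow_0 flow_add flow_fixed in auto)

text \<open>Urysohn's lemma for locally compact Hausdorff spaces, with the function extended by \<open>0\<close>.\<close>

lemma cutoff:
  assumes L: "compactin X L" "L \<subseteq> N"
  obtains \<eta> :: "'n \<Rightarrow> complex" and Kc where "continuous_map X euclidean \<eta>" "\<And>y. y \<in> L \<Longrightarrow> \<eta> y = 1"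
    "\<And>y. cmod (\<eta> y) \<le> 1" "compactin X Kc" "Kc \<subseteq> N" "\<And>y. y \<notin> Kc \<Longrightarrow> \<eta> y = 0"
proof -
  interpret N: open_flow "subtopology X N" \<Phi> N K by (rule open_flow_N)
  have LN: "compactin (subtopology X N) L" using L by (simp add: compactin_subtopology)
  obtain U Kc where U: "openin (subtopology X N) U" "compactin (subtopology X N) Kc" "L \<subseteq> U" "U \<subseteq> Kc"
    using N.locally_compact LN
    unfolding locally_compact_space_compact_closed_compact[OF disjI1[OF N.Hausdorff]] by blast
  have Kc: "compactin X Kc" "Kc \<subseteq> N" using U(2) by (auto simp: compactin_subtopology)
  have UX: "openin X U" using U(1) N_open by (rule openin_trans_full)
  have cr: "completely_regular_space X"
    using locally_compact_regular_imp_completely_regular_space locally_compact Hausdorff by blast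
  have "closedin X (topspace X - U)" using UX by blast
  moreover have "disjnt L (topspace X - U)" using U(3) by (auto simp: disjnt_def)
  ultimately obtain f where f: "continuous_map X (top_of_set {0..1::real}) f" "f ` (topspace X - U) \<subseteq> {0}" "f ` L \<subseteq> {1}"
    using Urysohn_completely_regular_compact_closed[of 0 1 X L "topspace X - U"] cr L(1) by auto
  define \<eta> where "\<eta> y = (if y \<in> topspace X then complex_of_real (f y) else 0)" for y
  have cf: "continuous_map X euclideanreal f" using f(1) by (auto simp: continuous_map_in_subtopology)
  have "continuous_map X euclidean (\<lambda>y. complex_of_real (f y))"
    using cf by (simp add: continuous_map_atin tendsto_of_real)
  then have "continuous_map X euclidean \<eta>" by (rule continuous_map_eq) (simp add: \<eta>_def)
  moreover have "\<eta> y = 1" if "y \<in> L" for y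
    using f(3) that compactin_subset_topspace[OF L(1)] by (auto simp: \<eta>_def)
  moreover have "cmod (\<eta> y) \<le> 1" for y
  proof (cases "y \<in> topspace X")
    case True
    then have "f y \<in> {0..1}" using f(1) by (auto simp: continuous_map_in_subtopology)
    then show ?thesis using True by (simp add: \<eta>_def)
  qed (simp add: \<eta>_def)
  moreover have "\<eta> y = 0" if "y \<notin> Kc" for y
    using f(2) that U(4) by (auto simp: \<eta>_def)
  ultimately show thesis using that Kc by blast
qed

lemma C0_carrier_cutoff:
  assumes \<eta>: "continuous_map X euclidean \<eta>" "compactin X Kc" "Kc \<subseteq> N" "\<And>y. y \<notin> Kc \<Longrightarrow> \<eta> y = 0"
    and f: "f \<in> C0_carrier (subtopology X N)"
  shows "wco \<eta> id f \<in> C0_carrier X"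
proof -
  have fc: "continuous_map (subtopology X N) euclidean (\<lambda>y. \<eta> y * f y)"
    using f by (intro continuous_map_complex_mult continuous_map_from_subtopology[OF \<eta>(1)]) (simp add: C0_carrier_def)
  have cl: "closedin X Kc" by (rule compactin_imp_closedin[OF Hausdorff \<eta>(2)])
  have "continuous_map X euclidean (\<lambda>y. \<eta> y * f y)"
    unfolding continuous_map_def
  proof (intro conjI allI impI)
    fix U :: "complex set" assume U: "openin euclidean U"
    have "openin (subtopology X N) {x \<in> topspace (subtopology X N). \<eta> x * f x \<in> U}"
      using fc U unfolding continuous_map_def by blast
    then have 1: "openin X {x \<in> N. \<eta> x * f x \<in> U}" unfolding topspace_N by (rule openin_trans_full[OF _ N_open])
    have 2: "openin X (if 0 \<in> U then topspace X - Kc else {})" using cl by auto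
    have "{x \<in> topspace X. \<eta> x * f x \<in> U} = {x \<in> N. \<eta> x * f x \<in> U} \<union> (if 0 \<in> U then topspace X - Kc else {})"
      using \<eta>(3,4) N_sub by (auto split: if_splits) (metis mult_zero_left subsetD)+
    then show "openin X {x \<in> topspace X. \<eta> x * f x \<in> U}" using openin_Un[OF 1 2] by simp
  qed auto
  moreover have "\<eta> y * f y = 0" if "y \<notin> topspace X" for y using \<eta>(3,4) N_sub that by (metis mult_zero_left subsetD)
  ultimately show ?thesis by (simp add: C0_carrier_def wco_def)
qed

text \<open>The support of \<open>\<eta>\<close> is compact in \<open>N\<close>, so a product with \<open>\<eta>\<close> extends by \<open>0\<close> to \<open>X\<close>, and restricts to a function vanishing at infinity on \<open>N\<close>.\<close>

lemma cutoff_morphism: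
  assumes \<eta>: "continuous_map X euclidean \<eta>" "compactin X Kc" "Kc \<subseteq> N" "\<And>y. y \<notin> Kc \<Longrightarrow> \<eta> y = 0" "\<And>y. cmod (\<eta> y) \<le> 1"
  shows "wco_morphism (C0 (subtopology X N) \<Phi>) (subtopology X N) \<Phi> {L. compactin (subtopology X N) L} (C0 X \<Phi>) X \<Phi> {L. compactin X L} \<eta> id"
    and "wco_morphism (C0b (subtopology X N) \<Phi>) (subtopology X N) \<Phi> {topspace (subtopology X N)} (C0b X \<Phi>) X \<Phi> {topspace X} \<eta> id"
    and "wco_morphism (C0inf X \<Phi>) X \<Phi> {topspace X} (C0inf (subtopology X N) \<Phi>) (subtopology X N) \<Phi> {topspace (subtopology X N)} \<eta> id"
proof -
  show "wco_morphism (C0 (subtopology X N) \<Phi>) (subtopology X N) \<Phi> {L. compactin (subtopology X N) L} (C0 X \<Phi>) X \<Phi> {L. compactin X L} \<eta> id"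
  proof (intro wco_morphism.intro sup_system_C0 wco_morphism_axioms.intro \<eta>(5))
    show "wco \<eta> id f \<in> carr (C0 X \<Phi>)" if "f \<in> carr (C0 (subtopology X N) \<Phi>)" for f
      using C0_carrier_cutoff[OF \<eta>(1-4)] that by (simp add: C0_def)
    show "\<exists>L\<in>{L. compactin (subtopology X N) L}. \<forall>y\<in>L'. \<eta> y \<noteq> 0 \<longrightarrow> id y \<in> L" if "L' \<in> {L. compactin X L}" for L'
      using \<eta>(2-4) by (intro bexI[of _ Kc]) (auto simp: compactin_subtopology)
  qed
  show "wco_morphism (C0b (subtopology X N) \<Phi>) (subtopology X N) \<Phi> {topspace (subtopology X N)} (C0b X \<Phi>) X \<Phi> {topspace X} \<eta> id"
  proof (intro wco_morphism.intro sup_system_C0b wco_morphism_axioms.intro \<eta>(5))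
    show "wco \<eta> id f \<in> carr (C0b X \<Phi>)" if f: "f \<in> carr (C0b (subtopology X N) \<Phi>)" for f
    proof -
      obtain B where B: "\<And>x. cmod (f x) \<le> B" using f by (auto simp: C0b_def bounded_range_iff)
      have "cmod (wco \<eta> id f y) \<le> B" for y
      proof -
        have "cmod (wco \<eta> id f y) \<le> cmod (f y)"
          unfolding wco_def norm_mult id_apply by (rule mult_left_le_one_le) (use \<eta>(5) in auto)
        with B[of y] show ?thesis by linarith
      qed
      then show ?thesis using C0_carrier_cutoff[OF \<eta>(1-4)] f unfolding C0b_def bounded_range_iff by auto
    qed
  qed (use \<eta>(3,4) in auto)
  show "wco_morphism (C0inf X \<Phi>) X \<Phi> {topspace X} (C0inf (subtopology X N) \<Phi>) (subtopology X N) \<Phi> {topspace (subtopology X N)} \<eta> id"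
  proof (intro wco_morphism.intro sup_system_C0inf wco_morphism_axioms.intro \<eta>(5))
    show "wco \<eta> id f \<in> carr (C0inf (subtopology X N) \<Phi>)" if f: "f \<in> carr (C0inf X \<Phi>)" for f
    proof -
      have "continuous_map X euclidean f" using f by (simp add: C0inf_def C0_carrier_def)
      then have "continuous_map (subtopology X N) euclidean (wco \<eta> id f)"
        unfolding wco_def id_apply by (intro continuous_map_from_subtopology continuous_map_complex_mult \<eta>(1))
      moreover have "wco \<eta> id f y = 0" if "y \<notin> Kc" for y using \<eta>(4) that by (simp add: wco_def)
      moreover have "compactin (subtopology X N) Kc" using \<eta>(2,3) by (simp add: compactin_subtopology)
      moreover have "Kc \<subseteq> topspace X" using \<eta>(3) N_sub by blast
      ultimately show ?thesis unfolding C0inf_def C0_carrier_def using \<eta>(3) by (auto intro!: exI[of _ Kc])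
    qed
  qed (use N_sub in auto)
qed

lemma cut_wco: "cut N = wco (indicator N) id"
  by (rule ext)+ (simp add: cut_def wco_def indicator_def)

lemma inclusion_morphism:
  "wco_morphism (C0inf (subtopology X N) \<Phi>) (subtopology X N) \<Phi> {topspace (subtopology X N)} (C0inf X \<Phi>) X \<Phi> {topspace X} (indicator N) id"
proof (intro wco_morphism.intro sup_system_C0inf wco_morphism_axioms.intro)
  show "wco (indicator N) id f \<in> carr (C0inf X \<Phi>)" if f: "f \<in> carr (C0inf (subtopology X N) \<Phi>)" for f
  proof -
    have out: "f y = 0" if "y \<notin> N" for y using f that by (auto simp: C0inf_def C0_carrier_def)
    have eq: "wco (indicator N) id f = f" using out by (auto simp: wco_def fun_eq_iff indicator_def)
    have fc: "continuous_map (subtopology X N) euclidean f" using f by (simp add: C0inf_def C0_carrier_def)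
    have small: "\<exists>K. compactin X K \<and> K \<subseteq> N \<and> (\<forall>x. x \<notin> K \<longrightarrow> cmod (f x) < e)" if e: "e > 0" for e
    proof -
      obtain K where K: "compactin (subtopology X N) K" "\<forall>x\<in>topspace (subtopology X N) - K. cmod (f x) < e"
        using C0inf_vanishing[OF f e] by blast
      have "cmod (f x) < e" if "x \<notin> K" for x using K(2) out[of x] that e unfolding topspace_N by (cases "x \<in> N") auto
      with K(1) show ?thesis by (auto simp: compactin_subtopology)
    qed
    have "continuous_map X euclidean f"
      unfolding continuous_map_def
    proof (intro conjI allI impI)
      fix U :: "complex set" assume U: "openin euclidean U"
      have "openin (subtopology X N) {x \<in> topspace (subtopology X N). f x \<in> U}"
        using fc U unfolding continuous_map_def by blast
      then have 1: "openin X {x \<in> N. f x \<in> U}" unfolding topspace_N by (rule openin_trans_full[OF _ N_open])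
      show "openin X {x \<in> topspace X. f x \<in> U}"
      proof (cases "0 \<in> U")
        case True
        then obtain e where e: "e > 0" "ball 0 e \<subseteq> U" using U open_contains_ball by (metis open_openin)
        obtain K' where K': "compactin X K'" "\<And>x. x \<notin> K' \<Longrightarrow> cmod (f x) < e" "K' \<subseteq> N" using small[OF e(1)] by blast
        have "openin X (topspace X - K')" using compactin_imp_closedin[OF Hausdorff K'(1)] by blast
        moreover have "{x \<in> topspace X. f x \<in> U} = {x \<in> N. f x \<in> U} \<union> (topspace X - K')"
        proof -
          have "f x \<in> U" if "x \<notin> K'" for x using K'(2)[OF that] e(2) by auto
          then show ?thesis using N_sub K'(3) by auto
        qed
        ultimately show ?thesis using openin_Un[OF 1] by metis
      next
        case False
        then have "{x \<in> topspace X. f x \<in> U} = {x \<in> N. f x \<in> U}" using out N_sub by auto metis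
        with 1 show ?thesis by simp
      qed
    qed auto
    moreover have "\<exists>K. compactin X K \<and> (\<forall>x\<in>topspace X - K. cmod (f x) < e)" if "e > 0" for e
      using small[OF that] by blast
    moreover have "f x = 0" if "x \<notin> topspace X" for x using out N_sub that by blast
    ultimately show ?thesis unfolding eq by (simp add: C0inf_def C0_carrier_def)
  qed
qed (auto simp: indicator_def)

text \<open>For the three algebras the domination needed in \<open>wco_continuous_star_hom\<close> is obtained by cutting off
  the Schwartz functions. For \<open>C\<^sup>0\<close> the seminorm \<open>q'\<close> on \<open>N\<close> is compared with \<open>q' \<circ> cut N\<close> on \<open>X\<close>. For
  \<open>C\<^sup>0\<^sub>\<infinity>\<close> the inclusion goes the other way, and Schwartz functions on \<open>X\<close> are cut off to \<open>N\<close>; only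
  points of \<open>N\<close> matter, as \<open>a\<close> vanishes on the orbits outside \<open>N\<close>.\<close>

theorem restriction:
  assumes part: "lattice_partition \<Lambda> \<phi>"
  shows "star_restricts \<Lambda> \<phi> \<Theta> X \<Phi> N"
proof -
  let ?Y = "subtopology X N"
  interpret N: open_flow ?Y \<Phi> N K by (rule open_flow_N)
  have cid: "continuous_map ?Y X id" by (simp add: continuous_map_from_subtopology)
  have idem: "(indicator N y :: complex) = 0 \<or> (indicator N y :: complex) = 1" for y by (auto simp: indicator_def)
  note mor = pullback_morphism(1)[OF cid, of \<Phi> \<Phi>, unfolded topspace_N] pullback_morphism(2)[OF cid, of \<Phi> \<Phi>, unfolded topspace_N]
  have cut0: "\<exists>\<eta> Kc. continuous_map X euclidean \<eta> \<and> compactin X Kc \<and> Kc \<subseteq> N \<and> (\<forall>y. y \<notin> Kc \<longrightarrow> \<eta> y = 0) \<and> (\<forall>y. cmod (\<eta> y) \<le> 1) \<and> (\<forall>y\<in>L. \<eta> y = 1)"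
    if "compactin X L" "L \<subseteq> N" for L
    using cutoff[OF that] by metis
  have i1: "act (C0 ?Y \<Phi>) v (wco (indicator N) id f) = wco (indicator N) id (act (C0 X \<Phi>) v f)"
    "act (C0b ?Y \<Phi>) v (wco (indicator N) id f) = wco (indicator N) id (act (C0b X \<Phi>) v f)" for v f
    using flow_N N_sub by (auto simp: wco_def fun_eq_iff indicator_def)
  have i2: "act (C0inf X \<Phi>) v (wco (indicator N) id f) = wco (indicator N) id (act (C0inf ?Y \<Phi>) v f)" for v f
    using flow_N flow_outside_N N_sub by (auto simp: wco_def fun_eq_iff indicator_def)
  note fN = N.flow_system_C0 N.flow_system_C0b flow_system_C0inf
  have "continuous_star_hom \<Lambda> \<phi> \<Theta> (C0 X \<Phi>) (C0 ?Y \<Phi>) (wco (indicator N) id)"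
  proof (rule wco_continuous_star_hom[OF mor(1) idem i1(1)])
    fix q' assume q': "q' \<in> qnorms (C0 ?Y \<Phi>)"
    define q where "q f = q' (wco (indicator N) id f)" for f
    have q: "q \<in> qnorms (C0 X \<Phi>)"
      using cstar_seminorm_pullback[OF mor(1) idem q'] by (simp add: q_def[abs_def])
    obtain L where L: "compactin ?Y L" "\<And>f g. f \<in> C0_carrier ?Y \<Longrightarrow> g \<in> C0_carrier ?Y \<Longrightarrow> (\<forall>y\<in>L. f y = g y) \<Longrightarrow> q' f = q' g"
      using continuous_cstar_seminorm_compact_support[OF q'] by metis
    have "compactin X L" "L \<subseteq> N" using L(1) by (auto simp: compactin_subtopology)
    from cut0[OF this] obtain \<eta> Kc where \<eta>: "continuous_map X euclidean \<eta>" "compactin X Kc" "Kc \<subseteq> N" "\<forall>y. y \<notin> Kc \<longrightarrow> \<eta> y = 0"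
        "\<forall>y. cmod (\<eta> y) \<le> 1" "\<forall>y\<in>L. \<eta> y = 1" by (elim exE conjE)
    note \<eta>' = \<eta>(4,5)[rule_format]
    interpret m: wco_morphism "C0 ?Y \<Phi>" ?Y \<Phi> "{L. compactin ?Y L}" "C0 X \<Phi>" X \<Phi> "{L. compactin X L}" \<eta> id
      by (rule cutoff_morphism(1)[OF \<eta>(1-3) \<eta>'])
    have key: "q (wco (\<lambda>n. cnj (\<eta> n) * \<eta> n) id h) = q' h" if h: "h \<in> C0_carrier ?Y" for h
    proof -
      have eq: "wco (indicator N) id (wco (\<lambda>n. cnj (\<eta> n) * \<eta> n) id h) = (\<lambda>n. (cnj (\<eta> n) * \<eta> n) * h n)"
        using \<eta>(3) \<eta>'(1) by (auto simp: wco_def fun_eq_iff indicator_def)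
      have "continuous_map ?Y euclidean (\<lambda>n. cnj (\<eta> n) * \<eta> n)"
      proof (rule continuous_map_complex_mult)
        show c: "continuous_map ?Y euclidean \<eta>" using \<eta>(1) by (rule continuous_map_from_subtopology)
        then show "continuous_map ?Y euclidean (\<lambda>n. cnj (\<eta> n))" by (simp add: continuous_map_atin tendsto_cnj)
      qed
      from C0_carrier_mult[OF h this]
      show ?thesis unfolding q_def eq using h by (intro L(2)) (auto simp: \<eta>(6))
    qed
    have "deformed_norm \<Lambda> \<phi> \<Theta> (C0 ?Y \<Phi>) q' (wco (indicator N) id (g - f)) \<le> deformed_norm \<Lambda> \<phi> \<Theta> (C0 X \<Phi>) q (g - f)"
      if fg: "f \<in> smooth_part (C0 X \<Phi>)" "g \<in> smooth_part (C0 X \<Phi>)" for f g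
    proof (rule deformed_norm_leI)
      let ?a = "wco (indicator N) id (g - f)"
      have "wco (indicator N) id a \<in> smooth_part (C0 ?Y \<Phi>)" if "a \<in> smooth_part (C0 X \<Phi>)" for a
        by (rule wco_morphism.wco_smooth_part[OF mor(1) i1(1) that])
      then have "flow_system.wsmooth (C0 ?Y \<Phi>) ?Y (wco (indicator N) id g - wco (indicator N) id f)"
        using fg by (intro flow_system.wsmooth_diff[OF fN(1)] flow_system.smooth_part_wsmooth[OF fN(1)]) blast+
      then have ws: "flow_system.wsmooth (C0 ?Y \<Phi>) ?Y ?a"
        unfolding wco_morphism.wco_diff[OF mor(1)] .
      fix k assume k: "k \<in> schwartz (C0 ?Y \<Phi>)" "module_norm q' k \<le> 1"
      let ?F = "\<lambda>v. act (C0 X \<Phi>) v (g - f)" and ?F' = "\<lambda>v. act (C0 ?Y \<Phi>) v ?a"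
      let ?k = "\<lambda>v. wco \<eta> id (k v)"
      have e: "Cu_star \<Lambda> \<phi> \<Theta> ?F ?k = (\<lambda>x. wco \<eta> id (Cu_star \<Lambda> \<phi> \<Theta> ?F' k x))"
      proof (rule Cu_star_wco)
        fix n v assume "\<eta> n \<noteq> 0"
        then have "n \<in> N" using \<eta>(3) \<eta>'(1) by blast
        then show "?F v n = ?F' v (id n)" unfolding i1 using N_sub by (auto simp: wco_def)
      qed
      note C0c = module_inner_C0[OF fN(1) N.first_countable part ws k(1)]
      have "module_norm q ?k = module_norm q' k"
        unfolding module_norm_def module_inner_wco key[OF C0c(1)] by (rule refl)
      moreover have "module_norm q (Cu_star \<Lambda> \<phi> \<Theta> ?F ?k) = module_norm q' (Cu_star \<Lambda> \<phi> \<Theta> ?F' k)"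
        unfolding module_norm_def e module_inner_wco key[OF C0c(2)] by (rule refl)
      ultimately show "ereal (module_norm q' (Cu_star \<Lambda> \<phi> \<Theta> ?F' k)) \<le> deformed_norm \<Lambda> \<phi> \<Theta> (C0 X \<Phi>) q (g - f)"
        using deformed_norm_upper[OF m.wco_schwartz[OF k(1)], of q \<Lambda> \<phi> \<Theta> "g - f"] k(2) by simp
    qed
    with q show "\<exists>q\<in>qnorms (C0 X \<Phi>). \<forall>f\<in>smooth_part (C0 X \<Phi>). \<forall>g\<in>smooth_part (C0 X \<Phi>).
        deformed_norm \<Lambda> \<phi> \<Theta> (C0 ?Y \<Phi>) q' (wco (indicator N) id (g - f)) \<le> deformed_norm \<Lambda> \<phi> \<Theta> (C0 X \<Phi>) q (g - f)" by blast
  qed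
  moreover have "continuous_star_hom \<Lambda> \<phi> \<Theta> (C0b X \<Phi>) (C0b ?Y \<Phi>) (wco (indicator N) id)"
  proof (rule wco_continuous_star_hom[OF mor(2) idem i1(2)])
    fix q' assume "q' \<in> qnorms (C0b ?Y \<Phi>)"
    then have q': "q' = sup_seminorm (topspace ?Y)" by (simp add: C0b_def)
    have m: "sup_seminorm (topspace X) \<in> qnorms (C0b X \<Phi>)" by (simp add: C0b_def)
    have "deformed_norm \<Lambda> \<phi> \<Theta> (C0b ?Y \<Phi>) (sup_seminorm (topspace ?Y)) (wco (indicator N) id (g - f))
        \<le> deformed_norm \<Lambda> \<phi> \<Theta> (C0b X \<Phi>) (sup_seminorm (topspace X)) (g - f)"
      if fg: "f \<in> smooth_part (C0b X \<Phi>)" "g \<in> smooth_part (C0b X \<Phi>)" for f g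
    proof (rule supnorm_domination[OF fN(2) part])
      have "wco (indicator N) id a \<in> smooth_part (C0b ?Y \<Phi>)" if "a \<in> smooth_part (C0b X \<Phi>)" for a
        by (rule wco_morphism.wco_smooth_part[OF mor(2) i1(2) that])
      then have "flow_system.wsmooth (C0b ?Y \<Phi>) ?Y (wco (indicator N) id g - wco (indicator N) id f)"
        using fg by (intro flow_system.wsmooth_diff[OF fN(2)] flow_system.smooth_part_wsmooth[OF fN(2)]) blast+
      then show "flow_system.wsmooth (C0b ?Y \<Phi>) ?Y (wco (indicator N) id (g - f))"
        unfolding wco_morphism.wco_diff[OF mor(2)] .
      have c: "\<exists>\<eta>. wco_morphism (C0b ?Y \<Phi>) ?Y \<Phi> {topspace ?Y} (C0b X \<Phi>) X \<Phi> {topspace X} \<eta> id \<and>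
        (\<forall>n v. \<eta> n \<noteq> 0 \<longrightarrow> act (C0b X \<Phi>) v (g - f) n = act (C0b ?Y \<Phi>) v (wco (indicator N) id (g - f)) n) \<and> (\<forall>y\<in>L. \<eta> y = 1)"
        if L: "compactin X L" "L \<subseteq> N" for L
      proof -
        from cut0[OF L] obtain \<eta> Kc where \<eta>: "continuous_map X euclidean \<eta>" "compactin X Kc" "Kc \<subseteq> N" "\<forall>y. y \<notin> Kc \<longrightarrow> \<eta> y = 0"
          "\<forall>y. cmod (\<eta> y) \<le> 1" "\<forall>y\<in>L. \<eta> y = 1" by (elim exE conjE)
        note \<eta>' = \<eta>(4,5)[rule_format]
        have "act (C0b X \<Phi>) v (g - f) n = act (C0b ?Y \<Phi>) v (wco (indicator N) id (g - f)) n" if "\<eta> n \<noteq> 0" for n v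
        proof -
          have "n \<in> N" using that \<eta>(3) \<eta>'(1) by blast
          then show ?thesis unfolding i1 using N_sub by (auto simp: wco_def)
        qed
        with cutoff_morphism(2)[OF \<eta>(1-3) \<eta>'] \<eta>(6) show ?thesis by blast
      qed
      show "\<exists>\<eta>. wco_morphism (C0b ?Y \<Phi>) ?Y \<Phi> {topspace ?Y} (C0b X \<Phi>) X \<Phi> {topspace X} \<eta> id \<and>
        (\<forall>n v. \<eta> n \<noteq> 0 \<longrightarrow> act (C0b X \<Phi>) v (g - f) n = act (C0b ?Y \<Phi>) v (wco (indicator N) id (g - f)) n)"
        using c[OF compactin_empty empty_subsetI] by blast
      fix n0 assume "n0 \<in> topspace ?Y"
      then have "n0 \<in> N" by simp
      then show "n0 \<in> topspace X \<and> (\<exists>\<eta>. wco_morphism (C0b ?Y \<Phi>) ?Y \<Phi> {topspace ?Y} (C0b X \<Phi>) X \<Phi> {topspace X} \<eta> id \<and>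
        (\<forall>n v. \<eta> n \<noteq> 0 \<longrightarrow> act (C0b X \<Phi>) v (g - f) n = act (C0b ?Y \<Phi>) v (wco (indicator N) id (g - f)) n) \<and> \<eta> n0 = 1)"
      proof -
        have L: "compactin X {n0}" "{n0} \<subseteq> N" using \<open>n0 \<in> N\<close> N_sub by auto
        show ?thesis using c[OF L] \<open>n0 \<in> N\<close> N_sub unfolding topspace_N by blast
      qed
    qed
    with m show "\<exists>q\<in>qnorms (C0b X \<Phi>). \<forall>f\<in>smooth_part (C0b X \<Phi>). \<forall>g\<in>smooth_part (C0b X \<Phi>).
        deformed_norm \<Lambda> \<phi> \<Theta> (C0b ?Y \<Phi>) q' (wco (indicator N) id (g - f)) \<le> deformed_norm \<Lambda> \<phi> \<Theta> (C0b X \<Phi>) q (g - f)"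
      unfolding q' by blast
  qed
  moreover have "continuous_star_hom \<Lambda> \<phi> \<Theta> (C0inf ?Y \<Phi>) (C0inf X \<Phi>) (wco (indicator N) id)"
  proof (rule wco_continuous_star_hom[OF inclusion_morphism idem i2])
    fix q' assume "q' \<in> qnorms (C0inf X \<Phi>)"
    then have q': "q' = sup_seminorm (topspace X)" by (simp add: C0inf_def)
    have m: "sup_seminorm (topspace ?Y) \<in> qnorms (C0inf ?Y \<Phi>)" by (simp add: C0inf_def)
    have "deformed_norm \<Lambda> \<phi> \<Theta> (C0inf X \<Phi>) (sup_seminorm (topspace X)) (wco (indicator N) id (g - f))
        \<le> deformed_norm \<Lambda> \<phi> \<Theta> (C0inf ?Y \<Phi>) (sup_seminorm (topspace ?Y)) (g - f)"
      if fg: "f \<in> smooth_part (C0inf ?Y \<Phi>)" "g \<in> smooth_part (C0inf ?Y \<Phi>)" for f g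
    proof (rule supnorm_domination[OF fN(3) part])
      have "wco (indicator N) id a \<in> smooth_part (C0inf X \<Phi>)" if "a \<in> smooth_part (C0inf ?Y \<Phi>)" for a
        by (rule wco_morphism.wco_smooth_part[OF inclusion_morphism i2 that])
      then have "flow_system.wsmooth (C0inf X \<Phi>) X (wco (indicator N) id g - wco (indicator N) id f)"
        using fg by (intro flow_system.wsmooth_diff[OF fN(3)] flow_system.smooth_part_wsmooth[OF fN(3)]) blast+
      then show "flow_system.wsmooth (C0inf X \<Phi>) X (wco (indicator N) id (g - f))"
        unfolding wco_morphism.wco_diff[OF inclusion_morphism] .
      have c: "\<exists>\<eta>. wco_morphism (C0inf X \<Phi>) X \<Phi> {topspace X} (C0inf ?Y \<Phi>) ?Y \<Phi> {topspace ?Y} \<eta> id \<and>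
        (\<forall>n v. \<eta> n \<noteq> 0 \<longrightarrow> act (C0inf ?Y \<Phi>) v (g - f) n = act (C0inf X \<Phi>) v (wco (indicator N) id (g - f)) n) \<and> (\<forall>y\<in>L. \<eta> y = 1)"
        if L: "compactin X L" "L \<subseteq> N" for L
      proof -
        from cut0[OF L] obtain \<eta> Kc where \<eta>: "continuous_map X euclidean \<eta>" "compactin X Kc" "Kc \<subseteq> N" "\<forall>y. y \<notin> Kc \<longrightarrow> \<eta> y = 0"
          "\<forall>y. cmod (\<eta> y) \<le> 1" "\<forall>y\<in>L. \<eta> y = 1" by (elim exE conjE)
        note \<eta>' = \<eta>(4,5)[rule_format]
        have "act (C0inf ?Y \<Phi>) v (g - f) n = act (C0inf X \<Phi>) v (wco (indicator N) id (g - f)) n" if "\<eta> n \<noteq> 0" for n v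
        proof -
          have "n \<in> N" using that \<eta>(3) \<eta>'(1) by blast
          then show ?thesis unfolding i2 by (simp add: wco_def)
        qed
        with cutoff_morphism(3)[OF \<eta>(1-3) \<eta>'] \<eta>(6) show ?thesis by blast
      qed
      show "\<exists>\<eta>. wco_morphism (C0inf X \<Phi>) X \<Phi> {topspace X} (C0inf ?Y \<Phi>) ?Y \<Phi> {topspace ?Y} \<eta> id \<and>
        (\<forall>n v. \<eta> n \<noteq> 0 \<longrightarrow> act (C0inf ?Y \<Phi>) v (g - f) n = act (C0inf X \<Phi>) v (wco (indicator N) id (g - f)) n)"
        using c[OF compactin_empty empty_subsetI] by blast
      fix n0 assume n0: "n0 \<in> topspace X" "\<exists>v. act (C0inf X \<Phi>) v (wco (indicator N) id (g - f)) n0 \<noteq> 0"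
      have "n0 \<in> N" using n0(2) unfolding i2 by (auto simp: wco_def indicator_def split: if_splits)
      then show "n0 \<in> topspace ?Y \<and> (\<exists>\<eta>. wco_morphism (C0inf X \<Phi>) X \<Phi> {topspace X} (C0inf ?Y \<Phi>) ?Y \<Phi> {topspace ?Y} \<eta> id \<and>
        (\<forall>n v. \<eta> n \<noteq> 0 \<longrightarrow> act (C0inf ?Y \<Phi>) v (g - f) n = act (C0inf X \<Phi>) v (wco (indicator N) id (g - f)) n) \<and> \<eta> n0 = 1)"
      proof -
        have L: "compactin X {n0}" "{n0} \<subseteq> N" using \<open>n0 \<in> N\<close> N_sub by auto
        show ?thesis using c[OF L] \<open>n0 \<in> N\<close> N_sub unfolding topspace_N by blast
      qed
    qed
    with m show "\<exists>q\<in>qnorms (C0inf ?Y \<Phi>). \<forall>f\<in>smooth_part (C0inf ?Y \<Phi>). \<forall>g\<in>smooth_part (C0inf ?Y \<Phi>).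
        deformed_norm \<Lambda> \<phi> \<Theta> (C0inf X \<Phi>) q' (wco (indicator N) id (g - f)) \<le> deformed_norm \<Lambda> \<phi> \<Theta> (C0inf ?Y \<Phi>) q (g - f)"
      unfolding q' by blast
  qed
  moreover have "continuous_star_hom \<Lambda> \<phi> \<Theta> (C0inf ?Y \<Phi>) (C0inf X \<Phi>) id"
    if hom: "continuous_star_hom \<Lambda> \<phi> \<Theta> (C0inf ?Y \<Phi>) (C0inf X \<Phi>) (wco (indicator N) id)"
  proof -
    have eq: "wco (indicator N) id h = h" if "\<And>n. n \<notin> N \<Longrightarrow> h n = 0" for h
      using that by (auto simp: wco_def fun_eq_iff indicator_def)
    have out: "a n = 0" if "a \<in> smooth_part (C0inf ?Y \<Phi>)" "n \<notin> N" for a n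
    proof -
      have "a \<in> carr (C0inf ?Y \<Phi>)"
        using that(1) unfolding smooth_part_def smooth_vectors_def sup_system.topspace_alg_top[OF sup_system_C0inf] by simp
      from sup_system.carr_outside[OF sup_system_C0inf this] show ?thesis using that(2) by simp
    qed
    have e1: "wco (indicator N) id a = a" if "a \<in> smooth_part (C0inf ?Y \<Phi>)" for a
      by (rule eq) (rule out[OF that])
    have e2: "wco (indicator N) id (star \<Lambda> \<phi> \<Theta> (C0inf ?Y \<Phi>) a b) = star \<Lambda> \<phi> \<Theta> (C0inf ?Y \<Phi>) a b" for a b
      by (rule eq) (simp add: star_osc)
    have "star_hom \<Lambda> \<phi> \<Theta> (C0inf ?Y \<Phi>) (C0inf X \<Phi>) id"
      using hom unfolding continuous_star_hom_def star_hom_def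
      by (auto simp: e1 e2 image_iff)
    moreover have "continuous_map (deformed_top \<Lambda> \<phi> \<Theta> (C0inf ?Y \<Phi>)) (deformed_top \<Lambda> \<phi> \<Theta> (C0inf X \<Phi>)) id"
      using hom unfolding continuous_star_hom_def
      by (auto elim!: continuous_map_eq simp: deformed_top_def e1)
    ultimately show ?thesis by (simp add: continuous_star_hom_def)
  qed
  ultimately show ?thesis unfolding star_restricts_def cut_wco by blast
qed

end

section \<open>Charts, derivatives and one-parameter groups\<close>

text \<open>Continuous partial derivatives imply differentiability: the increment is a sum of increments along the coordinates, each controlled by the mean value theorem.\<close>

lemma has_derivative_from_directional:
  fixes f :: "'e::euclidean_space \<Rightarrow> 'f::real_normed_vector"
  assumes S: "open S" "x \<in> S"
    and der: "\<And>y b. y \<in> S \<Longrightarrow> b \<in> Basis \<Longrightarrow> ((\<lambda>t. f (y + t *\<^sub>R b)) has_vector_derivative D b y) (at 0)"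
    and cont: "\<And>b. b \<in> Basis \<Longrightarrow> continuous_on S (D b)"
  shows "(f has_derivative (\<lambda>h. \<Sum>b\<in>Basis. (h \<bullet> b) *\<^sub>R D b x)) (at x)"
  unfolding has_derivative_at_alt
proof (intro conjI allI impI)
  show "bounded_linear (\<lambda>h. \<Sum>b\<in>Basis. (h \<bullet> b) *\<^sub>R D b x)"
    by (intro bounded_linear_sum bounded_linear_scaleR_const bounded_linear_inner_left)
  fix e :: real assume e: "0 < e"
  define e' where "e' = e / DIM('e)"
  have e': "0 < e'" using e by (simp add: e'_def)
  have "\<forall>b\<in>Basis. \<exists>d>0. \<forall>y. dist y x < d \<longrightarrow> y \<in> S \<and> norm (D b y - D b x) \<le> e'"
  proof
    fix b :: 'e assume b: "b \<in> Basis"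
    obtain d1 where d1: "d1 > 0" "\<And>y. dist y x < d1 \<Longrightarrow> y \<in> S" using S by (meson open_dist)
    obtain d2 where d2: "d2 > 0" "\<And>y. y \<in> S \<Longrightarrow> dist y x < d2 \<Longrightarrow> dist (D b y) (D b x) < e'"
      using cont[OF b] S(2) e' unfolding continuous_on_iff by blast
    show "\<exists>d>0. \<forall>y. dist y x < d \<longrightarrow> y \<in> S \<and> norm (D b y - D b x) \<le> e'"
      using d1 d2 by (intro exI[of _ "min d1 d2"]) (auto simp: dist_norm intro: less_imp_le)
  qed
  then obtain d where d: "\<And>b. b \<in> Basis \<Longrightarrow> 0 < d b" "\<And>b y. b \<in> Basis \<Longrightarrow> dist y x < d b \<Longrightarrow> y \<in> S"
    "\<And>b y. b \<in> Basis \<Longrightarrow> dist y x < d b \<Longrightarrow> norm (D b y - D b x) \<le> e'" by metis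
  define \<delta> where "\<delta> = Min (d ` Basis)"
  have \<delta>: "0 < \<delta>" "\<And>b. b \<in> Basis \<Longrightarrow> \<delta> \<le> d b" using d(1) by (auto simp: \<delta>_def)
  show "\<exists>d>0. \<forall>y. norm (y - x) < d \<longrightarrow> norm (f y - f x - (\<Sum>b\<in>Basis. ((y - x) \<bullet> b) *\<^sub>R D b x)) \<le> e * norm (y - x)"
  proof (intro exI[of _ \<delta>] conjI allI impI \<delta>(1))
    fix y assume y: "norm (y - x) < \<delta>"
    define h where "h = y - x"
    have step: "norm (f (x + (\<Sum>b\<in>B. (h \<bullet> b) *\<^sub>R b)) - f x - (\<Sum>b\<in>B. (h \<bullet> b) *\<^sub>R D b x)) \<le> real (card B) * (e' * norm h)"
      if "finite B" "B \<subseteq> Basis" for B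
      using that
    proof (induction B rule: finite_induct)
      case (insert b B)
      have b: "b \<in> Basis" using insert.prems by simp
      define z where "z = x + (\<Sum>b\<in>B. (h \<bullet> b) *\<^sub>R b)"
      have near: "dist (z + t *\<^sub>R b) x < d b" if t: "\<bar>t\<bar> \<le> \<bar>h \<bullet> b\<bar>" for t
      proof -
        have "norm ((\<Sum>b\<in>B. (h \<bullet> b) *\<^sub>R b) + t *\<^sub>R b) \<le> norm h"
        proof (rule norm_le_componentwise)
          fix c :: 'e assume c: "c \<in> Basis"
          have "(\<Sum>b\<in>B. (h \<bullet> b) *\<^sub>R b) \<bullet> c = (\<Sum>b\<in>B. if b = c then h \<bullet> c else 0)"
            unfolding inner_sum_left using insert.prems c by (intro sum.cong refl) (auto simp: inner_Basis)
          also have "\<dots> = (if c \<in> B then h \<bullet> c else 0)" using insert.hyps(1) by simp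
          finally show "\<bar>((\<Sum>b\<in>B. (h \<bullet> b) *\<^sub>R b) + t *\<^sub>R b) \<bullet> c\<bar> \<le> \<bar>h \<bullet> c\<bar>"
            using insert.hyps(2) t b c by (auto simp: inner_add_left inner_Basis)
        qed
        then have "dist (z + t *\<^sub>R b) x \<le> norm h" by (simp add: z_def dist_norm add.assoc)
        also have "\<dots> < d b" using y \<delta>(2)[OF b] by (simp add: h_def)
        finally show ?thesis .
      qed
      define g where "g t = f (z + t *\<^sub>R b) - t *\<^sub>R D b x" for t
      have "norm (g (h \<bullet> b) - g 0) \<le> e' * norm (h \<bullet> b - 0)"
      proof (rule differentiable_bound[of "closed_segment 0 (h \<bullet> b)" g "\<lambda>t s. s *\<^sub>R (D b (z + t *\<^sub>R b) - D b x)"])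
        fix t assume "t \<in> closed_segment 0 (h \<bullet> b)"
        then have t: "\<bar>t\<bar> \<le> \<bar>h \<bullet> b\<bar>" by (auto simp: closed_segment_eq_real_ivl split: if_splits)
        have zS: "z + t *\<^sub>R b \<in> S" by (rule d(2)[OF b near[OF t]])
        have "((\<lambda>s. f ((z + t *\<^sub>R b) + s *\<^sub>R b)) has_vector_derivative D b (z + t *\<^sub>R b)) (at (t - t))"
          using der[OF zS b] by simp
        moreover have "((\<lambda>s. s - t) has_vector_derivative 1) (at t)"
          by (auto intro!: derivative_eq_intros)
        ultimately have "((\<lambda>s. f ((z + t *\<^sub>R b) + s *\<^sub>R b)) \<circ> (\<lambda>s. s - t) has_vector_derivative 1 *\<^sub>R D b (z + t *\<^sub>R b)) (at t)"
          using vector_diff_chain_at by blast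
        then have "((\<lambda>s. f (z + s *\<^sub>R b)) has_vector_derivative D b (z + t *\<^sub>R b)) (at t)"
          by (simp add: o_def algebra_simps)
        then have "(g has_vector_derivative (D b (z + t *\<^sub>R b) - D b x)) (at t)"
          unfolding g_def by (auto intro!: derivative_eq_intros)
        then show "(g has_derivative (\<lambda>s. s *\<^sub>R (D b (z + t *\<^sub>R b) - D b x))) (at t within closed_segment 0 (h \<bullet> b))"
          unfolding has_vector_derivative_def by (rule has_derivative_at_withinI)
        show "onorm (\<lambda>s. s *\<^sub>R (D b (z + t *\<^sub>R b) - D b x)) \<le> e'"
          using d(3)[OF b near[OF t]] by (intro onorm_le) (simp, metis mult.commute mult_left_mono abs_ge_zero)
      qed auto
      also have "\<dots> \<le> e' * norm h" using e' Basis_le_norm[OF b, of h] by simp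
      finally have g: "norm (g (h \<bullet> b) - g 0) \<le> e' * norm h" .
      have "norm (f z - f x - (\<Sum>b\<in>B. (h \<bullet> b) *\<^sub>R D b x)) \<le> real (card B) * (e' * norm h)"
        using insert.IH insert.prems by (simp add: z_def)
      moreover have "f (x + (\<Sum>b\<in>insert b B. (h \<bullet> b) *\<^sub>R b)) - f x - (\<Sum>b\<in>insert b B. (h \<bullet> b) *\<^sub>R D b x)
          = (g (h \<bullet> b) - g 0) + (f z - f x - (\<Sum>b\<in>B. (h \<bullet> b) *\<^sub>R D b x))"
        using insert.hyps by (simp add: g_def z_def algebra_simps)
      ultimately have "norm (f (x + (\<Sum>b\<in>insert b B. (h \<bullet> b) *\<^sub>R b)) - f x - (\<Sum>b\<in>insert b B. (h \<bullet> b) *\<^sub>R D b x))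
          \<le> e' * norm h + real (card B) * (e' * norm h)"
        using g norm_triangle_le add_mono by metis
      then show ?case using insert.hyps by (simp add: algebra_simps)
    qed simp
    have "x + (\<Sum>b\<in>Basis. (h \<bullet> b) *\<^sub>R b) = y" by (simp add: euclidean_representation h_def)
    then have "norm (f y - f x - (\<Sum>b\<in>Basis. (h \<bullet> b) *\<^sub>R D b x)) \<le> real DIM('e) * (e' * norm h)"
      using step[OF finite_Basis subset_refl] by simp
    then show "norm (f y - f x - (\<Sum>b\<in>Basis. ((y - x) \<bullet> b) *\<^sub>R D b x)) \<le> e * norm (y - x)"
      by (simp add: h_def e'_def)
  qed
qed

lemma smooth_on_derivatives:
  fixes F :: "'e::euclidean_space \<Rightarrow> 'f::real_normed_vector"
  assumes "smooth_on S F"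
  shows "continuous_on S F"
    and "\<exists>D. (\<forall>b. continuous_on S (D b)) \<and> (\<forall>b. \<forall>y\<in>S. ((\<lambda>t. F (y + t *\<^sub>R b)) has_vector_derivative D b y) (at 0))"
proof -
  obtain D where D: "is_derivs euclidean S F D" using assms by (auto simp: smooth_on_def smooth_into_def)
  then have D0: "D [] = F" and Dc: "\<And>vs. continuous_map (top_of_set S) euclidean (D vs)"
    and Dd: "\<And>vs v x. x \<in> S \<Longrightarrow> limitin euclidean (\<lambda>t. (D vs (x + t *\<^sub>R v) - D vs x) /\<^sub>R t) (D (v # vs) x) (at 0)"
    unfolding is_derivs_def by simp_all
  show "continuous_on S F" using Dc[of "[]"] D0 by simp
  have "((\<lambda>t. F (y + t *\<^sub>R b)) has_vector_derivative D [b] y) (at 0)" if "y \<in> S" for b y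
    using Dd[OF that, of "[]" b] unfolding D0 has_vector_derivative_iff_quotient[of F] by simp
  moreover have "continuous_on S (D [b])" for b using Dc[of "[b]"] by simp
  ultimately show "\<exists>D. (\<forall>b. continuous_on S (D b)) \<and> (\<forall>b. \<forall>y\<in>S. ((\<lambda>t. F (y + t *\<^sub>R b)) has_vector_derivative D b y) (at 0))"
    by (intro exI[of _ "\<lambda>b. D [b]"]) blast
qed

lemma smooth_on_frechet:
  fixes F :: "'e::euclidean_space \<Rightarrow> 'f::real_normed_vector"
  assumes S: "open S" and F: "smooth_on S F"
  shows "x \<in> S \<Longrightarrow> (F has_derivative frechet_derivative F (at x)) (at x)"
    and "continuous_on (S \<times> UNIV) (\<lambda>(y, u). frechet_derivative F (at y) u)"
proof -
  obtain D where D: "\<And>b. continuous_on S (D b)"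
    "\<And>b y. y \<in> S \<Longrightarrow> ((\<lambda>t. F (y + t *\<^sub>R b)) has_vector_derivative D b y) (at 0)"
    using smooth_on_derivatives(2)[OF F] by metis
  have d: "(F has_derivative (\<lambda>h. \<Sum>b\<in>Basis. (h \<bullet> b) *\<^sub>R D b x)) (at x)" if "x \<in> S" for x
    by (rule has_derivative_from_directional[OF S that D(2) D(1)])
  have eq: "frechet_derivative F (at x) = (\<lambda>h. \<Sum>b\<in>Basis. (h \<bullet> b) *\<^sub>R D b x)" if "x \<in> S" for x
    by (rule frechet_derivative_at[OF d[OF that], symmetric])
  show "(F has_derivative frechet_derivative F (at x)) (at x)" if "x \<in> S"
    using d[OF that] eq[OF that] by simp
  have "continuous_on (S \<times> UNIV) (\<lambda>z. \<Sum>b\<in>Basis. (snd z \<bullet> b) *\<^sub>R D b (fst z))"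
    by (intro continuous_intros continuous_on_compose2[OF D(1)]) auto
  then show "continuous_on (S \<times> UNIV) (\<lambda>(y, u). frechet_derivative F (at y) u)"
    by (rule continuous_on_eq) (auto simp: eq)
qed

text \<open>The conditions on an atlas under which the chart topology has the expected properties; fibre and tangent atlases satisfy them.\<close>

definition cont_atlas :: "('a, 'e::euclidean_space) chart set \<Rightarrow> bool" where
  "cont_atlas A \<longleftrightarrow> (\<forall>c\<in>A. inj_on (snd c) (fst c)) \<and>
     (\<forall>c\<in>A. \<forall>d\<in>A. open (snd c ` (fst c \<inter> fst d)) \<and>
        continuous_on (snd c ` (fst c \<inter> fst d)) (snd d \<circ> chart_inv c))"

lemma smooth_atlas_cont_atlas: "smooth_atlas A \<Longrightarrow> cont_atlas A"
  unfolding smooth_atlas_def cont_atlas_def by (blast intro: smooth_on_derivatives(1))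

lemma chart_inv_left: "inj_on (snd c) (fst c) \<Longrightarrow> x \<in> fst c \<Longrightarrow> chart_inv c (snd c x) = x"
  by (simp add: chart_inv_def)

lemma chart_inv_right: "u \<in> snd c ` fst c \<Longrightarrow> snd c (chart_inv c u) = u"
  by (simp add: chart_inv_def f_inv_into_f)

lemma chart_inv_in: "u \<in> snd c ` fst c \<Longrightarrow> chart_inv c u \<in> fst c"
  by (simp add: chart_inv_def inv_into_into)

context
  fixes A :: "('a, 'e::euclidean_space) chart set"
  assumes A: "cont_atlas A"
begin

lemma cont_atlas_inj: "c \<in> A \<Longrightarrow> inj_on (snd c) (fst c)"
  using A by (simp add: cont_atlas_def)

lemma openin_cont_atlas: "openin (atlas_top A) W \<longleftrightarrow> W \<subseteq> atlas_space A \<and> (\<forall>c\<in>A. open (snd c ` (W \<inter> fst c)))"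
  by (rule openin_atlas_top) (use cont_atlas_inj in blast)

lemma openin_chart: "c \<in> A \<Longrightarrow> openin (atlas_top A) (fst c)"
  using A unfolding openin_cont_atlas cont_atlas_def atlas_space_def by (auto simp: Int_commute)

lemma topspace_atlas_top: "topspace (atlas_top A) = atlas_space A"
proof
  show "topspace (atlas_top A) \<subseteq> atlas_space A"
    using openin_topspace[of "atlas_top A"] unfolding openin_cont_atlas by blast
  show "atlas_space A \<subseteq> topspace (atlas_top A)"
    unfolding atlas_space_def using openin_subset[OF openin_chart] by blast
qed

lemma openin_chart_preimage:
  assumes c: "c \<in> A" and O: "open O'"
  shows "openin (atlas_top A) {x \<in> fst c. snd c x \<in> O'}"
  unfolding openin_cont_atlas
proof (intro conjI ballI)
  show "{x \<in> fst c. snd c x \<in> O'} \<subseteq> atlas_space A" using c by (auto simp: atlas_space_def)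
  fix d assume d: "d \<in> A"
  let ?S = "snd d ` (fst d \<inter> fst c)"
  have "snd d ` ({x \<in> fst c. snd c x \<in> O'} \<inter> fst d) = {u \<in> ?S. (snd c \<circ> chart_inv d) u \<in> O'}"
    using chart_inv_left[OF cont_atlas_inj[OF d]] by force
  also have "open \<dots>"
  proof -
    have "open ?S" "continuous_on ?S (snd c \<circ> chart_inv d)" using A c d by (auto simp: cont_atlas_def)
    from continuous_open_preimage[OF this(2,1) O] show ?thesis by (simp add: vimage_def Int_def)
  qed
  finally show "open (snd d ` ({x \<in> fst c. snd c x \<in> O'} \<inter> fst d))" .
qed

lemma continuous_chart:
  assumes "c \<in> A"
  shows "continuous_map (subtopology (atlas_top A) (fst c)) euclidean (snd c)"
  unfolding continuous_map_def
proof (intro conjI allI impI)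
  fix U :: "'e set" assume "openin euclidean U"
  then have "openin (atlas_top A) {x \<in> fst c. snd c x \<in> U}" using openin_chart_preimage[OF assms] by simp
  then show "openin (subtopology (atlas_top A) (fst c)) {x \<in> topspace (subtopology (atlas_top A) (fst c)). snd c x \<in> U}"
    using openin_subset[OF openin_chart[OF assms]] by (auto simp: openin_subtopology intro!: exI[of _ "{x \<in> fst c. snd c x \<in> U}"])
qed auto

lemma continuous_chart_inv:
  assumes "c \<in> A"
  shows "continuous_map (top_of_set (snd c ` fst c)) (atlas_top A) (chart_inv c)"
  unfolding continuous_map_def
proof (intro conjI allI impI)
  show "chart_inv c \<in> topspace (top_of_set (snd c ` fst c)) \<rightarrow> topspace (atlas_top A)"
  proof
    fix u assume "u \<in> topspace (top_of_set (snd c ` fst c))"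
    then have "chart_inv c u \<in> fst c" by (intro chart_inv_in) simp
    then show "chart_inv c u \<in> topspace (atlas_top A)" using assms unfolding topspace_atlas_top atlas_space_def by blast
  qed
  fix W assume "openin (atlas_top A) W"
  then have "open (snd c ` (W \<inter> fst c))" using assms by (simp add: openin_cont_atlas)
  moreover have "{u \<in> topspace (top_of_set (snd c ` fst c)). chart_inv c u \<in> W} = snd c ` (W \<inter> fst c)"
    using chart_inv_left[OF cont_atlas_inj[OF assms]] by auto
  ultimately show "openin (top_of_set (snd c ` fst c)) {u \<in> topspace (top_of_set (snd c ` fst c)). chart_inv c u \<in> W}"
    by (auto simp: openin_open)
qed

lemma locally_compact_atlas_top: "locally_compact_space (atlas_top A)"
  unfolding locally_compact_space_def topspace_atlas_top
proof
  fix x assume "x \<in> atlas_space A"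
  then obtain c where c: "c \<in> A" "x \<in> fst c" by (auto simp: atlas_space_def)
  have "open (snd c ` fst c)" using A c(1) unfolding cont_atlas_def by (metis Int_absorb)
  then obtain r where r: "r > 0" "cball (snd c x) r \<subseteq> snd c ` fst c"
    using c(2) open_contains_cball by (metis imageI)
  let ?U = "{y \<in> fst c. snd c y \<in> ball (snd c x) r}" and ?K = "chart_inv c ` cball (snd c x) r"
  have "compactin (top_of_set (snd c ` fst c)) (cball (snd c x) r)"
    using r(2) by (simp add: compactin_subtopology)
  then have "compactin (atlas_top A) ?K" by (rule image_compactin[OF _ continuous_chart_inv[OF c(1)]])
  moreover have "openin (atlas_top A) ?U" by (rule openin_chart_preimage[OF c(1)]) simp
  moreover have "?U \<subseteq> ?K"
  proof
    fix y assume y: "y \<in> ?U"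
    then have "y = chart_inv c (snd c y)" using chart_inv_left[OF cont_atlas_inj[OF c(1)]] by simp
    with y show "y \<in> ?K" by (metis (mono_tags, lifting) ball_subset_cball imageI mem_Collect_eq subsetD)
  qed
  ultimately show "\<exists>U K. openin (atlas_top A) U \<and> compactin (atlas_top A) K \<and> x \<in> U \<and> U \<subseteq> K"
    using c(2) r(1) by (intro exI[of _ ?U] exI[of _ ?K]) auto
qed

end

text \<open>The derivative of \<open>\<psi> (- t) (\<gamma> t)\<close> is \<open>D\<psi>\<^bsub>-t\<^esub> (\<gamma>' t) - X (\<psi>\<^bsub>-t\<^esub> (\<gamma> t))\<close>, which vanishes since
  \<open>D\<psi>\<^bsub>-t\<^esub>\<close> maps \<open>X\<close> to itself. This gives uniqueness of integral curves without a Lipschitz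
  argument; the constant curve at a zero of \<open>X\<close> is a special case.\<close>

lemma flow_generator:
  fixes \<psi> :: "real \<Rightarrow> 'e::euclidean_space \<Rightarrow> 'e"
  assumes diff: "\<And>z. (\<lambda>z. \<psi> (fst z) (snd z)) differentiable (at z)"
    and zero: "\<And>u. \<psi> 0 u = u" and add: "\<And>s t u. \<psi> (s + t) u = \<psi> s (\<psi> t u)"
  defines "X \<equiv> (\<lambda>u. vector_derivative (\<lambda>t. \<psi> t u) (at 0))"
  shows "((\<lambda>t. \<psi> t u) has_vector_derivative X (\<psi> t u)) (at t)"
    and "(\<gamma> has_vector_derivative X (\<gamma> t)) (at t) \<Longrightarrow> ((\<lambda>t. \<psi> (- t) (\<gamma> t)) has_vector_derivative 0) (at t)"
    and "X u = 0 \<Longrightarrow> \<psi> t u = u"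
proof -
  have curve: "((\<lambda>s. \<psi> (a s) (b s)) has_vector_derivative L (a', b')) (at s)"
    if L: "((\<lambda>z. \<psi> (fst z) (snd z)) has_derivative L) (at (a s, b s))"
      and a: "(a has_vector_derivative a') (at s)" and b: "(b has_vector_derivative b') (at s)" for a b a' b' s L
  proof -
    have "((\<lambda>s. (a s, b s)) has_derivative (\<lambda>h. (h *\<^sub>R a', h *\<^sub>R b'))) (at s)"
      using a b unfolding has_vector_derivative_def by (rule has_derivative_Pair)
    from has_derivative_compose[OF this, of "\<lambda>z. \<psi> (fst z) (snd z)" L] L
    have "((\<lambda>s. \<psi> (a s) (b s)) has_derivative (\<lambda>h. L (h *\<^sub>R a', h *\<^sub>R b'))) (at s)" by simp
    moreover have "L (h *\<^sub>R a', h *\<^sub>R b') = h *\<^sub>R L (a', b')" for h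
      using linear_scale[OF has_derivative_linear[OF L], of h "(a', b')"] by simp
    ultimately show ?thesis unfolding has_vector_derivative_def by simp
  qed
  have ex: "\<exists>L. ((\<lambda>z. \<psi> (fst z) (snd z)) has_derivative L) (at z)" for z using diff by (auto simp: differentiable_def)
  have at0: "((\<lambda>t. \<psi> t u) has_vector_derivative X u) (at 0)" for u
  proof -
    obtain L where L: "((\<lambda>z. \<psi> (fst z) (snd z)) has_derivative L) (at (0, u))" using ex by blast
    have "((\<lambda>t. \<psi> t u) has_vector_derivative L (1, 0)) (at 0)"
      by (rule curve[where a = "\<lambda>t. t" and b = "\<lambda>t. u"]) (use L in \<open>auto intro!: derivative_eq_intros\<close>)
    then show ?thesis unfolding X_def by (simp add: vector_derivative_works[symmetric] differentiableI_vector)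
  qed
  have shift: "((\<lambda>s. \<psi> s u) has_vector_derivative X (\<psi> t u)) (at t)" for t u
  proof -
    have "((\<lambda>s. \<psi> s (\<psi> t u)) has_vector_derivative X (\<psi> t u)) (at (t - t))" using at0 by simp
    moreover have "((\<lambda>s. s - t) has_vector_derivative 1) (at t)" by (auto intro!: derivative_eq_intros)
    ultimately have "((\<lambda>s. \<psi> s (\<psi> t u)) \<circ> (\<lambda>s. s - t) has_vector_derivative 1 *\<^sub>R X (\<psi> t u)) (at t)"
      using vector_diff_chain_at by blast
    then show ?thesis by (simp add: o_def add[symmetric])
  qed
  then show "((\<lambda>t. \<psi> t u) has_vector_derivative X (\<psi> t u)) (at t)" .
  show main: "((\<lambda>t. \<psi> (- t) (\<gamma> t)) has_vector_derivative 0) (at t)"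
    if g: "(\<gamma> has_vector_derivative X (\<gamma> t)) (at t)" for \<gamma> t
  proof -
    let ?w = "\<gamma> t"
    obtain L where L: "((\<lambda>z. \<psi> (fst z) (snd z)) has_derivative L) (at (- t, ?w))" using ex by blast
    have 1: "((\<lambda>t. \<psi> (- t) (\<gamma> t)) has_vector_derivative L (- 1, X ?w)) (at t)"
      by (rule curve[where a = "\<lambda>t. - t" and b = \<gamma>]) (use L g in \<open>auto intro!: derivative_eq_intros\<close>)
    have "((\<lambda>s. \<psi> s ?w) has_vector_derivative L (1, 0)) (at (- t))"
      by (rule curve[where a = "\<lambda>t. t" and b = "\<lambda>t. ?w"]) (use L in \<open>auto intro!: derivative_eq_intros\<close>)
    then have 2: "L (1, 0) = X (\<psi> (- t) ?w)" using shift by (rule vector_derivative_unique_at)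
    have "((\<lambda>s. \<psi> (- t) (\<psi> s ?w)) has_vector_derivative L (0, X ?w)) (at 0)"
      by (rule curve[where a = "\<lambda>s. - t" and b = "\<lambda>s. \<psi> s ?w"]) (use L zero at0 in \<open>auto intro!: derivative_eq_intros\<close>)
    moreover have "\<psi> (- t) (\<psi> s ?w) = \<psi> s (\<psi> (- t) ?w)" for s by (simp add: add[symmetric] add.commute)
    ultimately have "((\<lambda>s. \<psi> s (\<psi> (- t) ?w)) has_vector_derivative L (0, X ?w)) (at 0)" by simp
    then have 3: "L (0, X ?w) = X (\<psi> (- t) ?w)" using at0 by (rule vector_derivative_unique_at)
    have "L (- 1, X ?w) = L (0, X ?w) - L (1, 0)"
      using linear_diff[OF has_derivative_linear[OF L], of "(0, X ?w)" "(1, 0)"] by simp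
    then show ?thesis using 1 2 3 by simp
  qed
  show "\<psi> t u = u" if X0: "X u = 0"
  proof -
    have "((\<lambda>t. \<psi> (- t) u) has_vector_derivative 0) (at t)" for t
      by (rule main[where \<gamma> = "\<lambda>_. u"]) (simp add: X0)
    then have "((\<lambda>t. \<psi> (- t) u) has_derivative (\<lambda>h. 0)) (at t within UNIV)" for t
      by (simp add: has_vector_derivative_def)
    then obtain k where "\<And>t. \<psi> (- t) u = k"
      using has_derivative_zero_constant[of UNIV "\<lambda>t. \<psi> (- t) u"] by auto
    from this[of "- t"] this[of 0] show ?thesis using zero by simp
  qed
qed

section \<open>Tangent spaces and the tangent bundle\<close>

definition trans_deriv :: "'a \<Rightarrow> ('a, 'e::euclidean_space) chart \<Rightarrow> ('a, 'e) chart \<Rightarrow> 'e \<Rightarrow> 'e" where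
  "trans_deriv x d e = frechet_derivative (snd e \<circ> chart_inv d) (at (snd d x))"

text \<open>The tangent vector with coordinates \<open>u\<close> in the chart \<open>d\<close>.\<close>

definition from_coord :: "('a, 'e::euclidean_space) chart set \<Rightarrow> 'a \<Rightarrow> ('a, 'e) chart \<Rightarrow> 'e \<Rightarrow> ('a, 'e) tvec" where
  "from_coord A x d u = (\<lambda>e. if e \<in> A \<and> x \<in> fst e then trans_deriv x d e u else 0)"

definition fibre_chart :: "('a, 'e::euclidean_space) chart set \<Rightarrow> 'a \<Rightarrow> ('a, 'e) chart \<Rightarrow> (('a, 'e) tvec, 'e) chart" where
  "fibre_chart A p d = (tspace A p, \<lambda>v. v d)"

definition tangent_chart :: "('a, 'e::euclidean_space) chart set \<Rightarrow> ('a, 'e) chart \<Rightarrow> (('a, 'e) tpoint, 'e \<times> 'e) chart" where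
  "tangent_chart A d = ({w \<in> tbundle A. fst w \<in> fst d}, \<lambda>w. (snd d (fst w), snd w d))"

lemma fst_fibre_chart [simp]: "fst (fibre_chart A p d) = tspace A p"
  and snd_fibre_chart [simp]: "snd (fibre_chart A p d) = (\<lambda>v. v d)"
  by (simp_all add: fibre_chart_def)

lemma fst_tangent_chart [simp]: "fst (tangent_chart A d) = {w \<in> tbundle A. fst w \<in> fst d}"
  and snd_tangent_chart [simp]: "snd (tangent_chart A d) = (\<lambda>w. (snd d (fst w), snd w d))"
  by (simp_all add: tangent_chart_def)

lemma fibre_atlas_eq: "fibre_atlas A p = fibre_chart A p ` {c \<in> A. p \<in> fst c}"
  by (simp add: fibre_atlas_def fibre_chart_def)

lemma tangent_atlas_eq: "tangent_atlas A = tangent_chart A ` A"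
  by (simp add: tangent_atlas_def tangent_chart_def)

locale atlas =
  fixes A :: "('a, 'e::euclidean_space) chart set"
  assumes smooth: "smooth_atlas A"
begin

lemma inj: "c \<in> A \<Longrightarrow> inj_on (snd c) (fst c)"
  using smooth by (simp add: smooth_atlas_def)

lemma open_overlap: "c \<in> A \<Longrightarrow> d \<in> A \<Longrightarrow> open (snd c ` (fst c \<inter> fst d))"
  using smooth by (simp add: smooth_atlas_def)

lemma smooth_overlap: "c \<in> A \<Longrightarrow> d \<in> A \<Longrightarrow> smooth_on (snd c ` (fst c \<inter> fst d)) (snd d \<circ> chart_inv c)"
  using smooth by (simp add: smooth_atlas_def)

lemma cont: "cont_atlas A"
  by (rule smooth_atlas_cont_atlas[OF smooth])

lemma inv_left: "c \<in> A \<Longrightarrow> x \<in> fst c \<Longrightarrow> chart_inv c (snd c x) = x"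
  by (rule chart_inv_left[OF inj])

lemma trans_has_derivative:
  assumes "d \<in> A" "e \<in> A" "x \<in> fst d" "x \<in> fst e"
  shows "((snd e \<circ> chart_inv d) has_derivative trans_deriv x d e) (at (snd d x))"
  unfolding trans_deriv_def
  by (rule smooth_on_frechet(1)[OF open_overlap[OF assms(1,2)] smooth_overlap[OF assms(1,2)]]) (use assms in auto)

lemma linear_trans: "d \<in> A \<Longrightarrow> e \<in> A \<Longrightarrow> x \<in> fst d \<Longrightarrow> x \<in> fst e \<Longrightarrow> linear (trans_deriv x d e)"
  by (rule has_derivative_linear[OF trans_has_derivative])

lemma trans_comp:
  assumes d: "d \<in> A" "x \<in> fst d" and e: "e \<in> A" "x \<in> fst e" and f: "f \<in> A" "x \<in> fst f"
  shows "trans_deriv x e f (trans_deriv x d e u) = trans_deriv x d f u"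
proof -
  have x: "(snd e \<circ> chart_inv d) (snd d x) = snd e x" using inv_left[OF d] by simp
  have "((snd f \<circ> chart_inv e) has_derivative trans_deriv x e f) (at ((snd e \<circ> chart_inv d) (snd d x)))"
    unfolding x by (rule trans_has_derivative) (use e f in auto)
  from diff_chain_at[OF trans_has_derivative[OF d(1) e(1) d(2) e(2)] this]
  have 1: "((snd f \<circ> chart_inv e) \<circ> (snd e \<circ> chart_inv d) has_derivative trans_deriv x e f \<circ> trans_deriv x d e) (at (snd d x))" .
  let ?O = "snd d ` (fst d \<inter> fst e)"
  have "((snd f \<circ> chart_inv d) has_derivative trans_deriv x e f \<circ> trans_deriv x d e) (at (snd d x))"
  proof (rule has_derivative_transform_within_open[OF 1 open_overlap[OF d(1) e(1)]])
    show "snd d x \<in> ?O" using d e by auto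
    fix y assume "y \<in> ?O"
    then obtain z where z: "z \<in> fst d" "z \<in> fst e" "y = snd d z" by auto
    then show "((snd f \<circ> chart_inv e) \<circ> (snd e \<circ> chart_inv d)) y = (snd f \<circ> chart_inv d) y"
      using inv_left[OF d(1)] inv_left[OF e(1)] by simp
  qed
  from has_derivative_unique[OF this trans_has_derivative[OF d(1) f(1) d(2) f(2)]]
  show ?thesis by (simp add: fun_eq_iff)
qed

lemma trans_id: "d \<in> A \<Longrightarrow> x \<in> fst d \<Longrightarrow> trans_deriv x d d u = u"
proof -
  assume d: "d \<in> A" "x \<in> fst d"
  have "((\<lambda>y. y) has_derivative trans_deriv x d d) (at (snd d x))"
  proof (rule has_derivative_transform_within_open[OF trans_has_derivative[OF d(1) d(1) d(2) d(2)] open_overlap[OF d(1) d(1)]])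
    show "snd d x \<in> snd d ` (fst d \<inter> fst d)" using d by auto
    show "(snd d \<circ> chart_inv d) y = y" if "y \<in> snd d ` (fst d \<inter> fst d)" for y
      using that chart_inv_right[of y d] by simp
  qed
  from has_derivative_unique[OF this has_derivative_ident] show ?thesis by (simp add: fun_eq_iff)
qed

lemma tspaceI:
  assumes "\<And>c. c \<notin> A \<or> x \<notin> fst c \<Longrightarrow> v c = 0"
    and "\<And>c d. c \<in> A \<Longrightarrow> d \<in> A \<Longrightarrow> x \<in> fst c \<Longrightarrow> x \<in> fst d \<Longrightarrow> v d = trans_deriv x c d (v c)"
  shows "v \<in> tspace A x"
  unfolding tspace_def trans_deriv_def[symmetric] using assms by blast

lemma tspace_trans: "v \<in> tspace A x \<Longrightarrow> c \<in> A \<Longrightarrow> d \<in> A \<Longrightarrow> x \<in> fst c \<Longrightarrow> x \<in> fst d \<Longrightarrow> v d = trans_deriv x c d (v c)"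
  unfolding tspace_def trans_deriv_def by blast

lemma tspace_0: "v \<in> tspace A x \<Longrightarrow> c \<notin> A \<or> x \<notin> fst c \<Longrightarrow> v c = 0"
  unfolding tspace_def by blast

lemma from_coord_tspace: "d \<in> A \<Longrightarrow> x \<in> fst d \<Longrightarrow> from_coord A x d u \<in> tspace A x"
  by (rule tspaceI) (auto simp: from_coord_def trans_comp)

lemma from_coord_apply: "e \<in> A \<Longrightarrow> x \<in> fst e \<Longrightarrow> from_coord A x d u e = trans_deriv x d e u"
  by (simp add: from_coord_def)

lemma from_coord_same: "d \<in> A \<Longrightarrow> x \<in> fst d \<Longrightarrow> from_coord A x d u d = u"
  by (simp add: from_coord_def trans_id)

lemma from_coord_coord: "v \<in> tspace A x \<Longrightarrow> d \<in> A \<Longrightarrow> x \<in> fst d \<Longrightarrow> from_coord A x d (v d) = v"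
proof
  assume v: "v \<in> tspace A x" "d \<in> A" "x \<in> fst d"
  show "from_coord A x d (v d) e = v e" for e
  proof (cases "e \<in> A \<and> x \<in> fst e")
    case True
    then have "v e = trans_deriv x d e (v d)" by (intro tspace_trans v) auto
    then show ?thesis using True unfolding from_coord_def by (simp only: if_True simp_thms)
  next
    case False
    then show ?thesis using tspace_0[OF v(1), of e] unfolding from_coord_def by auto
  qed
qed

lemma fibre_chart_inj: "d \<in> A \<Longrightarrow> p \<in> fst d \<Longrightarrow> inj_on (snd (fibre_chart A p d)) (fst (fibre_chart A p d))"
  unfolding fst_fibre_chart snd_fibre_chart by (rule inj_onI) (metis from_coord_coord)

lemma fibre_chart_image: "d \<in> A \<Longrightarrow> p \<in> fst d \<Longrightarrow> (\<lambda>v. v d) ` tspace A p = UNIV"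
  using from_coord_tspace from_coord_same by (metis surjI UNIV_eq_I image_eqI)

lemma fibre_chart_inv: "d \<in> A \<Longrightarrow> p \<in> fst d \<Longrightarrow> chart_inv (fibre_chart A p d) u = from_coord A p d u"
  using chart_inv_left[OF fibre_chart_inj, of d p "from_coord A p d u"] from_coord_tspace from_coord_same by simp

lemma cont_atlas_fibre: "cont_atlas (fibre_atlas A p)"
  unfolding cont_atlas_def fibre_atlas_eq
proof (intro conjI ballI)
  fix c assume "c \<in> fibre_chart A p ` {c \<in> A. p \<in> fst c}"
  then obtain d where d: "d \<in> A" "p \<in> fst d" "c = fibre_chart A p d" by auto
  then show "inj_on (snd c) (fst c)" using fibre_chart_inj by simp
  fix c' assume "c' \<in> fibre_chart A p ` {c \<in> A. p \<in> fst c}"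
  then obtain e where e: "e \<in> A" "p \<in> fst e" "c' = fibre_chart A p e" by auto
  show "open (snd c ` (fst c \<inter> fst c'))" unfolding d(3) e(3) using fibre_chart_image[OF d(1,2)] by simp
  have "(snd c' \<circ> chart_inv c) = trans_deriv p d e"
    unfolding d(3) e(3) by (simp add: fun_eq_iff fibre_chart_inv d e from_coord_apply)
  then show "continuous_on (snd c ` (fst c \<inter> fst c')) (snd c' \<circ> chart_inv c)"
    using linear_continuous_on[OF linear_conv_bounded_linear[THEN iffD1, OF linear_trans[OF d(1) e(1) d(2) e(2)]]] by simp
qed

lemma atlas_space_fibre: "p \<in> atlas_space A \<Longrightarrow> atlas_space (fibre_atlas A p) = tspace A p"
  unfolding atlas_space_def fibre_atlas_eq by auto

lemma tangent_chart_inj: "d \<in> A \<Longrightarrow> inj_on (snd (tangent_chart A d)) (fst (tangent_chart A d))"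
proof (rule inj_onI)
  fix w w' assume d: "d \<in> A" and w: "w \<in> fst (tangent_chart A d)" "w' \<in> fst (tangent_chart A d)"
    and eq: "snd (tangent_chart A d) w = snd (tangent_chart A d) w'"
  have x: "fst w = fst w'" using eq w inj[OF d] by (auto simp: inj_on_def)
  have t: "snd w \<in> tspace A (fst w)" "snd w' \<in> tspace A (fst w)" "fst w \<in> fst d"
  proof -
    show "snd w \<in> tspace A (fst w)" "fst w \<in> fst d" using w(1) by (auto simp: tbundle_def)
    have "snd w' \<in> tspace A (fst w')" using w(2) by (auto simp: tbundle_def)
    then show "snd w' \<in> tspace A (fst w)" by (simp only: x)
  qed
  have c: "snd w d = snd w' d" using eq by simp
  have "snd w = from_coord A (fst w) d (snd w d)" by (rule from_coord_coord[OF t(1) d t(3), symmetric])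
  also have "\<dots> = snd w'" unfolding c by (rule from_coord_coord[OF t(2) d t(3)])
  finally have "snd w = snd w'" .
  with x show "w = w'" by (rule prod_eqI)
qed

lemma tangent_chart_inv:
  "d \<in> A \<Longrightarrow> x \<in> fst d \<Longrightarrow> chart_inv (tangent_chart A d) (snd d x, u) = (x, from_coord A x d u)"
proof -
  assume d: "d \<in> A" "x \<in> fst d"
  have "(x, from_coord A x d u) \<in> fst (tangent_chart A d)"
    using d from_coord_tspace[OF d] by (auto simp: tbundle_def atlas_space_def)
  from chart_inv_left[OF tangent_chart_inj[OF d(1)] this] show ?thesis using from_coord_same[OF d] by simp
qed

lemma tangent_chart_overlap:
  assumes "d \<in> A" "e \<in> A"
  shows "snd (tangent_chart A d) ` (fst (tangent_chart A d) \<inter> fst (tangent_chart A e)) = (snd d ` (fst d \<inter> fst e)) \<times> UNIV" (is "?l = ?r")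
proof
  show "?l \<subseteq> ?r" by auto
  show "?r \<subseteq> ?l"
  proof
    fix z assume "z \<in> ?r"
    then obtain x u where z: "z = (snd d x, u)" "x \<in> fst d" "x \<in> fst e" by auto
    have "(x, from_coord A x d u) \<in> fst (tangent_chart A d) \<inter> fst (tangent_chart A e)"
      using z assms from_coord_tspace[OF assms(1) z(2)] by (auto simp: tbundle_def atlas_space_def)
    then show "z \<in> ?l" using from_coord_same[OF assms(1) z(2)] z(1) by (intro image_eqI[of _ _ "(x, from_coord A x d u)"]) auto
  qed
qed

lemma cont_atlas_tangent: "cont_atlas (tangent_atlas A)"
  unfolding cont_atlas_def tangent_atlas_eq
proof (intro conjI ballI)
  fix c assume "c \<in> tangent_chart A ` A"
  then obtain d where d: "d \<in> A" "c = tangent_chart A d" by auto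
  then show "inj_on (snd c) (fst c)" using tangent_chart_inj by simp
  fix c' assume "c' \<in> tangent_chart A ` A"
  then obtain e where e: "e \<in> A" "c' = tangent_chart A e" by auto
  let ?O = "snd d ` (fst d \<inter> fst e)" and ?F = "snd e \<circ> chart_inv d"
  show "open (snd c ` (fst c \<inter> fst c'))"
    unfolding d(2) e(2) tangent_chart_overlap[OF d(1) e(1)] by (intro open_Times open_overlap d e open_UNIV)
  have "continuous_on (?O \<times> UNIV) (\<lambda>z. (?F (fst z), (\<lambda>(y, u). frechet_derivative ?F (at y) u) z))"
    using smooth_on_frechet(2)[OF open_overlap[OF d(1) e(1)] smooth_overlap[OF d(1) e(1)]]
      smooth_on_derivatives(1)[OF smooth_overlap[OF d(1) e(1)]]
    by (intro continuous_on_Pair continuous_on_compose2[OF _ continuous_on_fst[OF continuous_on_id]]) auto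
  then have "continuous_on (?O \<times> UNIV) (snd c' \<circ> chart_inv c)"
  proof (rule continuous_on_eq)
    fix z :: "'e \<times> 'e" assume "z \<in> ?O \<times> UNIV"
    then obtain x u where z: "z = (snd d x, u)" "x \<in> fst d" "x \<in> fst e" by auto
    show "(?F (fst z), (\<lambda>(y, u). frechet_derivative ?F (at y) u) z) = (snd c' \<circ> chart_inv c) z"
      unfolding d(2) e(2) z(1)
      using tangent_chart_inv[OF d(1) z(2)] inv_left[OF d(1) z(2)] from_coord_apply[OF e(1) z(3)]
      by (simp add: trans_deriv_def)
  qed
  then show "continuous_on (snd c ` (fst c \<inter> fst c')) (snd c' \<circ> chart_inv c)"
    unfolding d(2) e(2) tangent_chart_overlap[OF d(1) e(1)] .
qed

lemma atlas_space_tangent: "atlas_space (tangent_atlas A) = tbundle A"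
  unfolding atlas_space_def tangent_atlas_eq by (auto simp: tbundle_def atlas_space_def)

end

text \<open>The vector \<open>v\<close> is the sum of its components along the axes, and the flow of the field \<open>Z i\<close> is the action of the \<open>i\<close>-th axis.\<close>

lemma joint_flow_action:
  fixes F :: "real^('d::{finite,linorder}) \<Rightarrow> 'a \<Rightarrow> 'a"
  assumes closed: "\<And>v x. x \<in> S \<Longrightarrow> F v x \<in> S" and zero: "\<And>x. x \<in> S \<Longrightarrow> F 0 x = x"
    and add: "\<And>v w x. x \<in> S \<Longrightarrow> F (v + w) x = F v (F w x)"
    and flow: "\<And>i t x. x \<in> S \<Longrightarrow> field_flow A (Z i) t x = F (t *\<^sub>R axis i 1) x"
    and x: "x \<in> S"
  shows "joint_flow A Z v x = F v x"
proof -
  have *: "foldr (\<lambda>i h. field_flow A (Z i) (v $ i) \<circ> h) is id x = F (\<Sum>i\<in>set is. (v $ i) *\<^sub>R axis i 1) x"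
    if "distinct is" for "is"
    using that
  proof (induction "is")
    case Nil
    then show ?case using zero[OF x] by simp
  next
    case (Cons i "is")
    have IH: "foldr (\<lambda>i h. field_flow A (Z i) (v $ i) \<circ> h) is id x = F (\<Sum>i\<in>set is. (v $ i) *\<^sub>R axis i 1) x"
      by (rule Cons.IH) (use Cons.prems in simp)
    have "foldr (\<lambda>i h. field_flow A (Z i) (v $ i) \<circ> h) (i # is) id x
        = field_flow A (Z i) (v $ i) (foldr (\<lambda>i h. field_flow A (Z i) (v $ i) \<circ> h) is id x)"
      by simp
    also have "\<dots> = field_flow A (Z i) (v $ i) (F (\<Sum>i\<in>set is. (v $ i) *\<^sub>R axis i 1) x)"
      by (simp only: IH)
    also have "\<dots> = F ((v $ i) *\<^sub>R axis i 1) (F (\<Sum>i\<in>set is. (v $ i) *\<^sub>R axis i 1) x)"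
      by (rule flow[OF closed[OF x]])
    also have "\<dots> = F (\<Sum>j\<in>set (i # is). (v $ j) *\<^sub>R axis j 1) x"
      using Cons.prems by (simp add: add[OF x])
    finally show ?case .
  qed
  have "(\<Sum>i\<in>UNIV. (v $ i) *\<^sub>R axis i 1) = v"
    using basis_expansion[of v] by (simp add: scalar_mult_eq_scaleR)
  then show ?thesis unfolding joint_flow_def using *[of "sorted_list_of_set UNIV"] by simp
qed

section \<open>The vertical flow on a fibre\<close>

lemma field_flowI:
  assumes "integral_curve A Z x \<gamma>0" "\<And>\<gamma>. integral_curve A Z x \<gamma> \<Longrightarrow> \<gamma> = \<gamma>0"
  shows "field_flow A Z t x = \<gamma>0 t"
proof -
  have "(THE \<gamma>. integral_curve A Z x \<gamma>) = \<gamma>0" by (rule the_equality) (use assms in blast)+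
  then show ?thesis by (simp add: field_flow_def)
qed

lemma has_vector_derivative_linear:
  fixes T :: "'e::euclidean_space \<Rightarrow> 'f::real_normed_vector"
  assumes "linear T" "(g has_vector_derivative g') F"
  shows "((\<lambda>t. T (g t)) has_vector_derivative T g') F"
  using assms linear_conv_bounded_linear bounded_linear.has_vector_derivative by blast

lemma has_vector_derivative_frechet:
  assumes "(f has_derivative f') (at (g t))" "(g has_vector_derivative g') (at t)"
  shows "((\<lambda>s. f (g s)) has_vector_derivative f' g') (at t)"
proof -
  have "((\<lambda>s. f (g s)) has_derivative (\<lambda>h. f' (h *\<^sub>R g'))) (at t)"
    using has_derivative_compose[of g "\<lambda>h. h *\<^sub>R g'" t UNIV f f'] assms by (simp add: has_vector_derivative_def)
  then show ?thesis
    unfolding has_vector_derivative_def using linear_scale[OF has_derivative_linear[OF assms(1)]] by simp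
qed

lemma zero_derivative_constant_ball:
  fixes f :: "real \<Rightarrow> 'b::real_normed_vector"
  assumes "\<And>s. s \<in> ball t r \<Longrightarrow> (f has_vector_derivative 0) (at s)" "s \<in> ball t r" "r > 0"
  shows "f s = f t"
proof -
  have "\<exists>k. \<forall>s\<in>ball t r. f s = k"
    by (rule has_derivative_zero_constant)
       (use assms(1) in \<open>auto simp: has_vector_derivative_def intro: has_derivative_at_withinI\<close>)
  then show ?thesis using assms(2,3) by (metis centre_in_ball)
qed

locale vertical_flow = atlas A for A :: "('a, 'e::euclidean_space) chart set" +
  fixes \<sigma> :: "real^('d::{finite,linorder}) \<Rightarrow> ('a, 'e) tpoint \<Rightarrow> ('a, 'e) tpoint" and p :: 'a
  assumes action: "smooth_action (tangent_atlas A) \<sigma>"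
    and vertical: "\<And>v w. w \<in> tbundle A \<Longrightarrow> fst (\<sigma> v w) = fst w"
    and p: "p \<in> atlas_space A"
begin

abbreviation "FA \<equiv> fibre_atlas A p"
abbreviation "T \<equiv> tspace A p"

text \<open>Chosen such that its fibre chart is the one that \<open>chart_at\<close>, and hence \<open>differential\<close>, selects on the fibre; all computations in the fibre are made in these linear coordinates.\<close>

definition c0 :: "('a, 'e) chart" where
  "c0 = (SOME d. d \<in> A \<and> p \<in> fst d \<and> fibre_chart A p d = (SOME ch. ch \<in> FA))"

lemma c0: "c0 \<in> A" "p \<in> fst c0" and chart_at_fibre: "v \<in> T \<Longrightarrow> chart_at FA v = fibre_chart A p c0"
proof -
  have "\<exists>ch. ch \<in> FA" using p by (auto simp: fibre_atlas_eq atlas_space_def)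
  then have "(SOME ch. ch \<in> FA) \<in> FA" by (rule someI_ex)
  then have "(SOME ch. ch \<in> FA) \<in> fibre_chart A p ` {c \<in> A. p \<in> fst c}" by (simp only: fibre_atlas_eq)
  then obtain d where "d \<in> {c \<in> A. p \<in> fst c}" "(SOME ch. ch \<in> FA) = fibre_chart A p d" by (elim imageE)
  then have "d \<in> A \<and> p \<in> fst d \<and> fibre_chart A p d = (SOME ch. ch \<in> FA)" by (metis mem_Collect_eq)
  then have "\<exists>d. d \<in> A \<and> p \<in> fst d \<and> fibre_chart A p d = (SOME ch. ch \<in> FA)" by (rule exI)
  from someI_ex[OF this] have c: "c0 \<in> A \<and> p \<in> fst c0 \<and> fibre_chart A p c0 = (SOME ch. ch \<in> FA)" unfolding c0_def .
  then show "c0 \<in> A" "p \<in> fst c0" by auto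
  assume v: "v \<in> T"
  have "(\<lambda>ch. ch \<in> FA \<and> v \<in> fst ch) = (\<lambda>ch. ch \<in> FA)" using v by (auto simp: fibre_atlas_eq)
  then show "chart_at FA v = fibre_chart A p c0" using c unfolding chart_at_def by simp
qed

abbreviation "R \<equiv> from_coord A p c0"

lemma R_T: "R u \<in> T" by (rule from_coord_tspace[OF c0])
lemma R_c0 [simp]: "R u c0 = u" by (rule from_coord_same[OF c0])
lemma R_coord: "v \<in> T \<Longrightarrow> R (v c0) = v" by (rule from_coord_coord[OF _ c0])
lemma in_tbundle: "v \<in> T \<Longrightarrow> (p, v) \<in> tbundle A" using p by (simp add: tbundle_def)

lemma chart0: "fibre_chart A p c0 \<in> FA" using c0 by (auto simp: fibre_atlas_eq)
lemma chart0_inv: "chart_inv (fibre_chart A p c0) u = R u" by (rule fibre_chart_inv[OF c0])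
lemma chart0_image: "(\<lambda>v. v c0) ` T = UNIV" by (rule fibre_chart_image[OF c0])

lemma topspace_fibre: "topspace (atlas_top FA) = T"
  using topspace_atlas_top[OF cont_atlas_fibre] atlas_space_fibre[OF p] by simp

lemma continuous_R: "continuous_map euclidean (atlas_top FA) R"
  using continuous_chart_inv[OF cont_atlas_fibre chart0] chart0_image by (simp add: chart0_inv[abs_def])

lemma continuous_coord: "continuous_map (atlas_top FA) euclidean (\<lambda>v. v c0)"
  using continuous_chart[OF cont_atlas_fibre chart0] subtopology_topspace[of "atlas_top FA"] by (simp add: topspace_fibre)

definition Sg :: "real^('d::{finite,linorder}) \<Rightarrow> ('a, 'e) tvec \<Rightarrow> ('a, 'e) tvec" where
  "Sg s v = snd (\<sigma> s (p, v))"

lemma \<sigma>_tbundle: "w \<in> tbundle A \<Longrightarrow> \<sigma> s w \<in> tbundle A"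
proof -
  assume w: "w \<in> tbundle A"
  have "(\<lambda>(v, x). \<sigma> v x) ` (UNIV \<times> tbundle A) \<subseteq> tbundle A"
    using action unfolding smooth_action_def manifold_smooth_def atlas_space_tangent by blast
  moreover have "\<sigma> s w \<in> (\<lambda>(v, x). \<sigma> v x) ` (UNIV \<times> tbundle A)"
    using w by (intro image_eqI[of _ _ "(s, w)"]) auto
  ultimately show ?thesis by (rule subsetD)
qed

lemma Sg_T: "v \<in> T \<Longrightarrow> Sg s v \<in> T" and \<sigma>_eq: "v \<in> T \<Longrightarrow> \<sigma> s (p, v) = (p, Sg s v)"
proof -
  assume v: "v \<in> T"
  have 1: "fst (\<sigma> s (p, v)) = p" using vertical[OF in_tbundle[OF v]] by simp
  then show "\<sigma> s (p, v) = (p, Sg s v)" by (simp add: Sg_def prod_eq_iff)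
  show "Sg s v \<in> T" using \<sigma>_tbundle[OF in_tbundle[OF v], of s] 1 unfolding tbundle_def Sg_def by auto
qed

lemma Sg_0: "v \<in> T \<Longrightarrow> Sg 0 v = v"
  using action in_tbundle unfolding smooth_action_def atlas_space_tangent Sg_def by simp

lemma Sg_add: "v \<in> T \<Longrightarrow> Sg (s + t) v = Sg s (Sg t v)"
  using action in_tbundle \<sigma>_eq[of v t] unfolding smooth_action_def atlas_space_tangent Sg_def by simp

definition Psi :: "real^('d::{finite,linorder}) \<Rightarrow> 'e \<Rightarrow> 'e" where "Psi s u = Sg s (R u) c0"

lemma R_Psi: "R (Psi s u) = Sg s (R u)" unfolding Psi_def by (rule R_coord[OF Sg_T[OF R_T]])
lemma Psi_0: "Psi 0 u = u" by (simp add: Psi_def Sg_0 R_T)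
lemma Psi_add: "Psi (s + t) u = Psi s (Psi t u)" unfolding Psi_def[of s "Psi t u"] R_Psi by (simp add: Psi_def Sg_add R_T)
lemma Sg_coord: "v \<in> T \<Longrightarrow> Sg s v c0 = Psi s (v c0)" by (simp add: Psi_def R_coord)

lemma Psi_differentiable: "(\<lambda>z. Psi (fst z) (snd z)) differentiable (at z)"
proof -
  let ?\<tau> = "tangent_chart A c0"
  let ?pc = "(UNIV \<times> fst ?\<tau>, \<lambda>(x, y). (x, snd ?\<tau> y)) :: ((real^('d::{finite,linorder})) \<times> ('a, 'e) tpoint, (real^('d::{finite,linorder})) \<times> 'e \<times> 'e) chart"
  let ?f = "\<lambda>(v, x). \<sigma> v x"
  let ?G = "snd ?\<tau> \<circ> ?f \<circ> chart_inv ?pc"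
  have \<tau>: "?\<tau> \<in> tangent_atlas A" using c0 by (simp add: tangent_atlas_eq)
  have pc: "?pc \<in> product_atlas euclid_atlas (tangent_atlas A)"
    unfolding product_atlas_def euclid_atlas_def using \<tau> by (intro image_eqI[of _ _ "((UNIV, \<lambda>x. x), ?\<tau>)"]) auto
  have S: "(UNIV \<times> atlas_space (tangent_atlas A)) \<inter> fst ?pc \<inter> ?f -` fst ?\<tau> = UNIV \<times> fst ?\<tau>"
    unfolding atlas_space_tangent using \<sigma>_tbundle vertical by auto
  have im: "snd ?pc ` (UNIV \<times> fst ?\<tau>) = UNIV \<times> (snd c0 ` fst c0 \<times> UNIV)"
  proof -
    have "snd ?pc ` (UNIV \<times> fst ?\<tau>) = UNIV \<times> (snd ?\<tau> ` fst ?\<tau>)" by (auto simp: image_iff)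
    also have "snd ?\<tau> ` fst ?\<tau> = snd c0 ` fst c0 \<times> UNIV"
      using tangent_chart_overlap[OF c0(1) c0(1)] unfolding Int_absorb .
    finally show ?thesis .
  qed
  have op: "open ((UNIV :: (real^('d::{finite,linorder})) set) \<times> (snd c0 ` fst c0 \<times> (UNIV :: 'e set)))"
    using open_overlap[OF c0(1) c0(1)] by (intro open_Times open_UNIV) simp
  have "smooth_on (snd ?pc ` ((UNIV \<times> atlas_space (tangent_atlas A)) \<inter> fst ?pc \<inter> ?f -` fst ?\<tau>)) ?G"
    using action pc \<tau> unfolding smooth_action_def manifold_smooth_def by blast
  then have sm: "smooth_on (UNIV \<times> (snd c0 ` fst c0 \<times> UNIV)) ?G" unfolding S im .
  have inv: "chart_inv ?pc (s, (snd c0 p, u)) = (s, (p, R u))" for s u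
  proof -
    have "inj_on (snd ?pc) (fst ?pc)" using tangent_chart_inj[OF c0(1)] by (auto simp: inj_on_def)
    moreover have "(s, (p, R u)) \<in> fst ?pc" using in_tbundle[OF R_T] c0 by simp
    ultimately have "chart_inv ?pc (snd ?pc (s, (p, R u))) = (s, (p, R u))" by (rule chart_inv_left)
    then show ?thesis by simp
  qed
  have G: "Psi s u = snd (?G (s, (snd c0 p, u)))" for s u
    unfolding o_apply inv case_prod_conv \<sigma>_eq[OF R_T] by (simp add: Psi_def)
  obtain s u where z: "z = (s, u)" by (cases z)
  have "(?G has_derivative frechet_derivative ?G (at (s, (snd c0 p, u)))) (at (s, (snd c0 p, u)))"
    by (rule smooth_on_frechet(1)[OF op sm]) (use c0 in auto)
  moreover have "((\<lambda>z. (fst z, (snd c0 p, snd z))) has_derivative (\<lambda>h. (fst h, (0, snd h)))) (at (s, u))"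
    by (auto intro!: derivative_eq_intros)
  ultimately have "((\<lambda>z. ?G (fst z, (snd c0 p, snd z))) has_derivative
      (\<lambda>h. frechet_derivative ?G (at (s, (snd c0 p, u))) (fst h, (0, snd h)))) (at (s, u))"
    using has_derivative_compose[of "\<lambda>z. (fst z, (snd c0 p, snd z))" _ "(s, u)" UNIV ?G] by simp
  from has_derivative_snd[OF this]
  show ?thesis unfolding z differentiable_def G by blast
qed

definition psi :: "'d \<Rightarrow> real \<Rightarrow> 'e \<Rightarrow> 'e" where "psi i t u = Psi (t *\<^sub>R axis i 1) u"
definition gen :: "'d \<Rightarrow> 'e \<Rightarrow> 'e" where "gen i u = vector_derivative (\<lambda>t. psi i t u) (at 0)"

lemma psi_0: "psi i 0 u = u" by (simp add: psi_def Psi_0)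
lemma psi_add: "psi i (s + t) u = psi i s (psi i t u)" by (simp add: psi_def scaleR_add_left Psi_add)

lemma psi_differentiable: "(\<lambda>z. psi i (fst z) (snd z)) differentiable (at z)"
proof -
  obtain L where L: "((\<lambda>z. Psi (fst z) (snd z)) has_derivative L) (at (fst z *\<^sub>R axis i 1, snd z))"
    using Psi_differentiable unfolding differentiable_def by blast
  have "((\<lambda>z. (fst z *\<^sub>R axis i 1, snd z)) has_derivative (\<lambda>h. (fst h *\<^sub>R axis i 1, snd h))) (at z)"
    by (auto intro!: derivative_eq_intros)
  from has_derivative_compose[OF this L] show ?thesis unfolding psi_def differentiable_def by auto
qed

lemmas psi_generator = flow_generator[of "psi i" for i, OF psi_differentiable psi_0 psi_add, folded gen_def]

text \<open>The generator of the \<open>i\<close>-th one-parameter group as a tangent field of the fibre; tangent vectors are \<open>0\<close> on pairs that are not charts.\<close>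

definition field :: "'d \<Rightarrow> ('a, 'e) tvec \<Rightarrow> (('a, 'e) tvec, 'e) chart \<Rightarrow> 'e" where
  "field i v = (\<lambda>ch. if ch \<in> FA then snd ch (R (gen i (v c0))) else 0)"

lemma field_chart0: "field i v (fibre_chart A p c0) = gen i (v c0)"
  using chart0 by (simp add: field_def)

lemma orbit_derivative:
  assumes v: "v \<in> T" and d: "d \<in> A" "p \<in> fst d"
  shows "((\<lambda>s. Sg (s *\<^sub>R axis i 1) v d) has_vector_derivative R (gen i (Sg (t *\<^sub>R axis i 1) v c0)) d) (at t)"
proof -
  have eq: "Sg s v d = trans_deriv p c0 d (Psi s (v c0))" for s
    unfolding Sg_coord[OF v, symmetric] by (rule tspace_trans[OF Sg_T[OF v] c0(1) d(1) c0(2) d(2)])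
  have "((\<lambda>s. trans_deriv p c0 d (psi i s (v c0))) has_vector_derivative trans_deriv p c0 d (gen i (psi i t (v c0)))) (at t)"
    by (rule has_vector_derivative_linear[OF linear_trans[OF c0(1) d(1) c0(2) d(2)] psi_generator(1)])
  then show ?thesis
    unfolding eq from_coord_apply[OF d] Sg_coord[OF v] psi_def .
qed

text \<open>The first component vanishes because the action preserves the base point.\<close>

lemma fund_field_tangent_chart:
  assumes v: "v \<in> T" and d: "d \<in> A" "p \<in> fst d"
  shows "fund_field (tangent_atlas A) \<sigma> i (p, v) (tangent_chart A d) = (0, R (gen i (v c0)) d)"
proof -
  have 0: "\<sigma> (0 *\<^sub>R axis i 1) (p, v) = (p, v)" using \<sigma>_eq[OF v, of 0] Sg_0[OF v] by simp
  have "((\<lambda>s. (snd d p, Sg (s *\<^sub>R axis i 1) v d)) has_vector_derivative (0, R (gen i (v c0)) d)) (at 0)"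
    using orbit_derivative[OF v d, of i 0] Sg_0[OF v] by (auto intro!: has_vector_derivative_Pair)
  moreover have "snd (tangent_chart A d) \<circ> (\<lambda>t. \<sigma> (t *\<^sub>R axis i 1) (p, v)) = (\<lambda>s. (snd d p, Sg (s *\<^sub>R axis i 1) v d))"
    by (simp add: fun_eq_iff \<sigma>_eq[OF v])
  ultimately show ?thesis
    unfolding fund_field_def velocity_def 0
    using d in_tbundle[OF v] by (simp add: tangent_atlas_eq vector_derivative_at)
qed

lemma fund_field_outside:
  assumes v: "v \<in> T" and "\<tau> \<notin> tangent_atlas A \<or> (p, v) \<notin> fst \<tau>"
  shows "fund_field (tangent_atlas A) \<sigma> i (p, v) \<tau> = 0"
proof -
  have 0: "\<sigma> (0 *\<^sub>R axis i 1) (p, v) = (p, v)" using \<sigma>_eq[OF v, of 0] Sg_0[OF v] by simp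
  show ?thesis unfolding fund_field_def velocity_def 0 using assms(2) by auto
qed

lemma frechet_linear: "linear T' \<Longrightarrow> frechet_derivative T' (at x) = T'" for T' :: "'e \<Rightarrow> 'f::real_normed_vector"
  using frechet_derivative_at[OF bounded_linear_imp_has_derivative] linear_conv_bounded_linear by metis

lemma fibre_transition:
  assumes d: "d \<in> A" "p \<in> fst d" and e: "e \<in> A" "p \<in> fst e"
  shows "snd (fibre_chart A p e) \<circ> chart_inv (fibre_chart A p d) = trans_deriv p d e"
  by (simp add: fun_eq_iff fibre_chart_inv[OF d] from_coord_apply[OF e])

lemma fibre_differential:
  assumes v: "v \<in> T" and d: "d \<in> A" "p \<in> fst d"
  shows "differential FA (tangent_atlas A) (Pair p) v \<zeta> (tangent_chart A d) = (0, trans_deriv p c0 d (\<zeta> (fibre_chart A p c0)))"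
proof -
  have comp: "snd (tangent_chart A d) \<circ> Pair p \<circ> chart_inv (fibre_chart A p c0) = (\<lambda>u. (snd d p, trans_deriv p c0 d u))"
    by (simp add: fun_eq_iff chart0_inv from_coord_apply[OF d])
  have der: "((\<lambda>u. (snd d p, trans_deriv p c0 d u)) has_derivative (\<lambda>h. (0, trans_deriv p c0 d h))) (at x)" for x
    using linear_trans[OF c0(1) d(1) c0(2) d(2)] linear_conv_bounded_linear
    by (intro has_derivative_Pair has_derivative_const bounded_linear_imp_has_derivative) auto
  have fd: "frechet_derivative (\<lambda>u. (snd d p, trans_deriv p c0 d u)) (at x) = (\<lambda>h. (0, trans_deriv p c0 d h))" for x
    by (rule frechet_derivative_at[OF der, symmetric])
  have "tangent_chart A d \<in> tangent_atlas A" "(p, v) \<in> fst (tangent_chart A d)"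
    using d in_tbundle[OF v] by (auto simp: tangent_atlas_eq)
  then show ?thesis
    unfolding differential_def chart_at_fibre[OF v] comp fd by simp
qed

lemma field_tspace:
  assumes v: "v \<in> T"
  shows "field i v \<in> tspace FA v"
  unfolding tspace_def
proof (intro CollectI conjI allI ballI impI)
  fix c assume "c \<notin> FA \<or> v \<notin> fst c"
  then show "field i v c = 0" using v by (auto simp: field_def fibre_atlas_eq)
next
  fix c d assume "c \<in> FA" "d \<in> FA"
  then obtain c' d' where c: "c' \<in> A" "p \<in> fst c'" "c = fibre_chart A p c'" and d: "d' \<in> A" "p \<in> fst d'" "d = fibre_chart A p d'"
    by (auto simp: fibre_atlas_eq)
  have "field i v c = R (gen i (v c0)) c'" "field i v d = R (gen i (v c0)) d'"
    using \<open>c \<in> FA\<close> \<open>d \<in> FA\<close> by (simp_all add: field_def c(3) d(3))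
  then show "field i v d = frechet_derivative (snd d \<circ> chart_inv c) (at (snd c v)) (field i v c)"
    unfolding c(3) d(3) fibre_transition[OF c(1,2) d(1,2)] frechet_linear[OF linear_trans[OF c(1) d(1) c(2) d(2)]]
    using tspace_trans[OF R_T c(1) d(1) c(2) d(2)] by metis
qed

text \<open>In tangent charts the inclusion of the fibre has the differential \<open>\<zeta> \<mapsto> (0, \<zeta>)\<close>, which is injective; so \<open>field i v\<close> is the only tangent vector related to the vertical field.\<close>

lemma fibre_field_eq:
  assumes v: "v \<in> T"
  shows "fibre_field A p (fund_field (tangent_atlas A) \<sigma> i) v = field i v"
  unfolding fibre_field_def
proof (rule the_equality)
  have "differential FA (tangent_atlas A) (Pair p) v (field i v) \<tau> = fund_field (tangent_atlas A) \<sigma> i (p, v) \<tau>" for \<tau>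
  proof (cases "\<tau> \<in> tangent_atlas A \<and> (p, v) \<in> fst \<tau>")
    case True
    then obtain d where d: "d \<in> A" "p \<in> fst d" "\<tau> = tangent_chart A d" by (auto simp: tangent_atlas_eq)
    show ?thesis
      unfolding d(3) fibre_differential[OF v d(1,2)] fund_field_tangent_chart[OF v d(1,2)] field_chart0 from_coord_apply[OF d(1,2)] ..
  next
    case False
    then show ?thesis using fund_field_outside[OF v, of \<tau>] by (auto simp: differential_def)
  qed
  then show "field i v \<in> tspace FA v \<and> differential FA (tangent_atlas A) (Pair p) v (field i v) = fund_field (tangent_atlas A) \<sigma> i (p, v)"
    using field_tspace[OF v] by blast
  fix \<zeta> assume z: "\<zeta> \<in> tspace FA v \<and> differential FA (tangent_atlas A) (Pair p) v \<zeta> = fund_field (tangent_atlas A) \<sigma> i (p, v)"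
  then have "(0 :: 'e, \<zeta> (fibre_chart A p c0)) = (0, gen i (v c0))"
    using fibre_differential[OF v c0, of \<zeta>] fund_field_tangent_chart[OF v c0, of i] by (simp add: trans_id[OF c0])
  then have 0: "\<zeta> (fibre_chart A p c0) = field i v (fibre_chart A p c0)" by (simp add: field_chart0)
  show "\<zeta> = field i v"
  proof
    fix ch
    show "\<zeta> ch = field i v ch"
    proof (cases "ch \<in> FA")
      case True
      have "v \<in> fst ch" "v \<in> fst (fibre_chart A p c0)" using True v by (auto simp: fibre_atlas_eq)
      moreover have "\<eta> ch = frechet_derivative (snd ch \<circ> chart_inv (fibre_chart A p c0)) (at (snd (fibre_chart A p c0) v)) (\<eta> (fibre_chart A p c0))"
        if "\<eta> \<in> tspace FA v" for \<eta>
        using that True chart0 calculation unfolding tspace_def by blast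
      ultimately show ?thesis using z field_tspace[OF v] 0 by metis
    next
      case False
      have "\<zeta> ch = 0" using z False unfolding tspace_def by blast
      then show ?thesis using False by (simp add: field_def)
    qed
  qed
qed

lemma continuous_orbit:
  assumes v: "v \<in> T"
  shows "continuous_map euclideanreal (atlas_top FA) (\<lambda>t. Sg (t *\<^sub>R axis i 1) v)"
proof -
  have "continuous_on UNIV (\<lambda>t. psi i t (v c0))"
    by (intro continuous_at_imp_continuous_on ballI) (rule has_vector_derivative_continuous[OF psi_generator(1)])
  then have "continuous_map euclideanreal (atlas_top FA) (R \<circ> (\<lambda>t. psi i t (v c0)))"
    by (intro continuous_map_compose[OF _ continuous_R]) simp
  moreover have "R \<circ> (\<lambda>t. psi i t (v c0)) = (\<lambda>t. Sg (t *\<^sub>R axis i 1) v)"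
    by (simp add: fun_eq_iff psi_def R_Psi R_coord[OF v])
  ultimately show ?thesis by simp
qed

text \<open>An integral curve \<open>\<gamma>\<close> is, in coordinates, one for the generator of \<open>psi i\<close>; by \<open>flow_generator\<close> the function \<open>t \<mapsto> psi i (- t) (\<gamma> t)\<close> is constant.\<close>

lemma fibre_flow:
  assumes Z: "\<And>v. v \<in> T \<Longrightarrow> Z v = field i v" and v: "v \<in> T"
  shows "field_flow FA Z t v = Sg (t *\<^sub>R axis i 1) v"
proof (rule field_flowI)
  show "integral_curve FA Z v (\<lambda>t. Sg (t *\<^sub>R axis i 1) v)"
    unfolding integral_curve_def
  proof (intro conjI allI ballI impI)
    show "Sg (0 *\<^sub>R axis i 1) v = v" using Sg_0[OF v] by simp
    show "continuous_map euclideanreal (atlas_top FA) (\<lambda>t. Sg (t *\<^sub>R axis i 1) v)" by (rule continuous_orbit[OF v])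
    fix t c assume c: "c \<in> FA"
    then obtain d where d: "d \<in> A" "p \<in> fst d" "c = fibre_chart A p d" by (auto simp: fibre_atlas_eq)
    have "Z (Sg (t *\<^sub>R axis i 1) v) c = R (gen i (Sg (t *\<^sub>R axis i 1) v c0)) d"
      unfolding Z[OF Sg_T[OF v]] field_def using c by (simp add: d(3))
    then show "(snd c \<circ> (\<lambda>t. Sg (t *\<^sub>R axis i 1) v) has_vector_derivative Z (Sg (t *\<^sub>R axis i 1) v) c) (at t)"
      using orbit_derivative[OF v d(1,2), of i t] by (simp add: d(3) o_def)
  qed
  fix \<gamma> assume g: "integral_curve FA Z v \<gamma>"
  have gT: "\<gamma> t \<in> T" for t
    using g topspace_fibre unfolding integral_curve_def continuous_map_def by auto
  let ?u = "\<lambda>t. \<gamma> t c0"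
  have "(?u has_vector_derivative gen i (?u t)) (at t)" for t
  proof -
    have "(snd (fibre_chart A p c0) \<circ> \<gamma> has_vector_derivative Z (\<gamma> t) (fibre_chart A p c0)) (at t)"
    proof -
      have "\<forall>t. \<forall>c\<in>FA. \<gamma> t \<in> fst c \<longrightarrow> (snd c \<circ> \<gamma> has_vector_derivative Z (\<gamma> t) c) (at t)"
        using g unfolding integral_curve_def by blast
      moreover have "\<gamma> t \<in> fst (fibre_chart A p c0)" using gT by simp
      ultimately show ?thesis using chart0 by blast
    qed
    then show ?thesis unfolding Z[OF gT] field_chart0 by (simp add: o_def)
  qed
  then have "((\<lambda>t. psi i (- t) (?u t)) has_vector_derivative 0) (at t)" for t by (rule psi_generator(2))
  then have const: "psi i (- t) (?u t) = psi i (- 0) (?u 0)" for t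
    by (rule zero_derivative_constant_ball[of 0 "\<bar>t\<bar> + 1" "\<lambda>t. psi i (- t) (?u t)"]) auto
  have "?u 0 = v c0" using g by (simp add: integral_curve_def)
  show "\<gamma> = (\<lambda>t. Sg (t *\<^sub>R axis i 1) v)"
  proof
    fix t
    have "?u t = psi i (t + - t) (?u t)" by (simp add: psi_0)
    also have "\<dots> = psi i t (psi i (- t) (?u t))" by (rule psi_add)
    also have "psi i (- t) (?u t) = v c0" using const[of t] \<open>?u 0 = v c0\<close> by (simp only: minus_zero psi_0)
    finally have "R (?u t) = Sg (t *\<^sub>R axis i 1) v" by (simp add: psi_def R_Psi R_coord[OF v])
    then show "\<gamma> t = Sg (t *\<^sub>R axis i 1) v" using R_coord[OF gT] by simp
  qed
qed

lemma Sg_fixed: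
  assumes v: "v \<in> T" and fixd: "\<And>i t. Sg (t *\<^sub>R axis i 1) v = v"
  shows "Sg s v = v"
proof -
  have "Sg (\<Sum>i\<in>I. (s $ i) *\<^sub>R axis i 1) v = v" if "finite I" for I
    using that by (induction I rule: finite_induct) (simp_all add: Sg_0[OF v] Sg_add[OF v] fixd)
  from this[of UNIV] show ?thesis using basis_expansion[of s] by (simp add: scalar_mult_eq_scaleR)
qed

text \<open>Outside the supports all generators vanish, so the point is fixed by each axis of the parameter space and therefore by the whole group.\<close>

lemma Sg_fixed_outside_support:
  assumes v: "v \<in> T" and out: "\<And>i. (p, v) \<notin> field_support (tangent_atlas A) (fund_field (tangent_atlas A) \<sigma> i)"
  shows "gen i (v c0) = 0" and "Sg s v = v"
proof -
  have g0: "gen i (v c0) = 0" for i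
  proof (rule ccontr)
    assume "gen i (v c0) \<noteq> 0"
    then have "fund_field (tangent_atlas A) \<sigma> i (p, v) (tangent_chart A c0) \<noteq> 0"
      using fund_field_tangent_chart[OF v c0, of i] by (simp add: prod_eq_iff)
    then have "(p, v) \<in> {x \<in> atlas_space (tangent_atlas A). fund_field (tangent_atlas A) \<sigma> i x \<noteq> 0}"
      using in_tbundle[OF v] by (auto simp: atlas_space_tangent)
    then have "(p, v) \<in> field_support (tangent_atlas A) (fund_field (tangent_atlas A) \<sigma> i)"
      unfolding field_support_def
      using closure_of_subset[of "{x \<in> atlas_space (tangent_atlas A). fund_field (tangent_atlas A) \<sigma> i x \<noteq> 0}" "atlas_top (tangent_atlas A)"]
        topspace_atlas_top[OF cont_atlas_tangent] by blast
    with out show False by blast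
  qed
  then show "gen i (v c0) = 0" .
  show "Sg s v = v"
  proof (rule Sg_fixed[OF v])
    fix i t
    have "psi i t (v c0) = v c0" by (rule psi_generator(3)[OF g0])
    then have "R (Psi (t *\<^sub>R axis i 1) (v c0)) = R (v c0)" by (simp add: psi_def)
    then show "Sg (t *\<^sub>R axis i 1) v = v" by (simp add: R_Psi R_coord[OF v])
  qed
qed

lemma compactin_fibre:
  assumes "compactin (atlas_top (tangent_atlas A)) (C \<inter> {p} \<times> T)"
  shows "compactin (atlas_top FA) {v \<in> T. (p, v) \<in> C}"
proof -
  let ?\<tau> = "tangent_chart A c0"
  have \<tau>: "?\<tau> \<in> tangent_atlas A" using c0 by (simp add: tangent_atlas_eq)
  have "C \<inter> {p} \<times> T \<subseteq> fst ?\<tau>" using c0 in_tbundle by auto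
  then have "compactin (subtopology (atlas_top (tangent_atlas A)) (fst ?\<tau>)) (C \<inter> {p} \<times> T)"
    using assms by (simp add: compactin_subtopology)
  from image_compactin[OF this continuous_chart[OF cont_atlas_tangent \<tau>]]
  have "compact (snd ?\<tau> ` (C \<inter> {p} \<times> T))" by simp
  then have "compact (snd ` (snd ?\<tau> ` (C \<inter> {p} \<times> T)))"
    by (intro compact_continuous_image continuous_on_snd continuous_on_id)
  then have "compactin (atlas_top FA) (R ` (snd ` (snd ?\<tau> ` (C \<inter> {p} \<times> T))))"
    by (intro image_compactin[OF _ continuous_R]) simp
  moreover have "R ` (snd ` (snd ?\<tau> ` (C \<inter> {p} \<times> T))) = {v \<in> T. (p, v) \<in> C}"
  proof -
    have "R ` (snd ` (snd ?\<tau> ` (C \<inter> {p} \<times> T))) = (\<lambda>w. R (snd w c0)) ` (C \<inter> {p} \<times> T)" by (simp add: image_image)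
    also have "\<dots> = snd ` (C \<inter> {p} \<times> T)" by (rule image_cong) (auto simp: R_coord)
    also have "\<dots> = {v \<in> T. (p, v) \<in> C}" by force
    finally show ?thesis .
  qed
  ultimately show ?thesis by simp
qed

end

section \<open>The flow transported by a chart of the base\<close>

text \<open>The map \<open>ex\<close> stands for the exponential map; it is only used as a diffeomorphism from an open subset of the fibre onto an open subset of the manifold.\<close>

locale exp_chart = vertical_flow A \<sigma> p for A :: "('a, 'e::euclidean_space) chart set"
    and \<sigma> :: "real^('d::{finite,linorder}) \<Rightarrow> ('a, 'e) tpoint \<Rightarrow> ('a, 'e) tpoint" and p :: 'a +
  fixes ex :: "('a, 'e) tvec \<Rightarrow> 'a" and Up Vp K
  assumes diffeo: "diffeo (fibre_atlas A p) Up A Vp ex"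
    and K: "K = {v \<in> tspace A p. \<exists>i. (p, v) \<in> field_support (tangent_atlas A) (fund_field (tangent_atlas A) \<sigma> i)}"
    and K_compact: "compactin (atlas_top (fibre_atlas A p)) K" and K_sub: "K \<subseteq> Up"
    and Hausdorff_M: "Hausdorff_space (atlas_top A)"
begin

abbreviation "f0 \<equiv> fibre_chart A p c0"
abbreviation "Xp i \<equiv> fibre_field A p (fund_field (tangent_atlas A) \<sigma> i)"
abbreviation "Xp' i \<equiv> pushforward_field FA Up A ex (Xp i)"
abbreviation "lg \<equiv> inv_into Up ex"

lemma Up_open: "openin (atlas_top FA) Up" and Vp_open: "openin (atlas_top A) Vp" and bij: "bij_betw ex Up Vp"
  and smooth_ex: "manifold_smooth FA A Up ex" and smooth_lg: "manifold_smooth A FA Vp lg"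
  using diffeo by (simp_all add: diffeo_def)

lemma Up_T: "Up \<subseteq> T" using openin_subset[OF Up_open] by (simp add: topspace_fibre)
lemma Vp_M: "Vp \<subseteq> atlas_space A" using openin_subset[OF Vp_open] topspace_atlas_top[OF cont] by simp
lemma ex_Vp: "v \<in> Up \<Longrightarrow> ex v \<in> Vp" using bij by (auto simp: bij_betw_def)
lemma lg_Up: "y \<in> Vp \<Longrightarrow> lg y \<in> Up" using bij by (metis bij_betw_imp_surj_on inv_into_into)
lemma ex_lg: "y \<in> Vp \<Longrightarrow> ex (lg y) = y" using bij by (metis bij_betw_imp_surj_on f_inv_into_f)
lemma lg_ex: "v \<in> Up \<Longrightarrow> lg (ex v) = v" using bij by (metis bij_betw_imp_inj_on inv_into_f_f)

lemma cont_ex: "continuous_map (subtopology (atlas_top FA) Up) (atlas_top A) ex"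
  using smooth_ex by (simp add: manifold_smooth_def)
lemma cont_lg: "continuous_map (subtopology (atlas_top A) Vp) (atlas_top FA) lg"
  using smooth_lg by (simp add: manifold_smooth_def)

lemma outside_K: "v \<in> T \<Longrightarrow> v \<notin> K \<Longrightarrow> gen i (v c0) = 0" "v \<in> T \<Longrightarrow> v \<notin> K \<Longrightarrow> Sg s v = v"
  using Sg_fixed_outside_support(1)[of v i] Sg_fixed_outside_support(2)[of v s] unfolding K by auto

text \<open>A point outside \<open>Up\<close> is outside \<open>K\<close> and fixed by the whole group, so it lies on no orbit that starts in \<open>Up\<close>.\<close>

lemma Sg_Up: "v \<in> Up \<Longrightarrow> Sg s v \<in> Up"
proof (rule ccontr)
  assume v: "v \<in> Up" and no: "Sg s v \<notin> Up"
  have vT: "v \<in> T" using v Up_T by blast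
  have "Sg (- s) (Sg s v) = Sg s v" by (rule outside_K(2)[OF Sg_T[OF vT]]) (use no K_sub in blast)
  then have "v = Sg s v" using Sg_add[OF vT, of "- s" s] Sg_0[OF vT] by simp
  then show False using v no by simp
qed

lemma ex_derivative:
  assumes d: "d \<in> A" and v: "v \<in> Up" "ex v \<in> fst d"
  shows "((snd d \<circ> ex \<circ> chart_inv f0) has_derivative frechet_derivative (snd d \<circ> ex \<circ> chart_inv f0) (at (v c0))) (at (v c0))"
proof -
  let ?W = "Up \<inter> fst f0 \<inter> ex -` fst d"
  have "openin (subtopology (atlas_top FA) Up) {x \<in> topspace (subtopology (atlas_top FA) Up). ex x \<in> fst d}"
    by (rule openin_continuous_map_preimage[OF cont_ex openin_chart[OF cont d]])
  then have "openin (atlas_top FA) {x \<in> topspace (subtopology (atlas_top FA) Up). ex x \<in> fst d}"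
    by (rule openin_trans_full[OF _ Up_open])
  moreover have "{x \<in> topspace (subtopology (atlas_top FA) Up). ex x \<in> fst d} = ?W" using Up_T by (auto simp: topspace_fibre)
  ultimately have "openin (atlas_top FA) ?W" by simp
  then have "open (snd f0 ` (?W \<inter> fst f0))" using chart0 unfolding openin_cont_atlas[OF cont_atlas_fibre] by blast
  moreover have "?W \<inter> fst f0 = ?W" by blast
  ultimately have op: "open (snd f0 ` ?W)" by simp
  have sm: "smooth_on (snd f0 ` ?W) (snd d \<circ> ex \<circ> chart_inv f0)"
    using smooth_ex chart0 d unfolding manifold_smooth_def by blast
  show ?thesis by (rule smooth_on_frechet(1)[OF op sm]) (use v Up_T in auto)
qed

lemma lg_derivative:
  assumes d: "d \<in> A" and y: "y \<in> Vp" "y \<in> fst d"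
  shows "((snd f0 \<circ> lg \<circ> chart_inv d) has_derivative frechet_derivative (snd f0 \<circ> lg \<circ> chart_inv d) (at (snd d y))) (at (snd d y))"
proof -
  let ?W = "Vp \<inter> fst d \<inter> lg -` fst f0"
  have "?W = Vp \<inter> fst d" using lg_Up Up_T by auto
  moreover have "openin (atlas_top A) (Vp \<inter> fst d)" by (intro openin_Int Vp_open openin_chart[OF cont d])
  ultimately have "openin (atlas_top A) ?W" by simp
  then have "open (snd d ` (?W \<inter> fst d))" using d unfolding openin_cont_atlas[OF cont] by blast
  moreover have "?W \<inter> fst d = ?W" by blast
  ultimately have op: "open (snd d ` ?W)" by simp
  have sm: "smooth_on (snd d ` ?W) (snd f0 \<circ> lg \<circ> chart_inv d)"
    using smooth_lg chart0 d unfolding manifold_smooth_def by blast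
  show ?thesis by (rule smooth_on_frechet(1)[OF op sm]) (use y lg_Up Up_T in auto)
qed

lemma Xp_c0: "v \<in> T \<Longrightarrow> Xp i v f0 = gen i (v c0)"
  by (simp only: fibre_field_eq field_chart0)

lemma Xp'_Vp:
  assumes d: "d \<in> A" and v: "v \<in> Up" "ex v \<in> fst d"
  shows "Xp' i (ex v) d = frechet_derivative (snd d \<circ> ex \<circ> chart_inv f0) (at (v c0)) (gen i (v c0))"
proof -
  have vT: "v \<in> T" using v Up_T by blast
  have "ex v \<in> ex ` Up" using v by blast
  then have "Xp' i (ex v) d = differential FA A ex v (Xp i v) d"
    unfolding pushforward_field_def lg_ex[OF v(1)] by (simp only: if_True)
  also have "\<dots> = frechet_derivative (snd d \<circ> ex \<circ> chart_inv f0) (at (snd f0 v)) (Xp i v f0)"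
    unfolding differential_def chart_at_fibre[OF vT] using d v(2) by (simp only: simp_thms if_True)
  finally show ?thesis unfolding Xp_c0[OF vT] by simp
qed

lemma Xp'_notVp: "y \<notin> Vp \<Longrightarrow> Xp' i y d = 0"
  using bij unfolding pushforward_field_def bij_betw_def by simp

lemma Xp'_zero:
  assumes d: "d \<in> A" and y: "y \<in> fst d" "y \<notin> ex ` K"
  shows "Xp' i y d = 0"
proof (cases "y \<in> Vp")
  case True
  let ?v = "lg y"
  have v: "?v \<in> Up" "ex ?v = y" using lg_Up[OF True] ex_lg[OF True] by auto
  have "?v \<notin> K" using y(2) v(2) by (metis imageI)
  then have g: "gen i (?v c0) = 0" using outside_K(1) v(1) Up_T by blast
  have ev: "ex ?v \<in> fst d" using v(2) y(1) by simp
  have "Xp' i (ex ?v) d = 0"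
    unfolding Xp'_Vp[OF d v(1) ev] g by (rule linear_0[OF has_derivative_linear[OF ex_derivative[OF d v(1) ev]]])
  then show ?thesis unfolding v(2) .
qed (rule Xp'_notVp)

text \<open>This will turn out to be the joint flow of the push-forward fields.\<close>

definition F :: "real^('d::{finite,linorder}) \<Rightarrow> 'a \<Rightarrow> 'a" where
  "F s y = (if y \<in> Vp then ex (Sg s (lg y)) else y)"

lemma F_Vp: "y \<in> Vp \<Longrightarrow> F s y \<in> Vp" by (simp add: F_def ex_Vp Sg_Up lg_Up)
lemma F_closed: "y \<in> atlas_space A \<Longrightarrow> F s y \<in> atlas_space A" using F_Vp[of y s] Vp_M by (cases "y \<in> Vp") (auto simp: F_def)
lemma F_0: "F 0 y = y" using Up_T lg_Up[of y] by (auto simp: F_def Sg_0 ex_lg)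
lemma F_add: "F (s + t) y = F s (F t y)"
  using Up_T lg_Up[of y] by (auto simp: F_def ex_Vp Sg_Up lg_ex Sg_add)
lemma F_fixed: "y \<notin> ex ` K \<Longrightarrow> F s y = y"
proof (cases "y \<in> Vp")
  case True
  assume y: "y \<notin> ex ` K"
  have "lg y \<notin> K" using y ex_lg[OF True] by (metis imageI)
  then have "Sg s (lg y) = lg y" using outside_K(2) lg_Up[OF True] Up_T by blast
  then show ?thesis using True by (simp add: F_def ex_lg)
qed (simp add: F_def)
lemma F_ex: "v \<in> Up \<Longrightarrow> F s (ex v) = ex (Sg s v)" by (simp add: F_def ex_Vp lg_ex)

lemma exK_compact: "compactin (atlas_top A) (ex ` K)"
  using image_compactin[OF _ cont_ex, of K] K_compact K_sub by (simp add: compactin_subtopology)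

lemma exK_Vp: "ex ` K \<subseteq> Vp" using K_sub ex_Vp by blast

lemma integral_curve_F:
  assumes y: "y \<in> atlas_space A"
  shows "integral_curve A (Xp' i) y (\<lambda>t. F (t *\<^sub>R axis i 1) y)"
proof (cases "y \<in> Vp")
  case True
  let ?v = "lg y" let ?S = "\<lambda>t. Sg (t *\<^sub>R axis i 1) (lg y)"
  have v: "?v \<in> Up" "?v \<in> T" using lg_Up[OF True] Up_T by auto
  have S: "?S t \<in> Up" for t by (rule Sg_Up[OF v(1)])
  have c: "(\<lambda>t. F (t *\<^sub>R axis i 1) y) = ex \<circ> ?S" using True by (simp add: fun_eq_iff F_def)
  show ?thesis
    unfolding integral_curve_def
  proof (intro conjI allI ballI impI)
    show "F (0 *\<^sub>R axis i 1) y = y" by (simp add: F_0)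
    have "continuous_map euclideanreal (subtopology (atlas_top FA) Up) ?S"
      using continuous_orbit[OF v(2)] S by (auto simp: continuous_map_in_subtopology)
    from continuous_map_compose[OF this cont_ex]
    show "continuous_map euclideanreal (atlas_top A) (\<lambda>t. F (t *\<^sub>R axis i 1) y)" unfolding c .
    fix t d assume d: "d \<in> A" and "F (t *\<^sub>R axis i 1) y \<in> fst d"
    then have e: "ex (?S t) \<in> fst d" using True by (simp add: F_def)
    let ?E = "snd d \<circ> ex \<circ> chart_inv f0"
    have coord: "?S s c0 = psi i s (?v c0)" for s by (simp add: Sg_coord[OF v(2)] psi_def)
    have "((\<lambda>s. ?S s c0) has_vector_derivative gen i (?S t c0)) (at t)"
      unfolding coord by (rule psi_generator(1))
    from has_vector_derivative_frechet[OF ex_derivative[OF d S e] this]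
    have "((\<lambda>s. ?E (?S s c0)) has_vector_derivative Xp' i (ex (?S t)) d) (at t)"
      unfolding Xp'_Vp[OF d S e] .
    moreover have "?E (?S s c0) = (snd d \<circ> (\<lambda>t. F (t *\<^sub>R axis i 1) y)) s" for s
      unfolding c using R_coord[OF Sg_T[OF v(2)]] by (simp add: chart0_inv)
    moreover have "ex (?S t) = F (t *\<^sub>R axis i 1) y" using True by (simp add: F_def)
    ultimately show "(snd d \<circ> (\<lambda>t. F (t *\<^sub>R axis i 1) y) has_vector_derivative Xp' i (F (t *\<^sub>R axis i 1) y) d) (at t)"
      by (simp add: o_def)
  qed
next
  case False
  then have c: "(\<lambda>t. F (t *\<^sub>R axis i 1) y) = (\<lambda>t. y)" by (simp add: F_def)
  show ?thesis
    unfolding integral_curve_def c using y topspace_atlas_top[OF cont] Xp'_notVp[OF False]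
    by (auto simp: o_def)
qed

text \<open>The curve \<open>t \<mapsto> F (- t) (\<gamma> t)\<close> is locally constant. Near a time with \<open>\<gamma> t \<in> Vp\<close> this follows from
  \<open>flow_generator\<close> in the coordinates of the fibre. Near any other time \<open>\<gamma>\<close> stays outside the closed set
  \<open>ex ` K\<close>, where the field is \<open>0\<close> and \<open>F\<close> the identity; so \<open>\<gamma>\<close> itself is locally constant.\<close>

lemma integral_curve_unique:
  assumes y: "y \<in> atlas_space A" and g: "integral_curve A (Xp' i) y \<gamma>"
  shows "\<gamma> = (\<lambda>t. F (t *\<^sub>R axis i 1) y)"
proof -
  let ?\<beta> = "\<lambda>t. F ((- t) *\<^sub>R axis i 1) (\<gamma> t)"
  have g0: "\<gamma> 0 = y" and gc: "continuous_map euclideanreal (atlas_top A) \<gamma>"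
    and gd: "\<And>t d. d \<in> A \<Longrightarrow> \<gamma> t \<in> fst d \<Longrightarrow> ((\<lambda>s. snd d (\<gamma> s)) has_vector_derivative Xp' i (\<gamma> t) d) (at t)"
    using g by (auto simp: integral_curve_def o_def)
  have gM: "\<gamma> t \<in> atlas_space A" for t using gc topspace_atlas_top[OF cont] unfolding continuous_map_def by auto
  have nbhd: "\<exists>r>0. \<forall>s\<in>ball t r. \<gamma> s \<in> W" if W: "openin (atlas_top A) W" "\<gamma> t \<in> W" for t W
  proof -
    have "open {s. \<gamma> s \<in> W}" using openin_continuous_map_preimage[OF gc W(1)] by simp
    then have "\<forall>x\<in>{s. \<gamma> s \<in> W}. \<exists>e>0. ball x e \<subseteq> {s. \<gamma> s \<in> W}" unfolding open_contains_ball .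
    moreover have "t \<in> {s. \<gamma> s \<in> W}" by (rule CollectI) (rule W(2))
    ultimately have "\<exists>e>0. ball t e \<subseteq> {s. \<gamma> s \<in> W}" by (rule bspec)
    then show ?thesis
    proof (elim exE conjE)
      fix r assume r: "0 < r" "ball t r \<subseteq> {s. \<gamma> s \<in> W}"
      show ?thesis
      proof (intro exI[of _ r] conjI ballI)
        fix s assume "s \<in> ball t r"
        from subsetD[OF r(2) this] show "\<gamma> s \<in> W" by (rule CollectD)
      qed (rule r(1))
    qed
  qed
  have local: "\<exists>r>0. \<forall>s\<in>ball t r. ?\<beta> s = ?\<beta> t" for t
  proof -
    obtain d where d: "d \<in> A" "\<gamma> t \<in> fst d" using gM[of t] by (auto simp: atlas_space_def)
    show ?thesis
    proof (cases "\<gamma> t \<in> Vp")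
      case True
      have "openin (atlas_top A) (Vp \<inter> fst d)" by (intro openin_Int Vp_open openin_chart[OF cont d(1)])
      from nbhd[OF this, of t] True d(2) obtain r where r: "r > 0" "\<And>s. s \<in> ball t r \<Longrightarrow> \<gamma> s \<in> Vp \<and> \<gamma> s \<in> fst d" by auto
      let ?w = "\<lambda>s. lg (\<gamma> s) c0"
      let ?E = "snd d \<circ> ex \<circ> chart_inv f0" and ?L = "snd f0 \<circ> lg \<circ> chart_inv d"
      have L: "?L (snd d (\<gamma> s)) = ?w s" if "s \<in> ball t r" for s
        using inv_left[OF d(1)] r(2)[OF that] by simp
      have w': "(?w has_vector_derivative gen i (?w s)) (at s)" if s: "s \<in> ball t r" for s
      proof -
        let ?v = "lg (\<gamma> s)"
        have v: "?v \<in> Up" "ex ?v = \<gamma> s" "ex ?v \<in> fst d" using r(2)[OF s] lg_Up ex_lg by auto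
        have Es: "?E (?v c0) = snd d (\<gamma> s)" using R_coord v Up_T by (auto simp: chart0_inv)
        have DE: "(?E has_derivative frechet_derivative ?E (at (?v c0))) (at (?v c0))" by (rule ex_derivative[OF d(1) v(1,3)])
        have DL: "(?L has_derivative frechet_derivative ?L (at (snd d (\<gamma> s)))) (at (snd d (\<gamma> s)))"
          by (rule lg_derivative[OF d(1)]) (use r(2)[OF s] in auto)
        have "((\<lambda>h. snd d (\<gamma> h)) has_vector_derivative Xp' i (\<gamma> s) d) (at s)"
          by (rule gd[OF d(1)]) (use r(2)[OF s] in auto)
        from has_vector_derivative_frechet[OF DL this]
        have 1: "((\<lambda>h. ?L (snd d (\<gamma> h))) has_vector_derivative frechet_derivative ?L (at (snd d (\<gamma> s))) (Xp' i (\<gamma> s) d)) (at s)" .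
        have X: "Xp' i (\<gamma> s) d = frechet_derivative ?E (at (?v c0)) (gen i (?v c0))"
          using Xp'_Vp[OF d(1) v(1,3), of i] unfolding v(2) .
        have "((\<lambda>u. u) has_derivative (frechet_derivative ?L (at (snd d (\<gamma> s))) \<circ> frechet_derivative ?E (at (?v c0)))) (at (?v c0))"
        proof (rule has_derivative_transform_within_open)
          show "(?L \<circ> ?E has_derivative (frechet_derivative ?L (at (snd d (\<gamma> s))) \<circ> frechet_derivative ?E (at (?v c0)))) (at (?v c0))"
            by (rule diff_chain_at[OF DE]) (use DL in \<open>simp only: Es\<close>)
          have op: "openin (subtopology (atlas_top FA) Up) {x \<in> topspace (subtopology (atlas_top FA) Up). ex x \<in> fst d}"
            by (rule openin_continuous_map_preimage[OF cont_ex openin_chart[OF cont d(1)]])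
          have "openin (atlas_top FA) {x \<in> topspace (subtopology (atlas_top FA) Up). ex x \<in> fst d}"
            by (rule openin_trans_full[OF op Up_open])
          then show "open (snd f0 ` ({x \<in> topspace (subtopology (atlas_top FA) Up). ex x \<in> fst d} \<inter> fst f0))"
            using chart0 unfolding openin_cont_atlas[OF cont_atlas_fibre] by blast
          show "?v c0 \<in> snd f0 ` ({x \<in> topspace (subtopology (atlas_top FA) Up). ex x \<in> fst d} \<inter> fst f0)"
            using v Up_T by (auto simp: topspace_fibre)
          fix u assume "u \<in> snd f0 ` ({x \<in> topspace (subtopology (atlas_top FA) Up). ex x \<in> fst d} \<inter> fst f0)"
          then obtain x where x: "x \<in> Up" "x \<in> T" "ex x \<in> fst d" "u = x c0" by (auto simp: topspace_fibre)
          then show "(?L \<circ> ?E) u = u" using inv_left[OF d(1) x(3)] lg_ex[OF x(1)] R_coord[OF x(2)] by (simp add: chart0_inv)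
        qed
        from has_derivative_unique[OF this has_derivative_ident]
        have "frechet_derivative ?L (at (snd d (\<gamma> s))) (Xp' i (\<gamma> s) d) = gen i (?v c0)" unfolding X by (simp add: fun_eq_iff)
        with 1 have 2: "((\<lambda>h. ?L (snd d (\<gamma> h))) has_vector_derivative gen i (?w s)) (at s)" by simp
        show ?thesis by (rule has_vector_derivative_transform_within_open[OF 2 open_ball s L])
      qed
      have const: "psi i (- s) (?w s) = psi i (- t) (?w t)" if "s \<in> ball t r" for s
        by (rule zero_derivative_constant_ball[of t r "\<lambda>s. psi i (- s) (?w s)"]) (use psi_generator(2)[OF w'] that r(1) in auto)
      have b: "?\<beta> s = ex (R (psi i (- s) (?w s)))" if "s \<in> ball t r" for s
        using r(2)[OF that] lg_Up[of "\<gamma> s"] Up_T R_coord[of "lg (\<gamma> s)"] by (auto simp: F_def psi_def R_Psi)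
      have tt: "t \<in> ball t r" using r(1) by simp
      show ?thesis
        using r(1) by (intro exI[of _ r] conjI ballI) (simp_all only: b const b[OF tt])
    next
      case False
      then have nK: "\<gamma> t \<notin> ex ` K" using exK_Vp by blast
      have "closedin (atlas_top A) (ex ` K)" by (rule compactin_imp_closedin[OF Hausdorff_M exK_compact])
      then have "openin (atlas_top A) (fst d - ex ` K)" by (intro openin_diff openin_chart[OF cont d(1)])
      from nbhd[OF this, of t] nK d(2) obtain r where r: "r > 0" "\<And>s. s \<in> ball t r \<Longrightarrow> \<gamma> s \<in> fst d \<and> \<gamma> s \<notin> ex ` K" by auto
      have z: "((\<lambda>h. snd d (\<gamma> h)) has_vector_derivative 0) (at s)" if "s \<in> ball t r" for s
        using gd[OF d(1), of s] Xp'_zero[OF d(1), of "\<gamma> s" i] r(2)[OF that] by simp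
      have "\<gamma> s = \<gamma> t" if s: "s \<in> ball t r" for s
      proof -
        have "snd d (\<gamma> s) = snd d (\<gamma> t)" by (rule zero_derivative_constant_ball[OF z s r(1)])
        then show ?thesis using inj[OF d(1)] r(2)[OF s] d(2) by (auto simp: inj_on_def)
      qed
      moreover have "?\<beta> s = \<gamma> s" if "s \<in> ball t r" for s using F_fixed r(2)[OF that] by blast
      moreover have "t \<in> ball t r" using r(1) by simp
      ultimately show ?thesis using r(1) by (intro exI[of _ r]) metis
    qed
  qed
  have "?\<beta> constant_on UNIV"
  proof (rule locally_constant_imp_constant[OF connected_UNIV])
    fix t :: real assume "t \<in> UNIV"
    from local[of t] show "\<exists>W. openin (top_of_set UNIV) W \<and> t \<in> W \<and> (\<forall>s\<in>W. ?\<beta> s = ?\<beta> t)"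
    proof (elim exE conjE)
      fix r assume r: "0 < r" "\<forall>s\<in>ball t r. ?\<beta> s = ?\<beta> t"
      have "openin (top_of_set UNIV) (ball t r)" and "t \<in> ball t r" using r(1) by simp_all
      then show ?thesis using r(2) by (intro exI[of _ "ball t r"] conjI)
    qed
  qed
  then have const: "?\<beta> t = ?\<beta> 0" for t unfolding constant_on_def by (elim exE) (simp only: ball_simps UNIV_I simp_thms)
  have "\<gamma> t = F (t *\<^sub>R axis i 1) y" for t
  proof -
    have "?\<beta> t = ?\<beta> 0" by (rule const)
    also have "\<dots> = y" by (simp add: F_0 g0)
    finally have "F (t *\<^sub>R axis i 1) (?\<beta> t) = F (t *\<^sub>R axis i 1) y" by simp
    moreover have "F (t *\<^sub>R axis i 1) (?\<beta> t) = \<gamma> t"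
      using F_add[of "t *\<^sub>R axis i 1" "(- t) *\<^sub>R axis i 1" "\<gamma> t"] by (simp add: F_0)
    ultimately show ?thesis by simp
  qed
  then show ?thesis by (simp add: fun_eq_iff)
qed

lemma joint_flow_fibre: "v \<in> T \<Longrightarrow> joint_flow FA Xp s v = Sg s v"
  by (rule joint_flow_action[where S = T]) (simp_all add: Sg_T Sg_0 Sg_add fibre_flow[OF fibre_field_eq])

lemma joint_flow_M: "y \<in> atlas_space A \<Longrightarrow> joint_flow A Xp' s y = F s y"
  by (rule joint_flow_action[where S = "atlas_space A"])
     (simp_all add: F_closed F_0 F_add field_flowI[OF integral_curve_F integral_curve_unique])

end

section \<open>The exponential map and deformed products\<close>

theorem proposition4p5:
  fixes A :: "('a, 'e::euclidean_space) chart set"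
    and nabla :: "('a, 'e) field_op"
    and U :: "('a, 'e) tpoint set"
    and V :: "('a \<times> 'a) set"
    and \<theta> :: "(('a, 'e) tpoint, 'e \<times> 'e) bivector_field"
    and \<sigma> :: "real ^ ('d::{finite,linorder}) \<Rightarrow> ('a, 'e) tpoint \<Rightarrow> ('a, 'e) tpoint"
    and \<Theta> :: "real ^ ('d::{finite,linorder}) ^ ('d::{finite,linorder})"
    and p :: 'a
    and \<Lambda> :: "((real ^ ('d::{finite,linorder})) \<times> (real ^ ('d::{finite,linorder}))) set"
    and \<phi> :: "(real ^ ('d::{finite,linorder})) \<times> (real ^ ('d::{finite,linorder})) \<Rightarrow> real"
    and Up Vp Xp Xp' \<Phi> \<Phi>' TpM M
  assumes manifold: "smooth_manifold A"
    and conn: "connection A nabla" "torsion_free A nabla"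
    and U_open: "openin (atlas_top (tangent_atlas A)) U"
    and U_zero: "\<And>x. x \<in> atlas_space A \<Longrightarrow> (x, 0) \<in> U"
    and V_open: "openin (atlas_top (product_atlas A A)) V"
    and V_diag: "\<And>x. x \<in> atlas_space A \<Longrightarrow> (x, x) \<in> V"
    and exp_def_on_U: "\<And>x v. (x, v) \<in> U \<Longrightarrow> exp_defined A nabla x (- v) \<and> exp_defined A nabla x v"
    and exp_diffeo: "diffeo (tangent_atlas A) U (product_atlas A A) V
           (\<lambda>(x, v). (exp_map A nabla x (- v), exp_map A nabla x v))"
    and poisson: "poisson_structure (tangent_atlas A) \<theta>" "vertical_bivector A \<theta>"
    and adm: "admissible A U \<theta> \<sigma> \<Theta>"
    and p: "p \<in> atlas_space A"
    and Up: "Up = {v. (p, v) \<in> U}"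
    and Vp: "Vp = exp_map A nabla p ` Up"
    and exp_p_diffeo: "diffeo (fibre_atlas A p) Up A Vp (exp_map A nabla p)"
    and partition: "lattice_partition \<Lambda> \<phi>"
    and Xp: "Xp = (\<lambda>i. fibre_field A p (fund_field (tangent_atlas A) \<sigma> i))"
    and Xp': "Xp' = (\<lambda>i. pushforward_field (fibre_atlas A p) Up A (exp_map A nabla p) (Xp i))"
    and \<Phi>: "\<Phi> = joint_flow (fibre_atlas A p) Xp"
    and \<Phi>': "\<Phi>' = joint_flow A Xp'"
    and TpM: "TpM = atlas_top (fibre_atlas A p)"
    and M: "M = atlas_top A"
  shows
    "(star_restricts \<Lambda> \<phi> \<Theta> TpM \<Phi> Up \<and> star_restricts \<Lambda> \<phi> \<Theta> M \<Phi>' Vp) \<and>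
     continuous_star_iso \<Lambda> \<phi> \<Theta> (C0 (subtopology M Vp) \<Phi>') (C0 (subtopology TpM Up) \<Phi>)
       (pullback Up (exp_map A nabla p)) \<and>
     continuous_star_iso \<Lambda> \<phi> \<Theta> (C0b (subtopology M Vp) \<Phi>') (C0b (subtopology TpM Up) \<Phi>)
       (pullback Up (exp_map A nabla p)) \<and>
     continuous_star_iso \<Lambda> \<phi> \<Theta> (C0inf (subtopology M Vp) \<Phi>') (C0inf (subtopology TpM Up) \<Phi>)
       (pullback Up (exp_map A nabla p))"
proof -
  let ?TA = "tangent_atlas A" and ?FA = "fibre_atlas A p" and ?e = "exp_map A nabla p"
  let ?S = "\<lambda>i. field_support (tangent_atlas A) (fund_field (tangent_atlas A) \<sigma> i)"
  have smooth: "smooth_atlas A" and Hausdorff: "Hausdorff_space (atlas_top A)"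
    and second: "second_countable (atlas_top A)"
    using manifold by (simp_all add: smooth_manifold_def)
  have action: "smooth_action ?TA \<sigma>" and vertical: "\<And>v w. w \<in> tbundle A \<Longrightarrow> fst (\<sigma> v w) = fst w"
    and supp_U: "\<And>i. ?S i \<subseteq> U"
    and supp_compact: "\<And>i. compactin (atlas_top ?TA) (?S i \<inter> {p} \<times> tspace A p)"
    using adm p unfolding admissible_def by blast+
  interpret vf: vertical_flow A \<sigma> p
    by (intro vertical_flow.intro atlas.intro vertical_flow_axioms.intro smooth action vertical p)
  \<comment> \<open>All the fields vanish on the fibre outside \<open>K\<close>, so that it contains every point that moves.\<close>
  define K where "K = {v \<in> tspace A p. \<exists>i. (p, v) \<in> ?S i}"
  have "compactin (atlas_top ?FA) (\<Union>i\<in>UNIV. {v \<in> tspace A p. (p, v) \<in> ?S i})"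
    by (rule compactin_Union) (auto intro!: vf.compactin_fibre supp_compact)
  moreover have "(\<Union>i\<in>UNIV. {v \<in> tspace A p. (p, v) \<in> ?S i}) = K" by (auto simp: K_def)
  ultimately have K_compact: "compactin (atlas_top ?FA) K" by simp
  have K_Up: "K \<subseteq> Up" using supp_U by (auto simp: K_def Up)
  interpret ec: exp_chart A \<sigma> p ?e Up Vp K
    by (intro exp_chart.intro vf.vertical_flow_axioms exp_chart_axioms.intro exp_p_diffeo K_def K_compact K_Up Hausdorff)
  have T: "topspace TpM = tspace A p" unfolding TpM by (rule vf.topspace_fibre)
  have T': "topspace M = atlas_space A" unfolding M by (rule topspace_atlas_top[OF vf.cont])
  have flow: "\<Phi> v n = vf.Sg v n" if "n \<in> tspace A p" for v n
    unfolding \<Phi> Xp by (rule ec.joint_flow_fibre[OF that])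
  have flow': "\<Phi>' v n = ec.F v n" if "n \<in> atlas_space A" for v n
    unfolding \<Phi>' Xp' Xp by (rule ec.joint_flow_M[OF that])
  have Hausdorff_T: "Hausdorff_space TpM"
  proof (rule Hausdorff_space_injective_preimage[where Y = euclidean and f = "\<lambda>v. v vf.c0"])
    show "continuous_map TpM euclidean (\<lambda>v. v vf.c0)" unfolding TpM by (rule vf.continuous_coord)
    show "inj_on (\<lambda>v. v vf.c0) (topspace TpM)" unfolding T by (rule inj_onI) (metis vf.R_coord)
  qed simp
  have "homeomorphic_maps TpM euclidean (\<lambda>v. v vf.c0) vf.R"
    unfolding homeomorphic_maps_def T using vf.continuous_coord vf.continuous_R vf.R_coord by (simp add: TpM)
  then have "TpM homeomorphic_space (euclidean :: 'e topology)" by (rule homeomorphic_maps_imp_homeomorphic_space)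
  then have first_T: "first_countable TpM"
    using homeomorphic_space_first_countability metrizable_imp_first_countable[OF metrizable_space_euclidean] by blast
  have "open_flow TpM \<Phi> Up K"
  proof
    show "Hausdorff_space TpM" by (rule Hausdorff_T)
    show "locally_compact_space TpM" unfolding TpM by (rule locally_compact_atlas_top[OF vf.cont_atlas_fibre])
    show "first_countable TpM" by (rule first_T)
    show "openin TpM Up" unfolding TpM by (rule ec.Up_open)
    show "compactin TpM K" unfolding TpM by (rule K_compact)
    show "K \<subseteq> Up" by (rule K_Up)
    fix n v w
    show "n \<in> topspace TpM \<Longrightarrow> \<Phi> v n \<in> topspace TpM" by (simp add: T flow vf.Sg_T)
    show "n \<in> topspace TpM \<Longrightarrow> \<Phi> 0 n = n" by (simp add: T flow vf.Sg_0)
    show "n \<in> topspace TpM \<Longrightarrow> \<Phi> (v + w) n = \<Phi> v (\<Phi> w n)" by (simp add: T flow vf.Sg_T vf.Sg_add)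
    show "n \<in> topspace TpM - K \<Longrightarrow> \<Phi> v n = n" by (simp add: T flow ec.outside_K(2))
  qed
  then have restr: "star_restricts \<Lambda> \<phi> \<Theta> TpM \<Phi> Up" by (rule open_flow.restriction[OF _ partition])
  have "open_flow M \<Phi>' Vp (?e ` K)"
  proof
    show "Hausdorff_space M" unfolding M by (rule Hausdorff)
    show "locally_compact_space M" unfolding M by (rule locally_compact_atlas_top[OF vf.cont])
    show "first_countable M" unfolding M by (rule second_countable_imp_first_countable[OF second])
    show "openin M Vp" unfolding M by (rule ec.Vp_open)
    show "compactin M (?e ` K)" unfolding M by (rule ec.exK_compact)
    show "?e ` K \<subseteq> Vp" by (rule ec.exK_Vp)
    fix n v w
    show "n \<in> topspace M \<Longrightarrow> \<Phi>' v n \<in> topspace M" by (simp add: T' flow' ec.F_closed)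
    show "n \<in> topspace M \<Longrightarrow> \<Phi>' 0 n = n" by (simp add: T' flow' ec.F_0)
    show "n \<in> topspace M \<Longrightarrow> \<Phi>' (v + w) n = \<Phi>' v (\<Phi>' w n)" by (simp add: T' flow' ec.F_closed ec.F_add)
    show "n \<in> topspace M - ?e ` K \<Longrightarrow> \<Phi>' v n = n" by (simp add: T' flow' ec.F_fixed)
  qed
  then have restr': "star_restricts \<Lambda> \<phi> \<Theta> M \<Phi>' Vp" by (rule open_flow.restriction[OF _ partition])
  have Up_space: "topspace (subtopology TpM Up) = Up" using ec.Up_T by (auto simp: T)
  have Vp_space: "topspace (subtopology M Vp) = Vp" using ec.Vp_M by (auto simp: T')
  have to: "continuous_map (subtopology TpM Up) (subtopology M Vp) ?e"
    using ec.cont_ex ec.ex_Vp Up_space by (auto simp: continuous_map_in_subtopology TpM M)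
  have fro: "continuous_map (subtopology M Vp) (subtopology TpM Up) (inv_into Up ?e)"
    using ec.cont_lg ec.lg_Up Vp_space by (auto simp: continuous_map_in_subtopology TpM M)
  have flow_Up: "\<Phi> v y = vf.Sg v y" if "y \<in> Up" for v y using flow ec.Up_T that by blast
  have flow_Vp: "\<Phi>' v y = ec.F v y" if "y \<in> Vp" for v y using flow' ec.Vp_M that by blast
  have inv: "inv_into Up ?e (?e y) = y" if "y \<in> topspace (subtopology TpM Up)" for y
    using that unfolding Up_space by (rule ec.lg_ex)
  have inv': "?e (inv_into Up ?e x) = x" if "x \<in> topspace (subtopology M Vp)" for x
    using that unfolding Vp_space by (rule ec.ex_lg)
  have inter: "?e (\<Phi> v y) = \<Phi>' v (?e y)" if "y \<in> topspace (subtopology TpM Up)" for v y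
    using that unfolding Up_space by (simp add: flow_Up flow_Vp ec.ex_Vp ec.F_ex)
  have closed: "\<Phi> v y \<in> topspace (subtopology TpM Up)" if "y \<in> topspace (subtopology TpM Up)" for v y
    using that unfolding Up_space by (simp add: flow_Up ec.Sg_Up)
  have closed': "\<Phi>' v x \<in> topspace (subtopology M Vp)" if "x \<in> topspace (subtopology M Vp)" for v x
    using that unfolding Vp_space by (simp add: flow_Vp ec.F_Vp)
  note iso = pullback_star_iso[where Y' = "subtopology TpM Up" and Y = "subtopology M Vp" and \<kappa> = ?e and \<kappa>' = "inv_into Up ?e"
      and \<Phi> = \<Phi>' and \<Phi>' = \<Phi> and \<Lambda> = \<Lambda> and \<phi> = \<phi> and \<Theta> = \<Theta>,
      OF to fro inv inv' inter closed closed', unfolded Up_space]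
  show ?thesis by (intro conjI restr restr' iso)
qed

end
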